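(* Let $p\ge1$, $\theta\in\mathbb{R}^p$, $|\rho|<1$, and consider the adaptively controlled ARX$(p,0)$ process with first-order autoregressive noise described in the context, with the estimators $\widehat\theta_n$ and $\widehat\rho_n$ of $\theta$ and $\rho$. Assume that $\rho\ne0$ and that $(V_n)$ has a finite conditional moment of order $>2$. In addition, suppose that $(x_n)$ has the same almost sure regularity as $(V_n)$. Then, as $n\to\infty$, $$\sqrt n\begin{pmatrix}\widehat\theta_n-\theta\\ \widehat\rho_n-\rho\end{pmatrix}\ \xrightarrow{\ \mathcal L\ }\ \mathcal N(0,\Sigma),\qquad \Sigma=\nabla\Lambda^{-1}\nabla^t,$$ where $\Lambda$ and $\nabla$ are the matrices defined in the context. In particular, $$\sqrt n(\widehat\rho_n-\rho)\ \xrightarrow{\ \mathcal L\ }\ \mathcal N\left(0,\frac{1-\rho^2}{\rho^{2(p+1)}}\right).$$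
   Context: Model. For all $n\ge 0$, $$X_{n+1}=\sum_{k=1}^p\theta_kX_{n-k+1}+U_n+\varepsilon_{n+1},\qquad \varepsilon_{n+1}=\rho\varepsilon_n+V_{n+1},$$ with $\theta=(\theta_1,\dots,\theta_p)^t\in\mathbb{R}^p$, $|\rho|<1$. Initial values ($X_k$ for $k\le 0$, $\varepsilon_0$, $U_0$, $U_{-1}$) are arbitrary ($\mathcal F_0$-measurable). $(V_n)$ is a martingale difference sequence adapted to a filtration $(\mathcal F_n)$ with $\mathbb{E}[V_{n+1}^2\mid\mathcal F_n]=\sigma^2$ a.s. for all $n\ge0$, where $\sigma^2>0$ is a constant. "Finite conditional moment of order $>2$" means: there is $a>2$ with $\sup_{n\ge0}\mathbb{E}[|V_{n+1}|^a\mid\mathcal F_n]<\infty$ a.s. "$(x_n)$ has the same almost sure regularity as $(V_n)$" means: for this $a$ and all $2\le b<a$, $\sum_{k=1}^n|x_k|^b=\mathcal O(n)$ a.s. (a property that $(V_n)$ itself has). Regression vector and parameter. $\Phi_n=(X_n,X_{n-1},\dots,X_{n-p+1},X_{n-p},U_{n-1})^t\in\mathbb{R}^{p+2}$, and $\vartheta\in\mathbb{R}^{p+2}$ is $$\vartheta=\begin{pmatrix}\theta\\0\\0\end{pmatrix}-\rho\begin{pmatrix}-1\\ \theta\\ 1\end{pmatrix},$$ so that for $n\ge 1$, $X_{n+1}=\vartheta^t\Phi_n+U_n+V_{n+1}$. Estimator and control. $S_n=\sum_{k=0}^n\Phi_k\Phi_k^t+I_{p+2}$; the least squares estimator satisfies,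 for $n\ge0$, $$\widehat\vartheta_{n+1}=\widehat\vartheta_n+S_n^{-1}\Phi_n\bigl(X_{n+1}-U_n-\widehat\vartheta_n^{\,t}\Phi_n\bigr),$$ with $\widehat\vartheta_0$ arbitrary. The adaptive tracking control is $U_n=x_{n+1}-\widehat\vartheta_n^{\,t}\Phi_n$ (for $n\ge 1$; $U_0$ may be arbitrary), where $(x_n)$ is a predictable real reference trajectory ($x_{n+1}$ is $\mathcal F_n$-measurable) satisfying $\sum_{k=1}^n x_k^2=o(n)$ a.s. Estimators of $\theta$ and $\rho$. $\widehat\rho_n=-\widehat\vartheta_{n,p+2}$ (the opposite of the last coordinate of $\widehat\vartheta_n$), and $\widehat\theta_n=(\widehat\theta_{n,1},\dots,\widehat\theta_{n,p})^t$ with, for $1\le k\le p$, $$\widehat\theta_{n,k}=\sum_{i=1}^{k}\widehat\rho_n^{\,k-i}\,\widehat\vartheta_{n,i}+\widehat\rho_n^{\,k-1}\,\widehat\vartheta_{n,p+2}$$ (convention $0^0=1$). Matrices. $\Lambda=\begin{pmatrix} I_{p+1} & K^t\\ K & H\end{pmatrix}$ of order $p+2$, with $K=(0,-(\theta_1+\rho),\dots,-(\theta_p+\rho^p))$ and $H=\sum_{k=1}^p(\theta_k+\rho^k)^2+\frac{\rho^{2(p+1)}}{1-\rho^2}$; it is invertible when $\rho\neq0$. With $\xi_0=0$ and $\xi_k=\sum_{i=1}^k\rho^{k-i}\theta_i$ for $1\le k\le p-1$, $\nabla$ is the $(p+1)\times(p+2)$ matrix whose entries are: for $1\le k\le p$,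 $\nabla_{k,i}=\rho^{k-i}$ if $1\le i\le k$, $\nabla_{k,i}=0$ if $k<i\le p+1$, and $\nabla_{k,p+2}=\rho^{k-1}-\xi_{k-1}$; the last row is $(0,\dots,0,-1)$. $\xrightarrow{\mathcal L}$ denotes convergence in distribution. *)

theory Defs
  imports
    "HOL-Probability.Probability"
    "HOL-Library.Landau_Symbols"
    "Jordan_Normal_Form.Gauss_Jordan_Elimination"
begin

hide_type (open) Finite_Cartesian_Product.vec
hide_const (open) Finite_Cartesian_Product.vec Finite_Cartesian_Product.mat
unbundle no vec_syntax
unbundle no inner_syntax

text \<open>
  The order \<open>p\<close> is a natural number, so matrices and vectors are those of Jordan_Normal_Form
  and are indexed from 0: the component with index \<open>i\<close> in the usual notation (counted from 1)
  sits at position \<open>i - 1\<close>.  The scalars \<open>\<theta> 1, \<dots>, \<theta> p\<close> keep their usual indices; the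
  other values of \<open>\<theta>\<close> are never used.
\<close>

definition weak_conv_on :: "'b topology \<Rightarrow> (nat \<Rightarrow> 'b measure) \<Rightarrow> 'b measure \<Rightarrow> bool" where
  "weak_conv_on T \<mu>s \<mu> \<longleftrightarrow>
     (\<forall>f. continuous_map T euclideanreal f \<and> bounded (f ` topspace T) \<longrightarrow>
        (\<lambda>n. \<integral>x. f x \<partial>\<mu>s n) \<longlonglongrightarrow> (\<integral>x. f x \<partial>\<mu>))"

text \<open>
  Here \<open>\<real>\<close> to the power \<open>d\<close> is realised as the set of extensional functions on \<open>{..<d}\<close>,
  with the topology and the measurable structure below.
\<close>

abbreviation Rn_top :: "nat \<Rightarrow> (nat \<Rightarrow> real) topology" where
  "Rn_top d \<equiv> product_topology (\<lambda>_. euclideanreal) {..<d}"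

abbreviation Rn_borel :: "nat \<Rightarrow> (nat \<Rightarrow> real) measure" where
  "Rn_borel d \<equiv> PiM {..<d} (\<lambda>_. borel)"

text \<open>
  The law with mean \<open>m\<close> and covariance matrix \<open>C\<close> is specified by its characteristic function,
  which determines it and also covers singular \<open>C\<close>.
\<close>

definition mv_normal :: "nat \<Rightarrow> real vec \<Rightarrow> real mat \<Rightarrow> (nat \<Rightarrow> real) measure \<Rightarrow> bool" where
  "mv_normal d m C \<mu> \<longleftrightarrow>
     m \<in> carrier_vec d \<and> C \<in> carrier_mat d d \<and> C\<^sup>T = C \<and>
     prob_space \<mu> \<and> sets \<mu> = sets (Rn_borel d) \<and>
     (\<forall>t \<in> carrier_vec d.
        (CLINT x|\<mu>. iexp (\<Sum>i<d. t $ i * x i)) =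
        exp (\<i> * complex_of_real (t \<bullet> m) - complex_of_real (t \<bullet> (C *\<^sub>v t)) / 2))"

text \<open>Only the indices from 1 on matter; \<open>V 0\<close> is unconstrained.\<close>

definition martingale_difference ::
    "'a measure \<Rightarrow> (nat \<Rightarrow> 'a measure) \<Rightarrow> (nat \<Rightarrow> 'a \<Rightarrow> real) \<Rightarrow> bool" where
  "martingale_difference M F V \<longleftrightarrow>
     (\<forall>n. V (Suc n) \<in> borel_measurable (F (Suc n)) \<and>
          integrable M (V (Suc n)) \<and>
          (AE \<omega> in M. real_cond_exp M (F n) (V (Suc n)) \<omega> = 0))"

text \<open>\<open>(X n, X (n - 1), \<dots>, X (n - p), U (n - 1))\<close>; time runs over the integers because of
  the initial values.\<close>

definition regressor ::
    "nat \<Rightarrow> (int \<Rightarrow> 'a \<Rightarrow> real) \<Rightarrow> (int \<Rightarrow> 'a \<Rightarrow> real) \<Rightarrow> nat \<Rightarrow> 'a \<Rightarrow> real vec" where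
  "regressor p X U n \<omega> =
     vec (p + 2) (\<lambda>j. if j \<le> p then X (int n - int j) \<omega> else U (int n - 1) \<omega>)"

definition gram_matrix :: "nat \<Rightarrow> (nat \<Rightarrow> real vec) \<Rightarrow> nat \<Rightarrow> real mat" where
  "gram_matrix d \<Phi> n = mat d d (\<lambda>(i, j). \<Sum>k=0..n. \<Phi> k $ i * \<Phi> k $ j) + 1\<^sub>m d"

text \<open>\<open>mat_inverse\<close> returns \<open>None\<close> exactly for singular matrices; it is applied
  below to \<open>gram_matrix\<close>, which is positive definite, and to \<open>Lambda_mat\<close>, which is
  regular for \<open>\<rho> \<noteq> 0\<close>.\<close>

abbreviation inv_mat :: "real mat \<Rightarrow> real mat" where
  "inv_mat A \<equiv> the (mat_inverse A)"

text \<open>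
  Eliminating the autoregressive noise gives, for \<open>n \<ge> 1\<close>, the regression of \<open>X (n + 1)\<close> on
  \<open>\<Phi> n\<close> with parameter \<open>(\<theta> 1 + \<rho>, \<theta> 2 - \<rho> * \<theta> 1, \<dots>, \<theta> p - \<rho> * \<theta> (p - 1), - \<rho> * \<theta> p, - \<rho>)\<close>;
  the estimators below solve this for \<open>\<rho>\<close> and \<open>\<theta>\<close>, with \<open>v\<close> in place of the parameter.
\<close>

definition rho_hat :: "nat \<Rightarrow> real vec \<Rightarrow> real" where
  "rho_hat p v = - v $ (p + 1)"

definition theta_hat :: "nat \<Rightarrow> real vec \<Rightarrow> nat \<Rightarrow> real" where
  "theta_hat p v k =
     (\<Sum>i=1..k. rho_hat p v ^ (k - i) * v $ (i - 1)) + rho_hat p v ^ (k - 1) * v $ (p + 1)"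

definition estimation_error :: "nat \<Rightarrow> (nat \<Rightarrow> real) \<Rightarrow> real \<Rightarrow> real vec \<Rightarrow> nat \<Rightarrow> real" where
  "estimation_error p \<theta> \<rho> v j =
     (if j < p then theta_hat p v (j + 1) - \<theta> (j + 1) else rho_hat p v - \<rho>)"

definition K_row :: "nat \<Rightarrow> (nat \<Rightarrow> real) \<Rightarrow> real \<Rightarrow> real mat" where
  "K_row p \<theta> \<rho> = mat 1 (p + 1) (\<lambda>(_, j). if j = 0 then 0 else - (\<theta> j + \<rho> ^ j))"

definition H_const :: "nat \<Rightarrow> (nat \<Rightarrow> real) \<Rightarrow> real \<Rightarrow> real" where
  "H_const p \<theta> \<rho> = (\<Sum>k=1..p. (\<theta> k + \<rho> ^ k)\<^sup>2) + \<rho> ^ (2 * (p + 1)) / (1 - \<rho>\<^sup>2)"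

definition Lambda_mat :: "nat \<Rightarrow> (nat \<Rightarrow> real) \<Rightarrow> real \<Rightarrow> real mat" where
  "Lambda_mat p \<theta> \<rho> =
     four_block_mat (1\<^sub>m (p + 1)) ((K_row p \<theta> \<rho>)\<^sup>T)
                    (K_row p \<theta> \<rho>) (mat 1 1 (\<lambda>_. H_const p \<theta> \<rho>))"

definition xi :: "(nat \<Rightarrow> real) \<Rightarrow> real \<Rightarrow> nat \<Rightarrow> real" where
  "xi \<theta> \<rho> k = (\<Sum>i=1..k. \<rho> ^ (k - i) * \<theta> i)"

definition nabla_mat :: "nat \<Rightarrow> (nat \<Rightarrow> real) \<Rightarrow> real \<Rightarrow> real mat" where
  "nabla_mat p \<theta> \<rho> = mat (p + 1) (p + 2) (\<lambda>(r, c).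
     let k = r + 1; i = c + 1 in
       if k \<le> p then
         (if i \<le> k then \<rho> ^ (k - i)
          else if i \<le> p + 1 then 0
          else \<rho> ^ (k - 1) - xi \<theta> \<rho> (k - 1))
       else (if i = p + 2 then - 1 else 0))"

definition Sigma_mat :: "nat \<Rightarrow> (nat \<Rightarrow> real) \<Rightarrow> real \<Rightarrow> real mat" where
  "Sigma_mat p \<theta> \<rho> =
     nabla_mat p \<theta> \<rho> * inv_mat (Lambda_mat p \<theta> \<rho>) * (nabla_mat p \<theta> \<rho>)\<^sup>T"

end

(*
  The normal equations write the estimation error as the inverse of S_n applied to a martingale
  transform of the noise, so a martingale central limit theorem applies as soon as S_n / n converges
  almost surely to sigma^2 Lambda.

  Let pi_k be the prediction errors and R_k = det S_k.  The Lyapunov function (error)^t S (error),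
  divided by a small power of R, is an almost supermartingale with telescoping compensator, whence
  sum_k pi_k^2 R_(k-1) / R_k^(1+eta) < infinity almost surely.  A very large regressor can only stem
  from a large recent prediction error, and by this bound such an error multiplies R.  Iterating m
  times, no regressor exceeds a tiny power of R; as R is polynomial in the regressors, they grow
  slowly and the pi_k are negligible in quadratic mean.  Hence X_(n+1) behaves like V_(n+1), the
  control U_n like a fixed linear combination of past noise, and the strong law for products
  V_(k+j) V_k yields the limit of S_n / n.

  The map from the regression parameter to (theta, rho) is solved by a triangular recursion, which
  is linearised term by term with tight and negligible sequences.  Convergence of characteristic
  functions gives weak convergence by a multivariate Levy theorem, obtained from Stone-Weierstrass
  approximation by trigonometric sums.
*)

theory Submission
  imports Defs "Jordan_Normal_Form.Determinant" "HOL-Real_Asymp.Real_Asymp"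
begin

subsection \<open>Gram matrices and recursive least squares\<close>

text \<open>The difficulty is the closed loop: the control feeds estimation errors back into the
  regressors, so no bound on \<Phi>_n is available beforehand, while the analysis of the estimator
  wants one. Using det S_n instead of a trace breaks the circle: 1 - R_(k-1)/R_k is exactly the
  weight of V_(k+1)^2 in the Lyapunov recursion, so after division by R^\<eta> the compensator is
  bounded whatever the growth. The constants follow: noise and reference are O(n^(\<gamma>/2)) with
  2/a < \<gamma> < 1, \<tau> is an eighth of the slack 1 - \<gamma>, m makes the exponent 1/m small
  against the degree of the determinant, and \<eta> stays small after m losses of R^\<eta>. The
  noise has moments above order 2 only conditionally and with a random bound, so the corresponding
  estimates are made on predictable events where this bound is below an integer L. Eliminating the
  autoregressive noise uses the model one step back and holds from n = 1 on, which explains many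
  index shifts. The covariance is free of \<sigma>: the martingale part contributes \<sigma>^4, each
  inverse Gram matrix 1/\<sigma>^2.\<close>

lemma det_minus_rank_one:
  fixes S :: "real mat"
  assumes S: "S \<in> carrier_mat d d" and T: "T \<in> carrier_mat d d" and ST: "S * T = 1\<^sub>m d"
    and C: "C \<in> carrier_mat d 1" and R: "R \<in> carrier_mat 1 d"
  shows "Determinant.det (S - C * R) = Determinant.det S * Determinant.det (1\<^sub>m 1 - R * (T * C))"
proof -
  \<comment> \<open>The block matrix with rows (S, C) and (R, 1) is factored in two ways into block
    triangular matrices; comparing the determinants gives both sides.\<close>
  let ?B = "four_block_mat S C R (1\<^sub>m 1)"
  have CR: "C * R \<in> carrier_mat d d" and TC: "T * C \<in> carrier_mat d 1"
    and RTC: "R * (T * C) \<in> carrier_mat 1 1"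
    using assms by auto
  have SCR: "S - C * R \<in> carrier_mat d d" using CR by (rule minus_carrier_mat)
  have eq1: "?B = four_block_mat (S - C * R) C (0\<^sub>m 1 d) (1\<^sub>m 1) *
      four_block_mat (1\<^sub>m d) (0\<^sub>m d 1) R (1\<^sub>m 1)"
  proof -
    have "(S - C * R) * 1\<^sub>m d + C * R = S" using S C R CR by (intro eq_matI) auto
    moreover have "(S - C * R) * 0\<^sub>m d 1 + C * 1\<^sub>m 1 = C"
    proof -
      have "(S - C * R) * 0\<^sub>m d 1 = 0\<^sub>m d 1" using SCR by (rule right_mult_zero_mat)
      then show ?thesis using C by auto
    qed
    moreover have "0\<^sub>m 1 d * 1\<^sub>m d + 1\<^sub>m 1 * R = R" using R by auto
    moreover have "0\<^sub>m 1 d * 0\<^sub>m d 1 + 1\<^sub>m 1 * 1\<^sub>m 1 = (1\<^sub>m 1 :: real mat)" by auto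
    ultimately show ?thesis
      using S C R CR SCR by (subst mult_four_block_mat[of _ d d _ 1 _ 1 _ _ d _ 1]) auto
  qed
  have eq2: "?B = four_block_mat S (0\<^sub>m d 1) R (1\<^sub>m 1 - R * (T * C)) *
      four_block_mat (1\<^sub>m d) (T * C) (0\<^sub>m 1 d) (1\<^sub>m 1)"
  proof -
    have "S * (T * C) = C" using assoc_mult_mat[OF S T C] ST C by auto
    then have a: "S * (T * C) + 0\<^sub>m d 1 * 1\<^sub>m 1 = C" using C by auto
    have b: "S * 1\<^sub>m d + 0\<^sub>m d 1 * 0\<^sub>m 1 d = S" using S by auto
    have c: "R * 1\<^sub>m d + (1\<^sub>m 1 - R * (T * C)) * 0\<^sub>m 1 d = R"
    proof -
      have "(1\<^sub>m 1 - R * (T * C)) * 0\<^sub>m 1 d = 0\<^sub>m 1 d" using minus_carrier_mat[OF RTC] by (rule right_mult_zero_mat)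
      then show ?thesis using R by auto
    qed
    have e: "R * (T * C) + (1\<^sub>m 1 - R * (T * C)) * 1\<^sub>m 1 = 1\<^sub>m 1"
    proof -
      have "M + (1\<^sub>m 1 - M) = 1\<^sub>m 1" if "M \<in> carrier_mat 1 1" for M :: "real mat"
        using that by (intro eq_matI) auto
      then show ?thesis unfolding right_mult_one_mat[OF minus_carrier_mat[OF RTC]] using RTC by blast
    qed
    show ?thesis
      using S C R TC RTC a b c e by (subst mult_four_block_mat[of _ d d _ 1 _ 1 _ _ d _ 1]) auto
  qed
  have "Determinant.det ?B = Determinant.det (S - C * R)"
    unfolding eq1 using C R
    by (subst det_mult[OF four_block_carrier_mat[OF SCR one_carrier_mat] four_block_carrier_mat[OF one_carrier_mat one_carrier_mat]])
      (simp only: det_four_block_mat_lower_left_zero[OF SCR C refl one_carrier_mat]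
        det_four_block_mat_upper_right_zero[OF one_carrier_mat refl R one_carrier_mat] det_one mult_1_right)
  moreover have "Determinant.det ?B = Determinant.det S * Determinant.det (1\<^sub>m 1 - R * (T * C))"
    unfolding eq2 using C R
    by (subst det_mult[OF four_block_carrier_mat[OF S minus_carrier_mat[OF RTC]] four_block_carrier_mat[OF one_carrier_mat one_carrier_mat]])
      (simp only: det_four_block_mat_lower_left_zero[OF one_carrier_mat TC refl one_carrier_mat]
        det_four_block_mat_upper_right_zero[OF S refl R minus_carrier_mat[OF RTC]] det_one mult_1_right)
  ultimately show ?thesis by simp
qed

lemma inv_mat_props:
  fixes A :: "real mat"
  assumes A: "A \<in> carrier_mat d d" and det: "Determinant.det A \<noteq> 0"
  shows "inv_mat A \<in> carrier_mat d d" "A * inv_mat A = 1\<^sub>m d" "inv_mat A * A = 1\<^sub>m d"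
proof -
  obtain B where B: "mat_inverse A = Some B"
    using mat_inverse(1)[OF A, of undefined] det_non_zero_imp_unit[OF A det, of undefined]
    by (cases "mat_inverse A") auto
  from mat_inverse(2)[OF A B] show "inv_mat A \<in> carrier_mat d d" "A * inv_mat A = 1\<^sub>m d" "inv_mat A * A = 1\<^sub>m d"
    using B by auto
qed

text \<open>The adjugate formula makes each entry of the inverse a rational function of the entries,
  which later yields its measurability and continuity.\<close>

lemma inv_mat_eq_adj:
  fixes A :: "real mat"
  assumes A: "A \<in> carrier_mat d d" and det: "Determinant.det A \<noteq> 0"
  shows "inv_mat A = (1 / Determinant.det A) \<cdot>\<^sub>m adj_mat A"
proof -
  note I = inv_mat_props[OF A det]
  note J = adj_mat[OF A]
  have "inv_mat A = inv_mat A * (A * ((1 / Determinant.det A) \<cdot>\<^sub>m adj_mat A))"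
  proof -
    have "A * ((1 / Determinant.det A) \<cdot>\<^sub>m adj_mat A) = 1\<^sub>m d"
      unfolding mult_smult_distrib[OF A J(1)] J(2) using det by (intro eq_matI) auto
    then show ?thesis using I(1) by simp
  qed
  also have "\<dots> = (inv_mat A * A) * ((1 / Determinant.det A) \<cdot>\<^sub>m adj_mat A)"
    using assoc_mult_mat[OF I(1) A] J(1) by (metis smult_carrier_mat)
  finally show ?thesis using I(3) J(1) by simp
qed

section \<open>Gram determinants and the Lyapunov form\<close>

locale gram =
  fixes d :: nat and \<Phi> :: "nat \<Rightarrow> real vec"
  assumes dim: "\<And>k. \<Phi> k \<in> carrier_vec d"
begin

definition "S n = gram_matrix d \<Phi> n"
definition "T n = inv_mat (S n)"
text \<open>The leverage of the newest regressor; \<open>r_Suc\<close> identifies 1 -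
  \<open>f\<close> with the ratio of successive determinants.\<close>

definition "f n = \<Phi> n \<bullet> (T n *\<^sub>v \<Phi> n)"
definition "r n = Determinant.det (S n)"
definition "ssq n = (\<Sum>k=0..n. \<Phi> k \<bullet> \<Phi> k)"

lemma S_carrier [simp]: "S n \<in> carrier_mat d d"
  by (simp add: S_def gram_matrix_def)

lemma S_index: "i < d \<Longrightarrow> j < d \<Longrightarrow>
    S n $$ (i, j) = (\<Sum>k=0..n. \<Phi> k $ i * \<Phi> k $ j) + (if i = j then 1 else 0)"
  by (simp add: S_def gram_matrix_def)

lemma S_mult_vec_index:
  assumes v: "v \<in> carrier_vec d" and i: "i < d"
  shows "(S n *\<^sub>v v) $ i = v $ i + (\<Sum>k=0..n. \<Phi> k $ i * (\<Phi> k \<bullet> v))"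
proof -
  have "(S n *\<^sub>v v) $ i = (\<Sum>j=0..<d. S n $$ (i, j) * v $ j)"
    using v i S_carrier[of n, THEN carrier_matD(1)] S_carrier[of n, THEN carrier_matD(2)]
    by (simp add: scalar_prod_def)
  also have "\<dots> = (\<Sum>j=0..<d. (\<Sum>k=0..n. \<Phi> k $ i * \<Phi> k $ j) * v $ j + (if i = j then 1 else 0) * v $ j)"
    using i by (intro sum.cong) (auto simp: S_index ring_distribs)
  also have "\<dots> = (\<Sum>j=0..<d. (\<Sum>k=0..n. \<Phi> k $ i * \<Phi> k $ j) * v $ j) + v $ i"
    using i by (simp add: sum.distrib if_distrib[of "\<lambda>x. x * _"] cong: if_cong)
  also have "(\<Sum>j=0..<d. (\<Sum>k=0..n. \<Phi> k $ i * \<Phi> k $ j) * v $ j) =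
      (\<Sum>k=0..n. \<Sum>j=0..<d. \<Phi> k $ i * \<Phi> k $ j * v $ j)"
    by (subst sum.swap) (simp add: sum_distrib_right)
  also have "\<dots> = (\<Sum>k=0..n. \<Phi> k $ i * (\<Phi> k \<bullet> v))"
    using v by (simp add: scalar_prod_def sum_distrib_left mult.assoc)
  finally show ?thesis by simp
qed

lemma S_bilinear:
  assumes u: "u \<in> carrier_vec d" and v: "v \<in> carrier_vec d"
  shows "u \<bullet> (S n *\<^sub>v v) = u \<bullet> v + (\<Sum>k=0..n. (\<Phi> k \<bullet> u) * (\<Phi> k \<bullet> v))"
proof -
  have "u \<bullet> (S n *\<^sub>v v) = (\<Sum>i=0..<d. u $ i * (v $ i + (\<Sum>k=0..n. \<Phi> k $ i * (\<Phi> k \<bullet> v))))"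
    unfolding scalar_prod_def[of u] using S_carrier[of n, THEN carrier_matD(1)] S_mult_vec_index[OF v, of _ n]
    by (intro sum.cong) (auto simp del: index_mult_mat_vec)
  also have "\<dots> = u \<bullet> v + (\<Sum>i=0..<d. \<Sum>k=0..n. u $ i * \<Phi> k $ i * (\<Phi> k \<bullet> v))"
    using v by (simp add: ring_distribs sum.distrib sum_distrib_left scalar_prod_def mult.assoc)
  also have "(\<Sum>i=0..<d. \<Sum>k=0..n. u $ i * \<Phi> k $ i * (\<Phi> k \<bullet> v)) =
      (\<Sum>k=0..n. (\<Phi> k \<bullet> u) * (\<Phi> k \<bullet> v))"
    using u by (subst sum.swap) (simp add: scalar_prod_def sum_distrib_right mult.commute mult.left_commute)
  finally show ?thesis .
qed

lemma S_pos:
  assumes u: "u \<in> carrier_vec d"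
  shows "u \<bullet> u \<le> u \<bullet> (S n *\<^sub>v u)"
  unfolding S_bilinear[OF u u] by (simp add: sum_nonneg)

lemma r_nz: "r n \<noteq> 0"
proof
  assume "r n = 0"
  then obtain v where v: "v \<in> carrier_vec d" "v \<noteq> 0\<^sub>v d" "S n *\<^sub>v v = 0\<^sub>v d"
    using det_0_iff_vec_prod_zero[OF S_carrier] unfolding r_def by auto
  then have "v \<bullet> v \<le> 0" using S_pos[OF v(1), of n] by simp
  moreover have "v \<bullet> v = (\<Sum>i=0..<d. (v $ i)^2)" using v by (simp add: scalar_prod_def power2_eq_square)
  ultimately have "(\<Sum>i=0..<d. (v $ i)^2) = 0" by (simp add: sum_nonneg order_antisym)
  then have "\<forall>i<d. v $ i = 0" by (subst (asm) sum_nonneg_eq_0_iff) auto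
  then show False using v by (auto intro!: eq_vecI)
qed

lemma T_carrier [simp]: "T n \<in> carrier_mat d d"
  and ST: "S n * T n = 1\<^sub>m d" and TS: "T n * S n = 1\<^sub>m d"
  using inv_mat_props[OF S_carrier r_nz[unfolded r_def]] by (auto simp: T_def)

lemma S_T_vec: "v \<in> carrier_vec d \<Longrightarrow> S n *\<^sub>v (T n *\<^sub>v v) = v"
  using ST by (metis S_carrier T_carrier assoc_mult_mat_vec one_mult_mat_vec)

lemma T_S_vec: "v \<in> carrier_vec d \<Longrightarrow> T n *\<^sub>v (S n *\<^sub>v v) = v"
  using TS by (metis S_carrier T_carrier assoc_mult_mat_vec one_mult_mat_vec)

lemma S_Suc_bilinear:
  assumes "u \<in> carrier_vec d" "v \<in> carrier_vec d"
  shows "u \<bullet> (S (Suc n) *\<^sub>v v) = u \<bullet> (S n *\<^sub>v v) + (\<Phi> (Suc n) \<bullet> u) * (\<Phi> (Suc n) \<bullet> v)"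
  using assms by (simp add: S_bilinear)

lemma S_Suc_vec:
  assumes "v \<in> carrier_vec d"
  shows "S (Suc n) *\<^sub>v v = S n *\<^sub>v v + (\<Phi> (Suc n) \<bullet> v) \<cdot>\<^sub>v \<Phi> (Suc n)"
  using assms dim[of "Suc n"] S_carrier[of n] S_carrier[of "Suc n"]
  by (intro eq_vecI) (auto simp: S_mult_vec_index simp del: S_carrier mult_mat_vec_def index_mult_mat_vec)

text \<open>With \<open>w\<close> = S_(n+1)^(-1) \<Phi>_(n+1), both \<open>w\<close> \<bullet>
  S_(n+1) \<open>w\<close> and \<Phi>_(n+1) \<bullet> \<open>w\<close> equal \<open>f\<close>, so
  undoing the rank-one update leaves f - f^2 for S_n. The bounds on \<open>f\<close> come from the
  positivity of this quantity.\<close>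

lemma f_self:
  fixes n
  defines "w \<equiv> T (Suc n) *\<^sub>v \<Phi> (Suc n)"
  shows "f (Suc n) - (f (Suc n))^2 = w \<bullet> (S n *\<^sub>v w)"
proof -
  have w: "w \<in> carrier_vec d" using dim by (auto simp: w_def intro!: mult_mat_vec_carrier)
  have f: "f (Suc n) = w \<bullet> \<Phi> (Suc n)"
    using w dim by (simp add: f_def w_def[symmetric] comm_scalar_prod[of _ d])
  have "w \<bullet> (S (Suc n) *\<^sub>v w) = f (Suc n)" unfolding f using dim by (simp add: w_def S_T_vec)
  moreover have "\<Phi> (Suc n) \<bullet> w = f (Suc n)" by (simp add: f_def w_def)
  ultimately show ?thesis using S_Suc_bilinear[OF w w, of n] by (simp add: power2_eq_square)
qed

lemma scalar_prod_self_nonneg: "(v :: real vec) \<bullet> v \<ge> 0"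
  by (simp add: scalar_prod_def sum_nonneg)

lemma scalar_prod_Cauchy_Schwarz:
  assumes "u \<in> carrier_vec d" "v \<in> carrier_vec d"
  shows "(u \<bullet> v)^2 \<le> (u \<bullet> u) * (v \<bullet> (v :: real vec))"
proof -
  have "(\<Sum>i=0..<d. u $ i * v $ i)\<^sup>2 \<le> (\<Sum>i=0..<d. (u $ i)\<^sup>2) * (\<Sum>i=0..<d. (v $ i)\<^sup>2)"
    by (rule Cauchy_Schwarz_ineq_sum)
  then show ?thesis using assms by (simp add: scalar_prod_def power2_eq_square)
qed

text \<open>Because S_n dominates the identity, f - f^2 \<ge> |w|^2 \<ge> 0. If f were 1, then w = 0
  and f = \<Phi> \<bullet> w = 0. Cauchy-Schwarz gives f^2 \<le> |\<Phi>|^2 (f - f^2), and division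
  by f yields the third bound, which limits how fast the determinant can grow.\<close>

lemma f_bounds: "0 \<le> f (Suc n)" "f (Suc n) < 1"
  and f_le: "f (Suc n) \<le> (\<Phi> (Suc n) \<bullet> \<Phi> (Suc n)) * (1 - f (Suc n))"
proof -
  define w where "w = T (Suc n) *\<^sub>v \<Phi> (Suc n)"
  have w: "w \<in> carrier_vec d" using dim by (auto simp: w_def intro!: mult_mat_vec_carrier)
  have ge: "w \<bullet> w \<le> f (Suc n) - (f (Suc n))^2"
    using S_pos[OF w, of n] f_self[of n] by (simp add: w_def)
  have ww: "0 \<le> w \<bullet> w" by (rule scalar_prod_self_nonneg)
  have "0 \<le> f (Suc n) * (1 - f (Suc n))" using ge ww by (simp add: algebra_simps power2_eq_square)
  then have le: "0 \<le> f (Suc n) \<and> f (Suc n) \<le> 1" by (auto simp: zero_le_mult_iff)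
  then show ge0: "0 \<le> f (Suc n)" by simp
  have cs: "(f (Suc n))^2 \<le> (\<Phi> (Suc n) \<bullet> \<Phi> (Suc n)) * (w \<bullet> w)"
    using scalar_prod_Cauchy_Schwarz[OF dim[of "Suc n"] w] by (simp add: f_def w_def)
  have "f (Suc n) \<noteq> 1"
  proof
    assume 1: "f (Suc n) = 1"
    then have "w \<bullet> w = 0" using ge ww by simp
    then show False using cs 1 by simp
  qed
  then show "f (Suc n) < 1" using le by simp
  have PP: "0 \<le> \<Phi> (Suc n) \<bullet> \<Phi> (Suc n)" by (rule scalar_prod_self_nonneg)
  have "(f (Suc n))^2 \<le> (\<Phi> (Suc n) \<bullet> \<Phi> (Suc n)) * (f (Suc n) - (f (Suc n))^2)"
    using cs mult_left_mono[OF ge PP] by linarith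
  then have "f (Suc n) * f (Suc n) \<le> f (Suc n) * ((\<Phi> (Suc n) \<bullet> \<Phi> (Suc n)) * (1 - f (Suc n)))"
    by (simp add: algebra_simps power2_eq_square)
  then show "f (Suc n) \<le> (\<Phi> (Suc n) \<bullet> \<Phi> (Suc n)) * (1 - f (Suc n))"
  proof (cases "f (Suc n) = 0")
    case True then show ?thesis using PP by simp
  next
    case False
    then have "f (Suc n) > 0" using ge0 by simp
    then show ?thesis using \<open>f (Suc n) * f (Suc n) \<le> _\<close> by (simp only: mult_le_cancel_left_pos)
  qed
qed

lemma r_Suc: "r n = r (Suc n) * (1 - f (Suc n))"
proof -
  define C where "C = mat d 1 (\<lambda>(i, _). \<Phi> (Suc n) $ i)"
  have C: "C \<in> carrier_mat d 1" "C\<^sup>T \<in> carrier_mat 1 d" by (auto simp: C_def)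
  have "S (Suc n) - C * C\<^sup>T = S n"
    using C by (intro eq_matI) (auto simp: S_index C_def scalar_prod_def S_carrier[THEN carrier_matD(1)] S_carrier[THEN carrier_matD(2)])
  moreover have "Determinant.det (1\<^sub>m 1 - C\<^sup>T * (T (Suc n) * C)) = 1 - f (Suc n)"
  proof -
    have "1\<^sub>m 1 - C\<^sup>T * (T (Suc n) * C) \<in> carrier_mat 1 1" using C T_carrier[of "Suc n"] by auto
    then have "Determinant.det (1\<^sub>m 1 - C\<^sup>T * (T (Suc n) * C)) = (1\<^sub>m 1 - C\<^sup>T * (T (Suc n) * C)) $$ (0,0)"
      by (rule det_single)
    also have "\<dots> = 1 - f (Suc n)"
      using dim[of "Suc n"] T_carrier[of "Suc n", THEN carrier_matD(1)] T_carrier[of "Suc n", THEN carrier_matD(2)]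
      by (auto simp: C_def f_def scalar_prod_def)
    finally show ?thesis .
  qed
  ultimately show ?thesis
    using det_minus_rank_one[OF S_carrier T_carrier ST C, of "Suc n"] by (simp add: r_def)
qed

text \<open>Leibniz expansion: d! products of d entries, each entry at most 1 +
  \<open>ssq n\<close>. For the growth argument only the polynomial degree matters.\<close>

lemma r_abs_le: "\<bar>r n\<bar> \<le> fact d * (1 + ssq n) ^ d"
proof -
  have entry: "\<bar>S n $$ (i, j)\<bar> \<le> 1 + ssq n" if "i < d" "j < d" for i j
  proof -
    have "\<bar>\<Phi> k $ i * \<Phi> k $ j\<bar> \<le> \<Phi> k \<bullet> \<Phi> k" for k
    proof -
      have sq: "(\<Phi> k $ l)^2 \<le> \<Phi> k \<bullet> \<Phi> k" if "l < d" for l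
        using that dim[of k] member_le_sum[of l "{0..<d}" "\<lambda>l. (\<Phi> k $ l)^2"]
        by (simp add: scalar_prod_def power2_eq_square)
      have "2 * \<bar>\<Phi> k $ i * \<Phi> k $ j\<bar> \<le> (\<Phi> k $ i)^2 + (\<Phi> k $ j)^2"
        using sum_squares_bound[of "\<bar>\<Phi> k $ i\<bar>" "\<bar>\<Phi> k $ j\<bar>"] by (simp add: abs_mult)
      then show ?thesis using sq[of i] sq[of j] that by linarith
    qed
    then have "\<bar>\<Sum>k=0..n. \<Phi> k $ i * \<Phi> k $ j\<bar> \<le> ssq n"
      unfolding ssq_def by (intro order_trans[OF sum_abs] sum_mono)
    then show ?thesis using that by (auto simp: S_index)
  qed
  have ssq0: "0 \<le> ssq n" by (simp add: ssq_def sum_nonneg scalar_prod_self_nonneg)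
  have "\<bar>r n\<bar> \<le> (\<Sum>p | p permutes {0..<d}. \<bar>of_int (sign p) * (\<Prod>i = 0..<d. S n $$ (i, p i))\<bar>)"
    unfolding r_def det_def'[OF S_carrier] by (rule sum_abs)
  also have "\<dots> \<le> (\<Sum>p | p permutes {0..<d}. (1 + ssq n) ^ d)"
  proof (intro sum_mono)
    fix p assume "p \<in> {p. p permutes {0..<d}}"
    then have p: "\<And>i. i < d \<Longrightarrow> p i < d" using permutes_in_image by fastforce
    have "(\<Prod>i = 0..<d. \<bar>S n $$ (i, p i)\<bar>) \<le> (\<Prod>i = 0..<d. (1 + ssq n))"
      using entry p by (intro prod_mono) auto
    then show "\<bar>of_int (sign p) * (\<Prod>i = 0..<d. S n $$ (i, p i))\<bar> \<le> (1 + ssq n) ^ d"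
      by (simp add: abs_mult sign_def abs_prod)
  qed
  also have "\<dots> = fact d * (1 + ssq n) ^ d"
    by (simp add: card_permutations)
  finally show ?thesis .
qed

lemma r_0: "r 0 \<ge> 1"
proof -
  define C where "C = mat d 1 (\<lambda>(i, _). \<Phi> 0 $ i)"
  \<comment> \<open>S_0 adds a rank-one term to the identity; the sign goes into \<open>C'\<close>
    so that the determinant formula for a difference applies.\<close>
  define C' where "C' = mat d 1 (\<lambda>(i, _). - \<Phi> 0 $ i)"
  have C: "C \<in> carrier_mat d 1" "C\<^sup>T \<in> carrier_mat 1 d" "C' \<in> carrier_mat d 1" by (auto simp: C_def C'_def)
  have "1\<^sub>m d - C' * C\<^sup>T = S 0"
    using C by (intro eq_matI) (auto simp: S_index C_def C'_def scalar_prod_def S_carrier[THEN carrier_matD(1)] S_carrier[THEN carrier_matD(2)])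
  moreover have "Determinant.det (1\<^sub>m 1 - C\<^sup>T * (1\<^sub>m d * C')) = 1 + \<Phi> 0 \<bullet> \<Phi> 0"
  proof -
    have "1\<^sub>m 1 - C\<^sup>T * (1\<^sub>m d * C') \<in> carrier_mat 1 1" using C by auto
    then have "Determinant.det (1\<^sub>m 1 - C\<^sup>T * (1\<^sub>m d * C')) = (1\<^sub>m 1 - C\<^sup>T * (1\<^sub>m d * C')) $$ (0,0)"
      by (rule det_single)
    also have "\<dots> = 1 + \<Phi> 0 \<bullet> \<Phi> 0"
      using dim[of 0] by (auto simp: C_def C'_def scalar_prod_def sum_negf)
    finally show ?thesis .
  qed
  ultimately have "r 0 = 1 + \<Phi> 0 \<bullet> \<Phi> 0"
    using det_minus_rank_one[of "1\<^sub>m d" d "1\<^sub>m d" C' "C\<^sup>T"] C by (simp add: r_def)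
  then show ?thesis using scalar_prod_self_nonneg[of "\<Phi> 0"] by simp
qed

lemma r_pos: "r n \<ge> 1"
proof (induction n)
  case 0 show ?case by (rule r_0)
next
  case (Suc n)
  have "r (Suc n) * (1 - f (Suc n)) > 0" using Suc r_Suc[of n] by simp
  then have "r (Suc n) > 0" using f_bounds[of n] by (simp add: zero_less_mult_iff)
  then have "r (Suc n) * (1 - f (Suc n)) \<le> r (Suc n) * 1"
    using f_bounds[of n] by (intro mult_left_mono) auto
  then show ?case using Suc r_Suc[of n] by simp
qed

lemma r_mono: "r n \<le> r (Suc n)"
proof -
  have "r (Suc n) * (1 - f (Suc n)) \<le> r (Suc n) * 1"
    using f_bounds[of n] r_pos[of "Suc n"] by (intro mult_left_mono) auto
  then show ?thesis using r_Suc[of n] by simp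
qed

text \<open>\<open>f_le\<close> in multiplicative form: a jump of the determinant forces a large
  regressor at that very time.\<close>

lemma r_ratio: "r (Suc n) \<le> (1 + \<Phi> (Suc n) \<bullet> \<Phi> (Suc n)) * r n"
proof -
  have "1 \<le> (1 + \<Phi> (Suc n) \<bullet> \<Phi> (Suc n)) * (1 - f (Suc n))"
    using f_le[of n] by (simp add: algebra_simps)
  then have "r (Suc n) * 1 \<le> r (Suc n) * ((1 + \<Phi> (Suc n) \<bullet> \<Phi> (Suc n)) * (1 - f (Suc n)))"
    using r_pos[of "Suc n"] by (intro mult_left_mono) auto
  then show ?thesis unfolding r_Suc[of n] by (simp add: mult_ac)
qed

context
  fixes e e' :: "real vec" and v :: real and n :: nat
  assumes e: "e \<in> carrier_vec d"
    and e': "e' = e + (v - e \<bullet> \<Phi> (Suc n)) \<cdot>\<^sub>v (T (Suc n) *\<^sub>v \<Phi> (Suc n))"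
begin

lemma S_mult_e': "S (Suc n) *\<^sub>v e' = S (Suc n) *\<^sub>v e + (v - e \<bullet> \<Phi> (Suc n)) \<cdot>\<^sub>v \<Phi> (Suc n)"
proof -
  have w: "T (Suc n) *\<^sub>v \<Phi> (Suc n) \<in> carrier_vec d" using dim by (auto intro!: mult_mat_vec_carrier)
  have "S (Suc n) *\<^sub>v e' = S (Suc n) *\<^sub>v e + S (Suc n) *\<^sub>v ((v - e \<bullet> \<Phi> (Suc n)) \<cdot>\<^sub>v (T (Suc n) *\<^sub>v \<Phi> (Suc n)))"
    unfolding e' using e w by (intro mult_add_distrib_mat_vec[OF S_carrier]) auto
  then show ?thesis using w dim by (simp add: mult_mat_vec[OF S_carrier] S_T_vec)
qed

text \<open>The gain S_(n+1)^(-1) \<Phi>_(n+1) makes the correction cancel the rank-one change of S,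
  so S e accumulates v \<Phi> linearly. Summed over time these are the normal equations.\<close>

lemma normal_eq_step: "S (Suc n) *\<^sub>v e' = S n *\<^sub>v e + v \<cdot>\<^sub>v \<Phi> (Suc n)"
proof -
  have c: "\<Phi> (Suc n) \<bullet> e = e \<bullet> \<Phi> (Suc n)" using e dim by (auto intro: comm_scalar_prod)
  show ?thesis unfolding S_mult_e' S_Suc_vec[OF e] c
    using dim[of "Suc n"] S_carrier[of n, THEN carrier_matD(1)]
    by (intro eq_vecI) (auto simp: algebra_simps)
qed

text \<open>The quadratic form expanded at e' = e + g w, with w \<bullet> S_(n+1) e = e \<bullet>
  \<Phi>_(n+1) and w \<bullet> \<Phi>_(n+1) = f. The cross term is linear in v, so for a martingale
  difference v only f v^2 survives as an increase after conditioning.\<close>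

lemma lyapunov_step:
  "e' \<bullet> (S (Suc n) *\<^sub>v e') = e \<bullet> (S n *\<^sub>v e) - (1 - f (Suc n)) * (e \<bullet> \<Phi> (Suc n))\<^sup>2
     + 2 * ((1 - f (Suc n)) * (e \<bullet> \<Phi> (Suc n))) * v + f (Suc n) * v\<^sup>2"
proof -
  define w where "w = T (Suc n) *\<^sub>v \<Phi> (Suc n)"
  define g where "g = v - e \<bullet> \<Phi> (Suc n)"
  note P = dim[of "Suc n"]
  have w: "w \<in> carrier_vec d" using dim by (auto simp: w_def intro!: mult_mat_vec_carrier)
  have Se: "S (Suc n) *\<^sub>v e \<in> carrier_vec d" using e by (auto intro!: mult_mat_vec_carrier[OF S_carrier])
  have c: "\<Phi> (Suc n) \<bullet> e = e \<bullet> \<Phi> (Suc n)" using e dim by (auto intro: comm_scalar_prod)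
  have wS: "w \<bullet> (S (Suc n) *\<^sub>v e) = e \<bullet> \<Phi> (Suc n)"
  proof -
    have "w \<bullet> (S (Suc n) *\<^sub>v e) = e \<bullet> (S (Suc n) *\<^sub>v w)"
      unfolding S_bilinear[OF w e] S_bilinear[OF e w] using comm_scalar_prod[OF w e] by (simp add: mult.commute)
    then show ?thesis using P by (simp add: w_def S_T_vec)
  qed
  have wf: "w \<bullet> \<Phi> (Suc n) = f (Suc n)" using comm_scalar_prod[OF w P] by (simp add: f_def w_def)
  have "e' \<bullet> (S (Suc n) *\<^sub>v e') = (e + g \<cdot>\<^sub>v w) \<bullet> (S (Suc n) *\<^sub>v e + g \<cdot>\<^sub>v \<Phi> (Suc n))"
    unfolding S_mult_e' by (simp add: e' w_def g_def)
  also have "\<dots> = e \<bullet> (S (Suc n) *\<^sub>v e) + g * (e \<bullet> \<Phi> (Suc n)) + (g * (w \<bullet> (S (Suc n) *\<^sub>v e)) + g * (g * (w \<bullet> \<Phi> (Suc n))))"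
    using e w P Se by (simp add: add_scalar_prod_distrib[of _ d] scalar_prod_add_distrib[of _ d] distrib_left)
  also have "e \<bullet> (S (Suc n) *\<^sub>v e) = e \<bullet> (S n *\<^sub>v e) + (e \<bullet> \<Phi> (Suc n))\<^sup>2"
    using S_Suc_bilinear[OF e e] c by (simp add: power2_eq_square)
  finally show ?thesis unfolding wS wf g_def by (simp add: power2_eq_square algebra_simps)
qed

end

lemma lyapunov_nonneg: "e \<in> carrier_vec d \<Longrightarrow> 0 \<le> e \<bullet> (S n *\<^sub>v e)"
  using S_pos[of e n] scalar_prod_self_nonneg[of e] by linarith

end

subsection \<open>Strong laws for martingale differences\<close>

lemma integrable_mult_of_squares:
  fixes f g :: "'a \<Rightarrow> real"
  assumes f: "f \<in> borel_measurable M" "integrable M (\<lambda>x. (f x)\<^sup>2)"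
    and g: "g \<in> borel_measurable M" "integrable M (\<lambda>x. (g x)\<^sup>2)"
  shows "integrable M (\<lambda>x. f x * g x)"
proof (rule Bochner_Integration.integrable_bound)
  show "integrable M (\<lambda>x. (f x)\<^sup>2 + (g x)\<^sup>2)" using f g by auto
  show "(\<lambda>x. f x * g x) \<in> borel_measurable M" using f g by auto
  show "AE x in M. norm (f x * g x) \<le> norm ((f x)\<^sup>2 + (g x)\<^sup>2)"
  proof (intro AE_I2)
    fix x
    have "2 * \<bar>f x * g x\<bar> \<le> (f x)\<^sup>2 + (g x)\<^sup>2"
      using sum_squares_bound[of "\<bar>f x\<bar>" "\<bar>g x\<bar>"] by (simp add: abs_mult)
    moreover have "0 \<le> (f x)\<^sup>2 + (g x)\<^sup>2" by simp
    ultimately show "norm (f x * g x) \<le> norm ((f x)\<^sup>2 + (g x)\<^sup>2)" by simp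
  qed
qed

section \<open>Conditional moments of the noise with predictable weights\<close>

locale noise = prob_space M for M :: "'a measure" +
  fixes F :: "nat \<Rightarrow> 'a measure" and V :: "nat \<Rightarrow> 'a \<Rightarrow> real" and \<sigma> a :: real
  assumes filt: "filtration (space M) F"
    and sub: "\<And>n. subalgebra M (F n)"
    and md: "martingale_difference M F V"
    and \<sigma>_pos: "\<sigma> > 0"
    and var: "\<And>n. AE \<omega> in M. nn_cond_exp M (F n) (\<lambda>\<omega>. ennreal ((V (n + 1) \<omega>)\<^sup>2)) \<omega> = ennreal (\<sigma>\<^sup>2)"
    and a_gt: "a > 2"
    and mom: "AE \<omega> in M. (SUP n. nn_cond_exp M (F n) (\<lambda>\<omega>. ennreal (\<bar>V (n + 1) \<omega>\<bar> powr a)) \<omega>) < \<infinity>"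
begin

lemma F_M: "f \<in> measurable (F n) N \<Longrightarrow> f \<in> measurable M N"
  using measurable_from_subalg[OF sub] .

lemma F_mono: "f \<in> measurable (F m) N \<Longrightarrow> m \<le> n \<Longrightarrow> f \<in> measurable (F n) N"
  using filt sub unfolding filtration_def
  by (metis measurable_from_subalg subalgebra_def)

lemma sf: "sigma_finite_subalgebra M (F n)"
proof -
  interpret finite_measure_subalgebra M "F n"
    by unfold_locales (rule sub)
  show ?thesis by unfold_locales
qed

lemma V_F: "V (Suc n) \<in> borel_measurable (F (Suc n))"
  using md by (simp add: martingale_difference_def)

lemma V_M [measurable]: "V (Suc n) \<in> borel_measurable M"
  using V_F by (rule F_M)

text \<open>The conditional moment of order a is bounded in n only by a random constant. As
  \<open>\<kappa> n\<close> is \<open>F n\<close>-measurable, the event that it is at most L can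
  enter any estimate of V_(n+1) as a predictable weight.\<close>

definition \<kappa> where "\<kappa> n = nn_cond_exp M (F n) (\<lambda>\<omega>. ennreal (\<bar>V (Suc n) \<omega>\<bar> powr a))"

lemma \<kappa>_F: "\<kappa> n \<in> borel_measurable (F n)"
  by (simp add: \<kappa>_def)

lemma \<kappa>_bdd: "AE \<omega> in M. \<exists>L::nat. \<forall>n. \<kappa> n \<omega> \<le> of_nat L"
  using mom
proof eventually_elim
  case (elim \<omega>)
  then obtain L :: nat where "(SUP n. \<kappa> n \<omega>) < of_nat L"
    using ennreal_Ex_less_of_nat[of "SUP n. \<kappa> n \<omega>"] by (auto simp: \<kappa>_def)
  then show ?case by (meson SUP_upper UNIV_I less_imp_le order_trans)
qed

lemma nn_V2:
  assumes [measurable]: "G \<in> borel_measurable (F n)"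
  shows "(\<integral>\<^sup>+\<omega>. G \<omega> * ennreal ((V (Suc n) \<omega>)\<^sup>2) \<partial>M) = ennreal (\<sigma>\<^sup>2) * (\<integral>\<^sup>+\<omega>. G \<omega> \<partial>M)"
proof -
  interpret S: sigma_finite_subalgebra M "F n" by (rule sf)
  have "(\<integral>\<^sup>+\<omega>. G \<omega> * ennreal ((V (Suc n) \<omega>)\<^sup>2) \<partial>M) =
      (\<integral>\<^sup>+\<omega>. G \<omega> * nn_cond_exp M (F n) (\<lambda>\<omega>. ennreal ((V (Suc n) \<omega>)\<^sup>2)) \<omega> \<partial>M)"
    by (rule S.nn_cond_exp_intg[symmetric]) (use assms in measurable)
  also have "\<dots> = (\<integral>\<^sup>+\<omega>. ennreal (\<sigma>\<^sup>2) * G \<omega> \<partial>M)"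
    using var[of n] by (intro nn_integral_cong_AE) (auto simp: mult.commute)
  also have "\<dots> = ennreal (\<sigma>\<^sup>2) * (\<integral>\<^sup>+\<omega>. G \<omega> \<partial>M)"
    using F_M[OF assms] by (intro nn_integral_cmult) auto
  finally show ?thesis .
qed

lemma V2_integrable: "integrable M (\<lambda>\<omega>. (V (Suc n) \<omega>)\<^sup>2)"
  using nn_V2[of "\<lambda>_. 1" n] \<sigma>_pos
  by (intro integrableI_nn_integral_finite[where x = "\<sigma>\<^sup>2"]) (auto simp: emeasure_space_1)

lemma integral_V:
  assumes "G \<in> borel_measurable (F n)" "integrable M (\<lambda>\<omega>. G \<omega> * V (Suc n) \<omega>)"
  shows "(\<integral>\<omega>. G \<omega> * V (Suc n) \<omega> \<partial>M) = 0"
proof -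
  interpret S: sigma_finite_subalgebra M "F n" by (rule sf)
  have "(\<integral>\<omega>. G \<omega> * V (Suc n) \<omega> \<partial>M) = (\<integral>\<omega>. G \<omega> * real_cond_exp M (F n) (V (Suc n)) \<omega> \<partial>M)"
    using assms by (intro S.real_cond_exp_intg(2)[symmetric]) auto
  also have "\<dots> = (\<integral>\<omega>. 0 \<partial>M)"
  proof (intro integral_cong_AE)
    show "AE \<omega> in M. G \<omega> * real_cond_exp M (F n) (V (Suc n)) \<omega> = 0"
      using md unfolding martingale_difference_def by auto
  qed (use F_M[OF assms(1)] in auto)
  finally show ?thesis by simp
qed

lemma integral_V2:
  fixes G :: "'a \<Rightarrow> real"
  assumes G: "G \<in> borel_measurable (F n)" and b: "\<And>\<omega>. \<omega> \<in> space M \<Longrightarrow> \<bar>G \<omega>\<bar> \<le> C"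
  shows "integrable M (\<lambda>\<omega>. G \<omega> * (V (Suc n) \<omega>)\<^sup>2)"
    and "(\<integral>\<omega>. G \<omega> * (V (Suc n) \<omega>)\<^sup>2 \<partial>M) = \<sigma>\<^sup>2 * (\<integral>\<omega>. G \<omega> \<partial>M)"
proof -
  have [measurable]: "G \<in> borel_measurable M" using F_M[OF G] .
  have GM: "integrable M G"
    by (rule integrable_const_bound[where B = C]) (use b in auto)
  show int: "integrable M (\<lambda>\<omega>. G \<omega> * (V (Suc n) \<omega>)\<^sup>2)"
  proof (rule Bochner_Integration.integrable_bound)
    show "integrable M (\<lambda>\<omega>. C * (V (Suc n) \<omega>)\<^sup>2)" using V2_integrable by auto
    show "AE \<omega> in M. norm (G \<omega> * (V (Suc n) \<omega>)\<^sup>2) \<le> norm (C * (V (Suc n) \<omega>)\<^sup>2)"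
      using b by (intro AE_I2) (force simp: abs_mult intro!: mult_right_mono)
  qed auto
  \<comment> \<open>Adding C makes the weight nonnegative, so that \<open>nn_V2\<close> applies; the
    constant part is subtracted at the end.\<close>
  have nn: "0 \<le> G \<omega> + C" if "\<omega> \<in> space M" for \<omega> using b[OF that] by linarith
  have "(\<integral>\<omega>. (G \<omega> + C) * (V (Suc n) \<omega>)\<^sup>2 \<partial>M) = enn2real (\<integral>\<^sup>+\<omega>. ennreal ((G \<omega> + C) * (V (Suc n) \<omega>)\<^sup>2) \<partial>M)"
    using nn by (intro integral_eq_nn_integral) auto
  also have "(\<integral>\<^sup>+\<omega>. ennreal ((G \<omega> + C) * (V (Suc n) \<omega>)\<^sup>2) \<partial>M) = (\<integral>\<^sup>+\<omega>. ennreal (G \<omega> + C) * ennreal ((V (Suc n) \<omega>)\<^sup>2) \<partial>M)"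
    using nn by (intro nn_integral_cong) (simp add: ennreal_mult)
  also have "\<dots> = ennreal (\<sigma>\<^sup>2) * (\<integral>\<^sup>+\<omega>. ennreal (G \<omega> + C) \<partial>M)"
    using G by (intro nn_V2) auto
  also have "(\<integral>\<^sup>+\<omega>. ennreal (G \<omega> + C) \<partial>M) = ennreal (\<integral>\<omega>. G \<omega> + C \<partial>M)"
    using nn GM by (intro nn_integral_eq_integral) auto
  also have "enn2real (ennreal (\<sigma>\<^sup>2) * ennreal (\<integral>\<omega>. G \<omega> + C \<partial>M)) = \<sigma>\<^sup>2 * (\<integral>\<omega>. G \<omega> + C \<partial>M)"
    using nn by (subst ennreal_mult[symmetric]) (auto intro!: integral_nonneg_AE mult_nonneg_nonneg)
  finally have "(\<integral>\<omega>. (G \<omega> + C) * (V (Suc n) \<omega>)\<^sup>2 \<partial>M) = \<sigma>\<^sup>2 * (\<integral>\<omega>. G \<omega> + C \<partial>M)" .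
  moreover have "(\<integral>\<omega>. (V (Suc n) \<omega>)\<^sup>2 \<partial>M) = \<sigma>\<^sup>2"
    using nn_V2[of "\<lambda>_. 1" n] by (subst integral_eq_nn_integral) (auto simp: emeasure_space_1)
  ultimately show "(\<integral>\<omega>. G \<omega> * (V (Suc n) \<omega>)\<^sup>2 \<partial>M) = \<sigma>\<^sup>2 * (\<integral>\<omega>. G \<omega> \<partial>M)"
    using int GM V2_integrable[of n] by (simp add: ring_distribs prob_space)
qed

text \<open>A predictable weight supported where \<open>\<kappa> n\<close> is at most L turns the
  random conditional bound into a deterministic one.\<close>

lemma nn_Va:
  assumes [measurable]: "G \<in> borel_measurable (F n)"
    and L: "\<And>\<omega>. \<omega> \<in> space M \<Longrightarrow> G \<omega> \<noteq> 0 \<Longrightarrow> \<kappa> n \<omega> \<le> L"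
  shows "(\<integral>\<^sup>+\<omega>. G \<omega> * ennreal (\<bar>V (Suc n) \<omega>\<bar> powr a) \<partial>M) \<le> L * (\<integral>\<^sup>+\<omega>. G \<omega> \<partial>M)"
proof -
  interpret S: sigma_finite_subalgebra M "F n" by (rule sf)
  have "(\<integral>\<^sup>+\<omega>. G \<omega> * ennreal (\<bar>V (Suc n) \<omega>\<bar> powr a) \<partial>M) = (\<integral>\<^sup>+\<omega>. G \<omega> * \<kappa> n \<omega> \<partial>M)"
    unfolding \<kappa>_def by (rule S.nn_cond_exp_intg[symmetric]) (use assms in measurable)
  also have "\<dots> \<le> (\<integral>\<^sup>+\<omega>. L * G \<omega> \<partial>M)"
  proof (intro nn_integral_mono)
    fix \<omega> assume "\<omega> \<in> space M"
    then show "G \<omega> * \<kappa> n \<omega> \<le> L * G \<omega>"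
      using L[of \<omega>] by (cases "G \<omega> = 0") (auto simp: mult.commute[of L] intro!: mult_left_mono)
  qed
  also have "\<dots> = L * (\<integral>\<^sup>+\<omega>. G \<omega> \<partial>M)"
    using F_M[OF assms(1)] by (intro nn_integral_cmult) auto
  finally show ?thesis .
qed

lemma nn_Vb:
  assumes G: "G \<in> borel_measurable (F n)"
    and L: "\<And>\<omega>. \<omega> \<in> space M \<Longrightarrow> G \<omega> \<noteq> 0 \<Longrightarrow> \<kappa> n \<omega> \<le> L"
    and b: "0 \<le> b" "b \<le> a"
  shows "(\<integral>\<^sup>+\<omega>. G \<omega> * ennreal (\<bar>V (Suc n) \<omega>\<bar> powr b) \<partial>M) \<le> (1 + L) * (\<integral>\<^sup>+\<omega>. G \<omega> \<partial>M)"
proof -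
  have [measurable]: "G \<in> borel_measurable M" using F_M[OF G] .
  have "(\<integral>\<^sup>+\<omega>. G \<omega> * ennreal (\<bar>V (Suc n) \<omega>\<bar> powr b) \<partial>M)
      \<le> (\<integral>\<^sup>+\<omega>. G \<omega> + G \<omega> * ennreal (\<bar>V (Suc n) \<omega>\<bar> powr a) \<partial>M)"
  proof (intro nn_integral_mono)
    fix \<omega>
    have "\<bar>V (Suc n) \<omega>\<bar> powr b \<le> 1 + \<bar>V (Suc n) \<omega>\<bar> powr a"
    proof (cases "\<bar>V (Suc n) \<omega>\<bar> \<le> 1")
      case True
      then have "\<bar>V (Suc n) \<omega>\<bar> powr b \<le> 1" using b by (intro powr_le1) auto
      moreover have "0 \<le> \<bar>V (Suc n) \<omega>\<bar> powr a" by simp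
      ultimately show ?thesis by linarith
    next
      case False
      then have "\<bar>V (Suc n) \<omega>\<bar> powr b \<le> \<bar>V (Suc n) \<omega>\<bar> powr a" using b by (intro powr_mono) auto
      then show ?thesis by linarith
    qed
    then have "ennreal (\<bar>V (Suc n) \<omega>\<bar> powr b) \<le> 1 + ennreal (\<bar>V (Suc n) \<omega>\<bar> powr a)"
      by (metis ennreal_1 ennreal_leI ennreal_plus powr_ge_zero zero_le_one)
    then show "G \<omega> * ennreal (\<bar>V (Suc n) \<omega>\<bar> powr b) \<le> G \<omega> + G \<omega> * ennreal (\<bar>V (Suc n) \<omega>\<bar> powr a)"
      by (metis distrib_left mult.right_neutral mult_left_mono zero_le)
  qed
  also have "\<dots> = (\<integral>\<^sup>+\<omega>. G \<omega> \<partial>M) + (\<integral>\<^sup>+\<omega>. G \<omega> * ennreal (\<bar>V (Suc n) \<omega>\<bar> powr a) \<partial>M)"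
    by (intro nn_integral_add) auto
  also have "\<dots> \<le> (1 + L) * (\<integral>\<^sup>+\<omega>. G \<omega> \<partial>M)"
    using nn_Va[OF G L] by (simp add: distrib_right)
  finally show ?thesis .
qed

end

section \<open>Strong laws along subsequences\<close>

lemma (in prob_space) AE_tendsto_0_of_summable_squares:
  fixes Z :: "nat \<Rightarrow> 'a \<Rightarrow> real"
  assumes Z: "\<And>m. Z m \<in> borel_measurable M" "\<And>m. integrable M (\<lambda>\<omega>. (Z m \<omega>)\<^sup>2)"
    and s: "summable (\<lambda>m. \<integral>\<omega>. (Z m \<omega>)\<^sup>2 \<partial>M)"
  shows "AE \<omega> in M. (\<lambda>m. Z m \<omega>) \<longlonglongrightarrow> 0"
proof -
  note [measurable] = Z(1)
  have "(\<integral>\<^sup>+\<omega>. (\<Sum>m. ennreal ((Z m \<omega>)\<^sup>2)) \<partial>M) = (\<Sum>m. \<integral>\<^sup>+\<omega>. ennreal ((Z m \<omega>)\<^sup>2) \<partial>M)"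
    by (intro nn_integral_suminf) auto
  also have "\<dots> = (\<Sum>m. ennreal (\<integral>\<omega>. (Z m \<omega>)\<^sup>2 \<partial>M))"
    using Z by (intro suminf_cong nn_integral_eq_integral) auto
  also have "\<dots> = ennreal (\<Sum>m. \<integral>\<omega>. (Z m \<omega>)\<^sup>2 \<partial>M)"
    using s by (intro suminf_ennreal2) (auto intro!: integral_nonneg_AE)
  finally have "AE \<omega> in M. (\<Sum>m. ennreal ((Z m \<omega>)\<^sup>2)) \<noteq> \<infinity>"
    by (intro nn_integral_PInf_AE) auto
  then show ?thesis
  proof eventually_elim
    case (elim \<omega>)
    then have "summable (\<lambda>m. (Z m \<omega>)\<^sup>2)"
      by (intro summable_suminf_not_top) (auto simp: top_unique)
    then have "(\<lambda>m. (Z m \<omega>)\<^sup>2) \<longlonglongrightarrow> 0" by (rule summable_LIMSEQ_zero)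
    then have "(\<lambda>m. sqrt ((Z m \<omega>)\<^sup>2)) \<longlonglongrightarrow> sqrt 0" by (rule tendsto_real_sqrt)
    then show ?case by (simp add: tendsto_rabs_zero_iff)
  qed
qed

text \<open>Along the powers \<open>m ^ K\<close> the variances of the averages are summable; monotone
  majorants fill the gaps afterwards.\<close>

lemma (in prob_space) almost_orthogonal_slln:
  fixes D :: "nat \<Rightarrow> 'a \<Rightarrow> real" and K :: nat
  assumes D: "\<And>k. D k \<in> borel_measurable M" "\<And>k. integrable M (\<lambda>\<omega>. (D k \<omega>)\<^sup>2)"
    and diag: "\<And>k. (\<integral>\<omega>. (D k \<omega>)\<^sup>2 \<partial>M) \<le> C * (real k + 1) powr (1 - \<delta>)"
    and off: "\<And>k l. l < k \<Longrightarrow> \<bar>\<integral>\<omega>. D l \<omega> * D k \<omega> \<partial>M\<bar> \<le> C * (real k + 1) powr (- \<delta>)"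
    and \<delta>: "0 < \<delta>" "\<delta> \<le> 1" and K: "real K * \<delta> \<ge> 2"
  shows "AE \<omega> in M. (\<lambda>m. (\<Sum>k<m^K. D k \<omega>) / real (m^K)) \<longlonglongrightarrow> 0"
proof -
  note [measurable] = D(1)
  define S where "S n \<omega> = (\<Sum>k<n. D k \<omega>)" for n \<omega>
  have [measurable]: "S n \<in> borel_measurable M" for n unfolding S_def by measurable
  have prod_int: "integrable M (\<lambda>\<omega>. D l \<omega> * D k \<omega>)" for l k
    using D by (intro integrable_mult_of_squares) auto
  have S_int: "integrable M (\<lambda>\<omega>. (S n \<omega>)\<^sup>2)" for n
    unfolding S_def power2_eq_square sum_product by (intro Bochner_Integration.integrable_sum prod_int)
  have C: "0 \<le> C"
  proof -
    have "0 \<le> (\<integral>\<omega>. (D 0 \<omega>)\<^sup>2 \<partial>M)" by (intro integral_nonneg_AE) auto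
    also note diag[of 0]
    finally show ?thesis by simp
  qed
  \<comment> \<open>One new diagonal term plus n covariances of size n^(-\<delta>): the second
    moment grows by O(n^(1 - \<delta>)) per step.\<close>
  have step: "(\<integral>\<omega>. (S (Suc n) \<omega>)\<^sup>2 \<partial>M) \<le> (\<integral>\<omega>. (S n \<omega>)\<^sup>2 \<partial>M) + 3 * C * (real n + 1) powr (1 - \<delta>)" for n
  proof -
    have "(\<integral>\<omega>. (S (Suc n) \<omega>)\<^sup>2 \<partial>M) = (\<integral>\<omega>. (S n \<omega>)\<^sup>2 + 2 * (\<Sum>k<n. D k \<omega> * D n \<omega>) + (D n \<omega>)\<^sup>2 \<partial>M)"
      by (intro Bochner_Integration.integral_cong) (auto simp: S_def power2_eq_square algebra_simps sum_distrib_left sum_distrib_right)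
    also have "\<dots> = (\<integral>\<omega>. (S n \<omega>)\<^sup>2 \<partial>M) + 2 * (\<Sum>k<n. \<integral>\<omega>. D k \<omega> * D n \<omega> \<partial>M) + (\<integral>\<omega>. (D n \<omega>)\<^sup>2 \<partial>M)"
      using S_int D(2) prod_int by simp
    also have "(\<Sum>k<n. \<integral>\<omega>. D k \<omega> * D n \<omega> \<partial>M) \<le> (\<Sum>k<n. C * (real n + 1) powr (- \<delta>))"
      using off by (intro sum_mono) (meson abs_le_D1 lessThan_iff)
    also have "\<dots> = real n * (C * (real n + 1) powr (- \<delta>))" by simp
    also have "\<dots> \<le> (real n + 1) * (C * (real n + 1) powr (- \<delta>))"
      using C by (intro mult_right_mono) auto
    also have "\<dots> = C * (real n + 1) powr (1 - \<delta>)"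
      by (simp add: powr_diff powr_minus field_simps)
    finally show ?thesis using diag[of n] by simp
  qed
  have bound: "(\<integral>\<omega>. (S n \<omega>)\<^sup>2 \<partial>M) \<le> 3 * C * real n * real n powr (1 - \<delta>)" for n
  proof -
    have "(\<integral>\<omega>. (S n \<omega>)\<^sup>2 \<partial>M) \<le> (\<Sum>k<n. 3 * C * (real k + 1) powr (1 - \<delta>))"
    proof (induction n)
      case 0 then show ?case by (simp add: S_def)
    next
      case (Suc n) then show ?case using step[of n] by simp
    qed
    also have "\<dots> \<le> (\<Sum>k<n. 3 * C * real n powr (1 - \<delta>))"
      using C \<delta> by (intro sum_mono mult_left_mono powr_mono2) auto
    finally show ?thesis by (simp add: mult_ac)
  qed
  have Z: "(\<integral>\<omega>. (S (m^K) \<omega> / real (m^K))\<^sup>2 \<partial>M) \<le> 3 * C * (1 / real m ^ 2)" if "m > 0" for m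
  proof -
    define n where "n = m ^ K"
    have n: "real n > 0" using that by (simp add: n_def)
    have "(\<integral>\<omega>. (S n \<omega> / real n)\<^sup>2 \<partial>M) = (\<integral>\<omega>. (S n \<omega>)\<^sup>2 \<partial>M) / (real n)\<^sup>2"
      by (simp add: power_divide)
    also have "\<dots> \<le> (3 * C * real n * real n powr (1 - \<delta>)) / (real n)\<^sup>2"
      using bound by (intro divide_right_mono) auto
    also have "\<dots> = 3 * C * real n powr (- \<delta>)"
      using n by (simp add: powr_diff powr_minus power2_eq_square field_simps)
    \<comment> \<open>For n = m^K the normalised second moment is of order m^(- K \<delta>), at most
      m^(-2) and hence summable; this is the purpose of K \<delta> \<ge> 2.\<close>
    also have "real n powr (- \<delta>) = real m powr (- (real K * \<delta>))"
      using that by (simp add: n_def powr_powr flip: powr_realpow)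
    also have "\<dots> \<le> real m powr (- 2)"
      using that K by (intro powr_mono) auto
    also have "real m powr (-2) = 1 / real m ^ 2"
      using that by (simp add: powr_minus powr_realpow field_simps)
    finally show ?thesis using C by (simp add: n_def mult_left_mono)
  qed
  have "AE \<omega> in M. (\<lambda>m. S (m^K) \<omega> / real (m^K)) \<longlonglongrightarrow> 0"
  proof (rule AE_tendsto_0_of_summable_squares)
    show "integrable M (\<lambda>\<omega>. (S (m^K) \<omega> / real (m^K))\<^sup>2)" for m
      using S_int by (simp add: power_divide)
    show "summable (\<lambda>m. \<integral>\<omega>. (S (m^K) \<omega> / real (m^K))\<^sup>2 \<partial>M)"
    proof (rule summable_comparison_test_ev)
      show "summable (\<lambda>m. 3 * C * (1 / real m ^ 2))"
        using inverse_power_summable[of 2, where 'a=real] by (intro summable_mult) (simp add: inverse_eq_divide)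
      show "\<forall>\<^sub>F m in sequentially. norm (\<integral>\<omega>. (S (m^K) \<omega> / real (m^K))\<^sup>2 \<partial>M) \<le> 3 * C * (1 / real m ^ 2)"
        using eventually_gt_at_top[of 0]
      proof eventually_elim
        case (elim m)
        have "0 \<le> (\<integral>\<omega>. (S (m^K) \<omega> / real (m^K))\<^sup>2 \<partial>M)" by (intro integral_nonneg_AE) auto
        then show ?case using Z[OF elim] by simp
      qed
    qed
  qed measurable
  then show ?thesis by (simp add: S_def)
qed

lemma power_interval_ex:
  fixes K M n :: nat
  assumes K: "K \<ge> 1" and n: "M ^ K \<le> n"
  obtains m where "M \<le> m" "m ^ K \<le> n" "n < (m + 1) ^ K"
proof -
  define j where "j = (LEAST j. n < j ^ K)"
  have "n < (n + 1) ^ K"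
  proof -
    have "n + 1 \<le> (n + 1) ^ K" using K by (intro self_le_power) auto
    then show ?thesis by simp
  qed
  then have j: "n < j ^ K" unfolding j_def by (rule LeastI)
  moreover have "(0::nat) ^ K = 0" using K by simp
  ultimately have "j \<noteq> 0" by (metis not_less_zero)
  then obtain m where m: "j = m + 1" by (metis Suc_eq_plus1 not0_implies_Suc)
  have le: "m ^ K \<le> n" using not_less_Least[of m "\<lambda>j. n < j ^ K"] m by (simp add: j_def not_less)
  have "M < j" using j n K by (metis le_less_trans not_le power_mono zero_le leD)
  then show ?thesis using that[of m] le j m by auto
qed

text \<open>Inside a block from m^K to (m+1)^K the increments of P are dominated by those of Q. At
  both ends of the block the averages of Q are near q, and ((m+1)/m)^K tends to 1, so the block
  contributes only o(m^K).\<close>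

lemma tendsto_average_interpolate:
  fixes P Q :: "nat \<Rightarrow> real" and K :: nat
  assumes K: "K \<ge> 1"
    and P: "(\<lambda>m. P (m ^ K) / real (m ^ K)) \<longlonglongrightarrow> p"
    and Q: "(\<lambda>m. Q (m ^ K) / real (m ^ K)) \<longlonglongrightarrow> q"
    and PQ: "\<And>m n. m \<le> n \<Longrightarrow> \<bar>P n - P m\<bar> \<le> Q n - Q m"
  shows "(\<lambda>n. P n / real n) \<longlonglongrightarrow> p"
proof (rule LIMSEQ_I)
  fix e :: real assume e: "e > 0"
  define R where "R m = (real (m + 1) / real m) ^ K" for m
  have "(\<lambda>m. real (m + 1) / real m) \<longlonglongrightarrow> 1" by real_asymp
  then have R: "R \<longlonglongrightarrow> 1" unfolding R_def using tendsto_power[of _ 1 _ K] by fastforce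
  define E where "E m = (Q ((m + 1) ^ K) / real ((m + 1) ^ K)) * R m - Q (m ^ K) / real (m ^ K)
     + \<bar>P (m ^ K) / real (m ^ K) - p\<bar> + \<bar>p\<bar> * (1 - inverse (R m))" for m
  have Q': "(\<lambda>m. Q ((m + 1) ^ K) / real ((m + 1) ^ K)) \<longlonglongrightarrow> q"
    using LIMSEQ_Suc[OF Q] by simp
  have "E \<longlonglongrightarrow> q * 1 - q + \<bar>p - p\<bar> + \<bar>p\<bar> * (1 - inverse 1)"
    unfolding E_def by (intro tendsto_intros Q Q' P R) auto
  then have "eventually (\<lambda>m. E m < e \<and> m > 0) sequentially"
    using e by (intro eventually_conj order_tendstoD(2)[where y = 0] eventually_gt_at_top) auto
  then obtain M where M: "\<And>m. m \<ge> M \<Longrightarrow> E m < e \<and> m > 0" by (auto simp: eventually_sequentially)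
  show "\<exists>no. \<forall>n\<ge>no. norm (P n / real n - p) < e"
  proof (intro exI[of _ "M ^ K"] allI impI)
    fix n assume "M ^ K \<le> n"
    then obtain m where m: "M \<le> m" "m ^ K \<le> n" "n < (m + 1) ^ K"
      using power_interval_ex[OF K] by blast
    define N where "N = m ^ K"
    have m0: "m > 0" using M m by blast
    then have N: "real N > 0" "N \<le> n" using m by (auto simp: N_def)
    have RN: "R m = real ((m + 1) ^ K) / real N" by (simp add: R_def N_def power_divide)
    have nR: "1 - real N / real n \<le> 1 - inverse (R m)"
    proof -
      have "real N / real ((m + 1) ^ K) \<le> real N / real n"
        using m N by (intro divide_left_mono) (auto simp: less_imp_le simp flip: of_nat_power)
      then show ?thesis using RN by (simp add: inverse_eq_divide)
    qed
    have "\<bar>P n / real n - p\<bar> \<le> \<bar>P n - P N\<bar> / real n + \<bar>P N / real N - p\<bar> * (real N / real n) + \<bar>p\<bar> * (1 - real N / real n)"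
    proof -
      have "P n / real n - p = (P n - P N) / real n + (P N / real N - p) * (real N / real n) - p * (1 - real N / real n)"
        using N by (simp add: field_simps)
      also have "\<bar>\<dots>\<bar> \<le> \<bar>(P n - P N) / real n\<bar> + \<bar>(P N / real N - p) * (real N / real n)\<bar> + \<bar>p * (1 - real N / real n)\<bar>"
        by linarith
      also have "\<dots> = \<bar>P n - P N\<bar> / real n + \<bar>P N / real N - p\<bar> * (real N / real n) + \<bar>p\<bar> * (1 - real N / real n)"
        using N by (simp add: abs_mult)
      finally show ?thesis .
    qed
    moreover have "\<bar>P n - P N\<bar> / real n \<le> (Q ((m + 1) ^ K) - Q N) / real N"
    proof -
      have "\<bar>P n - P N\<bar> \<le> Q n - Q N" using PQ N by blast
      moreover have "Q n \<le> Q ((m + 1) ^ K)" using PQ[of n "(m + 1) ^ K"] m by linarith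
      ultimately have "\<bar>P n - P N\<bar> \<le> Q ((m + 1) ^ K) - Q N" by linarith
      then have "\<bar>P n - P N\<bar> / real n \<le> (Q ((m + 1) ^ K) - Q N) / real n"
        using N by (intro divide_right_mono) auto
      also have "\<dots> \<le> (Q ((m + 1) ^ K) - Q N) / real N"
      proof (intro divide_left_mono)
        show "0 \<le> Q ((m + 1) ^ K) - Q N"
          using \<open>\<bar>P n - P N\<bar> \<le> Q ((m + 1) ^ K) - Q N\<close> by linarith
      qed (use N in auto)
      finally show ?thesis .
    qed
    moreover have "\<bar>P N / real N - p\<bar> * (real N / real n) \<le> \<bar>P N / real N - p\<bar>"
      using N by (intro mult_left_le) (auto simp: divide_simps)
    moreover have "\<bar>p\<bar> * (1 - real N / real n) \<le> \<bar>p\<bar> * (1 - inverse (R m))"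
      using nR by (intro mult_left_mono) auto
    moreover have "(Q ((m + 1) ^ K) - Q N) / real N = (Q ((m + 1) ^ K) / real ((m + 1) ^ K)) * R m - Q (m ^ K) / real (m ^ K)"
      unfolding RN using N by (simp add: N_def diff_divide_distrib del: of_nat_power)
    ultimately have "\<bar>P n / real n - p\<bar> \<le> E m" unfolding E_def N_def by linarith
    then show "norm (P n / real n - p) < e" using M[OF m(1)] by simp
  qed
qed

text \<open>Finitely many changed terms contribute a constant divided by \<open>h m\<close>. This
  undoes a truncation that is eventually inactive.\<close>

lemma average_cong_eventually:
  fixes f g :: "nat \<Rightarrow> real"
  assumes "eventually (\<lambda>k. f k = g k) sequentially"
    and h: "filterlim h at_top sequentially"
    and "(\<lambda>m. (\<Sum>k<h m. f k) / real (h m)) \<longlonglongrightarrow> c"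
  shows "(\<lambda>m. (\<Sum>k<h m. g k) / real (h m)) \<longlonglongrightarrow> c"
proof -
  obtain N where N: "\<And>k. k \<ge> N \<Longrightarrow> f k = g k" using assms(1) by (auto simp: eventually_sequentially)
  define D where "D = (\<Sum>k<N. g k - f k)"
  have "(\<lambda>m. D / real (h m)) \<longlonglongrightarrow> 0"
    by (intro real_tendsto_divide_at_top[OF tendsto_const] filterlim_compose[OF filterlim_real_sequentially h])
  then have "(\<lambda>m. (\<Sum>k<h m. f k) / real (h m) + D / real (h m)) \<longlonglongrightarrow> c + 0"
    using assms(3) by (intro tendsto_add)
  moreover have "eventually (\<lambda>m. (\<Sum>k<h m. f k) / real (h m) + D / real (h m) = (\<Sum>k<h m. g k) / real (h m)) sequentially"
    using h[unfolded filterlim_at_top, rule_format, of N]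
  proof eventually_elim
    case (elim m)
    have "(\<Sum>k<h m. g k - f k) = (\<Sum>k<N. g k - f k)"
      using elim N by (intro sum.mono_neutral_right) (auto simp: not_less)
    then show ?case by (simp add: D_def sum_subtractf flip: add_divide_distrib)
  qed
  ultimately show ?thesis by (auto elim: Lim_transform_eventually)
qed

context noise begin

lemma \<kappa>_set [measurable]: "{\<omega> \<in> space M. \<kappa> n \<omega> \<le> L} \<in> sets (F n)"
proof -
  have "{\<omega> \<in> space (F n). \<kappa> n \<omega> \<le> L} \<in> sets (F n)" using \<kappa>_F[of n] by measurable
  then show ?thesis using sub[of n] by (simp add: subalgebra_def)
qed

text \<open>On the event that \<open>\<kappa> n\<close> is at most L, Markov's inequality for the
  moment of order a bounds the probability by L (n + 1)^(- \<gamma> a / 2), summable since \<gamma>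
  a > 2. Borel-Cantelli for each integer L and the random bound on \<open>\<kappa>\<close>
  conclude.\<close>

lemma V_growth:
  assumes \<gamma>: "\<gamma> * a > 2"
  shows "AE \<omega> in M. eventually (\<lambda>n. (V (Suc n) \<omega>)\<^sup>2 \<le> (real n + 1) powr \<gamma>) sequentially"
proof -
  have \<kappa>_M [measurable]: "\<kappa> n \<in> borel_measurable M" for n using F_M[OF \<kappa>_F] .
  define A where "A L n = {\<omega> \<in> space M. \<kappa> n \<omega> \<le> of_nat L \<and> (V (Suc n) \<omega>)\<^sup>2 > (real n + 1) powr \<gamma>}" for L n :: nat
  have A [measurable]: "A L n \<in> sets M" for L n unfolding A_def by measurable
  have meas: "measure M (A L n) \<le> real L * (real n + 1) powr (- (\<gamma> * a / 2))" for L n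
  proof -
    define B where "B = {\<omega> \<in> space M. \<kappa> n \<omega> \<le> of_nat L}"
    have B: "B \<in> sets (F n)" unfolding B_def by (rule \<kappa>_set)
    define c where "c = (real n + 1) powr (- (\<gamma> * a / 2))"
    have "emeasure M (A L n) = (\<integral>\<^sup>+\<omega>. indicator (A L n) \<omega> \<partial>M)" by simp
    also have "\<dots> \<le> (\<integral>\<^sup>+\<omega>. (ennreal c * indicator B \<omega>) * ennreal (\<bar>V (Suc n) \<omega>\<bar> powr a) \<partial>M)"
    proof (intro nn_integral_mono)
      fix \<omega> assume \<omega>: "\<omega> \<in> space M"
      have "1 \<le> c * \<bar>V (Suc n) \<omega>\<bar> powr a" if "\<omega> \<in> A L n"
      proof -
        have "((real n + 1) powr \<gamma>) powr (a/2) \<le> ((V (Suc n) \<omega>)\<^sup>2) powr (a/2)"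
          using that a_gt by (intro powr_mono2) (auto simp: A_def)
        also have "((V (Suc n) \<omega>)\<^sup>2) powr (a/2) = \<bar>V (Suc n) \<omega>\<bar> powr a"
        proof -
          have "(V (Suc n) \<omega>)\<^sup>2 = \<bar>V (Suc n) \<omega>\<bar> powr 2" by (cases "V (Suc n) \<omega> = 0") (auto simp: powr_numeral)
          then show ?thesis by (simp only: powr_powr) simp
        qed
        finally have "(real n + 1) powr (\<gamma> * a / 2) \<le> \<bar>V (Suc n) \<omega>\<bar> powr a" by (simp add: powr_powr)
        then have "c * (real n + 1) powr (\<gamma> * a / 2) \<le> c * \<bar>V (Suc n) \<omega>\<bar> powr a"
          by (intro mult_left_mono) (auto simp: c_def)
        then show ?thesis by (simp add: c_def flip: powr_add)
      qed
      then show "indicator (A L n) \<omega> \<le> (ennreal c * indicator B \<omega>) * ennreal (\<bar>V (Suc n) \<omega>\<bar> powr a)"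
        by (auto simp: indicator_def A_def B_def c_def simp flip: ennreal_mult)
    qed
    also have "\<dots> \<le> of_nat L * (\<integral>\<^sup>+\<omega>. ennreal c * indicator B \<omega> \<partial>M)"
    proof (rule nn_Va)
      show "(\<lambda>\<omega>. ennreal c * indicator B \<omega>) \<in> borel_measurable (F n)" using B by measurable
    qed (auto simp: B_def indicator_def split: if_splits)
    also have "\<dots> \<le> of_nat L * (\<integral>\<^sup>+\<omega>. ennreal c \<partial>M)"
      by (intro mult_left_mono nn_integral_mono) (auto simp: indicator_def)
    also have "\<dots> = ennreal (real L * c)"
      by (simp add: emeasure_space_1 ennreal_mult c_def ennreal_of_nat_eq_real_of_nat)
    finally show ?thesis by (simp add: emeasure_eq_measure c_def)
  qed
  have "AE \<omega> in M. \<forall>L. eventually (\<lambda>n. \<omega> \<in> space M - A L n) sequentially"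
    unfolding AE_all_countable
  proof
    fix L :: nat
    show "AE \<omega> in M. eventually (\<lambda>n. \<omega> \<in> space M - A L n) sequentially"
    proof (rule borel_cantelli_AE1[OF A])
      show "emeasure M (A L n) < \<infinity>" for n by (simp add: emeasure_eq_measure)
      show "summable (\<lambda>n. measure M (A L n))"
      proof (rule summable_comparison_test)
        have "summable (\<lambda>n. real (Suc n) powr (- (\<gamma> * a / 2)))"
          using \<gamma> by (subst summable_Suc_iff) (simp add: summable_real_powr_iff)
        then show "summable (\<lambda>n. real L * (real n + 1) powr (- (\<gamma> * a / 2)))"
          by (intro summable_mult) (simp add: add.commute)
        show "\<exists>N. \<forall>n\<ge>N. norm (measure M (A L n)) \<le> real L * (real n + 1) powr (- (\<gamma> * a / 2))"
          using meas by auto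
      qed
    qed
  qed
  then show ?thesis using \<kappa>_bdd AE_space
  proof eventually_elim
    case (elim \<omega>)
    then obtain L :: nat where L: "\<forall>n. \<kappa> n \<omega> \<le> of_nat L" by blast
    from elim(1) have "eventually (\<lambda>n. \<omega> \<in> space M - A L n) sequentially" by blast
    then show ?case by eventually_elim (use L elim(3) in \<open>auto simp: A_def not_less\<close>)
  qed
qed

lemma exp_V2: "(\<integral>\<omega>. (V (Suc n) \<omega>)\<^sup>2 \<partial>M) = \<sigma>\<^sup>2"
  using integral_V2(2)[of "\<lambda>_. 1" n 1] by (simp add: prob_space)

text \<open>When a < 4 the squares need not have a second moment. They are truncated at t_k = (k +
  1)^\<gamma> and restricted to the predictable events \<kappa> \<le> L; by \<open>V_growth\<close>
  and \<open>\<kappa>_bdd\<close> almost every path, for L large, eventually sees neither change.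
  The terms so modified are almost orthogonal.\<close>

lemma slln_V2: "AE \<omega> in M. (\<lambda>n. (\<Sum>k<n. (V (Suc k) \<omega>)\<^sup>2) / real n) \<longlonglongrightarrow> \<sigma>\<^sup>2"
proof -
  define \<gamma> where "\<gamma> = (1 + 2 / a) / 2"
  have "2 / a < 1" using a_gt by (simp add: field_simps)
  then have \<gamma>: "\<gamma> < 1" "\<gamma> > 2 / a" by (simp_all add: \<gamma>_def)
  then have \<gamma>a: "\<gamma> * a > 2" using a_gt by (simp add: pos_divide_less_eq)
  have \<gamma>0: "\<gamma> > 0" using \<gamma>(2) a_gt less_trans[of 0 "2 / a" \<gamma>] by simp
  \<comment> \<open>The first bound keeps the second moments, of order t_k, below k^(1 - \<delta>).
    The second controls the truncation bias, of order t_k^(-(a - 2)/2).\<close>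
  define \<delta> where "\<delta> = min (1 - \<gamma>) (\<gamma> * (a - 2) / 2)"
  have \<delta>: "0 < \<delta>" "\<delta> \<le> 1" "\<delta> \<le> 1 - \<gamma>" using \<gamma> \<gamma>0 a_gt by (auto simp: \<delta>_def)
  have \<delta>4: "\<delta> \<le> \<gamma> * (a - 2) / 2" unfolding \<delta>_def by (rule min.cobounded2)
  note \<delta> = \<delta> \<delta>4
  define K where "K = nat \<lceil>2 / \<delta>\<rceil>"
  have "2 / \<delta> \<le> real K" unfolding K_def by (rule real_nat_ceiling_ge)
  then have K: "real K * \<delta> \<ge> 2" using \<delta> by (simp add: pos_divide_le_eq)
  then have K1: "K \<ge> 1" using \<delta> by (cases K) auto
  define B where "B L n = {\<omega> \<in> space M. \<kappa> n \<omega> \<le> of_nat L}" for L n :: nat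
  have B [measurable]: "B L n \<in> sets (F n)" for L n unfolding B_def by (rule \<kappa>_set)
  have BM [measurable]: "B L n \<in> sets M" for L n using B sub[of n] by (auto simp: subalgebra_def)
  define t where "t k = (real k + 1) powr \<gamma>" for k :: nat
  have t1: "t k \<ge> 1" for k using \<gamma>0 by (simp add: t_def ge_one_powr_ge_zero)
  define D where "D L k \<omega> = indicator (B L k) \<omega> * ((if (V (Suc k) \<omega>)\<^sup>2 \<le> t k then (V (Suc k) \<omega>)\<^sup>2 else 0) - \<sigma>\<^sup>2)" for L k \<omega>
  have DF: "D L k \<in> borel_measurable (F (Suc k))" for L k
  proof -
    have [measurable]: "B L k \<in> sets (F (Suc k))"
      using B[of L k] filt unfolding filtration_def by (meson in_mono le_Suc_eq order_refl)
    note V_F[measurable]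
    show ?thesis unfolding D_def by measurable
  qed
  have DM [measurable]: "D L k \<in> borel_measurable M" for L k using F_M[OF DF] .
  have Dabs: "\<bar>D L k \<omega>\<bar> \<le> (V (Suc k) \<omega>)\<^sup>2 + \<sigma>\<^sup>2" and Dbd: "\<bar>D L k \<omega>\<bar> \<le> t k + \<sigma>\<^sup>2" for L k \<omega>
  proof -
    define y where "y = (if (V (Suc k) \<omega>)\<^sup>2 \<le> t k then (V (Suc k) \<omega>)\<^sup>2 else 0)"
    have y: "0 \<le> y" "y \<le> t k" "y \<le> (V (Suc k) \<omega>)\<^sup>2" using t1[of k] by (auto simp: y_def)
    have "\<bar>D L k \<omega>\<bar> \<le> \<bar>y - \<sigma>\<^sup>2\<bar>" by (auto simp: D_def y_def indicator_def)
    also have "\<dots> \<le> y + \<sigma>\<^sup>2" using y zero_le_power2[of \<sigma>] by linarith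
    finally show "\<bar>D L k \<omega>\<bar> \<le> (V (Suc k) \<omega>)\<^sup>2 + \<sigma>\<^sup>2" "\<bar>D L k \<omega>\<bar> \<le> t k + \<sigma>\<^sup>2"
      using y by linarith+
  qed
  have Dsq: "(D L k \<omega>)\<^sup>2 \<le> t k * (V (Suc k) \<omega>)\<^sup>2 + \<sigma>^4" for L k \<omega>
  proof -
    define y where "y = (if (V (Suc k) \<omega>)\<^sup>2 \<le> t k then (V (Suc k) \<omega>)\<^sup>2 else 0)"
    have y: "0 \<le> y" "y \<le> t k" "y \<le> (V (Suc k) \<omega>)\<^sup>2" using t1[of k] by (auto simp: y_def)
    have "(D L k \<omega>)\<^sup>2 \<le> (y - \<sigma>\<^sup>2)\<^sup>2" by (auto simp: D_def y_def indicator_def)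
    also have "\<dots> \<le> y * y + \<sigma>^4"
    proof -
      have "0 \<le> y * \<sigma>\<^sup>2" using y by simp
      then show ?thesis by (simp add: power2_eq_square power4_eq_xxxx algebra_simps)
    qed
    also have "y * y \<le> t k * (V (Suc k) \<omega>)\<^sup>2" using y by (intro mult_mono) auto
    finally show ?thesis by simp
  qed
  have Dint: "integrable M (\<lambda>\<omega>. (D L k \<omega>)\<^sup>2)" for L k
  proof (rule integrable_const_bound[where B = "(t k + \<sigma>\<^sup>2)\<^sup>2"])
    show "AE \<omega> in M. norm ((D L k \<omega>)\<^sup>2) \<le> (t k + \<sigma>\<^sup>2)\<^sup>2"
      using Dbd by (auto simp: power2_abs intro!: AE_I2 abs_le_square_iff[THEN iffD1] order_trans[OF Dbd])
  qed measurable
  have main: "AE \<omega> in M. (\<lambda>m. (\<Sum>k<m^K. D L k \<omega>) / real (m^K)) \<longlonglongrightarrow> 0" for L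
  proof (rule almost_orthogonal_slln[where C = "\<sigma>\<^sup>2 + \<sigma>^4 + 2 * \<sigma>\<^sup>2 * real L", OF DM Dint])
    fix k
    have "(\<integral>\<omega>. (D L k \<omega>)\<^sup>2 \<partial>M) \<le> (\<integral>\<omega>. t k * (V (Suc k) \<omega>)\<^sup>2 + \<sigma>^4 \<partial>M)"
      using Dsq Dint V2_integrable by (intro integral_mono) auto
    also have "\<dots> = t k * \<sigma>\<^sup>2 + \<sigma>^4" using V2_integrable exp_V2 by (simp add: prob_space)
    also have "\<dots> \<le> t k * (\<sigma>\<^sup>2 + \<sigma>^4)"
    proof -
      have "1 * \<sigma>^4 \<le> t k * \<sigma>^4" using t1[of k] by (intro mult_right_mono) auto
      then show ?thesis by (simp add: ring_distribs)
    qed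
    also have "t k \<le> (real k + 1) powr (1 - \<delta>)" unfolding t_def using \<delta> by (intro powr_mono) auto
    also have "(real k + 1) powr (1 - \<delta>) * (\<sigma>\<^sup>2 + \<sigma>^4) \<le> (real k + 1) powr (1 - \<delta>) * (\<sigma>\<^sup>2 + \<sigma>^4 + 2 * \<sigma>\<^sup>2 * real L)"
      by (intro mult_left_mono) auto
    finally show "(\<integral>\<omega>. (D L k \<omega>)\<^sup>2 \<partial>M) \<le> (\<sigma>\<^sup>2 + \<sigma>^4 + 2 * \<sigma>\<^sup>2 * real L) * (real k + 1) powr (1 - \<delta>)"
      by (simp add: mult.commute mult_right_mono)
  next
    fix k l :: nat assume lk: "l < k"
    \<comment> \<open>G is known at time k, so V_(k+1)^2 - \<sigma>^2 integrates to zero against it;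
      only the discarded tail H remains in the covariance.\<close>
    define G where "G \<omega> = D L l \<omega> * indicator (B L k) \<omega>" for \<omega>
    have G: "G \<in> borel_measurable (F k)"
    proof -
      have [measurable]: "D L l \<in> borel_measurable (F k)" using F_mono[OF DF[of L l], of k] lk by simp
      show ?thesis unfolding G_def by measurable
    qed
    have GM[measurable]: "G \<in> borel_measurable M" using F_M[OF G] .
    have Gb: "\<bar>G \<omega>\<bar> \<le> t l + \<sigma>\<^sup>2" for \<omega> using Dbd[of L l \<omega>] t1[of l] by (auto simp: G_def indicator_def)
    have Gint: "integrable M G" by (rule integrable_const_bound[where B = "t l + \<sigma>\<^sup>2"]) (use Gb in auto)
    define H where "H \<omega> = G \<omega> * (if (V (Suc k) \<omega>)\<^sup>2 \<le> t k then 0 else (V (Suc k) \<omega>)\<^sup>2)" for \<omega>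
    note V2 = integral_V2[OF G Gb]
    have HM [measurable]: "H \<in> borel_measurable M" unfolding H_def by measurable
    have Hint: "integrable M H"
      by (rule Bochner_Integration.integrable_bound[OF V2(1)]) (auto simp: H_def)
    have "(\<integral>\<omega>. D L l \<omega> * D L k \<omega> \<partial>M) = (\<integral>\<omega>. G \<omega> * (V (Suc k) \<omega>)\<^sup>2 - \<sigma>\<^sup>2 * G \<omega> - H \<omega> \<partial>M)"
      by (intro Bochner_Integration.integral_cong) (auto simp: H_def D_def G_def algebra_simps indicator_def)
    also have "\<dots> = - (\<integral>\<omega>. H \<omega> \<partial>M)"
      using V2 Gint Hint by simp
    finally have "\<bar>\<integral>\<omega>. D L l \<omega> * D L k \<omega> \<partial>M\<bar> = \<bar>\<integral>\<omega>. H \<omega> \<partial>M\<bar>" by simp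
    also have "\<dots> \<le> (\<integral>\<omega>. \<bar>H \<omega>\<bar> \<partial>M)" by (rule integral_abs_bound)
    also have "\<dots> \<le> 2 * \<sigma>\<^sup>2 * (real L * (real k + 1) powr (- \<delta>))"
    proof -
      define c where "c = (real k + 1) powr (- \<delta>)"
      have "ennreal (\<integral>\<omega>. \<bar>H \<omega>\<bar> \<partial>M) = (\<integral>\<^sup>+\<omega>. ennreal \<bar>H \<omega>\<bar> \<partial>M)"
        using Hint by (intro nn_integral_eq_integral[symmetric]) auto
      also have "\<dots> \<le> (\<integral>\<^sup>+\<omega>. ennreal (c * \<bar>G \<omega>\<bar>) * ennreal (\<bar>V (Suc k) \<omega>\<bar> powr a) \<partial>M)"
      proof (intro nn_integral_mono)
        fix \<omega>
        have "(if (V (Suc k) \<omega>)\<^sup>2 \<le> t k then 0 else (V (Suc k) \<omega>)\<^sup>2) \<le> c * \<bar>V (Suc k) \<omega>\<bar> powr a"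
        proof (cases "(V (Suc k) \<omega>)\<^sup>2 \<le> t k")
          case True then show ?thesis by (simp add: c_def)
        next
          case False
          define z where "z = \<bar>V (Suc k) \<omega>\<bar>"
          have tz: "t k \<le> z\<^sup>2" using False by (simp add: z_def)
          then have z: "z > 0" using t1[of k] by (cases "z = 0") (auto simp: z_def)
          have "1 \<le> c * (real k + 1) powr (\<gamma> * (a - 2) / 2)"
            unfolding c_def powr_add[symmetric] using \<delta> by (intro ge_one_powr_ge_zero) auto
          also have "(real k + 1) powr (\<gamma> * (a - 2) / 2) = t k powr ((a - 2)/2)"
            by (simp add: t_def powr_powr)
          also have "t k powr ((a - 2)/2) \<le> (z\<^sup>2) powr ((a - 2)/2)"
            using tz t1[of k] a_gt by (intro powr_mono2) auto
          also have "(z\<^sup>2) powr ((a - 2)/2) = z powr (a - 2)"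
          proof -
            have e: "2 * ((a - 2)/2) = a - 2" and "z\<^sup>2 = z powr 2" using z by (simp_all add: powr_numeral)
            then show ?thesis by (simp only: powr_powr)
          qed
          finally have "z\<^sup>2 * 1 \<le> z\<^sup>2 * (c * z powr (a - 2))" by (intro mult_left_mono) (auto simp: c_def mult_left_mono)
          also have "\<dots> = c * z powr a" using z by (simp add: powr_diff powr_numeral)
          finally show ?thesis using False by (simp add: z_def)
        qed
        then have "\<bar>H \<omega>\<bar> \<le> \<bar>G \<omega>\<bar> * (c * \<bar>V (Suc k) \<omega>\<bar> powr a)"
          by (auto simp: H_def abs_mult intro!: mult_left_mono)
        then show "ennreal \<bar>H \<omega>\<bar> \<le> ennreal (c * \<bar>G \<omega>\<bar>) * ennreal (\<bar>V (Suc k) \<omega>\<bar> powr a)"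
          by (simp add: mult_ac c_def flip: ennreal_mult)
      qed
      also have "\<dots> \<le> of_nat L * (\<integral>\<^sup>+\<omega>. ennreal (c * \<bar>G \<omega>\<bar>) \<partial>M)"
      proof (rule nn_Va)
        show "(\<lambda>\<omega>. ennreal (c * \<bar>G \<omega>\<bar>)) \<in> borel_measurable (F k)" using G by measurable
        show "\<kappa> k \<omega> \<le> of_nat L" if "\<omega> \<in> space M" "ennreal (c * \<bar>G \<omega>\<bar>) \<noteq> 0" for \<omega>
          using that by (cases "\<kappa> k \<omega> \<le> of_nat L") (auto simp: G_def B_def)
      qed
      \<comment> \<open>Bounding |G| by V_(l+1)^2 + \<sigma>^2 rather than by t_l keeps this factor
        uniform in l.\<close>
      also have "(\<integral>\<^sup>+\<omega>. ennreal (c * \<bar>G \<omega>\<bar>) \<partial>M) \<le> (\<integral>\<^sup>+\<omega>. ennreal (c * ((V (Suc l) \<omega>)\<^sup>2 + \<sigma>\<^sup>2)) \<partial>M)"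
        using Dabs[of L l] by (intro nn_integral_mono ennreal_leI mult_left_mono) (auto simp: G_def indicator_def c_def)
      also have "\<dots> = ennreal (\<integral>\<omega>. c * ((V (Suc l) \<omega>)\<^sup>2 + \<sigma>\<^sup>2) \<partial>M)"
        using V2_integrable by (intro nn_integral_eq_integral) (auto simp: c_def)
      also have "(\<integral>\<omega>. c * ((V (Suc l) \<omega>)\<^sup>2 + \<sigma>\<^sup>2) \<partial>M) = c * (2 * \<sigma>\<^sup>2)"
        using V2_integrable exp_V2[of l] by (simp add: prob_space)
      also have "of_nat L * ennreal (c * (2 * \<sigma>\<^sup>2)) = ennreal (2 * \<sigma>\<^sup>2 * (real L * c))"
        by (simp add: ennreal_of_nat_eq_real_of_nat c_def mult_ac flip: ennreal_mult)
      finally show ?thesis unfolding c_def by (simp add: mult_left_mono)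
    qed
    also have "\<dots> \<le> (\<sigma>\<^sup>2 + \<sigma>^4 + 2 * \<sigma>\<^sup>2 * real L) * (real k + 1) powr (- \<delta>)"
      unfolding mult.assoc[symmetric] by (intro mult_right_mono) auto
    finally show "\<bar>\<integral>\<omega>. D L l \<omega> * D L k \<omega> \<partial>M\<bar> \<le> (\<sigma>\<^sup>2 + \<sigma>^4 + 2 * \<sigma>\<^sup>2 * real L) * (real k + 1) powr (- \<delta>)" .
  qed (use \<delta> K in auto)
  have "AE \<omega> in M. \<forall>L. (\<lambda>m. (\<Sum>k<m^K. D L k \<omega>) / real (m^K)) \<longlonglongrightarrow> 0"
    unfolding AE_all_countable using main by blast
  then show ?thesis using \<kappa>_bdd V_growth[OF \<gamma>a] AE_space
  proof eventually_elim
    case (elim \<omega>)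
    then obtain L :: nat where L: "\<forall>n. \<kappa> n \<omega> \<le> of_nat L" by blast
    have "m \<le> m ^ K" for m :: nat using K1 by (cases "m = 0") (auto intro: self_le_power)
    then have h: "filterlim (\<lambda>m. m ^ K) at_top sequentially"
      by (intro filterlim_at_top_mono[OF filterlim_ident] always_eventually) auto
    have ev: "eventually (\<lambda>k. D L k \<omega> = (V (Suc k) \<omega>)\<^sup>2 - \<sigma>\<^sup>2) sequentially"
      using elim(3) by eventually_elim (use L elim(4) in \<open>auto simp: D_def B_def t_def\<close>)
    have "(\<lambda>m. (\<Sum>k<m^K. (V (Suc k) \<omega>)\<^sup>2 - \<sigma>\<^sup>2) / real (m^K)) \<longlonglongrightarrow> 0"
      by (rule average_cong_eventually[OF ev h]) (use elim(1) in blast)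
    from tendsto_add[OF this tendsto_const[of "\<sigma>\<^sup>2"]]
    have "(\<lambda>m. (\<Sum>k<m^K. (V (Suc k) \<omega>)\<^sup>2 - \<sigma>\<^sup>2) / real (m^K) + \<sigma>\<^sup>2) \<longlonglongrightarrow> \<sigma>\<^sup>2" by simp
    then have "(\<lambda>m. (\<Sum>k<m^K. (V (Suc k) \<omega>)\<^sup>2) / real (m^K)) \<longlonglongrightarrow> \<sigma>\<^sup>2"
      by (rule Lim_transform_eventually)
        (use eventually_gt_at_top[of 0] in eventually_elim, auto simp: sum_subtractf diff_divide_distrib)
    then show ?case
    proof (intro tendsto_average_interpolate[OF K1, where Q = "\<lambda>n. \<Sum>k<n. (V (Suc k) \<omega>)\<^sup>2"])
      fix m n :: nat assume "m \<le> n"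
      then have "(\<Sum>k<m. (V (Suc k) \<omega>)\<^sup>2) \<le> (\<Sum>k<n. (V (Suc k) \<omega>)\<^sup>2)" by (intro sum_mono2) auto
      then show "\<bar>(\<Sum>k<n. (V (Suc k) \<omega>)\<^sup>2) - (\<Sum>k<m. (V (Suc k) \<omega>)\<^sup>2)\<bar> \<le> (\<Sum>k<n. (V (Suc k) \<omega>)\<^sup>2) - (\<Sum>k<m. (V (Suc k) \<omega>)\<^sup>2)"
        by simp
    qed auto
  qed
qed

end

context noise begin

text \<open>Conditioning at time k + j makes the products exactly orthogonal with second moment
  \<sigma>^4, even if V has no fourth moment, so the subsequence of squares suffices. Increments are
  dominated through 2|xy| \<le> x^2 + y^2 by sums of squares, whose averages converge by
  \<open>slln_V2\<close>.\<close>

lemma slln_cross: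
  assumes j: "j \<ge> 1"
  shows "AE \<omega> in M. (\<lambda>n. (\<Sum>k<n. V (Suc (k + j)) \<omega> * V (Suc k) \<omega>) / real n) \<longlonglongrightarrow> 0"
proof -
  define D where "D k \<omega> = V (Suc (k + j)) \<omega> * V (Suc k) \<omega>" for k \<omega>
  have [measurable]: "D k \<in> borel_measurable M" for k unfolding D_def by measurable
  \<comment> \<open>Since j \<ge> 1, the earlier factor of each product is already known at time k +
    j.\<close>
  have VF: "V (Suc l) \<in> borel_measurable (F (k + j))" if "l \<le> k" for k l
    using F_mono[OF V_F[of l], of "k + j"] that j by simp
  have nn: "(\<integral>\<^sup>+\<omega>. ennreal ((D k \<omega>)\<^sup>2) \<partial>M) = ennreal (\<sigma>^4)" for k
  proof -
    have "(\<integral>\<^sup>+\<omega>. ennreal ((D k \<omega>)\<^sup>2) \<partial>M) = (\<integral>\<^sup>+\<omega>. ennreal ((V (Suc k) \<omega>)\<^sup>2) * ennreal ((V (Suc (k + j)) \<omega>)\<^sup>2) \<partial>M)"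
      by (intro nn_integral_cong) (simp add: D_def power_mult_distrib ennreal_mult mult.commute)
    also have "\<dots> = ennreal (\<sigma>\<^sup>2) * (\<integral>\<^sup>+\<omega>. ennreal ((V (Suc k) \<omega>)\<^sup>2) \<partial>M)"
      by (intro nn_V2 measurable_compose[OF _ measurable_ennreal] borel_measurable_power VF) simp
    also have "(\<integral>\<^sup>+\<omega>. ennreal ((V (Suc k) \<omega>)\<^sup>2) \<partial>M) = ennreal (\<sigma>\<^sup>2)"
      using nn_integral_eq_integral[OF V2_integrable[of k]] exp_V2 by simp
    finally show ?thesis by (simp flip: ennreal_mult power_add)
  qed
  have Dint: "integrable M (\<lambda>\<omega>. (D k \<omega>)\<^sup>2)" for k
    using nn[of k] by (intro integrableI_nn_integral_finite[where x = "\<sigma>^4"]) auto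
  have main: "AE \<omega> in M. (\<lambda>m. (\<Sum>k<m^2. D k \<omega>) / real (m^2)) \<longlonglongrightarrow> 0"
  proof (rule almost_orthogonal_slln[where C = "\<sigma>^4" and \<delta> = 1])
    fix k show "(\<integral>\<omega>. (D k \<omega>)\<^sup>2 \<partial>M) \<le> \<sigma>^4 * (real k + 1) powr (1 - 1)"
      using nn[of k] by (subst integral_eq_nn_integral) auto
  next
    fix k l :: nat assume lk: "l < k"
    define G where "G \<omega> = D l \<omega> * V (Suc k) \<omega>" for \<omega>
    have G: "G \<in> borel_measurable (F (k + j))"
      unfolding G_def D_def using VF[of k k] VF[of l k] F_mono[OF V_F[of "l + j"], of "k + j"] lk
      by (intro borel_measurable_times) auto
    have e: "D l \<omega> * D k \<omega> = G \<omega> * V (Suc (k + j)) \<omega>" for \<omega> by (simp add: G_def D_def mult_ac)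
    have "integrable M (\<lambda>\<omega>. D l \<omega> * D k \<omega>)" using Dint by (intro integrable_mult_of_squares) auto
    then show "\<bar>\<integral>\<omega>. D l \<omega> * D k \<omega> \<partial>M\<bar> \<le> \<sigma>^4 * (real k + 1) powr (-1)"
      unfolding e using integral_V[OF G] by simp
  qed (use Dint in auto)
  show ?thesis using main slln_V2
  proof eventually_elim
    case (elim \<omega>)
    define A where "A n = (\<Sum>k<n. (V (Suc k) \<omega>)\<^sup>2)" for n
    define Q where "Q n = (\<Sum>k<n. (V (Suc (k + j)) \<omega>)\<^sup>2 + (V (Suc k) \<omega>)\<^sup>2)" for n
    have QA: "Q n = A (n + j) - A j + A n" for n
    proof (induction n)
      case (Suc n)
      then show ?case by (simp add: Q_def A_def)
    qed (simp add: Q_def A_def)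
    have A: "(\<lambda>n. A n / real n) \<longlonglongrightarrow> \<sigma>\<^sup>2" using elim(2) by (simp add: A_def)
    have "(\<lambda>n. A (n + j) / real (n + j) * (real (n + j) / real n) - A j / real n + A n / real n) \<longlonglongrightarrow> \<sigma>\<^sup>2 * 1 - 0 + \<sigma>\<^sup>2"
    proof (intro tendsto_add tendsto_diff tendsto_mult A LIMSEQ_ignore_initial_segment[OF A] lim_const_over_n)
      show "(\<lambda>n. real (n + j) / real n) \<longlonglongrightarrow> 1" by real_asymp
    qed
    moreover have "eventually (\<lambda>n. A (n + j) / real (n + j) * (real (n + j) / real n) - A j / real n + A n / real n = Q n / real n) sequentially"
      using eventually_gt_at_top[of 0]
    proof eventually_elim
      case (elim n)
      then have "A (n + j) / real (n + j) * (real (n + j) / real n) = A (n + j) / real n" by simp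
      then show ?case unfolding QA add_divide_distrib diff_divide_distrib by linarith
    qed
    ultimately have "(\<lambda>n. Q n / real n) \<longlonglongrightarrow> \<sigma>\<^sup>2 * 1 - 0 + \<sigma>\<^sup>2"
      by (rule Lim_transform_eventually)
    then have Q: "(\<lambda>m. Q (m^2) / real (m^2)) \<longlonglongrightarrow> \<sigma>\<^sup>2 * 1 - 0 + \<sigma>\<^sup>2"
      by (rule filterlim_compose) (intro filterlim_at_top_mono[OF filterlim_ident] always_eventually, auto simp: power2_eq_square)
    show ?case
      unfolding D_def[symmetric]
    proof (rule tendsto_average_interpolate[OF _ elim(1) Q])
      fix m n :: nat assume mn: "m \<le> n"
      have "(\<Sum>k<n. g k) - (\<Sum>k<m. g k) = (\<Sum>k\<in>{m..<n}. g k)" for g :: "nat \<Rightarrow> real"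
        using sum_diff_nat_ivl[of 0 m n g] mn by (simp add: lessThan_atLeast0)
      then have e: "(\<Sum>k<n. g k) - (\<Sum>k<m. g k) = (\<Sum>k\<in>{m..<n}. g k)" for g :: "nat \<Rightarrow> real" .
      show "\<bar>(\<Sum>k<n. D k \<omega>) - (\<Sum>k<m. D k \<omega>)\<bar> \<le> Q n - Q m"
        unfolding Q_def e
      proof (intro order_trans[OF sum_abs] sum_mono)
        fix k
        have "2 * \<bar>D k \<omega>\<bar> \<le> (V (Suc (k + j)) \<omega>)\<^sup>2 + (V (Suc k) \<omega>)\<^sup>2"
          using sum_squares_bound[of "\<bar>V (Suc (k + j)) \<omega>\<bar>" "\<bar>V (Suc k) \<omega>\<bar>"] by (simp add: D_def abs_mult)
        then show "\<bar>D k \<omega>\<bar> \<le> (V (Suc (k + j)) \<omega>)\<^sup>2 + (V (Suc k) \<omega>)\<^sup>2" by linarith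
      qed
    qed auto
  qed
qed

text \<open>A Robbins--Siegmund argument in which the compensator is bounded by a constant, so that
  expectations suffice.\<close>

lemma summable_of_almost_supermartingale:
  fixes w al g c :: "nat \<Rightarrow> 'a \<Rightarrow> real"
  assumes meas: "\<And>n. n \<ge> 1 \<Longrightarrow> w n \<in> borel_measurable (F n)" "\<And>n. n \<ge> 1 \<Longrightarrow> al n \<in> borel_measurable (F n)"
      "\<And>n. n \<ge> 1 \<Longrightarrow> g n \<in> borel_measurable (F n)" "\<And>n. n \<ge> 1 \<Longrightarrow> c n \<in> borel_measurable (F n)"
    and nonneg: "\<And>n \<omega>. n \<ge> 1 \<Longrightarrow> \<omega> \<in> space M \<Longrightarrow> 0 \<le> w n \<omega>" "\<And>n \<omega>. n \<ge> 1 \<Longrightarrow> \<omega> \<in> space M \<Longrightarrow> 0 \<le> al n \<omega>"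
      "\<And>n \<omega>. n \<ge> 1 \<Longrightarrow> \<omega> \<in> space M \<Longrightarrow> 0 \<le> c n \<omega>"
    and c: "\<And>n \<omega>. \<omega> \<in> space M \<Longrightarrow> (\<Sum>k=1..n. c k \<omega>) \<le> C"
    and step: "\<And>n \<omega>. n \<ge> 1 \<Longrightarrow> \<omega> \<in> space M \<Longrightarrow>
        w (Suc n) \<omega> \<le> w n \<omega> - al n \<omega> + 2 * g n \<omega> * V (Suc n) \<omega> + c n \<omega> * (V (Suc n) \<omega>)\<^sup>2"
    and g: "\<And>n \<omega>. n \<ge> 1 \<Longrightarrow> \<omega> \<in> space M \<Longrightarrow> (g n \<omega>)\<^sup>2 \<le> w n \<omega>"
  shows "AE \<omega> in M. summable (\<lambda>n. al (Suc n) \<omega>)"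
proof -
  have measM: "n \<ge> 1 \<Longrightarrow> w n \<in> borel_measurable M" "n \<ge> 1 \<Longrightarrow> al n \<in> borel_measurable M"
    "n \<ge> 1 \<Longrightarrow> g n \<in> borel_measurable M" "n \<ge> 1 \<Longrightarrow> c n \<in> borel_measurable M" for n
    using meas F_M by blast+
  have cC: "c n \<omega> \<le> C" if "n \<ge> 1" "\<omega> \<in> space M" for n \<omega>
  proof -
    have "c n \<omega> \<le> (\<Sum>k=1..n. c k \<omega>)" using that nonneg(3) by (intro member_le_sum) auto
    then show ?thesis using c[OF that(2), of n] by linarith
  qed
  \<comment> \<open>The initial value w 1 may fail to be integrable, hence the localisation to an
    \<open>F 1\<close>-event on which it is bounded.\<close>
  have "AE \<omega> in M. w 1 \<omega> \<le> real L \<longrightarrow> summable (\<lambda>n. al (Suc n) \<omega>)" for L :: nat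
  proof -
    define B where "B = {\<omega> \<in> space M. w 1 \<omega> \<le> real L}"
    have "{\<omega> \<in> space (F 1). w 1 \<omega> \<le> real L} \<in> sets (F 1)" using meas(1)[of 1] by measurable
    then have B1: "B \<in> sets (F 1)" using sub[of 1] by (simp add: subalgebra_def B_def)
    have BF: "B \<in> sets (F n)" if "n \<ge> 1" for n
      using B1 filt that unfolding filtration_def by (meson in_mono)
    define \<chi> where "\<chi> = (indicator B :: 'a \<Rightarrow> real)"
    have \<chi>F: "\<chi> \<in> borel_measurable (F n)" if "n \<ge> 1" for n using BF[OF that] unfolding \<chi>_def by measurable
    have \<chi>M [measurable]: "\<chi> \<in> borel_measurable M" using F_M[OF \<chi>F[of 1]] by simp
    have \<chi>2: "\<chi> \<omega> = 0 \<or> \<chi> \<omega> = 1" for \<omega> by (auto simp: \<chi>_def indicator_def)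
    have inv: "integrable M (\<lambda>\<omega>. \<chi> \<omega> * w (Suc n) \<omega>) \<and> (\<forall>k\<in>{1..n}. integrable M (\<lambda>\<omega>. \<chi> \<omega> * al k \<omega>)) \<and>
        (\<integral>\<omega>. \<chi> \<omega> * w (Suc n) \<omega> \<partial>M) + (\<Sum>k=1..n. \<integral>\<omega>. \<chi> \<omega> * al k \<omega> \<partial>M) \<le> real L + \<sigma>\<^sup>2 * (\<Sum>k=1..n. \<integral>\<omega>. \<chi> \<omega> * c k \<omega> \<partial>M)" for n
    proof (induction n)
      case 0
      have b: "\<bar>\<chi> \<omega> * w 1 \<omega>\<bar> \<le> real L" if "\<omega> \<in> space M" for \<omega>
        using nonneg(1)[OF _ that, of 1] by (auto simp: \<chi>_def indicator_def B_def)
      have [measurable]: "w (Suc 0) \<in> borel_measurable M" using measM(1)[of 1] by simp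
      have i: "integrable M (\<lambda>\<omega>. \<chi> \<omega> * w 1 \<omega>)"
        by (rule integrable_const_bound[where B = "real L"]) (use b in auto)
      have "(\<integral>\<omega>. \<chi> \<omega> * w 1 \<omega> \<partial>M) \<le> (\<integral>\<omega>. real L \<partial>M)"
        using i b by (intro integral_mono) (auto intro: abs_le_D1)
      then show ?case using i by (simp add: prob_space)
    next
      case (Suc n)
      define m where "m = Suc n"
      have m: "m \<ge> 1" by (simp add: m_def)
      note [measurable] = measM[OF m] measM(1)[of "Suc m", simplified]
      have iw: "integrable M (\<lambda>\<omega>. \<chi> \<omega> * w m \<omega>)" using Suc by (simp add: m_def)
      \<comment> \<open>The bound g^2 \<le> w passes integrability from w to g^2, so that the cross
        term is integrable and has mean zero.\<close>
      have ig2: "integrable M (\<lambda>\<omega>. (\<chi> \<omega> * g m \<omega>)\<^sup>2)"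
      proof (rule Bochner_Integration.integrable_bound[OF iw])
        show "AE \<omega> in M. norm ((\<chi> \<omega> * g m \<omega>)\<^sup>2) \<le> norm (\<chi> \<omega> * w m \<omega>)"
        proof (intro AE_I2)
          fix \<omega> assume "\<omega> \<in> space M"
          then show "norm ((\<chi> \<omega> * g m \<omega>)\<^sup>2) \<le> norm (\<chi> \<omega> * w m \<omega>)"
            using g[OF m, of \<omega>] nonneg(1)[OF m, of \<omega>] \<chi>2[of \<omega>] by auto
        qed
      qed measurable
      have igV: "integrable M (\<lambda>\<omega>. \<chi> \<omega> * g m \<omega> * V (Suc m) \<omega>)"
        using ig2 V2_integrable by (intro integrable_mult_of_squares) auto
      have gV0: "(\<integral>\<omega>. \<chi> \<omega> * g m \<omega> * V (Suc m) \<omega> \<partial>M) = 0"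
        using igV \<chi>F[OF m] meas(3)[OF m] by (intro integral_V) auto
      have cF: "(\<lambda>\<omega>. \<chi> \<omega> * c m \<omega>) \<in> borel_measurable (F m)" using \<chi>F[OF m] meas(4)[OF m] by auto
      have cb: "\<bar>\<chi> \<omega> * c m \<omega>\<bar> \<le> \<bar>C\<bar>" if "\<omega> \<in> space M" for \<omega>
        using cC[OF m that] nonneg(3)[OF m that] \<chi>2[of \<omega>] by auto
      note cV = integral_V2[OF cF cb]
      define R where "R \<omega> = \<chi> \<omega> * w m \<omega> + 2 * (\<chi> \<omega> * g m \<omega> * V (Suc m) \<omega>) + \<chi> \<omega> * c m \<omega> * (V (Suc m) \<omega>)\<^sup>2" for \<omega>
      have iR: "integrable M R" unfolding R_def using iw igV cV(1) by auto
      have R: "(\<integral>\<omega>. R \<omega> \<partial>M) = (\<integral>\<omega>. \<chi> \<omega> * w m \<omega> \<partial>M) + \<sigma>\<^sup>2 * (\<integral>\<omega>. \<chi> \<omega> * c m \<omega> \<partial>M)"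
        unfolding R_def using iw igV cV gV0 by simp
      have le: "\<chi> \<omega> * w (Suc m) \<omega> + \<chi> \<omega> * al m \<omega> \<le> R \<omega>"
        and nn: "0 \<le> \<chi> \<omega> * w (Suc m) \<omega>" "0 \<le> \<chi> \<omega> * al m \<omega>" if "\<omega> \<in> space M" for \<omega>
        using step[OF m that] nonneg(1)[OF _ that, of "Suc m"] nonneg(2)[OF m that] \<chi>2[of \<omega>] by (auto simp: R_def)
      have i1: "integrable M (\<lambda>\<omega>. \<chi> \<omega> * w (Suc m) \<omega>)" and i2: "integrable M (\<lambda>\<omega>. \<chi> \<omega> * al m \<omega>)"
        by (rule Bochner_Integration.integrable_bound[OF iR]; use le nn in \<open>force intro!: AE_I2\<close>)+
      have "(\<integral>\<omega>. \<chi> \<omega> * w (Suc m) \<omega> \<partial>M) + (\<integral>\<omega>. \<chi> \<omega> * al m \<omega> \<partial>M) = (\<integral>\<omega>. \<chi> \<omega> * w (Suc m) \<omega> + \<chi> \<omega> * al m \<omega> \<partial>M)"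
        using i1 i2 by simp
      also have "\<dots> \<le> (\<integral>\<omega>. R \<omega> \<partial>M)" using i1 i2 iR le by (intro integral_mono) auto
      finally have "(\<integral>\<omega>. \<chi> \<omega> * w (Suc m) \<omega> \<partial>M) + (\<integral>\<omega>. \<chi> \<omega> * al m \<omega> \<partial>M)
          \<le> (\<integral>\<omega>. \<chi> \<omega> * w m \<omega> \<partial>M) + \<sigma>\<^sup>2 * (\<integral>\<omega>. \<chi> \<omega> * c m \<omega> \<partial>M)" using R by simp
      then show ?case using Suc i1 i2 unfolding m_def
        by (auto simp: le_Suc_eq algebra_simps)
    qed
    have bound: "(\<Sum>k=1..n. \<integral>\<omega>. \<chi> \<omega> * al k \<omega> \<partial>M) \<le> real L + \<sigma>\<^sup>2 * \<bar>C\<bar>" for n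
    proof -
      have ci: "integrable M (\<lambda>\<omega>. \<chi> \<omega> * c k \<omega>)" if k: "k \<in> {1..n}" for k
      proof (rule integrable_const_bound[where B = "\<bar>C\<bar>"])
        show "AE \<omega> in M. norm (\<chi> \<omega> * c k \<omega>) \<le> \<bar>C\<bar>"
        proof (intro AE_I2)
          fix \<omega> assume s: "\<omega> \<in> space M"
          show "norm (\<chi> \<omega> * c k \<omega>) \<le> \<bar>C\<bar>"
            using cC[OF _ s, of k] nonneg(3)[OF _ s, of k] \<chi>2[of \<omega>] k by auto
        qed
        show "(\<lambda>\<omega>. \<chi> \<omega> * c k \<omega>) \<in> borel_measurable M" using measM(4)[of k] k by auto
      qed
      have "(\<Sum>k=1..n. \<integral>\<omega>. \<chi> \<omega> * c k \<omega> \<partial>M) = (\<integral>\<omega>. (\<Sum>k=1..n. \<chi> \<omega> * c k \<omega>) \<partial>M)"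
        using ci by (subst Bochner_Integration.integral_sum) auto
      also have "\<dots> \<le> (\<integral>\<omega>. \<bar>C\<bar> \<partial>M)"
      proof (intro integral_mono)
        fix \<omega> assume s: "\<omega> \<in> space M"
        have "(\<Sum>k=1..n. \<chi> \<omega> * c k \<omega>) = \<chi> \<omega> * (\<Sum>k=1..n. c k \<omega>)" by (simp add: sum_distrib_left)
        then show "(\<Sum>k=1..n. \<chi> \<omega> * c k \<omega>) \<le> \<bar>C\<bar>" using c[OF s, of n] \<chi>2[of \<omega>] by auto
      qed (use ci in auto)
      finally have "(\<Sum>k=1..n. \<integral>\<omega>. \<chi> \<omega> * c k \<omega> \<partial>M) \<le> \<bar>C\<bar>" by (simp add: prob_space)
      then have "\<sigma>\<^sup>2 * (\<Sum>k=1..n. \<integral>\<omega>. \<chi> \<omega> * c k \<omega> \<partial>M) \<le> \<sigma>\<^sup>2 * \<bar>C\<bar>" by (intro mult_left_mono) auto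
      moreover have "0 \<le> (\<integral>\<omega>. \<chi> \<omega> * w (Suc n) \<omega> \<partial>M)"
        using nonneg(1)[of "Suc n"] by (intro integral_nonneg_AE) (auto simp: \<chi>_def)
      ultimately show ?thesis using inv[of n] by linarith
    qed
    have al_int: "integrable M (\<lambda>\<omega>. \<chi> \<omega> * al (Suc k) \<omega>)" for k using inv[of "Suc k"] by auto
    have al_nn: "0 \<le> \<chi> \<omega> * al (Suc k) \<omega>" if "\<omega> \<in> space M" for k \<omega>
      using nonneg(2)[OF _ that, of "Suc k"] by (simp add: \<chi>_def)
    have sm: "summable (\<lambda>k. \<integral>\<omega>. \<chi> \<omega> * al (Suc k) \<omega> \<partial>M)"
    proof (rule bounded_imp_summable)
      show "0 \<le> (\<integral>\<omega>. \<chi> \<omega> * al (Suc k) \<omega> \<partial>M)" for k using al_nn by (intro integral_nonneg_AE) auto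
      show "(\<Sum>k\<le>n. \<integral>\<omega>. \<chi> \<omega> * al (Suc k) \<omega> \<partial>M) \<le> real L + \<sigma>\<^sup>2 * \<bar>C\<bar>" for n
        using bound[of "Suc n"] unfolding One_nat_def sum.atLeast_Suc_atMost_Suc_shift
        by (simp add: atLeast0AtMost comp_def)
    qed
    have "(\<integral>\<^sup>+\<omega>. (\<Sum>k. ennreal (\<chi> \<omega> * al (Suc k) \<omega>)) \<partial>M) = (\<Sum>k. \<integral>\<^sup>+\<omega>. ennreal (\<chi> \<omega> * al (Suc k) \<omega>) \<partial>M)"
      using al_int by (intro nn_integral_suminf) auto
    also have "\<dots> = (\<Sum>k. ennreal (\<integral>\<omega>. \<chi> \<omega> * al (Suc k) \<omega> \<partial>M))"
      using al_int al_nn by (intro suminf_cong nn_integral_eq_integral) auto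
    also have "\<dots> = ennreal (\<Sum>k. \<integral>\<omega>. \<chi> \<omega> * al (Suc k) \<omega> \<partial>M)"
      using sm al_nn by (intro suminf_ennreal2) (auto intro!: integral_nonneg_AE)
    finally have "AE \<omega> in M. (\<Sum>k. ennreal (\<chi> \<omega> * al (Suc k) \<omega>)) \<noteq> \<infinity>"
      using al_int by (intro nn_integral_PInf_AE) (auto intro!: borel_measurable_suminf measurable_compose[OF borel_measurable_integrable measurable_ennreal])
    then show ?thesis using AE_space
    proof eventually_elim
      case (elim \<omega>)
      show ?case
      proof
        assume "w 1 \<omega> \<le> real L"
        then have 1: "\<chi> \<omega> = 1" using elim(2) by (simp add: \<chi>_def B_def)
        show "summable (\<lambda>n. al (Suc n) \<omega>)"
          using elim nonneg(2)[OF _ elim(2)] unfolding 1 by (intro summable_suminf_not_top) (auto simp: top_unique)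
      qed
    qed
  qed
  then have "AE \<omega> in M. \<forall>L::nat. w 1 \<omega> \<le> real L \<longrightarrow> summable (\<lambda>n. al (Suc n) \<omega>)"
    unfolding AE_all_countable by blast
  then show ?thesis by eventually_elim (meson real_arch_simple)
qed

end

subsection \<open>A martingale central limit theorem\<close>

text \<open>For |x| \<le> 1 the cubic Taylor bound applies, beyond 1 the quadratic one; every power
  between 2 and 3 lies above both. The free exponent b lets a moment of order barely above 2 control
  the remainder.\<close>

lemma iexp_quadratic_bound:
  fixes x b :: real
  assumes b: "2 \<le> b" "b \<le> 3"
  shows "cmod (iexp x - (1 + \<i> * x - x\<^sup>2 / 2)) \<le> \<bar>x\<bar> powr b"
proof -
  have e: "(\<Sum>k\<le>2. (\<i> * x)^k / fact k) = 1 + \<i> * x - x\<^sup>2 / 2"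
    by (simp add: numeral_2_eq_2 power2_eq_square algebra_simps)
  have 1: "cmod (iexp x - (1 + \<i> * x - x\<^sup>2 / 2)) \<le> \<bar>x\<bar>^3 / 6"
    using iexp_approx1[of x 2] unfolding e by (simp add: numeral_3_eq_3 fact_numeral)
  have 2: "cmod (iexp x - (1 + \<i> * x - x\<^sup>2 / 2)) \<le> \<bar>x\<bar>^2"
    using iexp_approx2[of x 2] unfolding e by simp
  show ?thesis
  proof (cases "\<bar>x\<bar> \<le> 1")
    case True
    have "\<bar>x\<bar>^3 / 6 \<le> \<bar>x\<bar> powr b"
    proof (cases "x = 0")
      case False
      have "\<bar>x\<bar>^3 = \<bar>x\<bar> powr 3" using False by (simp add: powr_numeral)
      also have "\<dots> \<le> \<bar>x\<bar> powr b" using True b False by (intro powr_mono') auto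
      finally show ?thesis using zero_le_power[of "\<bar>x\<bar>" 3] by linarith
    qed simp
    then show ?thesis using 1 by linarith
  next
    case False
    have "\<bar>x\<bar>^2 = \<bar>x\<bar> powr 2" using False by (simp add: powr_numeral)
    also have "\<dots> \<le> \<bar>x\<bar> powr b" using False b by (intro powr_mono) auto
    finally show ?thesis using 2 by linarith
  qed
qed

lemma exp_minus_quadratic_bound:
  fixes q :: real
  assumes "0 \<le> q"
  shows "\<bar>1 - q - exp (- q)\<bar> \<le> q\<^sup>2"
proof -
  have "exp (- q) \<ge> 1 - q" using exp_ge_add_one_self[of "-q"] by simp
  moreover have "exp (- q) \<le> 1 - q + q\<^sup>2"
  proof -
    have "1 \<le> (1 + q) * (1 - q + q\<^sup>2)"
      using assms by (simp add: algebra_simps power2_eq_square)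
    also have "\<dots> \<le> exp q * (1 - q + q\<^sup>2)"
    proof (rule mult_right_mono)
      show "1 + q \<le> exp q" by (simp add: exp_ge_add_one_self)
      have "0 \<le> (1 - q)\<^sup>2 + q" using assms by simp
      then show "0 \<le> 1 - q + q\<^sup>2" by (simp add: power2_eq_square algebra_simps)
    qed
    finally show ?thesis by (simp add: exp_minus field_simps)
  qed
  ultimately show ?thesis by auto
qed

context noise begin

text \<open>Multiplying by the inverse of the Gaussian factor makes \<open>T\<close> nearly a martingale.  The bound \<open>B\<close>
  has to hold everywhere, so the general case goes through a truncation.\<close>

lemma truncated_clt_step:
  fixes \<psi> :: "nat \<Rightarrow> 'a \<Rightarrow> real" and B d b :: real and L :: nat
  assumes \<psi>F: "\<And>k. \<psi> k \<in> borel_measurable (F k)"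
    and B: "\<And>\<omega> n. \<omega> \<in> space M \<Longrightarrow> (\<Sum>k<n. (\<psi> k \<omega>)\<^sup>2) \<le> B"
    and d: "\<And>k \<omega>. \<omega> \<in> space M \<Longrightarrow> (\<psi> k \<omega>)\<^sup>2 \<le> d"
    and L: "\<And>k \<omega>. \<omega> \<in> space M \<Longrightarrow> \<psi> k \<omega> \<noteq> 0 \<Longrightarrow> \<kappa> k \<omega> \<le> of_nat L"
    and b: "2 < b" "b \<le> 3" "b \<le> a"
  defines "T \<equiv> \<lambda>n \<omega>. exp (\<i> * of_real (\<Sum>k<n. \<psi> k \<omega> * V (Suc k) \<omega>) + of_real (\<sigma>\<^sup>2 / 2 * (\<Sum>k<n. (\<psi> k \<omega>)\<^sup>2)))"
  shows "cmod ((\<integral>\<omega>. T n \<omega> \<partial>M) - 1) \<le> exp (\<sigma>\<^sup>2 / 2 * B) * B * (\<sigma>^4 * d + (1 + real L) * d powr ((b - 2)/2))"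
proof -
  define C0 where "C0 = exp (\<sigma>\<^sup>2 / 2 * B)"
  define E where "E = C0 * (\<sigma>^4 * d + (1 + real L) * d powr ((b - 2)/2))"
  obtain \<omega>0 where \<omega>0: "\<omega>0 \<in> space M" using not_empty by auto
  have d0: "0 \<le> d" using d[OF \<omega>0, of 0] by (meson order_trans zero_le_power2)
  have E0: "0 \<le> E" using d0 by (simp add: E_def C0_def)
  have \<psi>M [measurable]: "\<psi> k \<in> borel_measurable M" for k using F_M[OF \<psi>F] .
  have TF: "T n \<in> borel_measurable (F n)" for n
  proof -
    have [measurable]: "\<psi> k \<in> borel_measurable (F n)" if "k \<in> {..<n}" for k using F_mono[OF \<psi>F[of k], of n] that by simp
    have [measurable]: "V (Suc k) \<in> borel_measurable (F n)" if "k \<in> {..<n}" for k using F_mono[OF V_F[of k], of n] that by simp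
    show ?thesis unfolding T_def by measurable
  qed
  have TM [measurable]: "T n \<in> borel_measurable M" for n using F_M[OF TF] .
  have \<psi>int: "integrable M (\<lambda>\<omega>. (\<psi> k \<omega>)\<^sup>2)" for k
    by (rule integrable_const_bound[where B = d]) (use d in auto)
  define e where "e k \<omega> = exp (\<sigma>\<^sup>2 / 2 * (\<psi> k \<omega>)\<^sup>2)" for k \<omega>
  have step: "cmod ((\<integral>\<omega>. T (Suc m) \<omega> \<partial>M) - (\<integral>\<omega>. T m \<omega> \<partial>M)) \<le> E * (\<integral>\<omega>. (\<psi> m \<omega>)\<^sup>2 \<partial>M)" for m
  proof -
    \<comment> \<open>G carries the Gaussian factor up to time m + 1 and is still
      \<open>F m\<close>-measurable because \<psi> m is. Both T m and T (m + 1) are G times a factor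
      depending on step m alone.\<close>
    define G where "G \<omega> = T m \<omega> * of_real (e m \<omega>)" for \<omega>
    have GF: "G \<in> borel_measurable (F m)" unfolding G_def e_def using TF[of m] \<psi>F[of m] by measurable
    have GM [measurable]: "G \<in> borel_measurable M" using F_M[OF GF] .
    have Gn: "cmod (G \<omega>) \<le> C0" if "\<omega> \<in> space M" for \<omega>
    proof -
      have "cmod (G \<omega>) = exp (\<sigma>\<^sup>2 / 2 * (\<Sum>k<Suc m. (\<psi> k \<omega>)\<^sup>2))"
        by (simp add: G_def T_def e_def norm_mult norm_exp_eq_Re exp_add[symmetric] algebra_simps)
      also have "\<dots> \<le> C0" unfolding C0_def using B[OF that, of "Suc m"] by (simp add: mult_left_mono)
      finally show ?thesis .
    qed
    define x where "x \<omega> = \<psi> m \<omega> * V (Suc m) \<omega>" for \<omega>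
    define q where "q \<omega> = \<sigma>\<^sup>2 / 2 * (\<psi> m \<omega>)\<^sup>2" for \<omega>
    define r where "r \<omega> = iexp (x \<omega>) - (1 + \<i> * x \<omega> - (x \<omega>)\<^sup>2 / 2)" for \<omega>
    have [measurable]: "x \<in> borel_measurable M" "q \<in> borel_measurable M" unfolding x_def q_def by measurable
    have [measurable]: "r \<in> borel_measurable M" unfolding r_def by measurable
    have x2: "integrable M (\<lambda>\<omega>. (x \<omega>)\<^sup>2)"
    proof -
      have "integrable M (\<lambda>\<omega>. (\<psi> m \<omega>)\<^sup>2 * (V (Suc m) \<omega>)\<^sup>2)"
        by (rule integral_V2(1)[where C = d]) (use \<psi>F[of m] d in auto)
      then show ?thesis by (simp add: x_def power_mult_distrib)
    qed
    have x1: "integrable M x"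
    proof -
      have "integrable M (\<lambda>\<omega>. \<psi> m \<omega> * V (Suc m) \<omega>)"
        using \<psi>int[of m] V2_integrable[of m] by (intro integrable_mult_of_squares) auto
      then show ?thesis by (simp add: x_def[abs_def])
    qed
    have bdd: "integrable M (\<lambda>\<omega>. G \<omega> * of_real (h \<omega>))" if h: "integrable M h" for h :: "'a \<Rightarrow> real"
    proof (rule Bochner_Integration.integrable_bound[where f = "\<lambda>\<omega>. C0 * h \<omega>"])
      show "integrable M (\<lambda>\<omega>. C0 * h \<omega>)" using h by auto
      show "(\<lambda>\<omega>. G \<omega> * of_real (h \<omega>)) \<in> borel_measurable M" using h by measurable
      show "AE \<omega> in M. cmod (G \<omega> * of_real (h \<omega>)) \<le> norm (C0 * h \<omega>)"
        using Gn by (intro AE_I2) (simp add: norm_mult abs_mult C0_def mult_right_mono)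
    qed
    have Gx: "(\<integral>\<omega>. G \<omega> * of_real (x \<omega>) \<partial>M) = 0"
    proof -
      note i = bdd[OF x1]
      have "(\<integral>\<omega>. (Re (G \<omega>) * \<psi> m \<omega>) * V (Suc m) \<omega> \<partial>M) = 0" "(\<integral>\<omega>. (Im (G \<omega>) * \<psi> m \<omega>) * V (Suc m) \<omega> \<partial>M) = 0"
        using integrable_Re[OF i] integrable_Im[OF i] GF \<psi>F[of m]
        by (intro integral_V; simp add: x_def mult_ac)+
      then show ?thesis using integral_Re[OF i] integral_Im[OF i]
        by (intro complex_eqI) (simp_all add: x_def mult_ac)
    qed
    have Gx2: "(\<integral>\<omega>. G \<omega> * of_real ((x \<omega>)\<^sup>2) \<partial>M) = of_real (\<sigma>\<^sup>2) * (\<integral>\<omega>. G \<omega> * of_real ((\<psi> m \<omega>)\<^sup>2) \<partial>M)"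
    proof -
      note i = bdd[OF x2] and i2 = bdd[OF \<psi>int[of m]]
      have bd: "\<bar>Re (G \<omega>) * (\<psi> m \<omega>)\<^sup>2\<bar> \<le> C0 * d" "\<bar>Im (G \<omega>) * (\<psi> m \<omega>)\<^sup>2\<bar> \<le> C0 * d" if "\<omega> \<in> space M" for \<omega>
        using order_trans[OF abs_Re_le_cmod Gn[OF that]] order_trans[OF abs_Im_le_cmod Gn[OF that]] d[OF that, of m] d0
        by (auto simp: abs_mult C0_def intro!: mult_mono)
      have re: "(\<integral>\<omega>. (Re (G \<omega>) * (\<psi> m \<omega>)\<^sup>2) * (V (Suc m) \<omega>)\<^sup>2 \<partial>M) = \<sigma>\<^sup>2 * (\<integral>\<omega>. Re (G \<omega>) * (\<psi> m \<omega>)\<^sup>2 \<partial>M)"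
        and im: "(\<integral>\<omega>. (Im (G \<omega>) * (\<psi> m \<omega>)\<^sup>2) * (V (Suc m) \<omega>)\<^sup>2 \<partial>M) = \<sigma>\<^sup>2 * (\<integral>\<omega>. Im (G \<omega>) * (\<psi> m \<omega>)\<^sup>2 \<partial>M)"
        by (rule integral_V2(2)[OF _ bd(1)] integral_V2(2)[OF _ bd(2)]; use GF \<psi>F[of m] in measurable)+
      have xx: "(x \<omega>)\<^sup>2 = (\<psi> m \<omega>)\<^sup>2 * (V (Suc m) \<omega>)\<^sup>2" for \<omega> by (simp add: x_def power_mult_distrib)
      have "Re (\<integral>\<omega>. G \<omega> * of_real ((x \<omega>)\<^sup>2) \<partial>M) = \<sigma>\<^sup>2 * Re (\<integral>\<omega>. G \<omega> * of_real ((\<psi> m \<omega>)\<^sup>2) \<partial>M)"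
        unfolding integral_Re[OF i, symmetric] integral_Re[OF i2, symmetric] using re
        by (simp add: xx mult.assoc del: of_real_power of_real_mult)
      moreover have "Im (\<integral>\<omega>. G \<omega> * of_real ((x \<omega>)\<^sup>2) \<partial>M) = \<sigma>\<^sup>2 * Im (\<integral>\<omega>. G \<omega> * of_real ((\<psi> m \<omega>)\<^sup>2) \<partial>M)"
        unfolding integral_Im[OF i, symmetric] integral_Im[OF i2, symmetric] using im
        by (simp add: xx mult.assoc del: of_real_power of_real_mult)
      ultimately show ?thesis
        by (intro complex_eqI) (simp_all del: of_real_power)
    qed
    have rbd: "cmod (r \<omega>) \<le> (x \<omega>)\<^sup>2" for \<omega>
      using iexp_quadratic_bound[of 2 "x \<omega>"] by (cases "x \<omega> = 0") (auto simp: r_def powr_numeral)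
    have ri: "integrable M (\<lambda>\<omega>. G \<omega> * r \<omega>)"
    proof (rule Bochner_Integration.integrable_bound[OF bdd[OF x2]])
      show "AE \<omega> in M. cmod (G \<omega> * r \<omega>) \<le> cmod (G \<omega> * of_real ((x \<omega>)\<^sup>2))"
      proof (intro AE_I2)
        fix \<omega>
        have "cmod (G \<omega>) * cmod (r \<omega>) \<le> cmod (G \<omega>) * (x \<omega>)\<^sup>2" by (intro mult_left_mono rbd) auto
        also have "\<dots> = cmod (G \<omega> * of_real ((x \<omega>)\<^sup>2))" unfolding norm_mult norm_of_real by simp
        finally show "cmod (G \<omega> * r \<omega>) \<le> cmod (G \<omega> * of_real ((x \<omega>)\<^sup>2))" by (simp only: norm_mult)
      qed
    qed measurable
    define p where "p \<omega> = 1 - q \<omega> - exp (- q \<omega>)" for \<omega>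
    have q0: "0 \<le> q \<omega>" for \<omega> by (simp add: q_def)
    have pb: "\<bar>p \<omega>\<bar> \<le> \<sigma>^4 * d * (\<psi> m \<omega>)\<^sup>2" if "\<omega> \<in> space M" for \<omega>
    proof -
      have "\<bar>p \<omega>\<bar> \<le> (q \<omega>)\<^sup>2" unfolding p_def by (intro exp_minus_quadratic_bound q0)
      also have "\<dots> = \<sigma>^4 / 4 * ((\<psi> m \<omega>)\<^sup>2 * (\<psi> m \<omega>)\<^sup>2)"
        by (simp add: q_def power2_eq_square power4_eq_xxxx)
      also have "\<dots> \<le> \<sigma>^4 * (d * (\<psi> m \<omega>)\<^sup>2)"
        using d[OF that, of m] d0 by (intro mult_mono) auto
      finally show ?thesis by (simp add: mult_ac)
    qed
    have pi: "integrable M p"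
    proof (rule Bochner_Integration.integrable_bound[where f = "\<lambda>\<omega>. \<sigma>^4 * d * (\<psi> m \<omega>)\<^sup>2"])
      show "p \<in> borel_measurable M" unfolding p_def by measurable
    qed (use \<psi>int[of m] pb d0 in auto)
    \<comment> \<open>After expanding both factors, the linear term has mean zero and the quadratic
      term cancels q in mean, as V_(m+1)^2 has conditional mean \<sigma>^2. Only the remainders r
      and p survive.\<close>
    have T: "T (Suc m) \<omega> - T m \<omega> = G \<omega> * r \<omega> + \<i> * (G \<omega> * of_real (x \<omega>)) - (G \<omega> * of_real ((x \<omega>)\<^sup>2)) / 2 + G \<omega> * of_real (q \<omega>) + G \<omega> * of_real (p \<omega>)" for \<omega>
    proof -
      have "T (Suc m) \<omega> = G \<omega> * iexp (x \<omega>)"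
        by (simp add: T_def G_def e_def x_def exp_add[symmetric] algebra_simps add_divide_distrib flip: exp_of_real)
      moreover have "T m \<omega> = G \<omega> * of_real (exp (- q \<omega>))"
        by (simp add: G_def e_def q_def flip: exp_of_real exp_add)
      ultimately show ?thesis by (simp add: r_def p_def algebra_simps)
    qed
    have qi: "integrable M q" unfolding q_def[abs_def] using \<psi>int[of m] by (intro integrable_mult_right) simp
    have Ti: "integrable M (T k)" for k
    proof (rule integrable_const_bound[where B = C0])
      show "AE \<omega> in M. cmod (T k \<omega>) \<le> C0"
        using B by (intro AE_I2) (simp add: T_def C0_def norm_exp_eq_Re mult_left_mono)
    qed measurable
    have "(\<integral>\<omega>. T (Suc m) \<omega> \<partial>M) - (\<integral>\<omega>. T m \<omega> \<partial>M) = (\<integral>\<omega>. T (Suc m) \<omega> - T m \<omega> \<partial>M)"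
      using Ti by simp
    also have "\<dots> = (\<integral>\<omega>. G \<omega> * r \<omega> \<partial>M) + \<i> * (\<integral>\<omega>. G \<omega> * of_real (x \<omega>) \<partial>M) - (\<integral>\<omega>. G \<omega> * of_real ((x \<omega>)\<^sup>2) \<partial>M) / 2
       + (\<integral>\<omega>. G \<omega> * of_real (q \<omega>) \<partial>M) + (\<integral>\<omega>. G \<omega> * of_real (p \<omega>) \<partial>M)"
      unfolding T using ri bdd[OF x1] bdd[OF x2] bdd[OF qi] bdd[OF pi]
      by (simp del: of_real_power)
    also have "(\<integral>\<omega>. G \<omega> * of_real ((x \<omega>)\<^sup>2) \<partial>M) / 2 = (\<integral>\<omega>. G \<omega> * of_real (q \<omega>) \<partial>M)"
    proof -
      have "(\<integral>\<omega>. G \<omega> * of_real (q \<omega>) \<partial>M) = (\<integral>\<omega>. of_real (\<sigma>\<^sup>2 / 2) * (G \<omega> * of_real ((\<psi> m \<omega>)\<^sup>2)) \<partial>M)"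
        by (intro Bochner_Integration.integral_cong) (simp_all add: q_def)
      then show ?thesis unfolding Gx2 by simp
    qed
    finally have eq: "(\<integral>\<omega>. T (Suc m) \<omega> \<partial>M) - (\<integral>\<omega>. T m \<omega> \<partial>M) = (\<integral>\<omega>. G \<omega> * r \<omega> \<partial>M) + (\<integral>\<omega>. G \<omega> * of_real (p \<omega>) \<partial>M)"
      unfolding Gx by simp
    have r_le: "cmod (\<integral>\<omega>. G \<omega> * r \<omega> \<partial>M) \<le> C0 * ((1 + real L) * d powr ((b - 2)/2)) * (\<integral>\<omega>. (\<psi> m \<omega>)\<^sup>2 \<partial>M)"
    proof -
      define D where "D = d powr ((b - 2)/2)"
      have "ennreal (cmod (\<integral>\<omega>. G \<omega> * r \<omega> \<partial>M)) \<le> (\<integral>\<^sup>+\<omega>. ennreal (cmod (G \<omega> * r \<omega>)) \<partial>M)"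
        using integral_norm_bound_ennreal[OF ri] by simp
      also have "\<dots> \<le> (\<integral>\<^sup>+\<omega>. ennreal (C0 * D * (\<psi> m \<omega>)\<^sup>2) * ennreal (\<bar>V (Suc m) \<omega>\<bar> powr b) \<partial>M)"
      proof (intro nn_integral_mono)
        fix \<omega> assume s: "\<omega> \<in> space M"
        \<comment> \<open>The excess power b - 2 is paid by the uniform bound d, leaving \<psi>^2,
          whose sum stays below B.\<close>
        have "\<bar>\<psi> m \<omega>\<bar> powr b \<le> D * (\<psi> m \<omega>)\<^sup>2"
        proof (cases "\<psi> m \<omega> = 0")
          case False
          have "\<bar>\<psi> m \<omega>\<bar> powr b = \<bar>\<psi> m \<omega>\<bar> powr 2 * \<bar>\<psi> m \<omega>\<bar> powr (2 * ((b - 2)/2))"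
          proof -
            have e: "2 + 2 * ((b - 2)/2) = b" by (simp add: field_simps)
            show ?thesis by (simp only: powr_add[symmetric] e)
          qed
          also have "\<bar>\<psi> m \<omega>\<bar> powr (2 * ((b - 2)/2)) = ((\<psi> m \<omega>)\<^sup>2) powr ((b - 2)/2)"
          proof -
            have "(\<psi> m \<omega>)\<^sup>2 = \<bar>\<psi> m \<omega>\<bar> powr 2" using False by (simp add: powr_numeral)
            then show ?thesis by (simp only: powr_powr)
          qed
          also have "\<bar>\<psi> m \<omega>\<bar> powr 2 = (\<psi> m \<omega>)\<^sup>2" using False by (simp add: powr_numeral)
          finally have "\<bar>\<psi> m \<omega>\<bar> powr b = (\<psi> m \<omega>)\<^sup>2 * ((\<psi> m \<omega>)\<^sup>2) powr ((b - 2)/2)" .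
          moreover have "((\<psi> m \<omega>)\<^sup>2) powr ((b - 2)/2) \<le> D"
            unfolding D_def using d[OF s, of m] b by (intro powr_mono2) auto
          ultimately show ?thesis by (simp only: mult.commute[of D] mult_left_mono zero_le_power2)
        qed (use b in \<open>simp add: D_def\<close>)
        then have "\<bar>x \<omega>\<bar> powr b \<le> D * (\<psi> m \<omega>)\<^sup>2 * \<bar>V (Suc m) \<omega>\<bar> powr b"
          by (simp add: x_def abs_mult powr_mult mult_right_mono)
        moreover have "cmod (r \<omega>) \<le> \<bar>x \<omega>\<bar> powr b" unfolding r_def using b by (intro iexp_quadratic_bound) auto
        ultimately have "cmod (r \<omega>) \<le> D * (\<psi> m \<omega>)\<^sup>2 * \<bar>V (Suc m) \<omega>\<bar> powr b" by linarith
        then have "cmod (G \<omega> * r \<omega>) \<le> C0 * (D * (\<psi> m \<omega>)\<^sup>2 * \<bar>V (Suc m) \<omega>\<bar> powr b)"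
          unfolding norm_mult using Gn[OF s] by (intro mult_mono) (auto simp: C0_def)
        then have "ennreal (cmod (G \<omega> * r \<omega>)) \<le> ennreal ((C0 * D * (\<psi> m \<omega>)\<^sup>2) * \<bar>V (Suc m) \<omega>\<bar> powr b)"
          by (intro ennreal_leI) (simp add: mult_ac)
        then show "ennreal (cmod (G \<omega> * r \<omega>)) \<le> ennreal (C0 * D * (\<psi> m \<omega>)\<^sup>2) * ennreal (\<bar>V (Suc m) \<omega>\<bar> powr b)"
          by (subst ennreal_mult[symmetric]) (auto simp: C0_def D_def)
      qed
      also have "\<dots> \<le> (1 + of_nat L) * (\<integral>\<^sup>+\<omega>. ennreal (C0 * D * (\<psi> m \<omega>)\<^sup>2) \<partial>M)"
      proof (rule nn_Vb)
        show "(\<lambda>\<omega>. ennreal (C0 * D * (\<psi> m \<omega>)\<^sup>2)) \<in> borel_measurable (F m)" using \<psi>F[of m] by measurable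
        show "\<kappa> m \<omega> \<le> of_nat L" if "\<omega> \<in> space M" "ennreal (C0 * D * (\<psi> m \<omega>)\<^sup>2) \<noteq> 0" for \<omega>
          using that by (intro L) auto
      qed (use b in auto)
      also have "(\<integral>\<^sup>+\<omega>. ennreal (C0 * D * (\<psi> m \<omega>)\<^sup>2) \<partial>M) = ennreal (C0 * D * (\<integral>\<omega>. (\<psi> m \<omega>)\<^sup>2 \<partial>M))"
        using \<psi>int[of m] by (subst nn_integral_eq_integral) (auto simp: C0_def D_def)
      also have "(1 + of_nat L) * ennreal (C0 * D * (\<integral>\<omega>. (\<psi> m \<omega>)\<^sup>2 \<partial>M)) = ennreal (C0 * ((1 + real L) * D) * (\<integral>\<omega>. (\<psi> m \<omega>)\<^sup>2 \<partial>M))"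
      proof -
        have eL: "(1 + of_nat L :: ennreal) = ennreal (1 + real L)" by (simp add: ennreal_of_nat_eq_real_of_nat)
        show ?thesis unfolding eL by (subst ennreal_mult[symmetric]) (auto simp: C0_def D_def mult_ac)
      qed
      finally show ?thesis by (simp add: D_def C0_def)
    qed
    have p_le: "cmod (\<integral>\<omega>. G \<omega> * of_real (p \<omega>) \<partial>M) \<le> C0 * (\<sigma>^4 * d) * (\<integral>\<omega>. (\<psi> m \<omega>)\<^sup>2 \<partial>M)"
    proof -
      have "cmod (\<integral>\<omega>. G \<omega> * of_real (p \<omega>) \<partial>M) \<le> (\<integral>\<omega>. cmod (G \<omega> * of_real (p \<omega>)) \<partial>M)"
        by (rule integral_norm_bound)
      also have "\<dots> \<le> (\<integral>\<omega>. C0 * (\<sigma>^4 * d) * (\<psi> m \<omega>)\<^sup>2 \<partial>M)"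
      proof (intro integral_mono)
        fix \<omega> assume s: "\<omega> \<in> space M"
        have "cmod (G \<omega> * of_real (p \<omega>)) \<le> C0 * (\<sigma>^4 * d * (\<psi> m \<omega>)\<^sup>2)"
          unfolding norm_mult norm_of_real using Gn[OF s] pb[OF s] by (intro mult_mono) (auto simp: C0_def)
        then show "cmod (G \<omega> * of_real (p \<omega>)) \<le> C0 * (\<sigma>^4 * d) * (\<psi> m \<omega>)\<^sup>2" by (simp add: mult_ac)
      qed (use bdd[OF pi] \<psi>int[of m] in auto)
      finally show ?thesis by simp
    qed
    show ?thesis unfolding eq
      using norm_triangle_ineq[of "\<integral>\<omega>. G \<omega> * r \<omega> \<partial>M" "\<integral>\<omega>. G \<omega> * of_real (p \<omega>) \<partial>M"] r_le p_le
      by (simp add: E_def ring_distribs)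
  qed
  have main: "cmod ((\<integral>\<omega>. T n \<omega> \<partial>M) - 1) \<le> E * (\<Sum>k<n. \<integral>\<omega>. (\<psi> k \<omega>)\<^sup>2 \<partial>M)" for n
  proof (induction n)
    case 0 show ?case by (simp add: T_def prob_space)
  next
    case (Suc n)
    have "cmod ((\<integral>\<omega>. T (Suc n) \<omega> \<partial>M) - 1) \<le> cmod ((\<integral>\<omega>. T (Suc n) \<omega> \<partial>M) - (\<integral>\<omega>. T n \<omega> \<partial>M)) + cmod ((\<integral>\<omega>. T n \<omega> \<partial>M) - 1)"
      by (metis norm_triangle_ineq diff_add_cancel add_diff_eq)
    then show ?case using Suc step[of n] by (simp add: distrib_left)
  qed
  have "(\<Sum>k<n. \<integral>\<omega>. (\<psi> k \<omega>)\<^sup>2 \<partial>M) = (\<integral>\<omega>. (\<Sum>k<n. (\<psi> k \<omega>)\<^sup>2) \<partial>M)"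
    using \<psi>int by (subst Bochner_Integration.integral_sum) auto
  also have "\<dots> \<le> (\<integral>\<omega>. B \<partial>M)" using \<psi>int B by (intro integral_mono) auto
  also have "\<dots> = B" by (simp add: prob_space)
  finally have "E * (\<Sum>k<n. \<integral>\<omega>. (\<psi> k \<omega>)\<^sup>2 \<partial>M) \<le> E * B" using E0 by (rule mult_left_mono)
  with main[of n] have "cmod ((\<integral>\<omega>. T n \<omega> \<partial>M) - 1) \<le> E * B" by linarith
  then show ?thesis by (simp add: E_def C0_def mult_ac)
qed

lemma prob_tendsto_0_of_AE_eventually:
  assumes A: "\<And>n. A n \<in> sets M" and ev: "AE \<omega> in M. eventually (\<lambda>n. \<omega> \<notin> A n) sequentially"
  shows "(\<lambda>n. prob (A n)) \<longlonglongrightarrow> 0"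
proof -
  note [measurable] = A
  have "(\<lambda>n. \<integral>\<omega>. indicator (A n) \<omega> \<partial>M) \<longlonglongrightarrow> (\<integral>\<omega>. (0::real) \<partial>M)"
  proof (rule integral_dominated_convergence[where w = "\<lambda>_. 1"])
    show "AE \<omega> in M. (\<lambda>n. indicator (A n) \<omega> :: real) \<longlonglongrightarrow> 0"
      using ev by eventually_elim (auto elim!: eventually_mono intro!: tendsto_eventually)
  qed (auto simp: indicator_def)
  then show ?thesis using A by simp
qed

text \<open>The averaged squares converge but are neither bounded nor deterministic. Predictable
  truncation supplies the bounds of \<open>truncated_clt_step\<close>; off events of small
  probability it changes nothing, and there the random Gaussian factor may be replaced by its limit
  c.\<close>

theorem martingale_clt:
  fixes \<phi> :: "nat \<Rightarrow> 'a \<Rightarrow> real" and v :: real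
  assumes \<phi>F: "\<And>k. \<phi> k \<in> borel_measurable (F k)"
    and conv: "AE \<omega> in M. (\<lambda>n. (\<Sum>k<n. (\<phi> k \<omega>)\<^sup>2) / real n) \<longlonglongrightarrow> v"
  shows "(\<lambda>n. CLINT \<omega>|M. iexp ((\<Sum>k<n. \<phi> k \<omega> * V (Suc k) \<omega>) / sqrt (real n))) \<longlonglongrightarrow> complex_of_real (exp (- (\<sigma>\<^sup>2 * v / 2)))"
proof -
  have [measurable]: "\<phi> k \<in> borel_measurable M" for k using F_M[OF \<phi>F] .
  have [measurable]: "\<kappa> k \<in> borel_measurable M" for k using F_M[OF \<kappa>_F] .
  have "AE \<omega> in M. 0 \<le> v"
    using conv by eventually_elim (rule LIMSEQ_le_const, auto intro!: exI[of _ 0] divide_nonneg_nonneg sum_nonneg)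
  then have v0: "0 \<le> v" by simp
  \<comment> \<open>The margin above v makes the truncation at B eventually inactive on almost every
    path.\<close>
  define B where "B = v + 1"
  define C0 where "C0 = exp (\<sigma>\<^sup>2 / 2 * B)"
  define c where "c = exp (\<sigma>\<^sup>2 / 2 * v)"
  define b where "b = min a 3"
  have b: "2 < b" "b \<le> 3" "b \<le> a" using a_gt by (auto simp: b_def)
  have cC: "c \<le> C0" unfolding c_def C0_def B_def by (simp add: mult_left_mono)
  \<comment> \<open>The cap \<open>2 * C0\<close> is a bound for the difference of the two
    integrands, and it makes dominated convergence applicable to h.\<close>
  define h where "h n \<omega> = min (2 * C0) \<bar>c - exp (\<sigma>\<^sup>2 / 2 * ((\<Sum>k<n. (\<phi> k \<omega>)\<^sup>2) / real n))\<bar>" for n \<omega>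
  define N where "N L = {\<omega> \<in> space M. \<exists>k. of_nat L < \<kappa> k \<omega>}" for L :: nat
  define H where "H d n = {\<omega> \<in> space M. \<not> ((\<Sum>k<n. (\<phi> k \<omega>)\<^sup>2) \<le> B * real n \<and> (\<forall>k<n. (\<phi> k \<omega>)\<^sup>2 \<le> d * real n))}" for d :: real and n :: nat
  define Z where "Z n \<omega> = (\<Sum>k<n. \<phi> k \<omega> * V (Suc k) \<omega>) / sqrt (real n)" for n \<omega>
  have [measurable]: "h n \<in> borel_measurable M" "N L \<in> sets M" "H d n \<in> sets M" "Z n \<in> borel_measurable M" for n d L
    unfolding h_def N_def H_def Z_def by measurable
  have h_bd: "\<bar>h n \<omega>\<bar> \<le> 2 * C0" "0 \<le> h n \<omega>" for n \<omega> by (auto simp: h_def C0_def)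
  have key: "cmod (of_real c * (CLINT \<omega>|M. iexp (Z n \<omega>)) - 1) \<le> (\<integral>\<omega>. h n \<omega> \<partial>M) + 2 * C0 * prob (N L) + 2 * C0 * prob (H d n)
      + C0 * B * (\<sigma>^4 * d + (1 + real L) * d powr ((b - 2)/2))"
    if n: "n \<ge> 1" and d: "d > 0" for n L d
  proof -
    \<comment> \<open>The partial sum includes j = k: as \<phi> k is \<open>F k\<close>-measurable,
      the cutoff remains predictable with respect to V_(k+1).\<close>
    define good where "good k \<omega> \<longleftrightarrow> (\<Sum>j\<le>k. (\<phi> j \<omega>)\<^sup>2) \<le> B * real n \<and> (\<phi> k \<omega>)\<^sup>2 \<le> d * real n \<and> \<kappa> k \<omega> \<le> of_nat L" for k \<omega>
    define \<psi> where "\<psi> k \<omega> = (if good k \<omega> then \<phi> k \<omega> / sqrt (real n) else 0)" for k \<omega>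
    have \<psi>2: "(\<psi> k \<omega>)\<^sup>2 = (if good k \<omega> then (\<phi> k \<omega>)\<^sup>2 / real n else 0)" for k \<omega>
      by (simp add: \<psi>_def power_divide)
    have \<psi>F: "\<psi> k \<in> borel_measurable (F k)" for k
    proof -
      have [measurable]: "\<phi> j \<in> borel_measurable (F k)" if "j \<in> {..k}" for j using F_mono[OF \<phi>F[of j], of k] that by simp
      have [measurable]: "\<phi> k \<in> borel_measurable (F k)" "\<kappa> k \<in> borel_measurable (F k)" using \<phi>F \<kappa>_F by auto
      show ?thesis unfolding \<psi>_def good_def by measurable
    qed
    \<comment> \<open>No stopping time is involved: at a good index the untruncated sum up to it is
      already at most B n, and it dominates the truncated one; at any other index nothing is
      added.\<close>
    have \<psi>B: "(\<Sum>k<m. (\<psi> k \<omega>)\<^sup>2) \<le> B" for m \<omega>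
    proof (induction m)
      case 0 show ?case using v0 by (simp add: B_def)
    next
      case (Suc m)
      show ?case
      proof (cases "good m \<omega>")
        case False then show ?thesis using Suc by (simp add: \<psi>2)
      next
        case True
        have "(\<Sum>k<Suc m. (\<psi> k \<omega>)\<^sup>2) \<le> (\<Sum>k<Suc m. (\<phi> k \<omega>)\<^sup>2 / real n)"
          by (intro sum_mono) (simp add: \<psi>2)
        also have "\<dots> = (\<Sum>k\<le>m. (\<phi> k \<omega>)\<^sup>2) / real n" by (simp only: sum_divide_distrib lessThan_Suc_atMost)
        also have "\<dots> \<le> B" using True n by (simp add: good_def field_simps)
        finally show ?thesis .
      qed
    qed
    have \<psi>d: "(\<psi> k \<omega>)\<^sup>2 \<le> d" for k \<omega> using n d by (auto simp: \<psi>2 good_def field_simps)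
    have \<psi>L: "\<kappa> k \<omega> \<le> of_nat L" if "\<psi> k \<omega> \<noteq> 0" for k \<omega> using that by (auto simp: \<psi>_def good_def split: if_splits)
    define T where "T \<omega> = exp (\<i> * of_real (\<Sum>k<n. \<psi> k \<omega> * V (Suc k) \<omega>) + of_real (\<sigma>\<^sup>2 / 2 * (\<Sum>k<n. (\<psi> k \<omega>)\<^sup>2)))" for \<omega>
    have [measurable]: "\<psi> k \<in> borel_measurable M" for k using F_M[OF \<psi>F] .
    have [measurable]: "T \<in> borel_measurable M" unfolding T_def by measurable
    have TC: "cmod (T \<omega>) \<le> C0" for \<omega>
      using \<psi>B[of \<omega> n] by (simp add: T_def C0_def norm_exp_eq_Re mult_left_mono)
    have Ti: "integrable M T" by (rule integrable_const_bound[where B = C0]) (use TC in auto)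
    have Zi: "integrable M (\<lambda>\<omega>. iexp (Z n \<omega>))" by (rule integrable_const_bound[where B = 1]) auto
    have trunc: "cmod ((\<integral>\<omega>. T \<omega> \<partial>M) - 1) \<le> C0 * B * (\<sigma>^4 * d + (1 + real L) * d powr ((b - 2)/2))"
      unfolding T_def C0_def by (rule truncated_clt_step[OF \<psi>F \<psi>B \<psi>d \<psi>L b])
    have pt: "cmod (of_real c * iexp (Z n \<omega>) - T \<omega>) \<le> h n \<omega> + 2 * C0 * indicator (N L) \<omega> + 2 * C0 * indicator (H d n) \<omega>" if s: "\<omega> \<in> space M" for \<omega>
    proof -
      have 2: "cmod (of_real c * iexp (Z n \<omega>) - T \<omega>) \<le> 2 * C0"
        using norm_triangle_ineq4[of "of_real c * iexp (Z n \<omega>)" "T \<omega>"] TC[of \<omega>] cC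
        by (simp add: norm_mult c_def)
      show ?thesis
      proof (cases "\<omega> \<in> N L \<or> \<omega> \<in> H d n")
        case True then show ?thesis using 2 h_bd[of n \<omega>] by (auto simp: indicator_def C0_def)
      next
        case False
        have "good k \<omega>" if k: "k < n" for k
        proof -
          have "(\<Sum>j\<le>k. (\<phi> j \<omega>)\<^sup>2) \<le> (\<Sum>j<n. (\<phi> j \<omega>)\<^sup>2)" using k by (intro sum_mono2) auto
          moreover have "(\<Sum>j<n. (\<phi> j \<omega>)\<^sup>2) \<le> B * real n" "(\<phi> k \<omega>)\<^sup>2 \<le> d * real n" "\<kappa> k \<omega> \<le> of_nat L"
            using False s k unfolding N_def H_def by (blast, blast, simp add: not_less)
          ultimately show ?thesis by (auto simp: good_def)
        qed
        then have \<psi>\<phi>: "\<psi> k \<omega> = \<phi> k \<omega> / sqrt (real n)" if "k < n" for k using that by (simp add: \<psi>_def)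
        have e1: "(\<Sum>k<n. \<psi> k \<omega> * V (Suc k) \<omega>) = Z n \<omega>"
          unfolding Z_def sum_divide_distrib by (intro sum.cong) (auto simp: \<psi>\<phi>)
        have e2: "(\<Sum>k<n. (\<psi> k \<omega>)\<^sup>2) = (\<Sum>k<n. (\<phi> k \<omega>)\<^sup>2) / real n"
          unfolding sum_divide_distrib by (intro sum.cong) (auto simp: \<psi>\<phi> power_divide)
        have "of_real c * iexp (Z n \<omega>) - T \<omega> = of_real (c - exp (\<sigma>\<^sup>2 / 2 * ((\<Sum>k<n. (\<phi> k \<omega>)\<^sup>2) / real n))) * iexp (Z n \<omega>)"
          unfolding T_def e1 e2 exp_add by (simp add: algebra_simps flip: exp_of_real)
        then have "cmod (of_real c * iexp (Z n \<omega>) - T \<omega>) = \<bar>c - exp (\<sigma>\<^sup>2 / 2 * ((\<Sum>k<n. (\<phi> k \<omega>)\<^sup>2) / real n))\<bar>"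
          by (simp only: norm_mult norm_of_real norm_exp_i_times mult_1_right)
        then show ?thesis using 2 False by (simp add: h_def)
      qed
    qed
    have hi: "integrable M (h n)" by (rule integrable_const_bound[where B = "2 * C0"]) (use h_bd in auto)
    have ind: "integrable M (indicat_real A)" if "A \<in> sets M" for A
      by (rule integrable_const_bound[where B = 1]) (use that in \<open>auto simp: indicator_def\<close>)
    have "cmod (of_real c * (CLINT \<omega>|M. iexp (Z n \<omega>)) - (\<integral>\<omega>. T \<omega> \<partial>M)) = cmod (\<integral>\<omega>. of_real c * iexp (Z n \<omega>) - T \<omega> \<partial>M)"
      using Ti Zi by simp
    also have "\<dots> \<le> (\<integral>\<omega>. cmod (of_real c * iexp (Z n \<omega>) - T \<omega>) \<partial>M)" by (rule integral_norm_bound)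
    also have "\<dots> \<le> (\<integral>\<omega>. h n \<omega> + 2 * C0 * indicator (N L) \<omega> + 2 * C0 * indicator (H d n) \<omega> \<partial>M)"
      using pt Ti Zi hi ind[of "N L"] ind[of "H d n"] by (intro integral_mono) auto
    also have "\<dots> = (\<integral>\<omega>. h n \<omega> \<partial>M) + 2 * C0 * prob (N L) + 2 * C0 * prob (H d n)"
      using hi ind[of "N L"] ind[of "H d n"] by simp
    finally have "cmod (of_real c * (CLINT \<omega>|M. iexp (Z n \<omega>)) - (\<integral>\<omega>. T \<omega> \<partial>M)) \<le> (\<integral>\<omega>. h n \<omega> \<partial>M) + 2 * C0 * prob (N L) + 2 * C0 * prob (H d n)" .
    then show ?thesis using trunc
      norm_triangle_ineq[of "of_real c * (CLINT \<omega>|M. iexp (Z n \<omega>)) - (\<integral>\<omega>. T \<omega> \<partial>M)" "(\<integral>\<omega>. T \<omega> \<partial>M) - 1"] by simp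
  qed
  have h0: "(\<lambda>n. \<integral>\<omega>. h n \<omega> \<partial>M) \<longlonglongrightarrow> 0"
  proof -
    have "(\<lambda>n. \<integral>\<omega>. h n \<omega> \<partial>M) \<longlonglongrightarrow> (\<integral>\<omega>. (0::real) \<partial>M)"
    proof (rule integral_dominated_convergence[where w = "\<lambda>_. 2 * C0"])
      show "AE \<omega> in M. (\<lambda>n. h n \<omega>) \<longlonglongrightarrow> 0"
        using conv
      proof eventually_elim
        case (elim \<omega>)
        have "(\<lambda>n. h n \<omega>) \<longlonglongrightarrow> min (2 * C0) \<bar>c - exp (\<sigma>\<^sup>2 / 2 * v)\<bar>"
          unfolding h_def by (intro tendsto_min tendsto_rabs tendsto_diff tendsto_exp tendsto_mult tendsto_const elim)
        then show ?case by (simp add: c_def C0_def)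
      qed
    qed (use h_bd in auto)
    then show ?thesis by simp
  qed
  have N0: "(\<lambda>L. prob (N L)) \<longlonglongrightarrow> 0"
  proof (rule prob_tendsto_0_of_AE_eventually)
    show "AE \<omega> in M. eventually (\<lambda>L. \<omega> \<notin> N L) sequentially"
      using \<kappa>_bdd
    proof eventually_elim
      case (elim \<omega>)
      then obtain L0 :: nat where L0: "\<forall>n. \<kappa> n \<omega> \<le> of_nat L0" by blast
      show ?case using eventually_ge_at_top[of L0]
      proof eventually_elim
        case (elim L)
        have "\<kappa> n \<omega> \<le> of_nat L" for n using L0 elim by (meson of_nat_mono order_trans)
        then show ?case by (auto simp: N_def not_less)
      qed
    qed
  qed simp
  have H0: "(\<lambda>n. prob (H d n)) \<longlonglongrightarrow> 0" if d: "d > 0" for d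
  proof (rule prob_tendsto_0_of_AE_eventually)
    show "AE \<omega> in M. eventually (\<lambda>n. \<omega> \<notin> H d n) sequentially"
      using conv
    proof eventually_elim
      case (elim \<omega>)
      define A where "A n = (\<Sum>k<n. (\<phi> k \<omega>)\<^sup>2)" for n
      have A: "(\<lambda>n. A n / real n) \<longlonglongrightarrow> v" using elim by (simp add: A_def)
      \<comment> \<open>Consecutive averages have the same limit, so \<phi>_n^2 / n tends to 0 and
        no single summand is of order n.\<close>
      have "(\<lambda>n. A (Suc n) / real (Suc n) * (real (Suc n) / real n) - A n / real n) \<longlonglongrightarrow> v * 1 - v"
        by (intro tendsto_diff tendsto_mult A LIMSEQ_Suc[OF A]) real_asymp
      then have "eventually (\<lambda>n. A (Suc n) / real (Suc n) * (real (Suc n) / real n) - A n / real n < d \<and> n > 0) sequentially"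
        using d by (intro eventually_conj order_tendstoD(2) eventually_gt_at_top) auto
      then obtain n0 where n0: "\<And>n. n \<ge> n0 \<Longrightarrow> A (Suc n) / real (Suc n) * (real (Suc n) / real n) - A n / real n < d \<and> n > 0"
        by (auto simp: eventually_sequentially)
      have big: "(\<phi> n \<omega>)\<^sup>2 \<le> d * real n" if "n \<ge> n0" for n
      proof -
        have n: "n > 0" using n0[OF that] by blast
        have "A (Suc n) / real (Suc n) * (real (Suc n) / real n) - A n / real n = (\<phi> n \<omega>)\<^sup>2 / real n"
        proof -
          have "A (Suc n) / real (Suc n) * (real (Suc n) / real n) = A (Suc n) / real n" by (simp del: of_nat_Suc)
          then show ?thesis by (simp add: A_def add_divide_distrib)
        qed
        then show ?thesis using n0[OF that] n by (simp add: field_simps)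
      qed
      define m where "m = (\<Sum>k<n0. (\<phi> k \<omega>)\<^sup>2) / d"
      have small: "(\<phi> k \<omega>)\<^sup>2 \<le> d * m" if "k < n0" for k
        using that d member_le_sum[of k "{..<n0}" "\<lambda>k. (\<phi> k \<omega>)\<^sup>2"] by (simp add: m_def)
      have "eventually (\<lambda>n. A n / real n < B) sequentially" using order_tendstoD(2)[OF A, of B] by (simp add: B_def)
      moreover have "eventually (\<lambda>n. m \<le> real n) sequentially"
        using filterlim_real_sequentially by (simp add: filterlim_at_top)
      ultimately show ?case using eventually_gt_at_top[of 0]
      proof eventually_elim
        case (elim n)
        have "A n \<le> B * real n" using elim by (simp add: field_simps)
        moreover have "(\<phi> k \<omega>)\<^sup>2 \<le> d * real n" if "k < n" for k
        proof (cases "k < n0")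
          case True
          have "d * m \<le> d * real n" using elim d by simp
          then show ?thesis using small[OF True] by linarith
        next
          case False
          have "d * real k \<le> d * real n" using that d by simp
          then show ?thesis using big[of k] False by simp
        qed
        ultimately show ?case by (auto simp: H_def A_def)
      qed
    qed
  qed simp
  \<comment> \<open>The integer L is fixed first, then d depending on L, and n last.\<close>
  have "(\<lambda>n. of_real c * (CLINT \<omega>|M. iexp (Z n \<omega>))) \<longlonglongrightarrow> 1"
  proof (rule LIMSEQ_I)
    fix e :: real assume e: "e > 0"
    have "(\<lambda>L. 2 * C0 * prob (N L)) \<longlonglongrightarrow> 2 * C0 * 0" by (intro tendsto_intros N0)
    then have "eventually (\<lambda>L. 2 * C0 * prob (N L) < e / 4) sequentially" using e by (intro order_tendstoD(2)) auto
    then obtain L where L: "2 * C0 * prob (N L) < e / 4" by (auto simp: eventually_sequentially)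
    have "((\<lambda>d. C0 * B * (\<sigma>^4 * d + (1 + real L) * d powr ((b - 2)/2))) \<longlongrightarrow> C0 * B * (\<sigma>^4 * 0 + (1 + real L) * 0)) (at_right 0)"
      by (intro tendsto_intros tendsto_zero_powrI) (use b in \<open>auto simp: eventually_at_filter\<close>)
    then have "eventually (\<lambda>d. C0 * B * (\<sigma>^4 * d + (1 + real L) * d powr ((b - 2)/2)) < e / 4 \<and> d > 0) (at_right 0)"
      using e by (intro eventually_conj order_tendstoD(2)) (auto simp: eventually_at_filter)
    then obtain d where d: "C0 * B * (\<sigma>^4 * d + (1 + real L) * d powr ((b - 2)/2)) < e / 4" "d > 0"
      using eventually_happens by (metis (no_types, lifting) trivial_limit_at_right_real)
    have "(\<lambda>n. 2 * C0 * prob (H d n)) \<longlonglongrightarrow> 2 * C0 * 0" by (intro tendsto_intros H0 d)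
    then have "eventually (\<lambda>n. 2 * C0 * prob (H d n) < e / 4) sequentially" using e by (intro order_tendstoD(2)) auto
    moreover have "eventually (\<lambda>n. (\<integral>\<omega>. h n \<omega> \<partial>M) < e / 4) sequentially" using e h0 by (intro order_tendstoD(2)) auto
    ultimately have "eventually (\<lambda>n. norm (of_real c * (CLINT \<omega>|M. iexp (Z n \<omega>)) - 1) < e) sequentially"
      using eventually_ge_at_top[of 1]
    proof eventually_elim
      case (elim n)
      show ?case using key[OF elim(3) d(2), of L] L d(1) elim(1,2) by linarith
    qed
    then show "\<exists>no. \<forall>n\<ge>no. norm (of_real c * (CLINT \<omega>|M. iexp (Z n \<omega>)) - 1) < e"
      by (simp add: eventually_sequentially)
  qed
  then have "(\<lambda>n. of_real (1 / c) * (of_real c * (CLINT \<omega>|M. iexp (Z n \<omega>)))) \<longlonglongrightarrow> of_real (1 / c) * 1"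
    by (intro tendsto_mult tendsto_const)
  moreover have "complex_of_real (1 / c) * (of_real c * w) = w" for w
    by (simp add: c_def)
  moreover have "1 / c = exp (- (\<sigma>\<^sup>2 * v / 2))" by (simp add: c_def exp_minus field_simps)
  ultimately show ?thesis by (simp only: Z_def mult_1_right)
qed

end

subsection \<open>Levy continuity on Euclidean space\<close>

text \<open>The linear span of the characters of R^d. Convergence of characteristic functions
  extends to it by linearity, and closure under products lets its real members enter
  Stone-Weierstrass.\<close>

inductive_set expsum :: "nat \<Rightarrow> ((nat \<Rightarrow> real) \<Rightarrow> complex) set" for d where
  wave: "(\<lambda>x. c * iexp (\<Sum>i<d. t i * x i)) \<in> expsum d"
| add: "f \<in> expsum d \<Longrightarrow> g \<in> expsum d \<Longrightarrow> (\<lambda>x. f x + g x) \<in> expsum d"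

lemma expsum_const: "(\<lambda>_. c) \<in> expsum d"
  using expsum.wave[where c = c and d = d and t = "\<lambda>_. 0"] by simp

lemma expsum_mult:
  assumes "f \<in> expsum d" "g \<in> expsum d"
  shows "(\<lambda>x. f x * g x) \<in> expsum d"
  using assms(1)
proof induction
  case (wave c t)
  show ?case using assms(2)
  proof induction
    case (wave c' t')
    have "(\<lambda>x. c * iexp (\<Sum>i<d. t i * x i) * (c' * iexp (\<Sum>i<d. t' i * x i))) = (\<lambda>x. (c * c') * iexp (\<Sum>i<d. (t i + t' i) * x i))"
      by (simp add: fun_eq_iff ring_distribs sum.distrib exp_add)
    then show ?case using expsum.wave[where c = "c * c'" and d = d and t = "\<lambda>i. t i + t' i"] by simp
  next
    case (add f g)
    then show ?case using expsum.add by (simp add: distrib_left)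
  qed
next
  case (add f g)
  then show ?case using expsum.add by (simp add: distrib_right)
qed

text \<open>With s small enough, these real members separate the points of a given bounded
  box.\<close>

lemma expsum_sin: "(\<lambda>x. of_real (sin (s * x i))) \<in> expsum d" if "i < d"
proof -
  have e: "(\<Sum>j<d. (if j = i then r else 0) * x j) = r * x i" for r and x :: "nat \<Rightarrow> real"
    using that by (simp add: if_distrib[of "\<lambda>y. y * _"] cong: if_cong)
  have "(\<lambda>x. 1 / (2 * \<i>) * iexp (\<Sum>j<d. (if j = i then s else 0) * x j) + (- 1 / (2 * \<i>)) * iexp (\<Sum>j<d. (if j = i then - s else 0) * x j)) \<in> expsum d"
    by (intro expsum.intros)
  also have "(\<lambda>x. 1 / (2 * \<i>) * iexp (\<Sum>j<d. (if j = i then s else 0) * x j) + (- 1 / (2 * \<i>)) * iexp (\<Sum>j<d. (if j = i then - s else 0) * x j))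
      = (\<lambda>x. of_real (sin (s * x i)))"
    unfolding e by (simp add: fun_eq_iff sin_exp_eq sin_of_real[symmetric] diff_divide_distrib right_diff_distrib)
  finally show ?thesis .
qed

lemma expsum_bounded: "f \<in> expsum d \<Longrightarrow> \<exists>C. \<forall>x. cmod (f x) \<le> C"
proof (induction rule: expsum.induct)
  case (wave c t)
  then show ?case by (intro exI[of _ "cmod c"]) (simp add: norm_mult)
next
  case (add f g)
  then show ?case by (meson add_mono norm_triangle_ineq order_trans)
qed

lemma expsum_continuous: "f \<in> expsum d \<Longrightarrow> continuous_on UNIV f"
proof (induction rule: expsum.induct)
  case (wave c t)
  show ?case by (intro continuous_intros continuous_on_product_coordinates)
qed (intro continuous_intros)

lemma coordinate_measurable: "i < d \<Longrightarrow> (\<lambda>x. x i) \<in> borel_measurable (Rn_borel d)"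
  using measurable_component_singleton[of i "{..<d}" "\<lambda>_. borel :: real measure"] by simp

lemma expsum_measurable: "f \<in> expsum d \<Longrightarrow> f \<in> borel_measurable (Rn_borel d)"
proof (induction rule: expsum.induct)
  case (wave c t)
  show ?case by measurable
qed measurable

locale char_converges =
  fixes d :: nat and \<mu>s :: "nat \<Rightarrow> (nat \<Rightarrow> real) measure" and \<mu> :: "(nat \<Rightarrow> real) measure"
  assumes prob_n: "\<And>n. prob_space (\<mu>s n)" and sets_n: "\<And>n. sets (\<mu>s n) = sets (Rn_borel d)"
    and prob: "prob_space \<mu>" and sets_\<mu>: "sets \<mu> = sets (Rn_borel d)"
    and conv: "\<And>t :: nat \<Rightarrow> real. (\<lambda>n. CLINT x|\<mu>s n. iexp (\<Sum>i<d. t i * x i)) \<longlonglongrightarrow> (CLINT x|\<mu>. iexp (\<Sum>i<d. t i * x i))"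
begin

lemma integrable_bdd:
  fixes f :: "(nat \<Rightarrow> real) \<Rightarrow> 'b::{banach, second_countable_topology}"
  assumes "f \<in> borel_measurable (Rn_borel d)" "\<And>x. x \<in> space (Rn_borel d) \<Longrightarrow> norm (f x) \<le> B"
  shows "integrable (\<mu>s n) f" "integrable \<mu> f"
proof -
  interpret P: prob_space "\<mu>s n" by (rule prob_n)
  interpret Q: prob_space \<mu> by (rule prob)
  show "integrable (\<mu>s n) f"
    using assms sets_eq_imp_space_eq[OF sets_n[of n]] measurable_cong_sets[OF sets_n[of n] refl]
    by (intro P.integrable_const_bound[where B = B]) auto
  show "integrable \<mu> f"
    using assms sets_eq_imp_space_eq[OF sets_\<mu>] measurable_cong_sets[OF sets_\<mu> refl]
    by (intro Q.integrable_const_bound[where B = B]) auto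
qed

lemma expsum_integrable:
  assumes "f \<in> expsum d"
  shows "integrable (\<mu>s n) f" "integrable \<mu> f"
  using expsum_bounded[OF assms] integrable_bdd[OF expsum_measurable[OF assms]] by blast+

lemma expsum_conv: "f \<in> expsum d \<Longrightarrow> (\<lambda>n. CLINT x|\<mu>s n. f x) \<longlonglongrightarrow> (CLINT x|\<mu>. f x)"
proof (induction rule: expsum.induct)
  case (wave c t)
  then show ?case using tendsto_mult[OF tendsto_const[of c] conv[of t]] by simp
next
  case (add f g)
  then show ?case using expsum_integrable by (simp add: tendsto_add)
qed

text \<open>With all other frequencies zero the hypothesis becomes that of one-dimensional Levy
  continuity. This supplies the tightness that the multivariate statement needs.\<close>

lemma marginal_conv:
  assumes i: "i < d" and g: "\<And>y. isCont g y" "\<And>y. \<bar>g y\<bar> \<le> (B::real)"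
  shows "(\<lambda>n. \<integral>x. g (x i) \<partial>\<mu>s n) \<longlonglongrightarrow> (\<integral>x. g (x i) \<partial>\<mu>)"
proof -
  have m: "(\<lambda>x. x i) \<in> borel_measurable (Rn_borel d)" using i by (rule coordinate_measurable)
  have mn: "(\<lambda>x. x i) \<in> borel_measurable (\<mu>s n)" for n using m measurable_cong_sets[OF sets_n[of n] refl] by blast
  have m\<mu>: "(\<lambda>x. x i) \<in> borel_measurable \<mu>" using m measurable_cong_sets[OF sets_\<mu> refl] by blast
  have gm: "g \<in> borel_measurable borel"
    using g(1) by (intro borel_measurable_continuous_onI continuous_at_imp_continuous_on) auto
  have e: "(\<Sum>j<d. (if j = i then s else 0) * x j) = s * x i" for s and x :: "nat \<Rightarrow> real"
    using i by (simp add: if_distrib[of "\<lambda>y. y * _"] cong: if_cong)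
  have rd: "real_distribution (distr (\<mu>s n) borel (\<lambda>x. x i))" for n
    using prob_space.prob_space_distr[OF prob_n mn]
    by (auto simp: real_distribution_def real_distribution_axioms_def)
  have rd': "real_distribution (distr \<mu> borel (\<lambda>x. x i))"
    using prob_space.prob_space_distr[OF prob m\<mu>]
    by (auto simp: real_distribution_def real_distribution_axioms_def)
  have c: "char (distr (\<mu>s n) borel (\<lambda>x. x i)) s = (CLINT x|\<mu>s n. iexp (s * x i))" for n s
    unfolding char_def using mn by (subst integral_distr) auto
  have c': "char (distr \<mu> borel (\<lambda>x. x i)) s = (CLINT x|\<mu>. iexp (s * x i))" for s
    unfolding char_def using m\<mu> by (subst integral_distr) auto
  have "weak_conv_m (\<lambda>n. distr (\<mu>s n) borel (\<lambda>x. x i)) (distr \<mu> borel (\<lambda>x. x i))"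
  proof (rule levy_continuity[OF rd rd'])
    show "(\<lambda>n. char (distr (\<mu>s n) borel (\<lambda>x. x i)) s) \<longlonglongrightarrow> char (distr \<mu> borel (\<lambda>x. x i)) s" for s
      using conv[of "\<lambda>j. if j = i then s else 0"] unfolding c c' e .
  qed
  from weak_conv_imp_integral_bdd_continuous_conv[OF rd rd' this g(1), of B]
  show ?thesis using g(2) gm mn m\<mu> by (simp add: integral_distr)
qed

end

lemma continuous_map_restrict:
  "continuous_map euclidean (Rn_top d) (\<lambda>x. restrict x {..<d})"
  unfolding continuous_map_componentwise
  by (auto intro!: continuous_on_product_coordinates)

text \<open>Composition with \<open>restrict\<close> extends f to a continuous function on the full
  countable product, where the Borel and the product \<sigma>-algebra coincide; on extensional
  functions nothing changes.\<close>

lemma Rn_continuous_measurable: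
  assumes f: "continuous_map (Rn_top d) euclideanreal f"
  shows "f \<in> borel_measurable (Rn_borel d)" and "continuous_on UNIV (\<lambda>x. f (restrict x {..<d}))"
proof -
  show c: "continuous_on UNIV (\<lambda>x. f (restrict x {..<d}))"
    using continuous_map_compose[OF continuous_map_restrict f] by (simp add: comp_def)
  have "(\<lambda>x. f (restrict x {..<d})) \<in> borel_measurable (PiM UNIV (\<lambda>_. borel))"
    using borel_measurable_continuous_onI[OF c] measurable_cong_sets[OF sets_PiM_equal_borel refl] by blast
  moreover have "(\<lambda>x. x) \<in> measurable (Rn_borel d) (PiM UNIV (\<lambda>_. borel))"
  proof (rule measurable_PiM_single')
    fix i :: nat
    show "(\<lambda>x. x i) \<in> borel_measurable (Rn_borel d)"
    proof (cases "i < d")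
      case False
      then have "(\<lambda>x. x i) \<in> borel_measurable (Rn_borel d) \<longleftrightarrow> (\<lambda>x. undefined :: real) \<in> borel_measurable (Rn_borel d)"
        by (intro measurable_cong) (auto simp: space_PiM PiE_def extensional_def)
      then show ?thesis by simp
    qed (rule coordinate_measurable)
  qed auto
  ultimately have "(\<lambda>x. f (restrict x {..<d})) \<in> borel_measurable (Rn_borel d)"
    by (rule measurable_compose[rotated])
  moreover have "(\<lambda>x. f (restrict x {..<d})) \<in> borel_measurable (Rn_borel d) \<longleftrightarrow> f \<in> borel_measurable (Rn_borel d)"
    by (intro measurable_cong) (auto simp: space_PiM PiE_def extensional_restrict)
  ultimately show "f \<in> borel_measurable (Rn_borel d)" by blast
qed

text \<open>Tychonoff's theorem, with the coordinates from d on pinned to the single value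
  \<open>undefined\<close>.\<close>

lemma compact_box: "compact {x :: nat \<Rightarrow> real. (\<forall>i<d. \<bar>x i\<bar> \<le> K) \<and> (\<forall>i\<ge>d. x i = undefined)}"
proof -
  have "compactin (product_topology (\<lambda>i. euclidean) UNIV) (PiE UNIV (\<lambda>i. if i < d then {- K..K} else {undefined :: real}))"
    by (subst compactin_PiE) auto
  also have "PiE UNIV (\<lambda>i. if i < d then {- K..K} else {undefined :: real}) = {x. (\<forall>i<d. \<bar>x i\<bar> \<le> K) \<and> (\<forall>i\<ge>d. x i = undefined)}"
    (is "?L = ?R")
  proof (intro Set.set_eqI iffI)
    fix x assume "x \<in> ?L"
    then have *: "x i \<in> (if i < d then {- K..K} else {undefined})" for i
      using PiE_mem[of x UNIV _ i] by blast
    show "x \<in> ?R"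
    proof (intro CollectI conjI allI impI)
      show "\<bar>x i\<bar> \<le> K" if "i < d" for i using *[of i] that by (simp add: abs_le_iff)
      show "x i = undefined" if "i \<ge> d" for i using *[of i] that by simp
    qed
  next
    fix x assume "x \<in> ?R"
    then have 1: "\<And>i. i < d \<Longrightarrow> \<bar>x i\<bar> \<le> K" and 2: "\<And>i. \<not> i < d \<Longrightarrow> x i = undefined" by simp_all
    have "x i \<in> (if i < d then {- K..K} else {undefined})" for i
      using 1[of i] 2[of i] by (cases "i < d") (simp_all add: abs_le_iff)
    then show "x \<in> ?L" by (intro PiE_I) auto
  qed
  finally show ?thesis by (simp add: euclidean_product_topology)
qed

text \<open>Stone-Weierstrass on the box controls the approximation only there. Composing it with a
  polynomial close to a clipping function keeps it a trigonometric sum and bounds it everywhere by B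
  + e, which makes the mass outside the box harmless.\<close>

lemma trig_approximation:
  assumes f: "continuous_map (Rn_top d) euclideanreal f" and B: "\<And>x. x \<in> topspace (Rn_top d) \<Longrightarrow> \<bar>f x\<bar> \<le> B"
    and e: "e > 0" and K: "K > 0"
  obtains h :: "(nat \<Rightarrow> real) \<Rightarrow> real" where "(\<lambda>x. of_real (h x)) \<in> expsum d" "\<And>x. \<bar>h x\<bar> \<le> B + e"
    "\<And>x. x \<in> topspace (Rn_top d) \<Longrightarrow> (\<forall>i<d. \<bar>x i\<bar> \<le> K) \<Longrightarrow> \<bar>f x - h x\<bar> \<le> 2 * e"
proof -
  define S where "S = {x :: nat \<Rightarrow> real. (\<forall>i<d. \<bar>x i\<bar> \<le> K) \<and> (\<forall>i\<ge>d. x i = undefined)}"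
  define R where "R = {g :: (nat \<Rightarrow> real) \<Rightarrow> real. (\<lambda>x. complex_of_real (g x)) \<in> expsum d}"
  have R_const: "(\<lambda>_. c) \<in> R" for c by (simp add: R_def expsum_const)
  have R_add: "(\<lambda>x. f x + g x) \<in> R" if "f \<in> R" "g \<in> R" for f g using that by (auto simp: R_def intro: expsum.add)
  have R_mult: "(\<lambda>x. f x * g x) \<in> R" if "f \<in> R" "g \<in> R" for f g using that by (auto simp: R_def intro: expsum_mult)
  have ring: "function_ring_on R S"
  proof
    show "compact S" unfolding S_def by (rule compact_box)
    show "continuous_on S g" if "g \<in> R" for g
    proof -
      have "continuous_on UNIV (\<lambda>x. complex_of_real (g x))"
        using that by (intro expsum_continuous) (simp add: R_def)
      from continuous_on_Re[OF this] show ?thesis by (auto intro: continuous_on_subset)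
    qed
    show "\<exists>g\<in>R. g x \<noteq> g y" if "x \<in> S" "y \<in> S" "x \<noteq> y" for x y
    proof -
      obtain i where i: "x i \<noteq> y i" using \<open>x \<noteq> y\<close> by auto
      have id: "i < d"
      proof (rule ccontr)
        assume "\<not> i < d"
        then have "x i = undefined" "y i = undefined" using that by (simp_all add: S_def)
        then show False using i by simp
      qed
      \<comment> \<open>After division by K the coordinates lie in [-1, 1], where the sine is
        injective.\<close>
      have b: "\<bar>x i / K\<bar> \<le> 1" "\<bar>y i / K\<bar> \<le> 1" using that id K by (auto simp: S_def)
      have "sin (x i / K) \<noteq> sin (y i / K)"
      proof
        assume eq: "sin (x i / K) = sin (y i / K)"
        have "x i / K = y i / K"
          by (rule sin_inj_pi[OF _ _ _ _ eq]) (use b pi_gt3 in linarith)+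
        then show False using i K by simp
      qed
      then show ?thesis using expsum_sin[OF id, of "1 / K"] by (intro bexI[of _ "\<lambda>x. sin (1 / K * x i)"]) (auto simp: R_def)
    qed
  qed (use R_const R_add R_mult in auto)
  have fS: "continuous_on S f"
  proof -
    have "continuous_on S (\<lambda>x. f (restrict x {..<d}))"
      using Rn_continuous_measurable(2)[OF f] by (rule continuous_on_subset) auto
    moreover have "restrict x {..<d} = x" if "x \<in> S" for x
      using that by (auto simp: S_def fun_eq_iff restrict_def not_less)
    ultimately show ?thesis by (auto cong: continuous_on_cong)
  qed
  obtain g where g: "g \<in> R" "\<And>x. x \<in> S \<Longrightarrow> \<bar>f x - g x\<bar> < e"
    using function_ring_on.Stone_Weierstrass_basic[OF ring fS e] by blast
  obtain C where C: "\<And>x. \<bar>g x\<bar> \<le> C" using g(1) expsum_bounded by (fastforce simp: R_def)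
  \<comment> \<open>The global bound C on g confines its values to a compact interval, on which
    clipping at B is a polynomial up to e. Clipping does not move g away from f because |f| \<le>
    B.\<close>
  define clip where "clip y = max (- B) (min B y)" for y
  have "continuous_on {-C..C} clip" unfolding clip_def by (intro continuous_intros)
  then obtain q where q: "real_polynomial_function q" "\<And>y. y \<in> {-C..C} \<Longrightarrow> \<bar>clip y - q y\<bar> < e"
    using Stone_Weierstrass_real_polynomial_function[of "{-C..C}" clip e] e by auto
  have qg: "(\<lambda>x. q (g x)) \<in> R"
    using q(1)
  proof induction
    case (linear l)
    obtain c where "l = (\<lambda>y. y * c)" using linear real_bounded_linear by blast
    then show ?case using R_mult[OF g(1) R_const[of c]] by simp
  qed (use R_const R_add R_mult in auto)
  have Cg: "g x \<in> {-C..C}" for x using C[of x] by (auto simp: abs_le_iff)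
  have topS: "x \<in> topspace (Rn_top d) \<Longrightarrow> (\<forall>i<d. \<bar>x i\<bar> \<le> K) \<Longrightarrow> x \<in> S" for x
    by (auto simp: S_def PiE_def extensional_def)
  have B0: "0 \<le> B"
  proof -
    have "(\<lambda>i\<in>{..<d}. 0) \<in> topspace (Rn_top d)" by auto
    then show ?thesis using B by (meson abs_ge_zero order_trans)
  qed
  show ?thesis
  proof (rule that)
    show "(\<lambda>x. of_real (q (g x))) \<in> expsum d" using qg by (simp add: R_def)
    show "\<bar>q (g x)\<bar> \<le> B + e" for x
      using q(2)[OF Cg[of x]] B0 unfolding clip_def by linarith
    show "\<bar>f x - q (g x)\<bar> \<le> 2 * e" if x: "x \<in> topspace (Rn_top d)" "\<forall>i<d. \<bar>x i\<bar> \<le> K" for x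
      using q(2)[OF Cg[of x]] g(2)[OF topS[OF x]] B[OF x(1)] B0 unfolding clip_def by linarith
  qed
qed

theorem (in char_converges) levy_continuity_Rn: "weak_conv_on (Rn_top d) \<mu>s \<mu>"
  unfolding weak_conv_on_def
proof (intro allI impI, elim conjE)
  fix f assume f: "continuous_map (Rn_top d) euclideanreal f" and "bounded (f ` topspace (Rn_top d))"
  then obtain B where B: "\<And>x. x \<in> topspace (Rn_top d) \<Longrightarrow> \<bar>f x\<bar> \<le> B"
    unfolding bounded_iff by auto
  have top_sp: "topspace (Rn_top d) = space (Rn_borel d)" by (auto simp: space_PiM)
  define B' where "B' = max B 1"
  have B': "\<And>x. x \<in> topspace (Rn_top d) \<Longrightarrow> \<bar>f x\<bar> \<le> B'" "B' \<ge> 1" using B by (force simp: B'_def)+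
  have fM: "f \<in> borel_measurable (Rn_borel d)" by (rule Rn_continuous_measurable(1)[OF f])
  have fi: "integrable (\<mu>s n) f" "integrable \<mu> f" for n
    using integrable_bdd[OF fM, of B'] B'(1)[unfolded top_sp] by simp_all
  \<comment> \<open>A continuous substitute for the indicator of |y| > K: it vanishes up to K and
    equals 1 from K + 1 on. Its integrals converge by \<open>marginal_conv\<close>, and under the
    limit law they vanish as K grows.\<close>
  define u where "u K y = min 1 (max 0 (\<bar>y\<bar> - K))" for K y :: real
  have u: "0 \<le> u K y" "\<bar>u K y\<bar> \<le> 1" "isCont (u K) y" for K y
    unfolding u_def by (auto intro!: continuous_intros)
  have um: "(\<lambda>x. u K (x i)) \<in> borel_measurable (Rn_borel d)" if "i < d" for K i
    unfolding u_def using coordinate_measurable[OF that] by simp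
  have uc: "(\<lambda>m. \<Sum>i<d. \<integral>x. u (real m) (x i) \<partial>\<mu>) \<longlonglongrightarrow> (\<Sum>i<d. \<integral>x. 0 \<partial>\<mu>)"
  proof (intro tendsto_sum integral_dominated_convergence[where w = "\<lambda>_. 1"])
    fix i assume i: "i \<in> {..<d}"
    interpret Q: prob_space \<mu> by (rule prob)
    show "integrable \<mu> (\<lambda>_. 1 :: real)" by simp
    show "AE x in \<mu>. (\<lambda>m. u (real m) (x i)) \<longlonglongrightarrow> 0"
    proof (intro AE_I2 tendsto_eventually)
      fix x :: "nat \<Rightarrow> real"
      have "eventually (\<lambda>m. \<bar>x i\<bar> \<le> real m) sequentially"
        using filterlim_real_sequentially by (simp add: filterlim_at_top)
      then show "eventually (\<lambda>m. u (real m) (x i) = 0) sequentially"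
        by eventually_elim (simp add: u_def)
    qed
    show "(\<lambda>x. u (real m) (x i)) \<in> borel_measurable \<mu>" for m
      using um[of i] i measurable_cong_sets[OF sets_\<mu> refl] by blast
  qed (use u in auto)
  show "(\<lambda>n. \<integral>x. f x \<partial>\<mu>s n) \<longlonglongrightarrow> (\<integral>x. f x \<partial>\<mu>)"
  proof (rule LIMSEQ_I)
    fix r :: real assume r: "r > 0"
    \<comment> \<open>Each of the two comparisons of f with h costs at most 2 e + 3 B' e' \<le> 3 r
      / 16, and the convergence for h costs r / 4; the total stays below r.\<close>
    define e where "e = min 1 (r / 16)"
    have e: "e > 0" "e \<le> 1" "e \<le> r / 16" using r by (auto simp: e_def)
    define e' where "e' = r / (16 * (3 * B'))"
    have e': "e' > 0" using r B' by (simp add: e'_def)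
    have "eventually (\<lambda>m. (\<Sum>i<d. \<integral>x. u (real m) (x i) \<partial>\<mu>) < e') sequentially"
      using uc e' by (intro order_tendstoD(2)) auto
    then obtain K0 where K0: "(\<Sum>i<d. \<integral>x. u (real K0) (x i) \<partial>\<mu>) < e'" by (auto simp: eventually_sequentially)
    define K where "K = real K0"
    have "(\<lambda>n. \<Sum>i<d. \<integral>x. u K (x i) \<partial>\<mu>s n) \<longlonglongrightarrow> (\<Sum>i<d. \<integral>x. u K (x i) \<partial>\<mu>)"
      using u by (intro tendsto_sum marginal_conv[where B = 1]) auto
    then have ev1: "eventually (\<lambda>n. (\<Sum>i<d. \<integral>x. u K (x i) \<partial>\<mu>s n) < e') sequentially"
      using K0 by (intro order_tendstoD(2)) (auto simp: K_def)
    obtain h where h: "(\<lambda>x. complex_of_real (h x)) \<in> expsum d" "\<And>x. \<bar>h x\<bar> \<le> B' + e"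
      "\<And>x. x \<in> topspace (Rn_top d) \<Longrightarrow> (\<forall>i<d. \<bar>x i\<bar> \<le> K + 1) \<Longrightarrow> \<bar>f x - h x\<bar> \<le> 2 * e"
      using trig_approximation[OF f B'(1) e(1), of "K + 1"] by (auto simp: K_def)
    have hM: "h \<in> borel_measurable (Rn_borel d)"
      using expsum_measurable[OF h(1)] by (subst (asm) borel_measurable_complex_iff) auto
    have hi: "integrable (\<mu>s n) h" "integrable \<mu> h" for n
      using integrable_bdd[OF hM, of "B' + e"] h(2) by simp_all
    have "(\<lambda>n. Re (CLINT x|\<mu>s n. of_real (h x))) \<longlonglongrightarrow> Re (CLINT x|\<mu>. of_real (h x))"
      by (intro tendsto_Re expsum_conv h(1))
    then have "(\<lambda>n. \<integral>x. h x \<partial>\<mu>s n) \<longlonglongrightarrow> (\<integral>x. h x \<partial>\<mu>)" by simp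
    then have ev2: "eventually (\<lambda>n. \<bar>(\<integral>x. h x \<partial>\<mu>s n) - (\<integral>x. h x \<partial>\<mu>)\<bar> < r / 4) sequentially"
      using r tendstoD[of _ "\<integral>x. h x \<partial>\<mu>" sequentially "r / 4"] by (auto simp: dist_real_def)
    have pt: "\<bar>f x - h x\<bar> \<le> 2 * e + 3 * B' * (\<Sum>i<d. u K (x i))" if x: "x \<in> space (Rn_borel d)" for x
    proof (cases "\<forall>i<d. \<bar>x i\<bar> \<le> K + 1")
      case True
      have "0 \<le> 3 * B' * (\<Sum>i<d. u K (x i))" using u B' by (intro mult_nonneg_nonneg sum_nonneg) auto
      moreover have "\<bar>f x - h x\<bar> \<le> 2 * e" using h(3)[OF x[folded top_sp] True] .
      ultimately show ?thesis by linarith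
    next
      case False
      then obtain i where i: "i < d" "\<bar>x i\<bar> > K + 1" by (auto simp: not_le)
      have "1 = u K (x i)" using i by (simp add: u_def)
      also have "\<dots> \<le> (\<Sum>i<d. u K (x i))" using i u by (intro member_le_sum) auto
      finally have "3 * B' * 1 \<le> 3 * B' * (\<Sum>i<d. u K (x i))" using B' by (intro mult_left_mono) auto
      \<comment> \<open>Outside the box |f| + |h| \<le> 2 B' + e \<le> 3 B', since e \<le> 1 \<le>
        B'.\<close>
      then show ?thesis using B'(1)[of x] h(2)[of x] x e B'(2) unfolding top_sp by linarith
    qed
    have diff: "\<bar>(\<integral>x. f x \<partial>\<nu>) - (\<integral>x. h x \<partial>\<nu>)\<bar> \<le> 2 * e + 3 * B' * (\<Sum>i<d. \<integral>x. u K (x i) \<partial>\<nu>)"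
      if \<nu>: "prob_space \<nu>" "sets \<nu> = sets (Rn_borel d)" "integrable \<nu> f" "integrable \<nu> h" for \<nu>
    proof -
      interpret P: prob_space \<nu> by (rule \<nu>)
      have ui: "integrable \<nu> (\<lambda>x. u K (x i))" if "i < d" for i
        using um[OF that] measurable_cong_sets[OF \<nu>(2) refl] u(2) by (intro P.integrable_const_bound[where B = 1]) auto
      have "\<bar>(\<integral>x. f x \<partial>\<nu>) - (\<integral>x. h x \<partial>\<nu>)\<bar> = \<bar>\<integral>x. f x - h x \<partial>\<nu>\<bar>" using \<nu> by simp
      also have "\<dots> \<le> (\<integral>x. \<bar>f x - h x\<bar> \<partial>\<nu>)" by (rule integral_abs_bound)
      also have "\<dots> \<le> (\<integral>x. 2 * e + 3 * B' * (\<Sum>i<d. u K (x i)) \<partial>\<nu>)"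
      proof (rule integral_mono)
        show "integrable \<nu> (\<lambda>x. \<bar>f x - h x\<bar>)" using \<nu>(3,4) by simp
        show "integrable \<nu> (\<lambda>x. 2 * e + 3 * B' * (\<Sum>i<d. u K (x i)))"
          by (intro Bochner_Integration.integrable_add integrable_mult_right Bochner_Integration.integrable_sum P.integrable_const ui) simp
        show "\<bar>f x - h x\<bar> \<le> 2 * e + 3 * B' * (\<Sum>i<d. u K (x i))" if "x \<in> space \<nu>" for x
          using pt that sets_eq_imp_space_eq[OF \<nu>(2)] by simp
      qed
      also have "\<dots> = 2 * e + 3 * B' * (\<Sum>i<d. \<integral>x. u K (x i) \<partial>\<nu>)"
      proof -
        define W where "W x = (\<Sum>i<d. u K (x i))" for x
        have "integrable \<nu> W" unfolding W_def by (intro Bochner_Integration.integrable_sum ui) simp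
        moreover have "(\<integral>x. W x \<partial>\<nu>) = (\<Sum>i<d. \<integral>x. u K (x i) \<partial>\<nu>)"
          unfolding W_def by (intro Bochner_Integration.integral_sum ui) simp
        ultimately show ?thesis unfolding W_def[symmetric] by (simp add: P.prob_space)
      qed
      finally show ?thesis .
    qed
    have e3: "3 * B' * e' = r / 16" using B' by (simp add: e'_def)
    have diff': "\<bar>(\<integral>x. f x \<partial>\<nu>) - (\<integral>x. h x \<partial>\<nu>)\<bar> \<le> r / 8 + r / 16"
      if "prob_space \<nu>" "sets \<nu> = sets (Rn_borel d)" "integrable \<nu> f" "integrable \<nu> h" "(\<Sum>i<d. \<integral>x. u K (x i) \<partial>\<nu>) < e'" for \<nu>
    proof -
      have "3 * B' * (\<Sum>i<d. \<integral>x. u K (x i) \<partial>\<nu>) \<le> 3 * B' * e'"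
        by (rule mult_left_mono) (use that(5) B'(2) in linarith)+
      then show ?thesis using diff[OF that(1-4)] e e3 by linarith
    qed
    have d2: "\<bar>(\<integral>x. f x \<partial>\<mu>) - (\<integral>x. h x \<partial>\<mu>)\<bar> \<le> r / 8 + r / 16"
      by (rule diff'[OF prob sets_\<mu> fi(2) hi(2) K0[folded K_def]])
    show "\<exists>no. \<forall>n\<ge>no. norm ((\<integral>x. f x \<partial>\<mu>s n) - (\<integral>x. f x \<partial>\<mu>)) < r"
      using ev1 ev2 unfolding eventually_sequentially[symmetric]
    proof eventually_elim
      case (elim n)
      have "\<bar>(\<integral>x. f x \<partial>\<mu>s n) - (\<integral>x. h x \<partial>\<mu>s n)\<bar> \<le> r / 8 + r / 16"
        by (rule diff'[OF prob_n sets_n fi(1) hi(1) elim(1)])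
      then show ?case using d2 elim(2) unfolding real_norm_def by linarith
    qed
  qed
qed

text \<open>The image of m independent standard normals under the linear map A; its covariance A A^t
  may be singular.\<close>

lemma gaussian_exists:
  fixes A :: "nat \<Rightarrow> nat \<Rightarrow> real" and d m :: nat
  obtains \<mu> where "prob_space \<mu>" "sets \<mu> = sets (Rn_borel d)"
    "\<And>t. (CLINT x|\<mu>. iexp (\<Sum>i<d. t i * x i)) = complex_of_real (exp (- (\<Sum>k<m. (\<Sum>i<d. t i * A i k)\<^sup>2) / 2))"
proof -
  let ?N = "\<lambda>_::nat. std_normal_distribution"
  interpret N: prob_space std_normal_distribution by (rule real_distribution.axioms(1)[OF real_dist_normal_dist])
  interpret P: product_prob_space ?N "{..<m}" by unfold_locales
  define G where "G z = (\<lambda>i\<in>{..<d}. \<Sum>k<m. A i k * z k)" for z :: "nat \<Rightarrow> real"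
  have setsP: "sets (PiM {..<m} ?N) = sets (Rn_borel m)" by (intro sets_PiM_cong) auto
  have G [measurable]: "G \<in> measurable (PiM {..<m} ?N) (Rn_borel d)"
    unfolding G_def by (subst measurable_cong_sets[OF setsP refl]) measurable
  show ?thesis
  proof
    show "prob_space (distr (PiM {..<m} ?N) (Rn_borel d) G)" by (rule P.prob_space_distr) measurable
    show "sets (distr (PiM {..<m} ?N) (Rn_borel d) G) = sets (Rn_borel d)" by simp
    fix t :: "nat \<Rightarrow> real"
    define s where "s k = (\<Sum>i<d. t i * A i k)" for k
    have "(CLINT x|distr (PiM {..<m} ?N) (Rn_borel d) G. iexp (\<Sum>i<d. t i * x i)) = (CLINT z|PiM {..<m} ?N. iexp (\<Sum>i<d. t i * G z i))"
      by (subst integral_distr) auto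
    also have "\<dots> = (CLINT z|PiM {..<m} ?N. (\<Prod>k<m. iexp (s k * z k)))"
    proof (intro Bochner_Integration.integral_cong refl)
      fix z :: "nat \<Rightarrow> real"
      have "(\<Sum>i<d. t i * G z i) = (\<Sum>i<d. \<Sum>k<m. t i * A i k * z k)"
        by (intro sum.cong) (auto simp: G_def sum_distrib_left mult_ac)
      also have "\<dots> = (\<Sum>k<m. s k * z k)" by (subst sum.swap) (simp add: s_def sum_distrib_right)
      finally show "iexp (\<Sum>i<d. t i * G z i) = (\<Prod>k<m. iexp (s k * z k))"
        by (simp add: sum_distrib_left exp_sum)
    qed
    also have "\<dots> = (\<Prod>k<m. CLINT y|std_normal_distribution. iexp (s k * y))"
      by (intro P.product_integral_prod N.integrable_const_bound[where B = 1]) auto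
    also have "\<dots> = (\<Prod>k<m. complex_of_real (exp (- (s k)\<^sup>2 / 2)))"
      using char_std_normal_distribution by (simp add: char_def fun_eq_iff)
    also have "\<dots> = complex_of_real (exp (- (\<Sum>k<m. (s k)\<^sup>2) / 2))"
      by (simp add: sum_negf sum_divide_distrib flip: of_real_prod exp_sum)
    finally show "(CLINT x|distr (PiM {..<m} ?N) (Rn_borel d) G. iexp (\<Sum>i<d. t i * x i)) = complex_of_real (exp (- (\<Sum>k<m. (\<Sum>i<d. t i * A i k)\<^sup>2) / 2))"
      by (simp add: s_def)
  qed
qed

subsection \<open>Negligible and tight sequences\<close>

lemma det_measurable:
  fixes A :: "'a \<Rightarrow> real mat"
  assumes A: "\<And>\<omega>. \<omega> \<in> space N \<Longrightarrow> A \<omega> \<in> carrier_mat n n"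
    and m: "\<And>i j. i < n \<Longrightarrow> j < n \<Longrightarrow> (\<lambda>\<omega>. A \<omega> $$ (i, j)) \<in> borel_measurable N"
  shows "(\<lambda>\<omega>. Determinant.det (A \<omega>)) \<in> borel_measurable N"
proof -
  have "(\<lambda>\<omega>. \<Sum>p | p permutes {0..<n}. of_int (sign p) * (\<Prod>i = 0..<n. A \<omega> $$ (i, p i))) \<in> borel_measurable N"
    using m by (intro borel_measurable_sum borel_measurable_times borel_measurable_prod borel_measurable_const) (auto simp: permutes_in_image)
  then show ?thesis using A by (subst measurable_cong[OF det_def']) auto
qed

lemma det_tendsto:
  fixes A :: "nat \<Rightarrow> real mat"
  assumes A: "\<And>k. A k \<in> carrier_mat n n" and B: "B \<in> carrier_mat n n"
    and m: "\<And>i j. i < n \<Longrightarrow> j < n \<Longrightarrow> (\<lambda>k. A k $$ (i, j)) \<longlonglongrightarrow> B $$ (i, j)"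
  shows "(\<lambda>k. Determinant.det (A k)) \<longlonglongrightarrow> Determinant.det B"
  unfolding det_def'[OF A] det_def'[OF B]
  using m by (intro tendsto_sum tendsto_mult tendsto_prod tendsto_const) (auto simp: permutes_in_image)

lemma inv_mat_index:
  fixes A :: "real mat"
  assumes A: "A \<in> carrier_mat n n" and det: "Determinant.det A \<noteq> 0" and ij: "i < n" "j < n"
  shows "inv_mat A $$ (i, j) = 1 / Determinant.det A * ((- 1) ^ (j + i) * Determinant.det (mat_delete A j i))"
  using adj_mat(1)[OF A] A ij unfolding inv_mat_eq_adj[OF A det] by (simp add: adj_mat_def cofactor_def)

lemma mat_delete_entry:
  assumes "A \<in> carrier_mat n n" "i' < n - 1" "j' < n - 1"
  shows "mat_delete A i j $$ (i', j') = A $$ (if i' < i then i' else Suc i', if j' < j then j' else Suc j')"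
  using assms by (simp add: mat_delete_def)

lemma inv_mat_measurable:
  fixes A :: "'a \<Rightarrow> real mat"
  assumes A: "\<And>\<omega>. \<omega> \<in> space N \<Longrightarrow> A \<omega> \<in> carrier_mat n n" "\<And>\<omega>. \<omega> \<in> space N \<Longrightarrow> Determinant.det (A \<omega>) \<noteq> 0"
    and m: "\<And>i j. i < n \<Longrightarrow> j < n \<Longrightarrow> (\<lambda>\<omega>. A \<omega> $$ (i, j)) \<in> borel_measurable N"
    and ij: "i < n" "j < n"
  shows "(\<lambda>\<omega>. inv_mat (A \<omega>) $$ (i, j)) \<in> borel_measurable N"
proof -
  have md: "(\<lambda>\<omega>. mat_delete (A \<omega>) j i $$ (i', j')) \<in> borel_measurable N" if "i' < n - 1" "j' < n - 1" for i' j'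
    using that A by (subst measurable_cong[OF mat_delete_entry]) (auto intro!: m)
  have "(\<lambda>\<omega>. Determinant.det (mat_delete (A \<omega>) j i)) \<in> borel_measurable N"
    by (rule det_measurable[OF mat_delete_carrier[OF A(1)] md])
  moreover have "(\<lambda>\<omega>. Determinant.det (A \<omega>)) \<in> borel_measurable N" using A m by (intro det_measurable) auto
  ultimately have "(\<lambda>\<omega>. 1 / Determinant.det (A \<omega>) * ((- 1) ^ (j + i) * Determinant.det (mat_delete (A \<omega>) j i))) \<in> borel_measurable N"
    by measurable
  then show ?thesis using A ij by (subst measurable_cong[OF inv_mat_index]) auto
qed

lemma inv_mat_tendsto:
  fixes A :: "nat \<Rightarrow> real mat"
  assumes A: "\<And>k. A k \<in> carrier_mat n n" "\<And>k. Determinant.det (A k) \<noteq> 0"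
    and B: "B \<in> carrier_mat n n" "Determinant.det B \<noteq> 0"
    and m: "\<And>i j. i < n \<Longrightarrow> j < n \<Longrightarrow> (\<lambda>k. A k $$ (i, j)) \<longlonglongrightarrow> B $$ (i, j)"
    and ij: "i < n" "j < n"
  shows "(\<lambda>k. inv_mat (A k) $$ (i, j)) \<longlonglongrightarrow> inv_mat B $$ (i, j)"
proof -
  have "(\<lambda>k. Determinant.det (mat_delete (A k) j i)) \<longlonglongrightarrow> Determinant.det (mat_delete B j i)"
  proof (rule det_tendsto)
    show "mat_delete (A k) j i \<in> carrier_mat (n - 1) (n - 1)" for k by (rule mat_delete_carrier[OF A(1)])
    show "mat_delete B j i \<in> carrier_mat (n - 1) (n - 1)" by (rule mat_delete_carrier[OF B(1)])
    show "(\<lambda>k. mat_delete (A k) j i $$ (i', j')) \<longlonglongrightarrow> mat_delete B j i $$ (i', j')" if "i' < n - 1" "j' < n - 1" for i' j'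
      unfolding mat_delete_entry[OF A(1) that] mat_delete_entry[OF B(1) that] using that by (intro m) auto
  qed
  then show ?thesis
    unfolding inv_mat_index[OF A ij] inv_mat_index[OF B ij]
    using B(2) det_tendsto[OF A(1) B(1) m] by (intro tendsto_intros) auto
qed

text \<open>Integral comparison for x^(-1-\<eta>), reduced by scaling to t = a / b and the
  inequality 1 + \<eta> (1 - t) \<le> t^(-\<eta>). It will sum the compensator of the Lyapunov
  function.\<close>

lemma power_telescope:
  fixes a b \<eta> :: real
  assumes a: "0 < a" "a \<le> b" and \<eta>: "0 < \<eta>"
  shows "(b - a) / b powr (1 + \<eta>) \<le> (a powr (- \<eta>) - b powr (- \<eta>)) / \<eta>"
proof -
  define t where "t = a / b"
  have t: "0 < t" "t \<le> 1" and b: "0 < b" using a by (auto simp: t_def)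
  have "1 + (- \<eta> * ln t) \<le> exp (- \<eta> * ln t)" by (rule exp_ge_add_one_self)
  moreover have "ln t \<le> t - 1" using t by (intro ln_le_minus_one) auto
  then have "\<eta> * ln t \<le> \<eta> * (t - 1)" using \<eta> by (intro mult_left_mono) auto
  ultimately have "1 + \<eta> * (1 - t) \<le> t powr (- \<eta>)" using t by (simp add: powr_def algebra_simps)
  then have "\<eta> * (1 - t) * b powr (- \<eta>) \<le> (t powr (- \<eta>) - 1) * b powr (- \<eta>)" by (intro mult_right_mono) auto
  also have "\<dots> = a powr (- \<eta>) - b powr (- \<eta>)"
    using a b by (simp add: t_def powr_divide left_diff_distrib)
  finally have "\<eta> * ((1 - t) * b powr (- \<eta>)) \<le> a powr (- \<eta>) - b powr (- \<eta>)" by (simp add: mult.assoc)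
  moreover have "(1 - t) * b powr (- \<eta>) = (b - a) / b powr (1 + \<eta>)"
    using b by (simp add: t_def powr_add powr_minus field_simps)
  ultimately show ?thesis using \<eta> by (simp add: pos_le_divide_eq mult.commute)
qed

lemma char_normal:
  fixes s :: real
  assumes s: "0 < s"
  shows "real_distribution (density lborel (normal_density 0 s))"
    and "char (density lborel (normal_density 0 s)) t = complex_of_real (exp (- (t\<^sup>2 * s\<^sup>2) / 2))"
proof -
  interpret N: prob_space std_normal_distribution by (rule real_distribution.axioms(1)[OF real_dist_normal_dist])
  have "distributed std_normal_distribution lborel (\<lambda>x. x) (normal_density 0 1)"
    unfolding distributed_def by (auto simp: distr_id2)
  then have "distributed std_normal_distribution lborel (\<lambda>x. 0 + s * x) (normal_density (0 + s * 0) (\<bar>s\<bar> * 1))"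
    using s by (intro N.normal_density_affine) auto
  then have d: "distr std_normal_distribution borel (\<lambda>x. s * x) = density lborel (normal_density 0 s)"
    using s distr_cong[of std_normal_distribution std_normal_distribution borel lborel "\<lambda>x. s * x" "\<lambda>x. s * x"]
    unfolding distributed_def by simp
  show "real_distribution (density lborel (normal_density 0 s))"
    unfolding d[symmetric] using N.prob_space_distr[of "\<lambda>x. s * x" borel]
    by (auto simp: real_distribution_def real_distribution_axioms_def)
  have "char (density lborel (normal_density 0 s)) t = char std_normal_distribution (t * s)"
    unfolding d[symmetric] char_def by (subst integral_distr) (auto simp: mult.assoc)
  then show "char (density lborel (normal_density 0 s)) t = complex_of_real (exp (- (t\<^sup>2 * s\<^sup>2) / 2))"
    by (simp add: char_std_normal_distribution power_mult_distrib)
qed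

section \<open>Convergence in probability and tightness\<close>

context prob_space begin

text \<open>Convergence in probability to 0, metrised by the expectation of min(1, |B|); in this
  form it is subadditive and bounds differences of characteristic functions directly.\<close>

definition conv0 :: "(nat \<Rightarrow> 'a \<Rightarrow> real) \<Rightarrow> bool" where
  "conv0 B \<longleftrightarrow> (\<forall>n. B n \<in> borel_measurable M) \<and> (\<lambda>n. \<integral>\<omega>. min 1 \<bar>B n \<omega>\<bar> \<partial>M) \<longlonglongrightarrow> 0"

text \<open>Only large n count, so that a limit in law implies tightness without a look at single
  laws.\<close>

definition tight_rv :: "(nat \<Rightarrow> 'a \<Rightarrow> real) \<Rightarrow> bool" where
  "tight_rv Z \<longleftrightarrow> (\<forall>n. Z n \<in> borel_measurable M) \<and>
     (\<forall>e>0. \<exists>K. eventually (\<lambda>n. prob {\<omega> \<in> space M. K < \<bar>Z n \<omega>\<bar>} < e) sequentially)"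

lemma min_integrable:
  assumes "B \<in> borel_measurable M"
  shows "integrable M (\<lambda>\<omega>. min 1 \<bar>B \<omega> :: real\<bar>)"
  using assms by (intro integrable_const_bound[where B = 1]) auto

lemma conv0_squeeze:
  assumes "\<And>n. B n \<in> borel_measurable M" "\<And>n. (\<integral>\<omega>. min 1 \<bar>B n \<omega>\<bar> \<partial>M) \<le> c n" "c \<longlonglongrightarrow> 0"
  shows "conv0 B"
  unfolding conv0_def
  using assms by (auto intro!: tendsto_sandwich[OF _ _ tendsto_const assms(3)] always_eventually integral_nonneg_AE)

lemma conv0_add: "conv0 A \<Longrightarrow> conv0 B \<Longrightarrow> conv0 (\<lambda>n \<omega>. A n \<omega> + B n \<omega>)"
proof -
  assume A: "conv0 A" and B: "conv0 B"
  note m = A[unfolded conv0_def, THEN conjunct1, rule_format] B[unfolded conv0_def, THEN conjunct1, rule_format]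
  show ?thesis
  proof (rule conv0_squeeze)
    show "(\<lambda>\<omega>. A n \<omega> + B n \<omega>) \<in> borel_measurable M" for n using m by measurable
    show "(\<integral>\<omega>. min 1 \<bar>A n \<omega> + B n \<omega>\<bar> \<partial>M) \<le> (\<integral>\<omega>. min 1 \<bar>A n \<omega>\<bar> \<partial>M) + (\<integral>\<omega>. min 1 \<bar>B n \<omega>\<bar> \<partial>M)" for n
    proof -
      have "(\<integral>\<omega>. min 1 \<bar>A n \<omega> + B n \<omega>\<bar> \<partial>M) \<le> (\<integral>\<omega>. min 1 \<bar>A n \<omega>\<bar> + min 1 \<bar>B n \<omega>\<bar> \<partial>M)"
      proof (intro integral_mono)
        show "min 1 \<bar>A n \<omega> + B n \<omega>\<bar> \<le> min 1 \<bar>A n \<omega>\<bar> + min 1 \<bar>B n \<omega>\<bar>" for \<omega> by linarith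
      qed (use m in \<open>auto intro!: min_integrable\<close>)
      then show ?thesis using m by (simp add: min_integrable)
    qed
    show "(\<lambda>n. (\<integral>\<omega>. min 1 \<bar>A n \<omega>\<bar> \<partial>M) + (\<integral>\<omega>. min 1 \<bar>B n \<omega>\<bar> \<partial>M)) \<longlonglongrightarrow> 0"
      using tendsto_add[of "\<lambda>n. \<integral>\<omega>. min 1 \<bar>A n \<omega>\<bar> \<partial>M" 0 sequentially "\<lambda>n. \<integral>\<omega>. min 1 \<bar>B n \<omega>\<bar> \<partial>M" 0] A B by (simp add: conv0_def)
  qed
qed

lemma conv0_zero: "conv0 (\<lambda>_ _. 0)" by (simp add: conv0_def)

lemma conv0_sum: "(\<And>i. i \<in> I \<Longrightarrow> conv0 (B i)) \<Longrightarrow> conv0 (\<lambda>n \<omega>. \<Sum>i\<in>I. B i n \<omega>)"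
  by (induction I rule: infinite_finite_induct) (auto simp: conv0_zero intro: conv0_add)

lemma conv0_AE:
  assumes m: "\<And>n. B n \<in> borel_measurable M" and ae: "AE \<omega> in M. (\<lambda>n. B n \<omega>) \<longlonglongrightarrow> 0"
  shows "conv0 B"
proof -
  have "(\<lambda>n. \<integral>\<omega>. min 1 \<bar>B n \<omega>\<bar> \<partial>M) \<longlonglongrightarrow> (\<integral>\<omega>. 0 \<partial>M)"
  proof (rule integral_dominated_convergence[where w = "\<lambda>_. 1"])
    show "AE \<omega> in M. (\<lambda>n. min 1 \<bar>B n \<omega>\<bar>) \<longlonglongrightarrow> 0"
      using ae
    proof eventually_elim
      case (elim \<omega>)
      then have "(\<lambda>n. min 1 \<bar>B n \<omega>\<bar>) \<longlonglongrightarrow> min 1 \<bar>0\<bar>" by (intro tendsto_min tendsto_rabs tendsto_const)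
      then show ?case by simp
    qed
  qed (use m in auto)
  then show ?thesis using m by (simp add: conv0_def)
qed

lemma conv0_cong:
  assumes B: "conv0 B" and A: "\<And>n. A n \<in> borel_measurable M"
    and eq: "\<And>n \<omega>. 1 \<le> n \<Longrightarrow> \<omega> \<in> space M \<Longrightarrow> A n \<omega> = B n \<omega>"
  shows "conv0 A"
proof -
  have "(\<integral>\<omega>. min 1 \<bar>A n \<omega>\<bar> \<partial>M) = (\<integral>\<omega>. min 1 \<bar>B n \<omega>\<bar> \<partial>M)" if "1 \<le> n" for n
    by (intro Bochner_Integration.integral_cong) (auto simp: eq[OF that])
  then have "eventually (\<lambda>n. (\<integral>\<omega>. min 1 \<bar>B n \<omega>\<bar> \<partial>M) = (\<integral>\<omega>. min 1 \<bar>A n \<omega>\<bar> \<partial>M)) sequentially"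
    by (intro eventually_sequentiallyI[of 1]) simp
  then show ?thesis
    using B A Lim_transform_eventually[of "\<lambda>n. \<integral>\<omega>. min 1 \<bar>B n \<omega>\<bar> \<partial>M" 0 sequentially "\<lambda>n. \<integral>\<omega>. min 1 \<bar>A n \<omega>\<bar> \<partial>M"]
    by (simp add: conv0_def)
qed

text \<open>Outside an event of small probability |Z| \<le> K, and min(1, |B Z|) \<le> K min(1, |B|)
  there once K \<ge> 1.\<close>

lemma conv0_mult_tight:
  assumes B: "conv0 B" and Z: "tight_rv Z"
  shows "conv0 (\<lambda>n \<omega>. B n \<omega> * Z n \<omega>)"
proof -
  have Bm [measurable]: "B n \<in> borel_measurable M" and Zm [measurable]: "Z n \<in> borel_measurable M" for n
    using B Z by (auto simp: conv0_def tight_rv_def)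
  have "(\<lambda>n. \<integral>\<omega>. min 1 \<bar>B n \<omega> * Z n \<omega>\<bar> \<partial>M) \<longlonglongrightarrow> 0"
  proof (rule LIMSEQ_I)
    fix e :: real assume e: "e > 0"
    obtain K0 where K0: "eventually (\<lambda>n. prob {\<omega> \<in> space M. K0 < \<bar>Z n \<omega>\<bar>} < e / 2) sequentially"
      using Z e unfolding tight_rv_def by (meson half_gt_zero)
    define K where "K = max 1 K0"
    have "(\<lambda>n. K * (\<integral>\<omega>. min 1 \<bar>B n \<omega>\<bar> \<partial>M)) \<longlonglongrightarrow> K * 0" using B by (intro tendsto_intros) (simp add: conv0_def)
    then have "eventually (\<lambda>n. K * (\<integral>\<omega>. min 1 \<bar>B n \<omega>\<bar> \<partial>M) < e / 2) sequentially" using e by (intro order_tendstoD(2)) auto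
    with K0 have "eventually (\<lambda>n. norm ((\<integral>\<omega>. min 1 \<bar>B n \<omega> * Z n \<omega>\<bar> \<partial>M) - 0) < e) sequentially"
    proof eventually_elim
      case (elim n)
      define S where "S = {\<omega> \<in> space M. K0 < \<bar>Z n \<omega>\<bar>}"
      have S [measurable]: "S \<in> sets M" unfolding S_def by measurable
      have Si: "integrable M (indicat_real S)" by (rule integrable_const_bound[where B = 1]) (auto simp: indicator_def)
      have "(\<integral>\<omega>. min 1 \<bar>B n \<omega> * Z n \<omega>\<bar> \<partial>M) \<le> (\<integral>\<omega>. indicator S \<omega> + K * min 1 \<bar>B n \<omega>\<bar> \<partial>M)"
      proof (intro integral_mono)
        fix \<omega> assume s: "\<omega> \<in> space M"
        show "min 1 \<bar>B n \<omega> * Z n \<omega>\<bar> \<le> indicator S \<omega> + K * min 1 \<bar>B n \<omega>\<bar>"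
        proof (cases "\<omega> \<in> S")
          case True then show ?thesis by (simp add: K_def min.coboundedI1)
        next
          case False
          then have "\<bar>Z n \<omega>\<bar> \<le> K" using s by (auto simp: S_def K_def)
          then have "\<bar>B n \<omega> * Z n \<omega>\<bar> \<le> \<bar>B n \<omega>\<bar> * K" unfolding abs_mult by (intro mult_left_mono) auto
          moreover have "1 \<le> K" by (simp add: K_def)
          ultimately have "min 1 \<bar>B n \<omega> * Z n \<omega>\<bar> \<le> K * min 1 \<bar>B n \<omega>\<bar>"
            by (cases "\<bar>B n \<omega>\<bar> \<le> 1") (auto simp: min_def mult.commute)
          then show ?thesis using False by simp
        qed
      qed (auto intro!: min_integrable Bochner_Integration.integrable_add Si integrable_mult_right simp del: integrable_indicator_iff)
      also have "\<dots> = prob S + K * (\<integral>\<omega>. min 1 \<bar>B n \<omega>\<bar> \<partial>M)" using Si by (simp add: min_integrable)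
      finally have "(\<integral>\<omega>. min 1 \<bar>B n \<omega> * Z n \<omega>\<bar> \<partial>M) < e" using elim by (simp add: S_def)
      moreover have "0 \<le> (\<integral>\<omega>. min 1 \<bar>B n \<omega> * Z n \<omega>\<bar> \<partial>M)" by (intro integral_nonneg_AE) auto
      ultimately show ?case by simp
    qed
    then show "\<exists>no. \<forall>n\<ge>no. norm ((\<integral>\<omega>. min 1 \<bar>B n \<omega> * Z n \<omega>\<bar> \<partial>M) - 0) < e" by (simp add: eventually_sequentially)
  qed
  then show ?thesis by (simp add: conv0_def)
qed

lemma tight_const: "tight_rv (\<lambda>_ _. c)"
  unfolding tight_rv_def
proof (intro conjI allI impI)
  fix e :: real assume e: "e > 0"
  have "{\<omega> \<in> space M. \<bar>c\<bar> < \<bar>c\<bar>} = {}" by simp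
  then show "\<exists>K. eventually (\<lambda>n. prob {\<omega> \<in> space M. K < \<bar>c\<bar>} < e) sequentially"
    using e by (intro exI[of _ "\<bar>c\<bar>"]) simp
qed auto

lemma conv0_cmult: "conv0 B \<Longrightarrow> conv0 (\<lambda>n \<omega>. c * B n \<omega>)"
  using conv0_mult_tight[OF _ tight_const[of c]] by (simp add: mult.commute)

lemma tight_add: "tight_rv A \<Longrightarrow> tight_rv B \<Longrightarrow> tight_rv (\<lambda>n \<omega>. A n \<omega> + B n \<omega>)"
proof -
  assume A: "tight_rv A" and B: "tight_rv B"
  have [measurable]: "A n \<in> borel_measurable M" "B n \<in> borel_measurable M" for n using A B by (auto simp: tight_rv_def)
  show ?thesis
    unfolding tight_rv_def
  proof (intro conjI allI impI)
    fix e :: real assume e: "e > 0"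
    obtain K where K: "eventually (\<lambda>n. prob {\<omega> \<in> space M. K < \<bar>A n \<omega>\<bar>} < e / 2) sequentially"
      using A e unfolding tight_rv_def by (meson half_gt_zero)
    obtain L where L: "eventually (\<lambda>n. prob {\<omega> \<in> space M. L < \<bar>B n \<omega>\<bar>} < e / 2) sequentially"
      using B e unfolding tight_rv_def by (meson half_gt_zero)
    from K L have "eventually (\<lambda>n. prob {\<omega> \<in> space M. K + L < \<bar>A n \<omega> + B n \<omega>\<bar>} < e) sequentially"
    proof eventually_elim
      case (elim n)
      have "prob {\<omega> \<in> space M. K + L < \<bar>A n \<omega> + B n \<omega>\<bar>} \<le> prob ({\<omega> \<in> space M. K < \<bar>A n \<omega>\<bar>} \<union> {\<omega> \<in> space M. L < \<bar>B n \<omega>\<bar>})"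
        by (intro finite_measure_mono) auto
      also have "\<dots> \<le> prob {\<omega> \<in> space M. K < \<bar>A n \<omega>\<bar>} + prob {\<omega> \<in> space M. L < \<bar>B n \<omega>\<bar>}"
        by (intro measure_Un_le) auto
      finally show ?case using elim by linarith
    qed
    then show "\<exists>K. eventually (\<lambda>n. prob {\<omega> \<in> space M. K < \<bar>A n \<omega> + B n \<omega>\<bar>} < e) sequentially" by blast
  qed measurable
qed

lemma tight_cmult: "tight_rv Z \<Longrightarrow> tight_rv (\<lambda>n \<omega>. c * Z n \<omega>)"
proof -
  assume Z: "tight_rv Z"
  have [measurable]: "Z n \<in> borel_measurable M" for n using Z by (auto simp: tight_rv_def)
  show ?thesis
    unfolding tight_rv_def
  proof (intro conjI allI impI)
    fix e :: real assume e: "e > 0"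
    then obtain K where K: "eventually (\<lambda>n. prob {\<omega> \<in> space M. K < \<bar>Z n \<omega>\<bar>} < e) sequentially"
      using Z unfolding tight_rv_def by meson
    then have "eventually (\<lambda>n. prob {\<omega> \<in> space M. \<bar>c\<bar> * K < \<bar>c * Z n \<omega>\<bar>} < e) sequentially"
    proof eventually_elim
      case (elim n)
      have "{\<omega> \<in> space M. \<bar>c\<bar> * K < \<bar>c * Z n \<omega>\<bar>} \<subseteq> {\<omega> \<in> space M. K < \<bar>Z n \<omega>\<bar>}"
        by (auto simp: abs_mult intro: mult_left_less_imp_less)
      then have "prob {\<omega> \<in> space M. \<bar>c\<bar> * K < \<bar>c * Z n \<omega>\<bar>} \<le> prob {\<omega> \<in> space M. K < \<bar>Z n \<omega>\<bar>}"
        by (intro finite_measure_mono) auto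
      then show ?case using elim by linarith
    qed
    then show "\<exists>K. eventually (\<lambda>n. prob {\<omega> \<in> space M. K < \<bar>c * Z n \<omega>\<bar>} < e) sequentially" by blast
  qed measurable
qed

lemma tight_sum: "(\<And>i. i \<in> I \<Longrightarrow> tight_rv (Z i)) \<Longrightarrow> tight_rv (\<lambda>n \<omega>. \<Sum>i\<in>I. Z i n \<omega>)"
  by (induction I rule: infinite_finite_induct) (auto simp: tight_const intro: tight_add)

lemma conv0_tight: "conv0 B \<Longrightarrow> tight_rv B"
proof -
  assume B: "conv0 B"
  have [measurable]: "B n \<in> borel_measurable M" for n using B by (auto simp: conv0_def)
  show ?thesis
    unfolding tight_rv_def
  proof (intro conjI allI impI)
    fix e :: real assume e: "e > 0"
    have "eventually (\<lambda>n. (\<integral>\<omega>. min 1 \<bar>B n \<omega>\<bar> \<partial>M) < e) sequentially"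
      using B e by (intro order_tendstoD(2)) (auto simp: conv0_def)
    then have "eventually (\<lambda>n. prob {\<omega> \<in> space M. 1 < \<bar>B n \<omega>\<bar>} < e) sequentially"
    proof eventually_elim
      case (elim n)
      define S where "S = {\<omega> \<in> space M. 1 < \<bar>B n \<omega>\<bar>}"
      have S [measurable]: "S \<in> sets M" unfolding S_def by measurable
      have Si: "integrable M (indicat_real S)" by (rule integrable_const_bound[where B = 1]) (auto simp: indicator_def)
      have "prob S = (\<integral>\<omega>. indicator S \<omega> \<partial>M)" using S by simp
      also have "\<dots> \<le> (\<integral>\<omega>. min 1 \<bar>B n \<omega>\<bar> \<partial>M)"
        by (rule integral_mono[OF Si min_integrable]) (auto simp: S_def indicator_def)
      finally show ?case using elim by (simp add: S_def)
    qed
    then show "\<exists>K. eventually (\<lambda>n. prob {\<omega> \<in> space M. K < \<bar>B n \<omega>\<bar>} < e) sequentially" by blast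
  qed measurable
qed

lemma tight_diff_conv0: "conv0 (\<lambda>n \<omega>. A n \<omega> - B n \<omega>) \<Longrightarrow> tight_rv B \<Longrightarrow> tight_rv A"
  using tight_add[OF conv0_tight, of "\<lambda>n \<omega>. A n \<omega> - B n \<omega>" B] by simp

text \<open>Viewed as laws on R^1, the sequence converges to a Gaussian law in the sense of
  \<open>marginal_conv\<close>; the continuous cutoff u compares the probability of |Z_n| > K + 1
  with the tail of the limit.\<close>

lemma tight_cong_char:
  assumes Z: "\<And>n. Z n \<in> borel_measurable M" and v: "0 \<le> v"
    and ch: "\<And>s. (\<lambda>n. CLINT \<omega>|M. iexp (s * Z n \<omega>)) \<longlonglongrightarrow> complex_of_real (exp (- (s\<^sup>2 * v) / 2))"
  shows "tight_rv Z"
proof -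
  obtain \<mu> where \<mu>: "prob_space \<mu>" "sets \<mu> = sets (Rn_borel 1)"
    "\<And>t. (CLINT x|\<mu>. iexp (\<Sum>i<1. t i * x i)) = complex_of_real (exp (- (\<Sum>k<(1::nat). (\<Sum>i<1. t i * sqrt v)\<^sup>2) / 2))"
    by (rule gaussian_exists[where d = 1 and m = 1 and A = "\<lambda>_ _. sqrt v"], rule that)
  define G where "G n \<omega> = (\<lambda>i\<in>{..<1::nat}. Z n \<omega>)" for n \<omega>
  have G [measurable]: "G n \<in> measurable M (Rn_borel 1)" for n unfolding G_def using Z by measurable
  interpret C: char_converges 1 "\<lambda>n. distr M (Rn_borel 1) (G n)" \<mu>
  proof (rule char_converges.intro)
    show "prob_space (distr M (Rn_borel 1) (G n))" for n by (rule prob_space_distr[OF G])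
    fix t :: "nat \<Rightarrow> real"
    have "(CLINT x|distr M (Rn_borel 1) (G n). iexp (\<Sum>i<1. t i * x i)) = (CLINT \<omega>|M. iexp (t 0 * Z n \<omega>))" for n
      by (subst integral_distr[OF G]) (auto simp: G_def intro!: measurable_compose[OF coordinate_measurable])
    then show "(\<lambda>n. CLINT x|distr M (Rn_borel 1) (G n). iexp (\<Sum>i<1. t i * x i)) \<longlonglongrightarrow> (CLINT x|\<mu>. iexp (\<Sum>i<1. t i * x i))"
      using ch[of "t 0"] v by (simp only: \<mu>(3)) (simp add: power_mult_distrib)
  qed (use \<mu> in auto)
  interpret Q: prob_space \<mu> by (rule \<mu>(1))
  show ?thesis
    unfolding tight_rv_def
  proof (intro conjI allI impI Z)
    fix e :: real assume e: "e > 0"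
    define u where "u K y = min 1 (max 0 (\<bar>y\<bar> - K))" for K y :: real
    have u: "0 \<le> u K y" "\<bar>u K y\<bar> \<le> 1" "isCont (u K) y" for K y
      unfolding u_def by (auto intro!: continuous_intros)
    have um: "(\<lambda>x. u K (x 0)) \<in> borel_measurable (Rn_borel 1)" for K
      unfolding u_def using coordinate_measurable[of 0 1] by simp
    have "(\<lambda>m. \<integral>x. u (real m) (x 0) \<partial>\<mu>) \<longlonglongrightarrow> (\<integral>x. 0 \<partial>\<mu>)"
    proof (rule integral_dominated_convergence[where w = "\<lambda>_. 1"])
      show "AE x in \<mu>. (\<lambda>m. u (real m) (x 0)) \<longlonglongrightarrow> 0"
      proof (intro AE_I2 tendsto_eventually)
        fix x :: "nat \<Rightarrow> real"
        have "eventually (\<lambda>m. \<bar>x 0\<bar> \<le> real m) sequentially"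
          using filterlim_real_sequentially by (simp add: filterlim_at_top)
        then show "eventually (\<lambda>m. u (real m) (x 0) = 0) sequentially"
          by eventually_elim (simp add: u_def)
      qed
      show "(\<lambda>x. u (real m) (x 0)) \<in> borel_measurable \<mu>" for m
        using um measurable_cong_sets[OF \<mu>(2) refl] by blast
    qed (use u in auto)
    then have "eventually (\<lambda>m. (\<integral>x. u (real m) (x 0) \<partial>\<mu>) < e) sequentially" using e by (intro order_tendstoD(2)) auto
    then obtain K where K: "(\<integral>x. u (real K) (x 0) \<partial>\<mu>) < e" by (auto simp: eventually_sequentially)
    have "(\<lambda>n. \<integral>x. u (real K) (x 0) \<partial>(distr M (Rn_borel 1) (G n))) \<longlonglongrightarrow> (\<integral>x. u (real K) (x 0) \<partial>\<mu>)"
      using u by (intro C.marginal_conv[where B = 1]) auto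
    moreover have "(\<integral>x. u (real K) (x 0) \<partial>(distr M (Rn_borel 1) (G n))) = (\<integral>\<omega>. u (real K) (Z n \<omega>) \<partial>M)" for n
      using um by (subst integral_distr[OF G]) (auto simp: G_def)
    ultimately have "eventually (\<lambda>n. (\<integral>\<omega>. u (real K) (Z n \<omega>) \<partial>M) < e) sequentially"
      using K by (intro order_tendstoD(2)) auto
    then have "eventually (\<lambda>n. prob {\<omega> \<in> space M. real K + 1 < \<bar>Z n \<omega>\<bar>} < e) sequentially"
    proof eventually_elim
      case (elim n)
      define S where "S = {\<omega> \<in> space M. real K + 1 < \<bar>Z n \<omega>\<bar>}"
      note [measurable] = Z[of n]
      have S [measurable]: "S \<in> sets M" unfolding S_def by measurable
      have Si: "integrable M (indicat_real S)" by (rule integrable_const_bound[where B = 1]) (auto simp: indicator_def)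
      have ui: "integrable M (\<lambda>\<omega>. u (real K) (Z n \<omega>))"
        unfolding u_def by (rule integrable_const_bound[where B = 1]) auto
      have "prob S = (\<integral>\<omega>. indicator S \<omega> \<partial>M)" using S by simp
      also have "\<dots> \<le> (\<integral>\<omega>. u (real K) (Z n \<omega>) \<partial>M)"
        by (rule integral_mono[OF Si ui]) (auto simp: S_def indicator_def u_def)
      finally show ?case using elim by (simp add: S_def)
    qed
    then show "\<exists>K. eventually (\<lambda>n. prob {\<omega> \<in> space M. K < \<bar>Z n \<omega>\<bar>} < e) sequentially" by blast
  qed
qed

text \<open>The integrands differ by |exp(i B) - 1| \<le> 2 min(1, |B|), whose expectation is what
  \<open>conv0\<close> controls.\<close>

lemma slutsky_char:
  assumes A: "\<And>n. A n \<in> borel_measurable M" and B: "conv0 B"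
    and ch: "(\<lambda>n. CLINT \<omega>|M. iexp (A n \<omega>)) \<longlonglongrightarrow> z"
  shows "(\<lambda>n. CLINT \<omega>|M. iexp (A n \<omega> + B n \<omega>)) \<longlonglongrightarrow> z"
proof -
  note [measurable] = A
  have [measurable]: "B n \<in> borel_measurable M" for n using B by (auto simp: conv0_def)
  have "(\<lambda>n. 2 * (\<integral>\<omega>. min 1 \<bar>B n \<omega>\<bar> \<partial>M)) \<longlonglongrightarrow> 2 * 0" using B by (intro tendsto_intros) (simp add: conv0_def)
  then have lim: "(\<lambda>n. 2 * (\<integral>\<omega>. min 1 \<bar>B n \<omega>\<bar> \<partial>M)) \<longlonglongrightarrow> 0" by simp
  have "(\<lambda>n. (CLINT \<omega>|M. iexp (A n \<omega> + B n \<omega>)) - (CLINT \<omega>|M. iexp (A n \<omega>))) \<longlonglongrightarrow> 0"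
  proof (rule Lim_null_comparison[OF _ lim], intro always_eventually allI)
    fix n
    have i: "integrable M (\<lambda>\<omega>. iexp (A n \<omega> + B n \<omega>))" "integrable M (\<lambda>\<omega>. iexp (A n \<omega>))"
      by (rule integrable_const_bound[where B = 1]; auto)+
    have "cmod ((CLINT \<omega>|M. iexp (A n \<omega> + B n \<omega>)) - (CLINT \<omega>|M. iexp (A n \<omega>))) = cmod (CLINT \<omega>|M. iexp (A n \<omega> + B n \<omega>) - iexp (A n \<omega>))"
      using i by simp
    also have "\<dots> \<le> (\<integral>\<omega>. cmod (iexp (A n \<omega> + B n \<omega>) - iexp (A n \<omega>)) \<partial>M)" by (rule integral_norm_bound)
    also have "\<dots> \<le> (\<integral>\<omega>. 2 * min 1 \<bar>B n \<omega>\<bar> \<partial>M)"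
    proof (rule integral_mono)
      show "integrable M (\<lambda>\<omega>. cmod (iexp (A n \<omega> + B n \<omega>) - iexp (A n \<omega>)))" using i by (intro integrable_norm) auto
      show "integrable M (\<lambda>\<omega>. 2 * min 1 \<bar>B n \<omega>\<bar>)" by (intro integrable_mult_right min_integrable) auto
      fix \<omega>
      have "iexp (A n \<omega> + B n \<omega>) - iexp (A n \<omega>) = iexp (A n \<omega>) * (iexp (B n \<omega>) - 1)"
        by (simp add: exp_add distrib_left right_diff_distrib)
      then have "cmod (iexp (A n \<omega> + B n \<omega>) - iexp (A n \<omega>)) = cmod (iexp (B n \<omega>) - 1)" by (simp add: norm_mult)
      moreover have "cmod (iexp (B n \<omega>) - 1) \<le> \<bar>B n \<omega>\<bar>" using iexp_approx1[of "B n \<omega>" 0] by simp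
      moreover have "cmod (iexp (B n \<omega>) - 1) \<le> 2" using norm_triangle_ineq4[of "iexp (B n \<omega>)" 1] by simp
      ultimately show "cmod (iexp (A n \<omega> + B n \<omega>) - iexp (A n \<omega>)) \<le> 2 * min 1 \<bar>B n \<omega>\<bar>" by linarith
    qed
    also have "\<dots> = 2 * (\<integral>\<omega>. min 1 \<bar>B n \<omega>\<bar> \<partial>M)" by simp
    finally show "norm ((CLINT \<omega>|M. iexp (A n \<omega> + B n \<omega>)) - (CLINT \<omega>|M. iexp (A n \<omega>))) \<le> 2 * (\<integral>\<omega>. min 1 \<bar>B n \<omega>\<bar> \<partial>M)" .
  qed
  from tendsto_add[OF this ch] show ?thesis by simp
qed

end

subsection \<open>Growth of the regressors\<close>

text \<open>Here \<open>y n\<close> is the squared norm of a regressor, \<open>r n\<close> the determinant of its Gram matrix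
  and \<open>q2 n\<close> a squared prediction error.\<close>

locale growth =
  fixes y r q2 :: "nat \<Rightarrow> real" and p n0 d m :: nat and A C1 C2 \<gamma> \<eta> \<tau> :: real
  assumes y: "\<And>n. 0 \<le> y n" and q2: "\<And>n. 0 \<le> q2 n"
    and r1: "\<And>n. 1 \<le> r n" and r_mono: "\<And>n. r n \<le> r (Suc n)"
    and r_ratio: "\<And>n. r (Suc n) \<le> (1 + y (Suc n)) * r n"
    and A: "0 \<le> A" "\<And>n. (\<Sum>k=1..n. q2 k * r (k - 1) / r k powr (1 + \<eta>)) \<le> A"
    and rec: "\<And>n. n0 \<le> n \<Longrightarrow> \<exists>j\<in>{1..p+1}. y n \<le> C1 * (q2 (n - j) + real n powr \<gamma>)"
    and n0: "p + 2 \<le> n0" and C1: "1 \<le> C1"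
    and rb: "\<And>n. r n \<le> C2 * (1 + (\<Sum>k=0..n. y k)) ^ d" and C2: "1 \<le> C2"
    and \<gamma>: "0 < \<gamma>" and \<tau>: "0 < \<tau>" "8 * \<tau> \<le> 1 - \<gamma>"
    and m: "1 \<le> m" "real d \<le> real m * \<tau> / 2" and \<eta>: "0 < \<eta>" "\<eta> * real m * real d \<le> \<tau> / 2"
begin

lemma r_monoD: "i \<le> j \<Longrightarrow> r i \<le> r j"
  using r_mono by (rule lift_Suc_mono_le)

text \<open>A single term of the bounded sum: a large prediction error at k forces r to be
  multiplied by a proportional factor, up to r^\<eta>.\<close>

lemma q2_le: "1 \<le> k \<Longrightarrow> q2 k \<le> A * r k powr \<eta> * (r k / r (k - 1))"
proof -
  assume k: "1 \<le> k"
  have "q2 k * r (k - 1) / r k powr (1 + \<eta>) \<le> (\<Sum>k=1..k. q2 k * r (k - 1) / r k powr (1 + \<eta>))"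
    using k q2 r1 by (intro member_le_sum) (auto intro!: divide_nonneg_nonneg mult_nonneg_nonneg order_trans[OF zero_le_one r1])
  then have le: "q2 k * r (k - 1) / r k powr (1 + \<eta>) \<le> A" using A(2)[of k] by linarith
  have pos: "0 < r k" "0 < r (k - 1)" using r1[of k] r1[of "k - 1"] by linarith+
  then have "q2 k * r (k - 1) \<le> A * r k powr (1 + \<eta>)" using le by (simp add: pos_divide_le_eq)
  also have "\<dots> = A * r k powr \<eta> * r k" using pos by (simp add: powr_add)
  finally show ?thesis using pos by (simp add: field_simps)
qed

context
  fixes N :: nat
  assumes N: "1 \<le> N"
begin

text \<open>The factor lost in one link of the chain; r_k^\<eta> is replaced by r_N^\<eta> to make
  it the same for all links up to time N.\<close>

definition "c = C1 * (A + 1) * r N powr \<eta>"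
definition "G = real N powr \<gamma>"

lemma G1: "1 \<le> G" unfolding G_def using N \<gamma> by (intro ge_one_powr_ge_zero) auto

lemma R\<eta>: "1 \<le> r N powr \<eta>" using r1[of N] \<eta> by (intro ge_one_powr_ge_zero) auto

lemma c1: "1 \<le> c"
proof -
  have "1 * 1 * 1 \<le> C1 * (A + 1) * r N powr \<eta>" using C1 A(1) R\<eta> by (intro mult_mono) auto
  then show ?thesis by (simp add: c_def)
qed

text \<open>A large \<open>y n\<close> forces, through \<open>rec\<close>, a large \<open>q2\<close> at one of the last \<open>p + 1\<close> times,
  hence by \<open>q2_le\<close> a proportional jump of \<open>r\<close> and a still large \<open>y\<close> there; the jumps multiply.\<close>

lemma chain:
  "n \<le> N \<Longrightarrow> n0 + M * (p + 1) \<le> n \<Longrightarrow> (4 * c) ^ M * G < y n \<Longrightarrow>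
    (y n / (4 * c) ^ M) ^ M * r (n - 1 - M * (p + 1)) \<le> r (n - 1)"
proof (induction M arbitrary: n)
  case 0 then show ?case by simp
next
  case (Suc M)
  define K where "K = (4 * c) ^ M"
  have K: "1 \<le> K" unfolding K_def using c1 by (intro one_le_power) simp
  have KS: "(4 * c) ^ Suc M = 4 * c * K" by (simp add: K_def)
  have yn: "4 * c * K * G < y n" using Suc.prems by (simp add: K_def)
  have "4 * c * 1 * 1 \<le> 4 * c * K * G" using c1 K G1 by (intro mult_mono) auto
  then have y4c: "4 * c \<le> y n" using yn by linarith
  have cG: "4 * c * 1 * G \<le> 4 * c * K * G" using c1 K G1 by (intro mult_right_mono mult_left_mono) auto
  obtain j where j: "j \<in> {1..p+1}" "y n \<le> C1 * (q2 (n - j) + real n powr \<gamma>)"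
    using rec[of n] Suc.prems by auto
  define k where "k = n - j"
  have k: "1 \<le> k" "k \<le> N" "k < n" "n0 + M * (p + 1) \<le> k" using j(1) Suc.prems n0 by (auto simp: k_def)
  define q where "q = r k / r (k - 1)"
  have rp: "0 < r k" "0 < r (k - 1)" using r1[of k] r1[of "k - 1"] by linarith+
  have q1: "1 \<le> q" unfolding q_def using rp r_monoD[of "k - 1" k] by simp
  have "y n \<le> C1 * (A * r N powr \<eta> * q + G)"
  proof -
    have "q2 k \<le> A * r k powr \<eta> * q" using q2_le[OF k(1)] by (simp add: q_def)
    also have "\<dots> \<le> A * r N powr \<eta> * q"
      using A(1) q1 rp \<eta> r_monoD[OF k(2)] by (intro mult_right_mono mult_left_mono powr_mono2) auto
    finally have 1: "q2 k \<le> A * r N powr \<eta> * q" .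
    have 2: "real n powr \<gamma> \<le> G" unfolding G_def using \<gamma> Suc.prems by (intro powr_mono2) auto
    have "C1 * (q2 k + real n powr \<gamma>) \<le> C1 * (A * r N powr \<eta> * q + G)"
      using 1 2 C1 by (intro mult_left_mono) auto
    then show ?thesis using j(2) by (simp add: k_def)
  qed
  also have "\<dots> \<le> c * (q + G)"
  proof -
    have "C1 * G \<le> c * G"
    proof -
      have "C1 * 1 * 1 \<le> C1 * (A + 1) * r N powr \<eta>" using C1 A(1) R\<eta> by (intro mult_mono) auto
      then show ?thesis using G1 by (intro mult_right_mono) (auto simp: c_def)
    qed
    moreover have "C1 * (A * r N powr \<eta> * q) \<le> c * q"
    proof -
      have "C1 * (A * r N powr \<eta>) \<le> C1 * ((A + 1) * r N powr \<eta>)"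
        using C1 R\<eta> by (intro mult_left_mono mult_right_mono) auto
      then have "C1 * (A * r N powr \<eta>) * q \<le> c * q" using q1 by (intro mult_right_mono) (auto simp: c_def mult.assoc)
      then show ?thesis by (simp add: mult.assoc)
    qed
    ultimately show ?thesis by (simp add: distrib_left)
  qed
  finally have ycq: "y n \<le> c * (q + G)" .
  \<comment> \<open>If the ratio q were at most G, then y n \<le> 2 c G, whereas y n exceeds 4 c G:
    the noise part of \<open>rec\<close> alone cannot account for y n.\<close>
  have "G < q"
  proof (rule ccontr)
    assume "\<not> G < q"
    then have "c * (q + G) \<le> c * (2 * G)" using c1 by (intro mult_left_mono) auto
    then have "y n \<le> 2 * (c * G)" using ycq by simp
    moreover have "4 * (c * G) < y n" using cG yn by simp
    moreover have "0 \<le> c * G" using c1 G1 by simp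
    ultimately show False by linarith
  qed
  then have "c * (q + G) \<le> c * (2 * q)" using c1 by (intro mult_left_mono) auto
  then have "y n \<le> c * (2 * q)" using ycq by linarith
  then have q_ge: "y n / (2 * c) \<le> q" using c1 by (simp add: pos_divide_le_eq mult_ac)
  have "q \<le> 1 + y k"
  proof -
    have "r k \<le> (1 + y k) * r (k - 1)" using r_ratio[of "k - 1"] k(1) by simp
    then show ?thesis unfolding q_def using rp by (simp add: pos_divide_le_eq)
  qed
  \<comment> \<open>In y n / (2 c) \<le> q \<le> 1 + y k, one half of the left side absorbs the 1
    and the other half remains as lower bound for y k.\<close>
  moreover have "1 \<le> y n / (4 * c)" using y4c c1 by (simp add: pos_le_divide_eq)
  moreover have "y n / (2 * c) = y n / (4 * c) + y n / (4 * c)" by simp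
  ultimately have yk: "y n / (4 * c) \<le> y k" using q_ge by linarith
  have "K * G < y n / (4 * c)" using yn c1 by (simp add: pos_less_divide_eq mult_ac)
  then have "(4 * c) ^ M * G < y k" using yk by (simp add: K_def)
  from Suc.IH[OF k(2) k(4) this] have IH: "(y k / K) ^ M * r (k - 1 - M * (p + 1)) \<le> r (k - 1)" by (simp add: K_def)
  have base: "y n / (4 * c * K) \<le> y k / K"
    using divide_right_mono[OF yk, of K] K by simp
  have base0: "0 \<le> y n / (4 * c * K)" using y[of n] c1 K by simp
  have "(y n / (4 * c * K)) ^ M * r (n - 1 - Suc M * (p + 1)) \<le> (y k / K) ^ M * r (k - 1 - M * (p + 1))"
  proof (intro mult_mono power_mono base base0)
    \<comment> \<open>A link goes back at most p + 1 steps, so the window of the remaining M links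
      stays inside that of \<open>Suc M\<close> links.\<close>
    have "n - 1 - Suc M * (p + 1) \<le> k - 1 - M * (p + 1)" using j(1) by (auto simp: k_def)
    then show "r (n - 1 - Suc M * (p + 1)) \<le> r (k - 1 - M * (p + 1))" by (rule r_monoD)
  next
    show "0 \<le> (y k / K) ^ M" using y[of k] K by simp
    show "0 \<le> r (n - 1 - Suc M * (p + 1))" using r1 order_trans zero_le_one by blast
  qed
  with IH have IH': "(y n / (4 * c * K)) ^ M * r (n - 1 - Suc M * (p + 1)) \<le> r (k - 1)" by linarith
  have "y n / (4 * c * K) \<le> q"
  proof -
    have "2 * c * 1 \<le> (2 * c) * (2 * K)" using c1 K by (intro mult_left_mono) auto
    then have "y n / (4 * c * K) \<le> y n / (2 * c)" using y[of n] c1 K by (intro divide_left_mono) auto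
    then show ?thesis using q_ge by linarith
  qed
  then have "(y n / (4 * c * K)) * ((y n / (4 * c * K)) ^ M * r (n - 1 - Suc M * (p + 1))) \<le> q * r (k - 1)"
    using IH' base0 q1 by (intro mult_mono) (auto intro!: mult_nonneg_nonneg order_trans[OF zero_le_one r1])
  also have "\<dots> = r k" using rp by (simp add: q_def)
  also have "r k \<le> r (n - 1)" using k(3) by (intro r_monoD) simp
  finally show ?case unfolding KS by (simp add: mult.assoc)
qed

text \<open>Covers the times that are too early for a chain of m links.\<close>

definition "C4 = (\<Sum>k<n0 + m * (p + 1). y k)"
definition "C5 = 1 + C4 + (4 * C1 * (A + 1)) ^ m"

lemma C5_ge: "1 \<le> C5" using y C1 A(1) by (auto simp: C5_def C4_def intro!: add_increasing2 sum_nonneg)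

text \<open>Unless y_n is already of order z G with z = (4 c)^m, the full chain of m links gives
  (y_n / z)^m \<le> r_N. Taking the m-th root leaves the exponent 1/m on r_N, and z itself
  contributes r_N^(\<eta> m).\<close>

lemma y_le_R:
  assumes n: "n \<le> N"
  shows "1 + y n \<le> 2 * C5 * r N powr (\<eta> * real m + 1 / real m) * G"
proof -
  have R1: "1 \<le> r N powr s" if "0 \<le> s" for s using r1 that by (intro ge_one_powr_ge_zero) auto
  have e0: "0 \<le> \<eta> * real m + 1 / real m" using \<eta> by simp
  have cm: "(4 * c) ^ m = (4 * C1 * (A + 1)) ^ m * r N powr (\<eta> * real m)"
  proof -
    have "(r N powr \<eta>) ^ m = r N powr (\<eta> * real m)" using r1[of N] by (simp add: powr_powr flip: powr_realpow)
    moreover have "4 * c = (4 * C1 * (A + 1)) * r N powr \<eta>" by (simp add: c_def)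
    ultimately show ?thesis by (simp only: power_mult_distrib)
  qed
  have "y n \<le> C5 * r N powr (\<eta> * real m + 1 / real m) * G"
  proof (cases "n < n0 + m * (p + 1)")
    case True
    then have "y n \<le> C4" unfolding C4_def using y by (intro member_le_sum) auto
    also have "\<dots> \<le> C5 * 1 * 1" using C1 A(1) by (auto simp: C5_def)
    also have "\<dots> \<le> C5 * r N powr (\<eta> * real m + 1 / real m) * G"
      using C5_ge G1 R1[OF e0] by (intro mult_mono) auto
    finally show ?thesis .
  next
    case False
    define z where "z = (4 * c) ^ m"
    have z: "1 \<le> z" unfolding z_def using c1 by (intro one_le_power) simp
    have "y n \<le> z * r N powr (1 / real m) * G"
    proof (cases "z * G < y n")
      case True
      have "(y n / z) ^ m * 1 \<le> (y n / z) ^ m * r (n - 1 - m * (p + 1))"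
        using r1 y z by (intro mult_left_mono) auto
      also have "\<dots> \<le> r (n - 1)" using chain[OF n, of m] False True by (simp add: z_def)
      also have "\<dots> \<le> r N" using n by (intro r_monoD) simp
      finally have le: "(y n / z) ^ m \<le> r N" by simp
      have yz: "0 \<le> y n / z" using y z by simp
      have "y n / z \<le> r N powr (1 / real m)"
      proof (cases "y n / z = 0")
        case False
        have root: "x = (x ^ m) powr (1 / real m)" if "0 < x" for x :: real
          using that m by (simp add: powr_powr flip: powr_realpow)
        have "0 < y n / z" using False yz by linarith
        then have "y n / z = ((y n / z) ^ m) powr (1 / real m)" by (rule root)
        also have "\<dots> \<le> r N powr (1 / real m)" using le yz by (intro powr_mono2) auto
        finally show ?thesis .
      next
        case True then show ?thesis by (simp only: powr_ge_zero)
      qed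
      then have "y n \<le> z * r N powr (1 / real m) * 1" using z by (simp add: pos_divide_le_eq mult.commute)
      also have "\<dots> \<le> z * r N powr (1 / real m) * G" using z G1 by (intro mult_left_mono) auto
      finally show ?thesis .
    next
      case False
      then have "y n \<le> z * 1 * G" by simp
      also have "\<dots> \<le> z * r N powr (1 / real m) * G" using z G1 R1[of "1 / real m"] by (intro mult_right_mono mult_left_mono) auto
      finally show ?thesis .
    qed
    also have "\<dots> = (4 * C1 * (A + 1)) ^ m * r N powr (\<eta> * real m + 1 / real m) * G"
      unfolding z_def cm by (simp add: powr_add)
    also have "\<dots> \<le> C5 * r N powr (\<eta> * real m + 1 / real m) * G"
      using G1 y by (intro mult_right_mono) (auto simp: C5_def C4_def intro!: add_nonneg_nonneg sum_nonneg)
    finally show ?thesis .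
  qed
  moreover have "1 * 1 * 1 \<le> C5 * r N powr (\<eta> * real m + 1 / real m) * G"
    using C5_ge G1 R1[OF e0] by (intro mult_mono) auto
  ultimately show ?thesis by simp
qed

end

text \<open>Let Y be the largest 1 + y_k up to N. \<open>y_le_R\<close> bounds Y by a small power of
  r_N times N^\<gamma>, while r_N is at most of order (N Y)^d; together Y \<le> C N^(\<tau> +
  \<gamma>) Y^\<tau>, which can be solved for Y because \<tau> < 1. Removing the weights from the
  bounded sum then costs only Y r_N^\<eta>.\<close>

lemma growth:
  obtains C where "\<And>N. 1 \<le> N \<Longrightarrow> (\<Sum>k=1..N. q2 k) \<le> C * real N powr (1 - 4 * \<tau>)"
proof -
  have C5: "1 \<le> C5" using C5_ge[of 1] by simp
  define C6 where "C6 = C2 * 3 ^ d"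
  have C6: "1 \<le> C6" using C2 mult_mono[of 1 C2 1 "3 ^ d"] by (simp add: C6_def)
  have \<tau>1: "\<tau> < 1 / 8" using \<tau> \<gamma> by linarith
  \<comment> \<open>The exponent of r_N in \<open>y_le_R\<close>; each of its two summands, times d,
    is at most \<tau> / 2 by the choice of \<eta> and of m.\<close>
  define \<kappa> where "\<kappa> = \<eta> * real m + 1 / real m"
  have \<kappa>: "0 < \<kappa>" using \<eta> m by (simp add: \<kappa>_def add_pos_nonneg)
  have d\<kappa>: "real d * \<kappa> \<le> \<tau>"
  proof -
    have "real d / real m \<le> \<tau> / 2" using m by (simp add: pos_divide_le_eq mult_ac)
    moreover have "real d * \<kappa> = \<eta> * real m * real d + real d / real m" by (simp add: \<kappa>_def algebra_simps)
    ultimately show ?thesis using \<eta>(2) by linarith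
  qed
  have d\<eta>: "real d * \<eta> \<le> \<tau>"
  proof -
    have "real d * \<eta> * 1 \<le> real d * \<eta> * real m" using \<eta> m by (intro mult_left_mono) auto
    then show ?thesis using \<eta>(2) \<tau> by (simp add: mult_ac)
  qed
  define C7 where "C7 = 2 * C5 * C6 powr \<kappa>"
  define C8 where "C8 = C7 powr (1 / (1 - \<tau>))"
  have C7: "1 \<le> C7"
  proof -
    have "1 * 1 \<le> (2 * C5) * C6 powr \<kappa>" using C5 C6 \<kappa> by (intro mult_mono ge_one_powr_ge_zero) auto
    then show ?thesis by (simp add: C7_def)
  qed
  have C8: "1 \<le> C8" unfolding C8_def using C7 \<tau>1 by (intro ge_one_powr_ge_zero) auto
  show ?thesis
  proof (rule that[of "A * C8 * (C6 powr \<eta> * C8 powr \<tau>)"])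
    fix N :: nat assume N: "1 \<le> N"
    define Y where "Y = Max ((\<lambda>k. 1 + y k) ` {..N})"
    have Yle: "1 + y k \<le> Y" if "k \<le> N" for k unfolding Y_def using that by (intro Max_ge) auto
    have Y1: "1 \<le> Y" using Yle[of 0] y[of 0] by simp
    have "Y \<in> (\<lambda>k. 1 + y k) ` {..N}" unfolding Y_def by (intro Max_in) auto
    then obtain n where n: "n \<le> N" "Y = 1 + y n" by auto
    have NY: "1 \<le> real N * Y" using mult_mono[of 1 "real N" 1 Y] N Y1 by simp
    have RY: "r N \<le> C6 * (real N * Y) ^ d"
    proof -
      have "(\<Sum>k=0..N. y k) \<le> (\<Sum>k=0..N. Y)" using Yle by (intro sum_mono) force
      also have "\<dots> = (real N + 1) * Y" by simp
      also have "\<dots> \<le> (real N + real N) * Y" using N Y1 by (intro mult_right_mono) auto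
      finally have "1 + (\<Sum>k=0..N. y k) \<le> 3 * (real N * Y)" using NY by simp
      then have "(1 + (\<Sum>k=0..N. y k)) ^ d \<le> (3 * (real N * Y)) ^ d"
        using y by (intro power_mono) (auto intro!: add_nonneg_nonneg sum_nonneg)
      then have "C2 * (1 + (\<Sum>k=0..N. y k)) ^ d \<le> C2 * (3 * (real N * Y)) ^ d" using C2 by (intro mult_left_mono) auto
      then show ?thesis using rb[of N] by (simp add: C6_def power_mult_distrib)
    qed
    have Rpow: "r N powr s \<le> C6 powr s * (real N * Y) powr \<tau>" if s: "0 \<le> s" "real d * s \<le> \<tau>" for s
    proof -
      have "r N powr s \<le> (C6 * (real N * Y) ^ d) powr s" using RY r1[of N] s by (intro powr_mono2) auto
      also have "\<dots> = C6 powr s * ((real N * Y) ^ d) powr s" by (rule powr_mult)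
      also have "((real N * Y) ^ d) powr s = (real N * Y) powr (real d * s)"
        using NY N Y1 by (simp add: powr_powr flip: powr_realpow)
      also have "(real N * Y) powr (real d * s) \<le> (real N * Y) powr \<tau>" using NY s by (intro powr_mono) auto
      finally show ?thesis using C6 by (simp add: mult_left_mono)
    qed
    have "Y \<le> 2 * C5 * r N powr \<kappa> * real N powr \<gamma>"
      using y_le_R[OF N n(1)] n(2) by (simp add: \<kappa>_def G_def[OF N])
    also have "\<dots> \<le> 2 * C5 * (C6 powr \<kappa> * (real N * Y) powr \<tau>) * real N powr \<gamma>"
      using C5 \<kappa> d\<kappa> by (intro mult_right_mono mult_left_mono Rpow) simp_all
    also have "\<dots> = C7 * real N powr (\<tau> + \<gamma>) * Y powr \<tau>"
      using N Y1 by (simp add: C7_def powr_mult powr_add)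
    finally have 1: "Y \<le> C7 * real N powr (\<tau> + \<gamma>) * Y powr \<tau>" .
    have "Y powr (1 - \<tau>) \<le> C7 * real N powr (\<tau> + \<gamma>)"
      using 1 Y1 by (simp add: powr_diff pos_divide_le_eq)
    then have "(Y powr (1 - \<tau>)) powr (1 / (1 - \<tau>)) \<le> (C7 * real N powr (\<tau> + \<gamma>)) powr (1 / (1 - \<tau>))"
      using \<tau>1 by (intro powr_mono2) auto
    also have "(Y powr (1 - \<tau>)) powr (1 / (1 - \<tau>)) = Y" using Y1 \<tau>1 by (simp add: powr_powr)
    also have "(C7 * real N powr (\<tau> + \<gamma>)) powr (1 / (1 - \<tau>)) = C8 * real N powr ((\<tau> + \<gamma>) / (1 - \<tau>))"
      using C7 N by (simp add: C8_def powr_mult powr_powr)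
    \<comment> \<open>Here 8 \<tau> \<le> 1 - \<gamma> enters: \<tau> + \<gamma> \<le> 1 - 7 \<tau>
      \<le> (1 - 6 \<tau>) (1 - \<tau>). Of the margin 6 \<tau>, the factor r_N^\<eta> later takes 2
      \<tau>, which leaves the exponent 1 - 4 \<tau>.\<close>
    also have "\<dots> \<le> C8 * real N powr (1 - 6 * \<tau>)"
    proof (intro mult_left_mono powr_mono)
      have "\<tau> + \<gamma> \<le> 1 - 7 * \<tau>" using \<tau> by linarith
      also have "\<dots> \<le> (1 - 6 * \<tau>) * (1 - \<tau>)" by (simp add: algebra_simps)
      finally show "(\<tau> + \<gamma>) / (1 - \<tau>) \<le> 1 - 6 * \<tau>" using \<tau>1 by (simp add: pos_divide_le_eq)
    qed (use N C8 in auto)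
    finally have YN: "Y \<le> C8 * real N powr (1 - 6 * \<tau>)" .
    have "(\<Sum>k=1..N. q2 k) \<le> (\<Sum>k=1..N. (q2 k * r (k - 1) / r k powr (1 + \<eta>)) * (Y * r N powr \<eta>))"
    proof (intro sum_mono)
      fix k assume k: "k \<in> {1..N}"
      have rp: "0 < r k" "0 < r (k - 1)" using r1[of k] r1[of "k - 1"] by linarith+
      have "r k \<le> (1 + y k) * r (k - 1)" using r_ratio[of "k - 1"] k by simp
      also have "\<dots> \<le> Y * r (k - 1)" using Yle[of k] k rp by (intro mult_right_mono) auto
      finally have rk: "r k \<le> Y * r (k - 1)" .
      have "r k powr (1 + \<eta>) = r k powr \<eta> * r k" using rp by (simp add: powr_add)
      also have "\<dots> \<le> r N powr \<eta> * (Y * r (k - 1))"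
        using rp \<eta> k rk by (intro mult_mono powr_mono2 r_monoD) auto
      finally have "r k powr (1 + \<eta>) \<le> r N powr \<eta> * (Y * r (k - 1))" .
      then have "1 \<le> r N powr \<eta> * (Y * r (k - 1)) / r k powr (1 + \<eta>)" using rp by (simp add: pos_le_divide_eq)
      then have "q2 k * 1 \<le> q2 k * (r N powr \<eta> * (Y * r (k - 1)) / r k powr (1 + \<eta>))"
        using q2 by (intro mult_left_mono) auto
      then show "q2 k \<le> (q2 k * r (k - 1) / r k powr (1 + \<eta>)) * (Y * r N powr \<eta>)" by (simp add: mult_ac)
    qed
    also have "\<dots> \<le> A * (Y * r N powr \<eta>)"
      unfolding sum_distrib_right[symmetric] using A(2)[of N] Y1 by (intro mult_right_mono) auto
    also have "\<dots> \<le> A * ((C8 * real N powr (1 - 6 * \<tau>)) * (C6 powr \<eta> * (C8 powr \<tau> * real N powr (2 * \<tau>))))"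
    proof (intro mult_left_mono mult_mono YN)
      have "r N powr \<eta> \<le> C6 powr \<eta> * (real N * Y) powr \<tau>" using \<eta> d\<eta> by (intro Rpow) auto
      also have "(real N * Y) powr \<tau> \<le> (C8 * real N powr 2) powr \<tau>"
      proof (intro powr_mono2)
        have "real N * Y \<le> real N * (C8 * real N powr (1 - 6 * \<tau>))" using YN by (intro mult_left_mono) auto
        also have "\<dots> = C8 * real N powr (2 - 6 * \<tau>)" using N by (simp add: powr_mult_base)
        also have "\<dots> \<le> C8 * real N powr 2" using N C8 \<tau> by (intro mult_left_mono powr_mono) auto
        finally show "real N * Y \<le> C8 * real N powr 2" .
      qed (use NY \<tau> in auto)
      also have "(C8 * real N powr 2) powr \<tau> = C8 powr \<tau> * real N powr (2 * \<tau>)"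
        by (simp only: powr_mult powr_powr)
      finally show "r N powr \<eta> \<le> C6 powr \<eta> * (C8 powr \<tau> * real N powr (2 * \<tau>))"
        using C6 by (simp add: mult_left_mono)
    qed (use A(1) C8 in auto)
    also have "\<dots> = A * C8 * (C6 powr \<eta> * C8 powr \<tau>) * real N powr (1 - 4 * \<tau>)"
      using powr_add[of "real N" "1 - 6 * \<tau>" "2 * \<tau>"] by (simp add: mult_ac)
    finally show "(\<Sum>k=1..N. q2 k) \<le> A * C8 * (C6 powr \<eta> * C8 powr \<tau>) * real N powr (1 - 4 * \<tau>)" .
  qed
qed

lemma average_tendsto_0: "(\<lambda>n. (\<Sum>k=1..n. q2 k) / real n) \<longlonglongrightarrow> 0"
proof -
  obtain C where C: "\<And>N. 1 \<le> N \<Longrightarrow> (\<Sum>k=1..N. q2 k) \<le> C * real N powr (1 - 4 * \<tau>)" using growth by blast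
  have "(\<lambda>n. real n powr (- (4 * \<tau>))) \<longlonglongrightarrow> 0"
    using \<tau> by (intro tendsto_neg_powr filterlim_real_sequentially) auto
  then have 0: "(\<lambda>n. C * real n powr (- (4 * \<tau>))) \<longlonglongrightarrow> 0" using tendsto_mult_right_zero by blast
  show ?thesis
  proof (rule tendsto_sandwich[OF _ _ tendsto_const 0])
    show "\<forall>\<^sub>F n in sequentially. 0 \<le> (\<Sum>k=1..n. q2 k) / real n"
      using q2 by (intro always_eventually allI divide_nonneg_nonneg sum_nonneg) auto
    show "\<forall>\<^sub>F n in sequentially. (\<Sum>k=1..n. q2 k) / real n \<le> C * real n powr (- (4 * \<tau>))"
      using eventually_ge_at_top[of 1]
    proof eventually_elim
      case (elim n)
      have "(\<Sum>k=1..n. q2 k) / real n \<le> C * real n powr (1 - 4 * \<tau>) / real n"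
        using C[OF elim] by (intro divide_right_mono) auto
      also have "\<dots> = C * real n powr (- (4 * \<tau>))" using elim by (simp add: powr_diff powr_minus field_simps)
      finally show ?case .
    qed
  qed
qed

end

subsection \<open>Empirical covariances\<close>

definition avg :: "(nat \<Rightarrow> real) \<Rightarrow> nat \<Rightarrow> real" where
  "avg u n = (\<Sum>k<n. u k) / real n"

lemma avg_add: "avg (\<lambda>k. u k + w k) n = avg u n + avg w n"
  by (simp add: avg_def sum.distrib add_divide_distrib)

lemma avg_cmult: "avg (\<lambda>k. c * u k) n = c * avg u n"
  by (simp add: avg_def flip: sum_distrib_left)

lemma avg_sum: "avg (\<lambda>k. \<Sum>i\<in>I. u i k) n = (\<Sum>i\<in>I. avg (u i) n)"
  by (simp add: avg_def sum.swap[of _ _ I] sum_divide_distrib)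

lemma avg_nonneg: "(\<And>k. 0 \<le> u k) \<Longrightarrow> 0 \<le> avg u n"
  by (simp add: avg_def sum_nonneg)

lemma avg_Cauchy_Schwarz: "(avg (\<lambda>k. u k * w k) n)\<^sup>2 \<le> avg (\<lambda>k. (u k)\<^sup>2) n * avg (\<lambda>k. (w k)\<^sup>2) n"
  using Cauchy_Schwarz_ineq_sum[of u w "{..<n}"]
  by (simp add: avg_def power_divide power2_eq_square[of "real n"] divide_right_mono)

lemma avg_shift:
  assumes "avg u \<longlonglongrightarrow> c"
  shows "avg (\<lambda>k. u (k + j)) \<longlonglongrightarrow> c"
proof -
  have "(\<lambda>n. avg u (n + j) * (real (n + j) / real n) - (\<Sum>k<j. u k) / real n) \<longlonglongrightarrow> c * 1 - 0"
  proof (intro tendsto_diff tendsto_mult LIMSEQ_ignore_initial_segment[OF assms] lim_const_over_n)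
    show "(\<lambda>n. real (n + j) / real n) \<longlonglongrightarrow> 1" by real_asymp
  qed
  moreover have "eventually (\<lambda>n. avg u (n + j) * (real (n + j) / real n) - (\<Sum>k<j. u k) / real n = avg (\<lambda>k. u (k + j)) n) sequentially"
    using eventually_gt_at_top[of 0]
  proof eventually_elim
    case (elim n)
    have "(\<Sum>k<n + j. u k) = (\<Sum>k<j. u k) + (\<Sum>k<n. u (k + j))"
    proof (induction n)
      case (Suc n) then show ?case by (simp add: add.commute)
    qed simp
    moreover have "avg u (n + j) * (real (n + j) / real n) = (\<Sum>k<n + j. u k) / real n"
      using elim by (simp add: avg_def del: of_nat_add)
    ultimately show ?case by (simp add: avg_def add_divide_distrib)
  qed
  ultimately show ?thesis by (auto elim: Lim_transform_eventually)
qed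

lemma avg_unshift:
  assumes "avg (\<lambda>k. u (k + j)) \<longlonglongrightarrow> c"
  shows "avg u \<longlonglongrightarrow> c"
proof -
  have "(\<lambda>n. avg (\<lambda>k. u (k + j)) n * (real n / real (n + j)) + (\<Sum>k<j. u k) / real (n + j)) \<longlonglongrightarrow> c * 1 + 0"
  proof (intro tendsto_add tendsto_mult assms)
    show "(\<lambda>n. real n / real (n + j)) \<longlonglongrightarrow> 1" by real_asymp
    show "(\<lambda>n. (\<Sum>k<j. u k) / real (n + j)) \<longlonglongrightarrow> 0" by (rule LIMSEQ_ignore_initial_segment[OF lim_const_over_n])
  qed
  moreover have "eventually (\<lambda>n. avg (\<lambda>k. u (k + j)) n * (real n / real (n + j)) + (\<Sum>k<j. u k) / real (n + j) = avg u (n + j)) sequentially"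
    using eventually_gt_at_top[of 0]
  proof eventually_elim
    case (elim n)
    have "(\<Sum>k<n + j. u k) = (\<Sum>k<j. u k) + (\<Sum>k<n. u (k + j))"
    proof (induction n)
      case (Suc n) then show ?case by (simp add: add.commute)
    qed simp
    moreover have "avg (\<lambda>k. u (k + j)) n * (real n / real (n + j)) = (\<Sum>k<n. u (k + j)) / real (n + j)"
      using elim by (simp add: avg_def)
    ultimately show ?case by (simp add: avg_def add_divide_distrib)
  qed
  ultimately have "(\<lambda>n. avg u (n + j)) \<longlonglongrightarrow> c" by (auto elim: Lim_transform_eventually)
  then show ?thesis by (rule LIMSEQ_offset)
qed

text \<open>The difference telescopes to (u_n - u_0) / n. It turns each recursion into an equation
  between limits of averages.\<close>

lemma avg_shift_diff:
  assumes "(\<lambda>n. u n / real n) \<longlonglongrightarrow> 0"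
  shows "(\<lambda>n. avg (\<lambda>k. u (Suc k)) n - avg u n) \<longlonglongrightarrow> 0"
proof -
  have "(\<lambda>n. u n / real n - u 0 / real n) \<longlonglongrightarrow> 0 - 0" by (intro tendsto_diff assms lim_const_over_n)
  moreover have "avg (\<lambda>k. u (Suc k)) n - avg u n = u n / real n - u 0 / real n" for n
    unfolding avg_def by (simp add: sum_lessThan_telescope flip: sum_subtractf diff_divide_distrib)
  ultimately show ?thesis by simp
qed

definition sq_bounded :: "(nat \<Rightarrow> real) \<Rightarrow> bool" where
  "sq_bounded u \<longleftrightarrow> (\<exists>C. \<forall>n. avg (\<lambda>k. (u k)\<^sup>2) n \<le> C)"

text \<open>Negligible in quadratic mean along a path; by Cauchy-Schwarz such sequences leave all
  empirical covariances of square-bounded sequences unchanged.\<close>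

definition null_avg :: "(nat \<Rightarrow> real) \<Rightarrow> bool" where
  "null_avg u \<longleftrightarrow> avg (\<lambda>k. (u k)\<^sup>2) \<longlonglongrightarrow> 0"

lemma sq_boundedI: "avg (\<lambda>k. (u k)\<^sup>2) \<longlonglongrightarrow> c \<Longrightarrow> sq_bounded u"
  using convergent_imp_Bseq[of "avg (\<lambda>k. (u k)\<^sup>2)"] unfolding sq_bounded_def convergent_def Bseq_def
  by (metis abs_le_D1 real_norm_def)

lemma null_imp_bounded: "null_avg u \<Longrightarrow> sq_bounded u"
  unfolding null_avg_def by (rule sq_boundedI)

lemma null_cross:
  assumes u: "null_avg u" and w: "sq_bounded w"
  shows "avg (\<lambda>k. u k * w k) \<longlonglongrightarrow> 0"
proof -
  obtain C where C: "\<And>n. avg (\<lambda>k. (w k)\<^sup>2) n \<le> C" using w by (auto simp: sq_bounded_def)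
  have "(\<lambda>n. (avg (\<lambda>k. u k * w k) n)\<^sup>2) \<longlonglongrightarrow> 0"
  proof (rule tendsto_sandwich[OF _ _ tendsto_const])
    show "\<forall>\<^sub>F n in sequentially. (avg (\<lambda>k. u k * w k) n)\<^sup>2 \<le> avg (\<lambda>k. (u k)\<^sup>2) n * C"
      using avg_Cauchy_Schwarz C avg_nonneg[of "\<lambda>k. (u k)\<^sup>2"]
      by (intro always_eventually allI) (meson mult_left_mono order_trans zero_le_power2)
    show "(\<lambda>n. avg (\<lambda>k. (u k)\<^sup>2) n * C) \<longlonglongrightarrow> 0"
      using tendsto_mult[OF u[unfolded null_avg_def] tendsto_const[of C]] by simp
  qed auto
  then have "(\<lambda>n. sqrt ((avg (\<lambda>k. u k * w k) n)\<^sup>2)) \<longlonglongrightarrow> sqrt 0" by (rule tendsto_real_sqrt)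
  then show ?thesis by (simp add: tendsto_rabs_zero_iff)
qed

lemma null_add: "null_avg u \<Longrightarrow> null_avg w \<Longrightarrow> null_avg (\<lambda>k. u k + w k)"
proof -
  assume u: "null_avg u" and w: "null_avg w"
  have "(\<lambda>n. avg (\<lambda>k. (u k)\<^sup>2) n + 2 * avg (\<lambda>k. u k * w k) n + avg (\<lambda>k. (w k)\<^sup>2) n) \<longlonglongrightarrow> 0 + 2 * 0 + 0"
    using u w null_cross[OF u null_imp_bounded[OF w]] unfolding null_avg_def by (intro tendsto_intros)
  moreover have "avg (\<lambda>k. (u k + w k)\<^sup>2) = (\<lambda>n. avg (\<lambda>k. (u k)\<^sup>2) n + 2 * avg (\<lambda>k. u k * w k) n + avg (\<lambda>k. (w k)\<^sup>2) n)"
    unfolding avg_cmult[symmetric] avg_add[symmetric] by (simp add: power2_eq_square algebra_simps)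
  ultimately show ?thesis unfolding null_avg_def by simp
qed

lemma null_cmult: "null_avg u \<Longrightarrow> null_avg (\<lambda>k. c * u k)"
  unfolding null_avg_def power_mult_distrib avg_cmult using tendsto_mult_right_zero by blast

lemma null_zero: "null_avg (\<lambda>_. 0)"
proof -
  have "avg (\<lambda>k. 0\<^sup>2) = (\<lambda>_. 0)" by (simp add: avg_def fun_eq_iff)
  then show ?thesis by (simp add: null_avg_def)
qed

lemma null_sum: "(\<And>i. i \<in> I \<Longrightarrow> null_avg (u i)) \<Longrightarrow> null_avg (\<lambda>k. \<Sum>i\<in>I. u i k)"
  by (induction I rule: infinite_finite_induct) (auto simp: null_zero intro: null_add)

lemma null_shift: "null_avg u \<Longrightarrow> null_avg (\<lambda>k. u (k + j))"
  unfolding null_avg_def by (rule avg_shift)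

lemma avg_perturb:
  assumes c: "avg (\<lambda>k. u k * w k) \<longlonglongrightarrow> c" and u: "sq_bounded u" and w: "sq_bounded w"
    and u': "null_avg u'" and w': "null_avg w'"
  shows "avg (\<lambda>k. (u k + u' k) * (w k + w' k)) \<longlonglongrightarrow> c"
proof -
  have "(\<lambda>n. avg (\<lambda>k. u k * w k) n + avg (\<lambda>k. w' k * u k) n + avg (\<lambda>k. u' k * w k) n + avg (\<lambda>k. u' k * w' k) n) \<longlonglongrightarrow> c + 0 + 0 + 0"
    by (intro tendsto_intros c null_cross u w u' w' null_imp_bounded)
  moreover have "avg (\<lambda>k. (u k + u' k) * (w k + w' k)) =
      (\<lambda>n. avg (\<lambda>k. u k * w k) n + avg (\<lambda>k. w' k * u k) n + avg (\<lambda>k. u' k * w k) n + avg (\<lambda>k. u' k * w' k) n)"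
    unfolding avg_add[symmetric] by (simp add: algebra_simps)
  ultimately show ?thesis by simp
qed

section \<open>Empirical covariances of a first-order autoregression\<close>

locale ar1_path =
  fixes e v :: "nat \<Rightarrow> real" and \<rho> s2 :: real
  assumes ar: "\<And>k. e (Suc k) = \<rho> * e k + v (Suc k)" and \<rho>: "\<bar>\<rho>\<bar> < 1"
    and vv: "avg (\<lambda>k. (v (Suc k))\<^sup>2) \<longlonglongrightarrow> s2"
    and e_small: "(\<lambda>n. (e n)\<^sup>2 / real n) \<longlonglongrightarrow> 0" and v_small: "(\<lambda>n. (v n)\<^sup>2 / real n) \<longlonglongrightarrow> 0"
    and cross: "\<And>j. 1 \<le> j \<Longrightarrow> avg (\<lambda>k. v (Suc (k + j)) * v (Suc k)) \<longlonglongrightarrow> 0"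
begin

lemma vv': "avg (\<lambda>k. (v (k + j))\<^sup>2) \<longlonglongrightarrow> s2"
proof -
  have "avg (\<lambda>k. (v (k + 1))\<^sup>2) \<longlonglongrightarrow> s2" using vv by simp
  then have "avg (\<lambda>k. (v k)\<^sup>2) \<longlonglongrightarrow> s2" by (rule avg_unshift)
  then show ?thesis by (rule avg_shift)
qed

lemma e_bounded: "sq_bounded e"
proof -
  define B where "B = (e 0)\<^sup>2"
  define W where "W n = (\<Sum>k<n. (v (Suc k))\<^sup>2) / (1 - \<bar>\<rho>\<bar>)" for n
  \<comment> \<open>Convexity of the square with weights |\<rho>| and 1 - |\<rho>|. The factor
    |\<rho>| < 1 lets the sum of e_k^2 be absorbed on the left.\<close>
  have conv: "(\<rho> * x + y)\<^sup>2 \<le> \<bar>\<rho>\<bar> * x\<^sup>2 + y\<^sup>2 / (1 - \<bar>\<rho>\<bar>)" for x y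
  proof -
    define t where "t = \<bar>\<rho>\<bar>"
    have t: "0 \<le> t" "t < 1" using \<rho> by (auto simp: t_def)
    have "(\<rho> * x + y)\<^sup>2 \<le> (t * \<bar>x\<bar> + \<bar>y\<bar>)\<^sup>2"
    proof -
      have "\<bar>\<rho> * x + y\<bar> \<le> t * \<bar>x\<bar> + \<bar>y\<bar>" using abs_triangle_ineq[of "\<rho> * x" y] by (simp add: t_def abs_mult)
      then show ?thesis by (metis abs_ge_zero abs_le_square_iff abs_of_nonneg order_trans power2_abs)
    qed
    also have "(t * \<bar>x\<bar> + \<bar>y\<bar>)\<^sup>2 \<le> t * x\<^sup>2 + y\<^sup>2 / (1 - t)"
    proof -
      have "0 \<le> t * ((1 - t) * \<bar>x\<bar> - \<bar>y\<bar>)\<^sup>2" using t by simp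
      then have "(1 - t) * (t * \<bar>x\<bar> + \<bar>y\<bar>)\<^sup>2 \<le> (1 - t) * (t * x\<^sup>2) + y\<^sup>2"
        by (simp add: power2_eq_square algebra_simps)
      then show ?thesis using t by (simp add: field_simps)
    qed
    finally show ?thesis by (simp add: t_def)
  qed
  have le: "(\<Sum>k<n. (e k)\<^sup>2) \<le> (B + W n) / (1 - \<bar>\<rho>\<bar>)" for n
  proof -
    have "(\<Sum>k<Suc n. (e k)\<^sup>2) = B + (\<Sum>k<n. (e (Suc k))\<^sup>2)"
      by (subst sum.lessThan_Suc_shift) (simp add: B_def)
    also have "\<dots> \<le> B + (\<Sum>k<n. \<bar>\<rho>\<bar> * (e k)\<^sup>2 + (v (Suc k))\<^sup>2 / (1 - \<bar>\<rho>\<bar>))"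
      unfolding ar by (intro add_left_mono sum_mono conv)
    also have "\<dots> = B + \<bar>\<rho>\<bar> * (\<Sum>k<n. (e k)\<^sup>2) + W n"
      by (simp add: sum.distrib sum_distrib_left W_def sum_divide_distrib)
    finally have "(\<Sum>k<n. (e k)\<^sup>2) + (e n)\<^sup>2 \<le> B + \<bar>\<rho>\<bar> * (\<Sum>k<n. (e k)\<^sup>2) + W n" by simp
    moreover have "0 \<le> (e n)\<^sup>2" by simp
    ultimately have "(1 - \<bar>\<rho>\<bar>) * (\<Sum>k<n. (e k)\<^sup>2) \<le> B + W n" by (simp only: left_diff_distrib)
    then show ?thesis using \<rho> by (simp add: pos_le_divide_eq mult.commute)
  qed
  obtain C where C: "\<And>n. avg (\<lambda>k. (v (Suc k))\<^sup>2) n \<le> C" using sq_boundedI[OF vv] by (auto simp: sq_bounded_def)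
  have C0: "0 \<le> C" using C[of 0] by (simp add: avg_def)
  have "avg (\<lambda>k. (e k)\<^sup>2) n \<le> (B + C / (1 - \<bar>\<rho>\<bar>)) / (1 - \<bar>\<rho>\<bar>)" for n
  proof (cases "n = 0")
    case True
    have "0 \<le> (B + C / (1 - \<bar>\<rho>\<bar>)) / (1 - \<bar>\<rho>\<bar>)" using \<rho> C0 by (simp add: B_def)
    then show ?thesis using True by (simp add: avg_def)
  next
    case False
    have "avg (\<lambda>k. (e k)\<^sup>2) n \<le> (B + W n) / (1 - \<bar>\<rho>\<bar>) / real n"
      unfolding avg_def using le[of n] by (intro divide_right_mono) auto
    also have "\<dots> = (B / real n + W n / real n) / (1 - \<bar>\<rho>\<bar>)" by (simp add: add_divide_distrib mult.commute)
    also have "\<dots> \<le> (B + C / (1 - \<bar>\<rho>\<bar>)) / (1 - \<bar>\<rho>\<bar>)"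
    proof (intro divide_right_mono add_mono)
      have "B / real n \<le> B / 1" using False by (intro divide_left_mono) (auto simp: B_def)
      then show "B / real n \<le> B" by simp
      have "W n / real n = avg (\<lambda>k. (v (Suc k))\<^sup>2) n / (1 - \<bar>\<rho>\<bar>)" by (simp add: W_def avg_def)
      also have "\<dots> \<le> C / (1 - \<bar>\<rho>\<bar>)" using C \<rho> by (intro divide_right_mono) auto
      finally show "W n / real n \<le> C / (1 - \<bar>\<rho>\<bar>)" .
    qed (use \<rho> in auto)
    finally show ?thesis .
  qed
  then show ?thesis unfolding sq_bounded_def by blast
qed

lemma e_unroll: "e (k + N) = \<rho> ^ N * e k + (\<Sum>i<N. \<rho> ^ i * v (k + N - i))"
proof (induction N)
  case (Suc N)
  have "(\<Sum>i<Suc N. \<rho> ^ i * v (k + Suc N - i)) = v (Suc (k + N)) + \<rho> * (\<Sum>i<N. \<rho> ^ i * v (k + N - i))"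
    by (subst sum.lessThan_Suc_shift) (simp add: sum_distrib_left mult.assoc)
  then show ?case using ar[of "k + N"] Suc by (simp add: algebra_simps)
qed simp

lemma cross':
  assumes "i < j"
  shows "avg (\<lambda>k. v (k + i) * v (k + j)) \<longlonglongrightarrow> 0"
proof -
  have "avg (\<lambda>k. v (k + 1) * v (k + 1 + (j - i))) \<longlonglongrightarrow> 0"
    using cross[of "j - i"] assms by (simp add: mult.commute)
  then have "avg (\<lambda>k. v k * v (k + (j - i))) \<longlonglongrightarrow> 0" by (rule avg_unshift[of "\<lambda>k. v k * v (k + (j - i))"])
  then have "avg (\<lambda>k. v (k + i) * v (k + i + (j - i))) \<longlonglongrightarrow> 0" by (rule avg_shift)
  then show ?thesis using assms by simp
qed

lemma ev_small: "(\<lambda>n. e n * v (n + j) / real n) \<longlonglongrightarrow> 0"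
proof -
  have v: "(\<lambda>n. (v (n + j))\<^sup>2 / real n) \<longlonglongrightarrow> 0"
  proof -
    have "(\<lambda>n. (v (n + j))\<^sup>2 / real (n + j) * (real (n + j) / real n)) \<longlonglongrightarrow> 0 * 1"
      by (intro tendsto_mult LIMSEQ_ignore_initial_segment[OF v_small]) real_asymp
    moreover have "eventually (\<lambda>n. (v (n + j))\<^sup>2 / real (n + j) * (real (n + j) / real n) = (v (n + j))\<^sup>2 / real n) sequentially"
      using eventually_gt_at_top[of 0] by eventually_elim (simp del: of_nat_add)
    ultimately show ?thesis by (auto elim: Lim_transform_eventually)
  qed
  have "(\<lambda>n. (e n)\<^sup>2 / real n + (v (n + j))\<^sup>2 / real n) \<longlonglongrightarrow> 0 + 0" by (intro tendsto_add e_small v)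
  then have lim: "(\<lambda>n. (e n)\<^sup>2 / real n + (v (n + j))\<^sup>2 / real n) \<longlonglongrightarrow> 0" by simp
  show ?thesis
  proof (rule Lim_null_comparison[OF _ lim], intro always_eventually allI)
    fix n
    have "\<bar>e n * v (n + j)\<bar> \<le> (e n)\<^sup>2 + (v (n + j))\<^sup>2"
    proof -
      have "2 * \<bar>e n * v (n + j)\<bar> \<le> (e n)\<^sup>2 + (v (n + j))\<^sup>2"
        using sum_squares_bound[of "\<bar>e n\<bar>" "\<bar>v (n + j)\<bar>"] by (simp add: abs_mult)
      then show ?thesis using abs_ge_zero[of "e n * v (n + j)"] by linarith
    qed
    then show "norm (e n * v (n + j) / real n) \<le> (e n)\<^sup>2 / real n + (v (n + j))\<^sup>2 / real n"
      by (simp add: abs_mult divide_right_mono flip: add_divide_distrib)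
  qed
qed

text \<open>When the recursion is multiplied by v_(k+1+j) and averaged, the product of two noises
  vanishes and the shift by one is immaterial.\<close>

lemma e_v_step:
  assumes j: "1 \<le> j"
  shows "(\<lambda>n. avg (\<lambda>k. e k * v (k + j)) n - \<rho> * avg (\<lambda>k. e k * v (k + Suc j)) n) \<longlonglongrightarrow> 0"
proof -
  have "(\<lambda>n. avg (\<lambda>k. v (k + 1) * v (k + Suc j)) n - (avg (\<lambda>k. e (Suc k) * v (Suc k + j)) n - avg (\<lambda>k. e k * v (k + j)) n)) \<longlonglongrightarrow> 0 - 0"
    using j by (intro tendsto_diff cross' avg_shift_diff[OF ev_small]) auto
  moreover have "avg (\<lambda>k. e (Suc k) * v (Suc k + j)) n = \<rho> * avg (\<lambda>k. e k * v (k + Suc j)) n + avg (\<lambda>k. v (k + 1) * v (k + Suc j)) n" for n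
    unfolding ar avg_cmult[symmetric] avg_add[symmetric] by (simp add: algebra_simps)
  ultimately show ?thesis by simp
qed

text \<open>Iteration gives a_j close to \<rho>^N a_(j+N) for each fixed N, and Cauchy-Schwarz
  bounds a_(j+N), for large n, by a constant independent of N. Fixing N before n grows avoids any
  uniformity in the lag.\<close>

lemma e_v:
  assumes j: "1 \<le> j"
  shows "avg (\<lambda>k. e k * v (k + j)) \<longlonglongrightarrow> 0"
proof -
  define a where "a j n = avg (\<lambda>k. e k * v (k + j)) n" for j n
  have step: "(\<lambda>n. a j n - \<rho> ^ N * a (j + N) n) \<longlonglongrightarrow> 0" for N
  proof (induction N)
    case (Suc N)
    have "(\<lambda>n. (a j n - \<rho> ^ N * a (j + N) n) + \<rho> ^ N * (a (j + N) n - \<rho> * a (Suc (j + N)) n)) \<longlonglongrightarrow> 0 + \<rho> ^ N * 0"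
      using e_v_step[of "j + N"] j by (intro tendsto_add Suc tendsto_mult tendsto_const) (auto simp: a_def)
    then show ?case by (simp add: algebra_simps)
  qed simp
  obtain C where C: "\<And>n. avg (\<lambda>k. (e k)\<^sup>2) n \<le> C" using e_bounded by (auto simp: sq_bounded_def)
  have C0: "0 \<le> C" using C[of 0] by (simp add: avg_def)
  have s2: "0 \<le> s2" using vv by (rule LIMSEQ_le_const) (simp add: avg_nonneg)
  define D where "D = sqrt (C * (s2 + 1))"
  have "a j \<longlonglongrightarrow> 0"
  proof (rule LIMSEQ_I)
    fix r :: real assume r: "r > 0"
    have "(\<lambda>N. \<bar>\<rho>\<bar> ^ N * D) \<longlonglongrightarrow> 0 * D" using \<rho> by (intro tendsto_intros LIMSEQ_power_zero) auto
    then have "eventually (\<lambda>N. \<bar>\<rho>\<bar> ^ N * D < r / 2) sequentially" using r by (intro order_tendstoD(2)) auto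
    then obtain N where N: "\<bar>\<rho>\<bar> ^ N * D < r / 2" by (auto simp: eventually_sequentially)
    have ev1: "eventually (\<lambda>n. \<bar>a j n - \<rho> ^ N * a (j + N) n\<bar> < r / 2) sequentially"
      using tendstoD[OF step[of N], of "r / 2"] r by (simp add: dist_real_def)
    have "eventually (\<lambda>n. avg (\<lambda>k. (v (k + (j + N)))\<^sup>2) n < s2 + 1) sequentially"
      using vv' by (intro order_tendstoD(2)) auto
    then have ev2: "eventually (\<lambda>n. \<bar>a (j + N) n\<bar> \<le> D) sequentially"
    proof eventually_elim
      case (elim n)
      have "(a (j + N) n)\<^sup>2 \<le> avg (\<lambda>k. (e k)\<^sup>2) n * avg (\<lambda>k. (v (k + (j + N)))\<^sup>2) n"
        unfolding a_def by (rule avg_Cauchy_Schwarz)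
      also have "\<dots> \<le> C * (s2 + 1)" using C elim C0 by (intro mult_mono avg_nonneg) auto
      finally show ?case unfolding D_def by (metis real_sqrt_abs real_sqrt_le_iff)
    qed
    have "eventually (\<lambda>n. norm (a j n - 0) < r) sequentially"
      using ev1 ev2
    proof eventually_elim
      case (elim n)
      have "\<bar>\<rho> ^ N * a (j + N) n\<bar> \<le> \<bar>\<rho>\<bar> ^ N * D" using elim by (simp add: abs_mult power_abs mult_left_mono)
      then show ?case using elim N unfolding real_norm_def by linarith
    qed
    then show "\<exists>no. \<forall>n\<ge>no. norm (a j n - 0) < r" by (simp add: eventually_sequentially)
  qed
  then show ?thesis by (simp add: a_def[abs_def])
qed

text \<open>Squaring the recursion expresses the average of e^2, for each n, exactly through
  quantities with known limits, so its convergence is not presupposed.\<close>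

lemma e_e: "avg (\<lambda>k. (e k)\<^sup>2) \<longlonglongrightarrow> s2 / (1 - \<rho>\<^sup>2)"
proof -
  have \<rho>2: "\<rho>\<^sup>2 < 1" using \<rho> by (simp add: abs_square_less_1)
  have "(\<lambda>n. (2 * \<rho> * avg (\<lambda>k. e k * v (k + 1)) n + avg (\<lambda>k. (v (Suc k))\<^sup>2) n - (avg (\<lambda>k. (e (Suc k))\<^sup>2) n - avg (\<lambda>k. (e k)\<^sup>2) n)) / (1 - \<rho>\<^sup>2))
      \<longlonglongrightarrow> (2 * \<rho> * 0 + s2 - 0) / (1 - \<rho>\<^sup>2)"
    using \<rho>2 by (intro tendsto_divide tendsto_diff tendsto_add tendsto_mult tendsto_const e_v vv avg_shift_diff[OF e_small]) auto
  moreover have "(2 * \<rho> * avg (\<lambda>k. e k * v (k + 1)) n + avg (\<lambda>k. (v (Suc k))\<^sup>2) n - (avg (\<lambda>k. (e (Suc k))\<^sup>2) n - avg (\<lambda>k. (e k)\<^sup>2) n)) / (1 - \<rho>\<^sup>2)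
      = avg (\<lambda>k. (e k)\<^sup>2) n" for n
  proof -
    have "avg (\<lambda>k. (e (Suc k))\<^sup>2) n = \<rho>\<^sup>2 * avg (\<lambda>k. (e k)\<^sup>2) n + (2 * \<rho> * avg (\<lambda>k. e k * v (k + 1)) n + avg (\<lambda>k. (v (Suc k))\<^sup>2) n)"
      unfolding ar avg_cmult[symmetric] avg_add[symmetric] by (simp add: power2_eq_square algebra_simps)
    then show ?thesis using \<rho>2 by (simp add: field_simps)
  qed
  ultimately show ?thesis by simp
qed

end

subsection \<open>The controlled process along a trajectory\<close>

text \<open>A triangular square root of \<Lambda>. Row c holds the coefficients of regressor
  coordinate c in the limiting orthogonal system: the noises of the last p + 1 times, then the
  normalised older autoregressive noise. It yields the regularity of \<Lambda> and an explicit
  Gaussian limit.\<close>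

definition Lambda_factor :: "nat \<Rightarrow> (nat \<Rightarrow> real) \<Rightarrow> real \<Rightarrow> nat \<Rightarrow> nat \<Rightarrow> real" where
  "Lambda_factor p \<theta> \<rho> c l =
     (if c \<le> p then (if l = c then 1 else 0)
      else if l = 0 then 0 else if l \<le> p then - (\<theta> l + \<rho> ^ l) else - (\<rho> ^ (p + 1)) / sqrt (1 - \<rho>\<^sup>2))"

lemma Lambda_factorization:
  assumes \<rho>: "\<bar>\<rho>\<bar> < 1" and i: "i < p + 2" and j: "j < p + 2"
  shows "Lambda_mat p \<theta> \<rho> $$ (i, j) = (\<Sum>l<p+2. Lambda_factor p \<theta> \<rho> i l * Lambda_factor p \<theta> \<rho> j l)"
proof -
  have \<rho>2: "\<rho>\<^sup>2 < 1" using \<rho> by (simp add: abs_square_less_1)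
  have pick: "(\<Sum>l<p+2. (if l = c then 1 else 0) * g l) = g c" if "c < p + 2" for c and g :: "nat \<Rightarrow> real"
    using that by (simp add: if_distrib[of "\<lambda>y. y * _"] cong: if_cong)
  have H: "(\<Sum>l<p+2. Lambda_factor p \<theta> \<rho> (p+1) l * Lambda_factor p \<theta> \<rho> (p+1) l) = H_const p \<theta> \<rho>"
  proof -
    have "(\<Sum>l<p+2. Lambda_factor p \<theta> \<rho> (p+1) l * Lambda_factor p \<theta> \<rho> (p+1) l) =
        (\<Sum>l<p+1. Lambda_factor p \<theta> \<rho> (p+1) l * Lambda_factor p \<theta> \<rho> (p+1) l) + (\<rho> ^ (p + 1) / sqrt (1 - \<rho>\<^sup>2))\<^sup>2"
      by (simp add: Lambda_factor_def power2_eq_square)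
    also have "(\<rho> ^ (p + 1) / sqrt (1 - \<rho>\<^sup>2))\<^sup>2 = \<rho> ^ (2 * (p + 1)) / (1 - \<rho>\<^sup>2)"
      using \<rho>2 by (simp add: power_divide power_mult[symmetric] mult.commute del: power_Suc)
    also have "(\<Sum>l<p+1. Lambda_factor p \<theta> \<rho> (p+1) l * Lambda_factor p \<theta> \<rho> (p+1) l) = (\<Sum>l=1..p. (\<theta> l + \<rho> ^ l)\<^sup>2)"
    proof -
      have "(\<Sum>l<p+1. Lambda_factor p \<theta> \<rho> (p+1) l * Lambda_factor p \<theta> \<rho> (p+1) l) = (\<Sum>l\<in>{1..p}. Lambda_factor p \<theta> \<rho> (p+1) l * Lambda_factor p \<theta> \<rho> (p+1) l)"
        by (intro sum.mono_neutral_right) (auto simp: Lambda_factor_def)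
      also have "\<dots> = (\<Sum>l=1..p. (\<theta> l + \<rho> ^ l)\<^sup>2)"
        by (intro sum.cong) (auto simp: Lambda_factor_def power2_eq_square algebra_simps)
      finally show ?thesis .
    qed
    finally show ?thesis by (simp add: H_const_def)
  qed
  consider "i \<le> p" "j \<le> p" | "i \<le> p" "j = p + 1" | "i = p + 1" "j \<le> p" | "i = p + 1" "j = p + 1"
    using i j by linarith
  then show ?thesis
  proof cases
    case 1
    have "(\<Sum>l<p+2. Lambda_factor p \<theta> \<rho> i l * Lambda_factor p \<theta> \<rho> j l) = (\<Sum>l<p+2. (if l = i then 1 else 0) * Lambda_factor p \<theta> \<rho> j l)"
      using 1 by (intro sum.cong) (auto simp: Lambda_factor_def)
    also have "\<dots> = Lambda_factor p \<theta> \<rho> j i" by (rule pick[OF i])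
    finally show ?thesis using 1 by (auto simp: Lambda_mat_def Lambda_factor_def)
  next
    case 2
    have "(\<Sum>l<p+2. Lambda_factor p \<theta> \<rho> i l * Lambda_factor p \<theta> \<rho> j l) = (\<Sum>l<p+2. (if l = i then 1 else 0) * Lambda_factor p \<theta> \<rho> j l)"
      using 2 by (intro sum.cong) (auto simp: Lambda_factor_def)
    also have "\<dots> = Lambda_factor p \<theta> \<rho> j i" by (rule pick[OF i])
    finally show ?thesis using 2 by (auto simp: Lambda_mat_def Lambda_factor_def K_row_def)
  next
    case 3
    have "(\<Sum>l<p+2. Lambda_factor p \<theta> \<rho> i l * Lambda_factor p \<theta> \<rho> j l) = (\<Sum>l<p+2. (if l = j then 1 else 0) * Lambda_factor p \<theta> \<rho> i l)"
      using 3 by (intro sum.cong) (auto simp: Lambda_factor_def)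
    also have "\<dots> = Lambda_factor p \<theta> \<rho> i j" by (rule pick[OF j])
    finally show ?thesis using 3 by (auto simp: Lambda_mat_def Lambda_factor_def K_row_def)
  next
    case 4
    then show ?thesis using H by (simp add: Lambda_mat_def K_row_def)
  qed
qed

text \<open>Coordinate j \<le> p is \<theta>_(j+1) - \<rho> \<theta>_j under the conventions
  \<theta>_0 = -1 and \<theta>_(p+1) = 0.\<close>

definition true_param :: "nat \<Rightarrow> (nat \<Rightarrow> real) \<Rightarrow> real \<Rightarrow> real vec" where
  "true_param p \<theta> \<rho> = vec (p + 2) (\<lambda>j. if j = p + 1 then - \<rho>
     else (if j < p then \<theta> (j + 1) else 0) - \<rho> * (if j = 0 then - 1 else \<theta> j))"

locale arx_path =
  fixes p d :: nat and \<theta> :: "nat \<Rightarrow> real" and \<rho> :: real and X U :: "int \<Rightarrow> real"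
    and \<epsilon> V x :: "nat \<Rightarrow> real" and \<Phi> vh :: "nat \<Rightarrow> real vec"
  assumes p: "1 \<le> p" and d: "d = p + 2" and \<rho>: "\<bar>\<rho>\<bar> < 1"
    and model: "\<And>n. X (int n + 1) = (\<Sum>k=1..p. \<theta> k * X (int n - int k + 1)) + U (int n) + \<epsilon> (n + 1)"
    and noise: "\<And>n. \<epsilon> (n + 1) = \<rho> * \<epsilon> n + V (n + 1)"
    and \<Phi>: "\<And>n. \<Phi> n = vec d (\<lambda>j. if j \<le> p then X (int n - int j) else U (int n - 1))"
    and vh0: "vh 0 \<in> carrier_vec d"
    and lse: "\<And>n. vh (n + 1) = vh n + (X (int n + 1) - U (int n) - vh n \<bullet> \<Phi> n) \<cdot>\<^sub>v
               (inv_mat (gram_matrix d \<Phi> n) *\<^sub>v \<Phi> n)"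
    and control: "\<And>n. 1 \<le> n \<Longrightarrow> U (int n) = x (n + 1) - vh n \<bullet> \<Phi> n"
begin

abbreviation "vt \<equiv> true_param p \<theta> \<rho>"

sublocale gram d \<Phi> by unfold_locales (simp add: \<Phi>)

lemma vt_carrier [simp]: "vt \<in> carrier_vec d" by (simp add: true_param_def d)

lemma vh_carrier [simp]: "vh n \<in> carrier_vec d"
proof (induction n)
  case (Suc n)
  have "T n *\<^sub>v \<Phi> n \<in> carrier_vec d" using dim by (auto intro!: mult_mat_vec_carrier)
  then show ?case using lse[of n] Suc by (simp add: T_def S_def)
qed (rule vh0)

lemma dim_vec_params [simp]: "dim_vec vt = d" "dim_vec (vh n) = d"
  using vt_carrier vh_carrier[of n] by (auto simp only: carrier_vecD)

definition "e n = vh n - vt"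

lemma e_carrier [simp]: "e n \<in> carrier_vec d" unfolding e_def by (intro minus_carrier_vec) simp_all

lemma \<Phi>_index: "j \<le> p \<Longrightarrow> \<Phi> n $ j = X (int n - int j)" "\<Phi> n $ (p + 1) = U (int n - 1)"
  by (simp_all add: \<Phi> d)

text \<open>The noise \<epsilon>_n is eliminated through the model equation at time n - 1, available
  only for n \<ge> 1; this fixes where the later sums begin.\<close>

lemma regression:
  assumes n: "1 \<le> n"
  shows "X (int n + 1) = vt \<bullet> \<Phi> n + U (int n) + V (n + 1)"
proof -
  obtain m where m: "n = m + 1" using n by (cases n) auto
  have "vt \<bullet> \<Phi> n = (\<Sum>j<p+2. vt $ j * \<Phi> n $ j)"
    using dim[of n] by (simp add: scalar_prod_def atLeast0LessThan d)
  also have "\<dots> = (\<Sum>j<p+1. vt $ j * \<Phi> n $ j) - \<rho> * U (int n - 1)"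
    using \<Phi>_index(2) by (simp add: true_param_def)
  also have "(\<Sum>j<p+1. vt $ j * \<Phi> n $ j) =
      (\<Sum>j<p+1. (if j < p then \<theta> (j + 1) else 0) * X (int n - int j)) - \<rho> * (\<Sum>j<p+1. (if j = 0 then - 1 else \<theta> j) * X (int n - int j))"
    unfolding sum_distrib_left sum_subtractf[symmetric]
    by (intro sum.cong) (auto simp: true_param_def \<Phi>_index(1) algebra_simps)
  also have "(\<Sum>j<p+1. (if j < p then \<theta> (j + 1) else 0) * X (int n - int j)) = (\<Sum>k=1..p. \<theta> k * X (int n - int k + 1))"
  proof -
    have "(\<Sum>j<p+1. (if j < p then \<theta> (j + 1) else 0) * X (int n - int j)) = (\<Sum>j<p. \<theta> (Suc j) * X (int n - int (Suc j) + 1))"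
      by simp
    also have "\<dots> = (\<Sum>k\<in>Suc ` {..<p}. \<theta> k * X (int n - int k + 1))"
      by (subst sum.reindex) auto
    also have "Suc ` {..<p} = {1..p}" by (simp add: image_Suc_lessThan)
    finally show ?thesis .
  qed
  also have "(\<Sum>j<p+1. (if j = 0 then - 1 else \<theta> j) * X (int n - int j)) = - X (int n) + (\<Sum>k=1..p. \<theta> k * X (int n - int k))"
  proof -
    have "(\<Sum>j<p+1. (if j = 0 then - 1 else \<theta> j) * X (int n - int j)) = (\<Sum>j\<in>insert 0 {1..p}. (if j = 0 then - 1 else \<theta> j) * X (int n - int j))"
      by (intro sum.cong) auto
    also have "\<dots> = - X (int n) + (\<Sum>k=1..p. (if k = 0 then - 1 else \<theta> k) * X (int n - int k))" by simp
    also have "(\<Sum>k=1..p. (if k = 0 then - 1 else \<theta> k) * X (int n - int k)) = (\<Sum>k=1..p. \<theta> k * X (int n - int k))"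
      by (intro sum.cong) auto
    finally show ?thesis .
  qed
  also have "(\<Sum>k=1..p. \<theta> k * X (int n - int k)) = X (int n) - U (int n - 1) - \<epsilon> n"
    using model[of m] by (simp add: m algebra_simps)
  finally have "vt \<bullet> \<Phi> n = (\<Sum>k=1..p. \<theta> k * X (int n - int k + 1)) + \<rho> * \<epsilon> n" by (simp add: algebra_simps)
  then show ?thesis using model[of n] noise[of n] by simp
qed

lemma innovation: "1 \<le> n \<Longrightarrow> X (int n + 1) - U (int n) - vh n \<bullet> \<Phi> n = V (n + 1) - e n \<bullet> \<Phi> n"
  using regression[of n] dim[of n] minus_scalar_prod_distrib[OF vh_carrier vt_carrier dim[of n], of n] by (simp add: e_def)

text \<open>The control cancels the whole predicted part of the output. Large outputs can therefore
  be traced back to prediction errors.\<close>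

lemma tracking: "1 \<le> n \<Longrightarrow> X (int n + 1) = x (n + 1) - e n \<bullet> \<Phi> n + V (n + 1)"
  using innovation[of n] control[of n] by simp

lemma e_step:
  assumes n: "1 \<le> n"
  shows "e (n + 1) = e n + (V (n + 1) - e n \<bullet> \<Phi> n) \<cdot>\<^sub>v (T n *\<^sub>v \<Phi> n)"
proof -
  define w where "w = T n *\<^sub>v \<Phi> n"
  define g where "g = V (n + 1) - e n \<bullet> \<Phi> n"
  have w: "w \<in> carrier_vec d" using dim by (auto simp: w_def intro!: mult_mat_vec_carrier)
  have "vh (n + 1) = vh n + g \<cdot>\<^sub>v w"
    using lse[of n] innovation[OF n] by (simp add: T_def S_def w_def g_def)
  then have "e (n + 1) = e n + g \<cdot>\<^sub>v w" unfolding e_def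
    using w by (intro eq_vecI) auto
  then show ?thesis by (simp add: w_def g_def)
qed

text \<open>The sum starts at 1 because the regression is available only from time 1; the constant
  vector S_0 e_1 absorbs the arbitrary first step and disappears after division by sqrt n.\<close>

lemma normal_eq:
  assumes i: "i < d"
  shows "(S n *\<^sub>v e (Suc n)) $ i = (S 0 *\<^sub>v e 1) $ i + (\<Sum>k=1..n. \<Phi> k $ i * V (Suc k))"
proof (induction n)
  case (Suc n)
  have "S (Suc n) *\<^sub>v e (Suc (Suc n)) = S n *\<^sub>v e (Suc n) + V (Suc (Suc n)) \<cdot>\<^sub>v \<Phi> (Suc n)"
    using e_step[of "Suc n"] by (intro normal_eq_step) simp_all
  then show ?case using Suc i dim[of "Suc n"] S_carrier[of n] by (simp del: index_mult_mat_vec)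
qed simp

lemma lyapunov:
  "e (Suc (Suc n)) \<bullet> (S (Suc n) *\<^sub>v e (Suc (Suc n))) = e (Suc n) \<bullet> (S n *\<^sub>v e (Suc n))
     - (1 - f (Suc n)) * (e (Suc n) \<bullet> \<Phi> (Suc n))\<^sup>2
     + 2 * ((1 - f (Suc n)) * (e (Suc n) \<bullet> \<Phi> (Suc n))) * V (Suc (Suc n)) + f (Suc n) * (V (Suc (Suc n)))\<^sup>2"
  using e_step[of "Suc n"] by (intro lyapunov_step) simp_all

text \<open>The Lyapunov identity for a fictitious step with zero noise, whose result is again
  nonnegative. It will bound the squared coefficient of the martingale term.\<close>

lemma lyapunov_dominates: "(1 - f (Suc n)) * (e (Suc n) \<bullet> \<Phi> (Suc n))\<^sup>2 \<le> e (Suc n) \<bullet> (S n *\<^sub>v e (Suc n))"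
proof -
  define e' where "e' = e (Suc n) + (0 - e (Suc n) \<bullet> \<Phi> (Suc n)) \<cdot>\<^sub>v (T (Suc n) *\<^sub>v \<Phi> (Suc n))"
  have "T (Suc n) *\<^sub>v \<Phi> (Suc n) \<in> carrier_vec d" using dim by (auto intro!: mult_mat_vec_carrier)
  then have "e' \<in> carrier_vec d" unfolding e'_def using e_carrier[of "Suc n"] by (intro add_carrier_vec) auto
  then have "0 \<le> e' \<bullet> (S (Suc n) *\<^sub>v e')" by (rule lyapunov_nonneg)
  then show ?thesis using lyapunov_step[OF e_carrier e'_def] by simp
qed

end

section \<open>Almost sure limits along one trajectory\<close>

locale arx_path_limit = arx_path +
  fixes \<gamma> \<eta> \<tau> A Cb s2 :: real and m :: nat
  assumes \<gamma>: "0 < \<gamma>" "\<gamma> < 1"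
    and V_bd: "\<And>n. 1 \<le> n \<Longrightarrow> \<bar>V n\<bar> \<le> Cb * real n powr (\<gamma> / 2)"
    and x_bd: "\<And>n. 1 \<le> n \<Longrightarrow> \<bar>x n\<bar> \<le> Cb * real n powr (\<gamma> / 2)"
    and x_avg: "avg (\<lambda>k. (x (Suc k))\<^sup>2) \<longlonglongrightarrow> 0"
    and V_avg: "avg (\<lambda>k. (V (Suc k))\<^sup>2) \<longlonglongrightarrow> s2"
    and V_cross: "\<And>j. 1 \<le> j \<Longrightarrow> avg (\<lambda>k. V (Suc (k + j)) * V (Suc k)) \<longlonglongrightarrow> 0"
    and A: "\<And>n. (\<Sum>k=1..n. (e k \<bullet> \<Phi> k)\<^sup>2 * r (k - 1) / r k powr (1 + \<eta>)) \<le> A"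
    and \<tau>: "0 < \<tau>" "8 * \<tau> \<le> 1 - \<gamma>"
    and m: "1 \<le> m" "real d \<le> real m * \<tau> / 2" and \<eta>: "0 < \<eta>" "\<eta> * real m * real d \<le> \<tau> / 2"
begin

lemma Cb: "0 \<le> Cb" using V_bd[of 1] by simp

lemma pow1: "1 \<le> n \<Longrightarrow> 1 \<le> real n powr (\<gamma> / 2)"
  using \<gamma> by (intro ge_one_powr_ge_zero) auto

lemma \<epsilon>_bd: obtains D where "0 \<le> D" "\<And>n. 1 \<le> n \<Longrightarrow> \<bar>\<epsilon> n\<bar> \<le> D * real n powr (\<gamma> / 2)"
proof -
  \<comment> \<open>The fixed point of D = |\<rho>| D + |\<epsilon>_0| + Cb, which reproduces itself
    in the induction.\<close>
  define D where "D = (\<bar>\<epsilon> 0\<bar> + Cb) / (1 - \<bar>\<rho>\<bar>)"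
  have D0: "0 \<le> D" using \<rho> Cb by (simp add: D_def)
  have D: "\<bar>\<rho>\<bar> * D + (\<bar>\<epsilon> 0\<bar> + Cb) = D"
  proof -
    have "(1 - \<bar>\<rho>\<bar>) * D = \<bar>\<epsilon> 0\<bar> + Cb" using \<rho> by (simp add: D_def)
    then show ?thesis by (simp add: algebra_simps)
  qed
  have D2: "\<bar>\<epsilon> 0\<bar> \<le> D"
  proof -
    have "(\<bar>\<epsilon> 0\<bar> + Cb) / 1 \<le> D" unfolding D_def using \<rho> Cb by (intro divide_left_mono) auto
    then show ?thesis using Cb by simp
  qed
  have "\<bar>\<epsilon> (Suc n)\<bar> \<le> D * real (Suc n) powr (\<gamma> / 2)" for n
  proof (induction n)
    case 0
    have "\<bar>\<epsilon> 1\<bar> \<le> \<bar>\<rho>\<bar> * \<bar>\<epsilon> 0\<bar> + \<bar>V 1\<bar>" using noise[of 0] abs_triangle_ineq[of "\<rho> * \<epsilon> 0" "V 1"] by (simp add: abs_mult)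
    also have "\<dots> \<le> \<bar>\<rho>\<bar> * D + (\<bar>\<epsilon> 0\<bar> + Cb)" using V_bd[of 1] D2 by (intro add_mono mult_left_mono) auto
    finally show ?case using D by simp
  next
    case (Suc n)
    define b where "b = real (Suc (Suc n)) powr (\<gamma> / 2)"
    have b1: "1 \<le> b" unfolding b_def by (rule pow1) simp
    have "\<bar>\<epsilon> (Suc (Suc n))\<bar> \<le> \<bar>\<rho>\<bar> * \<bar>\<epsilon> (Suc n)\<bar> + \<bar>V (Suc (Suc n))\<bar>"
      using noise[of "Suc n"] abs_triangle_ineq[of "\<rho> * \<epsilon> (Suc n)" "V (Suc (Suc n))"] by (simp add: abs_mult)
    also have "\<dots> \<le> \<bar>\<rho>\<bar> * (D * b) + Cb * b"
    proof (intro add_mono mult_left_mono)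
      have "D * real (Suc n) powr (\<gamma> / 2) \<le> D * b" unfolding b_def using D0 \<gamma> by (intro mult_left_mono powr_mono2) auto
      then show "\<bar>\<epsilon> (Suc n)\<bar> \<le> D * b" using Suc by linarith
      show "\<bar>V (Suc (Suc n))\<bar> \<le> Cb * b" unfolding b_def by (rule V_bd) simp
    qed simp
    also have "\<dots> \<le> (\<bar>\<rho>\<bar> * D + (\<bar>\<epsilon> 0\<bar> + Cb)) * b" using b1 by (simp add: algebra_simps)
    finally show ?case unfolding D b_def .
  qed
  then have "\<bar>\<epsilon> n\<bar> \<le> D * real n powr (\<gamma> / 2)" if "1 \<le> n" for n using that by (cases n) auto
  then show ?thesis using that D0 by blast
qed

lemma pow_sq: "(real n powr (\<gamma> / 2))\<^sup>2 = real n powr \<gamma>"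
  by (simp add: power2_eq_square flip: powr_add)

lemma small_of_bound:
  assumes "\<And>n. 1 \<le> n \<Longrightarrow> \<bar>u n\<bar> \<le> D * real n powr (\<gamma> / 2)"
  shows "(\<lambda>n. (u n)\<^sup>2 / real n) \<longlonglongrightarrow> 0"
proof -
  have "(\<lambda>n. real n powr (- (1 - \<gamma>))) \<longlonglongrightarrow> 0" using \<gamma> by (intro tendsto_neg_powr filterlim_real_sequentially) auto
  then have lim: "(\<lambda>n. D\<^sup>2 * real n powr (- (1 - \<gamma>))) \<longlonglongrightarrow> 0" using tendsto_mult_right_zero by blast
  show ?thesis
  proof (rule Lim_null_comparison[OF _ lim])
    show "\<forall>\<^sub>F n in sequentially. norm ((u n)\<^sup>2 / real n) \<le> D\<^sup>2 * real n powr (- (1 - \<gamma>))"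
      using eventually_ge_at_top[of 1]
    proof eventually_elim
      case (elim n)
      have "(u n)\<^sup>2 = \<bar>u n\<bar>\<^sup>2" by simp
      also have "\<dots> \<le> (D * real n powr (\<gamma> / 2))\<^sup>2" using assms[OF elim] by (intro power_mono) auto
      also have "\<dots> = D\<^sup>2 * real n powr \<gamma>" by (simp only: power_mult_distrib pow_sq)
      finally have "(u n)\<^sup>2 / real n \<le> D\<^sup>2 * real n powr \<gamma> / real n" by (intro divide_right_mono) auto
      also have "\<dots> = D\<^sup>2 * real n powr (- (1 - \<gamma>))" using elim by (simp add: powr_diff powr_minus field_simps)
      finally show ?case by simp
    qed
  qed
qed

sublocale ar: ar1_path \<epsilon> V \<rho> s2
proof
  obtain D where D: "\<And>n. 1 \<le> n \<Longrightarrow> \<bar>\<epsilon> n\<bar> \<le> D * real n powr (\<gamma> / 2)" using \<epsilon>_bd by blast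
  show "(\<lambda>n. (\<epsilon> n)\<^sup>2 / real n) \<longlonglongrightarrow> 0" using D by (rule small_of_bound)
  show "(\<lambda>n. (V n)\<^sup>2 / real n) \<longlonglongrightarrow> 0" using V_bd by (rule small_of_bound)
  show "\<epsilon> (Suc k) = \<rho> * \<epsilon> k + V (Suc k)" for k using noise[of k] by simp
qed (fact \<rho> V_avg V_cross)+

text \<open>The growth argument applies because U_(n-1) can be read off the model equation:
  |\<Phi>_n|^2 is then controlled by \<epsilon>_n and the largest of |X_n|, ..., |X_(n-p)|, and that
  entry is, by \<open>tracking\<close>, an earlier prediction error up to reference and
  noise.\<close>

lemma prediction_null: "null_avg (\<lambda>k. e (Suc k) \<bullet> \<Phi> (Suc k))"
proof -
  obtain D where D: "0 \<le> D" "\<And>n. 1 \<le> n \<Longrightarrow> \<bar>\<epsilon> n\<bar> \<le> D * real n powr (\<gamma> / 2)" using \<epsilon>_bd by blast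
  define Th where "Th = (\<Sum>k=1..p. \<bar>\<theta> k\<bar>)"
  have Th: "0 \<le> Th" by (simp add: Th_def sum_nonneg)
  define C0 where "C0 = real (p + 1) + 2 * (1 + Th)\<^sup>2"
  define C1 where "C1 = 3 * C0 + 6 * C0 * Cb\<^sup>2 + 2 * D\<^sup>2 + 1"
  have C0: "0 \<le> C0" by (simp add: C0_def)
  have rec: "\<exists>j\<in>{1..p+1}. \<Phi> n \<bullet> \<Phi> n \<le> C1 * ((e (n - j) \<bullet> \<Phi> (n - j))\<^sup>2 + real n powr \<gamma>)" if n: "p + 2 \<le> n" for n
  proof -
    define Mx where "Mx = Max ((\<lambda>j. \<bar>X (int n - int j)\<bar>) ` {..p})"
    have Mx: "\<bar>X (int n - int j)\<bar> \<le> Mx" if "j \<le> p" for j unfolding Mx_def using that by (intro Max_ge) auto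
    have "Mx \<in> (\<lambda>j. \<bar>X (int n - int j)\<bar>) ` {..p}" unfolding Mx_def by (intro Max_in) auto
    then obtain j where j: "j \<le> p" "Mx = \<bar>X (int n - int j)\<bar>" by auto
    have Mx0: "0 \<le> Mx" using j by simp
    obtain n' where n': "n = n' + 1" using n by (cases n) auto
    define U' where "U' = U (int n - 1)"
    have "X (int n' + 1) = (\<Sum>k=1..p. \<theta> k * X (int n' - int k + 1)) + U (int n') + \<epsilon> (n' + 1)" by (rule model)
    then have U: "U' = X (int n) - (\<Sum>k=1..p. \<theta> k * X (int n - int k)) - \<epsilon> n"
      by (simp add: U'_def n' algebra_simps)
    have "\<bar>\<Sum>k=1..p. \<theta> k * X (int n - int k)\<bar> \<le> (\<Sum>k=1..p. \<bar>\<theta> k\<bar> * Mx)"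
      using Mx by (intro order_trans[OF sum_abs] sum_mono) (auto simp: abs_mult intro!: mult_left_mono)
    then have "\<bar>\<Sum>k=1..p. \<theta> k * X (int n - int k)\<bar> \<le> Th * Mx" by (simp add: Th_def sum_distrib_right)
    then have "\<bar>U'\<bar> \<le> (1 + Th) * Mx + \<bar>\<epsilon> n\<bar>"
      using Mx[of 0] unfolding U by (simp add: algebra_simps)
    then have "\<bar>U'\<bar>\<^sup>2 \<le> ((1 + Th) * Mx + \<bar>\<epsilon> n\<bar>)\<^sup>2" by (intro power_mono) auto
    also have "\<dots> \<le> 2 * ((1 + Th) * Mx)\<^sup>2 + 2 * \<bar>\<epsilon> n\<bar>\<^sup>2"
      using sum_squares_bound[of "(1 + Th) * Mx" "\<bar>\<epsilon> n\<bar>"] by (simp add: power2_sum)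
    finally have U2: "U'\<^sup>2 \<le> 2 * (1 + Th)\<^sup>2 * Mx\<^sup>2 + 2 * (\<epsilon> n)\<^sup>2" by (simp add: power_mult_distrib)
    have "\<Phi> n \<bullet> \<Phi> n = (\<Sum>j<p+2. (\<Phi> n $ j)\<^sup>2)"
      using dim[of n] by (simp add: scalar_prod_def atLeast0LessThan power2_eq_square d)
    also have "\<dots> = (\<Sum>j<p+1. (\<Phi> n $ j)\<^sup>2) + U'\<^sup>2" using \<Phi>_index(2)[of n] by (simp add: U'_def)
    also have "(\<Sum>j<p+1. (\<Phi> n $ j)\<^sup>2) \<le> (\<Sum>j<p+1. Mx\<^sup>2)"
      using Mx Mx0 by (intro sum_mono) (auto simp: \<Phi>_index(1) abs_le_square_iff[symmetric])
    finally have y: "\<Phi> n \<bullet> \<Phi> n \<le> C0 * Mx\<^sup>2 + 2 * (\<epsilon> n)\<^sup>2" using U2 by (simp add: C0_def algebra_simps)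
    \<comment> \<open>X_(n-j) results from the prediction at time n - j - 1, whence the lags 1 to p
      + 1; n \<ge> p + 2 keeps that time at least 1, where \<open>tracking\<close> holds.\<close>
    define k where "k = n - (j + 1)"
    have k: "1 \<le> k" "int n - int j = int k + 1" "k + 1 \<le> n" using j n by (auto simp: k_def)
    define z where "z = e k \<bullet> \<Phi> k"
    have Xk: "X (int n - int j) = x (k + 1) - z + V (k + 1)" unfolding k(2) z_def by (rule tracking[OF k(1)])
    have bnd: "w\<^sup>2 \<le> Cb\<^sup>2 * real n powr \<gamma>" if "\<bar>w\<bar> \<le> Cb * real (k + 1) powr (\<gamma> / 2)" for w
    proof -
      have "Cb * real (k + 1) powr (\<gamma> / 2) \<le> Cb * real n powr (\<gamma> / 2)"
        using Cb k \<gamma> by (intro mult_left_mono powr_mono2) auto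
      then have "\<bar>w\<bar>\<^sup>2 \<le> (Cb * real n powr (\<gamma> / 2))\<^sup>2" using that by (intro power_mono) auto
      then show ?thesis by (simp only: power2_abs power_mult_distrib pow_sq)
    qed
    have "(x (k + 1) - z + V (k + 1))\<^sup>2 \<le> 3 * ((x (k + 1))\<^sup>2 + z\<^sup>2 + (V (k + 1))\<^sup>2)"
    proof -
      have "0 \<le> (x (k + 1) + z)\<^sup>2 + (x (k + 1) - V (k + 1))\<^sup>2 + (z + V (k + 1))\<^sup>2" by simp
      then show ?thesis by (simp add: power2_eq_square algebra_simps)
    qed
    also have "\<dots> \<le> 3 * (Cb\<^sup>2 * real n powr \<gamma> + z\<^sup>2 + Cb\<^sup>2 * real n powr \<gamma>)"
      using bnd[OF x_bd[of "k + 1"]] bnd[OF V_bd[of "k + 1"]] by (intro mult_left_mono add_mono) auto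
    finally have Mx2: "Mx\<^sup>2 \<le> 3 * z\<^sup>2 + 6 * Cb\<^sup>2 * real n powr \<gamma>" using j(2) Xk by (simp add: algebra_simps)
    have "\<bar>\<epsilon> n\<bar>\<^sup>2 \<le> (D * real n powr (\<gamma> / 2))\<^sup>2" using D(2)[of n] n by (intro power_mono) auto
    then have \<epsilon>2: "(\<epsilon> n)\<^sup>2 \<le> D\<^sup>2 * real n powr \<gamma>" by (simp only: power2_abs power_mult_distrib pow_sq)
    have "C0 * Mx\<^sup>2 \<le> C0 * (3 * z\<^sup>2 + 6 * Cb\<^sup>2 * real n powr \<gamma>)" using Mx2 C0 by (intro mult_left_mono)
    then have "\<Phi> n \<bullet> \<Phi> n \<le> 3 * C0 * z\<^sup>2 + (6 * C0 * Cb\<^sup>2 + 2 * D\<^sup>2) * real n powr \<gamma>"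
      using y \<epsilon>2 by (simp add: algebra_simps)
    also have "\<dots> \<le> C1 * z\<^sup>2 + C1 * real n powr \<gamma>"
      using C0 by (intro add_mono mult_right_mono) (auto simp: C1_def)
    finally have "\<Phi> n \<bullet> \<Phi> n \<le> C1 * (z\<^sup>2 + real n powr \<gamma>)" by (simp add: distrib_left)
    then show ?thesis using j(1) by (intro bexI[of _ "j + 1"]) (auto simp: z_def k_def)
  qed
  interpret growth "\<lambda>n. \<Phi> n \<bullet> \<Phi> n" r "\<lambda>n. (e n \<bullet> \<Phi> n)\<^sup>2" p "p + 2" d m A C1 "fact d" \<gamma> \<eta> \<tau>
  proof
    show "0 \<le> \<Phi> n \<bullet> \<Phi> n" for n by (rule scalar_prod_self_nonneg)
    show "1 \<le> r n" for n by (rule r_pos)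
    show "r n \<le> r (Suc n)" for n by (rule r_mono)
    show "r (Suc n) \<le> (1 + \<Phi> (Suc n) \<bullet> \<Phi> (Suc n)) * r n" for n by (rule r_ratio)
    show "0 \<le> A" using A[of 0] by simp
    show "1 \<le> C1" using C0 by (simp add: C1_def)
    show "r n \<le> fact d * (1 + (\<Sum>k=0..n. \<Phi> k \<bullet> \<Phi> k)) ^ d" for n
      using r_abs_le[of n] by (simp add: ssq_def)
    show "1 \<le> (fact d :: real)" by (rule fact_ge_1)
  qed (use A rec \<gamma> \<tau> m \<eta> in auto)
  have "avg (\<lambda>k. (e (Suc k) \<bullet> \<Phi> (Suc k))\<^sup>2) = (\<lambda>n. (\<Sum>k=1..n. (e k \<bullet> \<Phi> k)\<^sup>2) / real n)"
  proof
    fix n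
    have "(\<Sum>k=1..n. (e k \<bullet> \<Phi> k)\<^sup>2) = (\<Sum>k\<in>Suc ` {..<n}. (e k \<bullet> \<Phi> k)\<^sup>2)" by (simp add: image_Suc_lessThan)
    also have "\<dots> = (\<Sum>k<n. (e (Suc k) \<bullet> \<Phi> (Suc k))\<^sup>2)" by (subst sum.reindex) auto
    finally show "avg (\<lambda>k. (e (Suc k) \<bullet> \<Phi> (Suc k))\<^sup>2) n = (\<Sum>k=1..n. (e k \<bullet> \<Phi> k)\<^sup>2) / real n" by (simp add: avg_def)
  qed
  then show ?thesis unfolding null_avg_def using average_tendsto_0 by simp
qed

text \<open>At time \<open>k + p + 2\<close> the regressor is, up to a null sequence, \<open>Lambda_factor\<close> applied to this
  asymptotically orthogonal system.\<close>

definition "basis l k = (if l \<le> p then V (k + (p + 2) - l) else \<epsilon> (k + 1) * sqrt (1 - \<rho>\<^sup>2))"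

lemma \<rho>2: "\<rho>\<^sup>2 < 1" using \<rho> by (simp add: abs_square_less_1)

text \<open>The noises have distinct times, and \<epsilon>_(k+1) precedes all of them, the earliest
  being V_(k+2). The factor sqrt(1 - \<rho>^2) normalises the limit s2 / (1 - \<rho>^2) of the
  averaged \<epsilon>^2.\<close>

lemma basis_orthogonal:
  assumes "l < p + 2" "l' < p + 2"
  shows "avg (\<lambda>k. basis l k * basis l' k) \<longlonglongrightarrow> (if l = l' then s2 else 0)"
proof -
  have ord: "avg (\<lambda>k. basis l k * basis l' k) \<longlonglongrightarrow> 0" if "l' < l" "l < p + 2" for l l'
  proof (cases "l \<le> p")
    case True
    have "avg (\<lambda>k. V (k + (p + 2 - l)) * V (k + (p + 2 - l'))) \<longlonglongrightarrow> 0"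
      using True that by (intro ar.cross') auto
    then show ?thesis using True that by (simp add: basis_def)
  next
    case False
    have "avg (\<lambda>k. \<epsilon> k * V (k + (p + 1 - l'))) \<longlonglongrightarrow> 0" using False that by (intro ar.e_v) auto
    from avg_shift[OF this, of 1]
    have "avg (\<lambda>k. \<epsilon> (k + 1) * V (k + 1 + (p + 1 - l'))) \<longlonglongrightarrow> 0" .
    moreover have "k + 1 + (p + 1 - l') = k + (p + 2) - l'" for k using that False by simp
    ultimately have "avg (\<lambda>k. \<epsilon> (k + 1) * V (k + (p + 2) - l')) \<longlonglongrightarrow> 0" by simp
    then have "(\<lambda>n. sqrt (1 - \<rho>\<^sup>2) * avg (\<lambda>k. \<epsilon> (k + 1) * V (k + (p + 2) - l')) n) \<longlonglongrightarrow> 0" by (rule tendsto_mult_right_zero)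
    moreover have "(\<lambda>n. sqrt (1 - \<rho>\<^sup>2) * avg (\<lambda>k. \<epsilon> (k + 1) * V (k + (p + 2) - l')) n) = avg (\<lambda>k. basis l k * basis l' k)"
      using False that unfolding avg_cmult[symmetric] by (simp add: basis_def mult_ac)
    ultimately show ?thesis by simp
  qed
  have diag: "avg (\<lambda>k. basis l k * basis l k) \<longlonglongrightarrow> s2" if "l < p + 2" for l
  proof (cases "l \<le> p")
    case True
    have "avg (\<lambda>k. (V (k + (p + 2 - l)))\<^sup>2) \<longlonglongrightarrow> s2" by (rule ar.vv')
    then show ?thesis using True by (simp add: basis_def power2_eq_square)
  next
    case False
    from avg_shift[OF ar.e_e, of 1] have "avg (\<lambda>k. (\<epsilon> (k + 1))\<^sup>2) \<longlonglongrightarrow> s2 / (1 - \<rho>\<^sup>2)" .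
    then have "(\<lambda>n. (1 - \<rho>\<^sup>2) * avg (\<lambda>k. (\<epsilon> (k + 1))\<^sup>2) n) \<longlonglongrightarrow> (1 - \<rho>\<^sup>2) * (s2 / (1 - \<rho>\<^sup>2))" by (intro tendsto_mult tendsto_const)
    moreover have "(\<lambda>n. (1 - \<rho>\<^sup>2) * avg (\<lambda>k. (\<epsilon> (k + 1))\<^sup>2) n) = avg (\<lambda>k. basis l k * basis l k)"
    proof -
      have "basis l k * basis l k = (1 - \<rho>\<^sup>2) * (\<epsilon> (k + 1))\<^sup>2" for k
      proof -
        have "basis l k * basis l k = (sqrt (1 - \<rho>\<^sup>2))\<^sup>2 * (\<epsilon> (k + 1))\<^sup>2" using False by (simp add: basis_def power2_eq_square)
        then show ?thesis using \<rho>2 by simp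
      qed
      then show ?thesis unfolding avg_cmult[symmetric] by simp
    qed
    ultimately show ?thesis using \<rho>2 by simp
  qed
  show ?thesis
  proof (cases l l' rule: linorder_cases)
    case less
    then show ?thesis using ord[of l l'] assms by (simp add: mult.commute)
  next
    case equal then show ?thesis using diag assms by simp
  next
    case greater then show ?thesis using ord[of l' l] assms by simp
  qed
qed

text \<open>Outputs are noise plus a null sequence by \<open>tracking\<close>. The control
  coordinate U_n, with n = k + p + 1, is solved from the model equation, where \<epsilon>_(n+1) is
  unrolled p + 1 steps down to \<epsilon>_(k+1).\<close>

lemma regressor_expansion:
  assumes c: "c < p + 2"
  obtains w where "null_avg w" "\<And>k. \<Phi> (k + (p + 2)) $ c = (\<Sum>l<p+2. Lambda_factor p \<theta> \<rho> c l * basis l k) + w k"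
proof -
  define nul where "nul j k = x (k + (p + 2) - j) - e (k + (p + 1) - j) \<bullet> \<Phi> (k + (p + 1) - j)" for j k
  have nul: "null_avg (nul j)" if j: "j \<le> p" for j
  proof -
    have "null_avg (\<lambda>k. x (Suc k))" using x_avg by (simp add: null_avg_def)
    from null_shift[OF this, of "p + 1 - j"] null_shift[OF prediction_null, of "p - j"]
    have "null_avg (\<lambda>k. x (Suc (k + (p + 1 - j))) + (- 1) * (e (Suc (k + (p - j))) \<bullet> \<Phi> (Suc (k + (p - j)))))"
      by (intro null_add null_cmult)
    moreover have "Suc (k + (p + 1 - j)) = k + (p + 2) - j" "Suc (k + (p - j)) = k + (p + 1) - j" for k using j by auto
    ultimately show ?thesis by (simp add: nul_def[abs_def])
  qed
  have Xn: "X (int (k + (p + 2)) - int j) = V (k + (p + 2) - j) + nul j k" if j: "j \<le> p" for j k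
  proof -
    have "X (int (k + (p + 1) - j) + 1) = x (k + (p + 1) - j + 1) - e (k + (p + 1) - j) \<bullet> \<Phi> (k + (p + 1) - j) + V (k + (p + 1) - j + 1)"
      using j by (intro tracking) auto
    moreover have "int (k + (p + 1) - j) + 1 = int (k + (p + 2)) - int j" "k + (p + 1) - j + 1 = k + (p + 2) - j" using j by auto
    ultimately have "X (int (k + (p + 2)) - int j) = x (k + (p + 2) - j) - e (k + (p + 1) - j) \<bullet> \<Phi> (k + (p + 1) - j) + V (k + (p + 2) - j)"
      by (simp only:)
    then show ?thesis unfolding nul_def by linarith
  qed
  show ?thesis
  proof (cases "c \<le> p")
    case True
    have "(\<Sum>l<p+2. Lambda_factor p \<theta> \<rho> c l * basis l k) = V (k + (p + 2) - c)" for k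
    proof -
      have "(\<Sum>l<p+2. Lambda_factor p \<theta> \<rho> c l * basis l k) = (\<Sum>l<p+2. if l = c then basis c k else 0)"
        using True by (intro sum.cong) (auto simp: Lambda_factor_def)
      also have "\<dots> = basis c k" using True by (subst sum.delta) auto
      finally show ?thesis using True by (simp add: basis_def)
    qed
    then show ?thesis using that[OF nul[OF True]] Xn[OF True] \<Phi>_index(1)[OF True] by simp
  next
    case False
    then have c': "c = p + 1" using c by simp
    define w where "w k = nul 0 k + (- 1) * (\<Sum>i\<in>{1..p}. \<theta> i * nul i k)" for k
    have "null_avg w" unfolding w_def by (intro null_add null_cmult null_sum nul) auto
    moreover have "\<Phi> (k + (p + 2)) $ c = (\<Sum>l<p+2. Lambda_factor p \<theta> \<rho> c l * basis l k) + w k" for k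
    proof -
      define n where "n = k + (p + 1)"
      have "\<Phi> (k + (p + 2)) $ c = U (int n)" unfolding c' \<Phi>_index(2) by (simp add: n_def)
      \<comment> \<open>The newest noise V_(k+p+2) occurs both in X_(n+1) and in \<epsilon>_(n+1)
        and cancels, as it must since U_n is chosen before it. This is the zero at l = 0 in the last
        row of \<open>Lambda_factor\<close>.\<close>
      also have "\<dots> = X (int n + 1) - (\<Sum>i=1..p. \<theta> i * X (int n - int i + 1)) - \<epsilon> (n + 1)" using model[of n] by simp
      also have "X (int n + 1) = V (k + (p + 2)) + nul 0 k" using Xn[of 0 k] by (simp add: n_def add_ac)
      also have "(\<Sum>i=1..p. \<theta> i * X (int n - int i + 1)) = (\<Sum>i=1..p. \<theta> i * V (k + (p + 2) - i)) + (\<Sum>i=1..p. \<theta> i * nul i k)"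
        unfolding sum.distrib[symmetric]
      proof (intro sum.cong refl)
        fix i assume i: "i \<in> {1..p}"
        have "int n - int i + 1 = int (k + (p + 2)) - int i" by (simp add: n_def)
        then show "\<theta> i * X (int n - int i + 1) = \<theta> i * V (k + (p + 2) - i) + \<theta> i * nul i k"
          using Xn[of i k] i by (simp only: distrib_left) (simp add: distrib_left)
      qed
      also have "\<epsilon> (n + 1) = \<rho> ^ (p + 1) * \<epsilon> (k + 1) + V (k + (p + 2)) + (\<Sum>i=1..p. \<rho> ^ i * V (k + (p + 2) - i))"
      proof -
        have kk: "k + 1 + (p + 1) = k + (p + 2)" "n + 1 = k + (p + 2)" by (simp_all add: n_def)
        have "{..<p+1} = insert 0 {1..p}" by auto
        then have "(\<Sum>i<p + 1. \<rho> ^ i * V (k + (p + 2) - i)) = V (k + (p + 2)) + (\<Sum>i=1..p. \<rho> ^ i * V (k + (p + 2) - i))"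
          by (simp only:) simp
        then show ?thesis using ar.e_unroll[of "k + 1" "p + 1"] unfolding kk by linarith
      qed
      finally have "\<Phi> (k + (p + 2)) $ c = w k - (\<Sum>i=1..p. \<theta> i * V (k + (p + 2) - i)) - (\<Sum>i=1..p. \<rho> ^ i * V (k + (p + 2) - i)) - \<rho> ^ (p + 1) * \<epsilon> (k + 1)"
        by (simp add: w_def)
      moreover have "(\<Sum>l<p+2. Lambda_factor p \<theta> \<rho> c l * basis l k) = - (\<Sum>i=1..p. \<theta> i * V (k + (p + 2) - i)) - (\<Sum>i=1..p. \<rho> ^ i * V (k + (p + 2) - i)) - \<rho> ^ (p + 1) * \<epsilon> (k + 1)"
      proof -
        have "{..<p+2} = insert 0 (insert (p + 1) {1..p})" by auto
        then have "(\<Sum>l<p+2. Lambda_factor p \<theta> \<rho> c l * basis l k) = Lambda_factor p \<theta> \<rho> c 0 * basis 0 k + Lambda_factor p \<theta> \<rho> c (p + 1) * basis (p + 1) k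
            + (\<Sum>l=1..p. Lambda_factor p \<theta> \<rho> c l * basis l k)" by simp
        also have "(\<Sum>l=1..p. Lambda_factor p \<theta> \<rho> c l * basis l k) = (\<Sum>l=1..p. - (\<theta> l * V (k + (p + 2) - l)) - \<rho> ^ l * V (k + (p + 2) - l))"
          by (intro sum.cong) (auto simp: Lambda_factor_def c' basis_def algebra_simps)
        also have "Lambda_factor p \<theta> \<rho> c (p + 1) * basis (p + 1) k = - (\<rho> ^ (p + 1) * \<epsilon> (k + 1))"
          using \<rho>2 by (simp add: Lambda_factor_def c' basis_def)
        finally show ?thesis by (simp add: Lambda_factor_def c' sum_subtractf sum_negf)
      qed
      ultimately show ?thesis by simp
    qed
    ultimately show ?thesis by (rule that)
  qed
qed

text \<open>Up to null sequences the regressor is a fixed matrix applied to an asymptotically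
  orthogonal system of common variance s2, so the limit is s2 times that matrix times its transpose,
  which is s2 \<Lambda>.\<close>

theorem gram_limit_avg:
  assumes i: "i < d" and j: "j < d"
  shows "avg (\<lambda>k. \<Phi> k $ i * \<Phi> k $ j) \<longlonglongrightarrow> s2 * Lambda_mat p \<theta> \<rho> $$ (i, j)"
proof -
  define L where "L c k = (\<Sum>l<d. Lambda_factor p \<theta> \<rho> c l * basis l k)" for c k
  have LL: "avg (\<lambda>k. L c k * L c' k) \<longlonglongrightarrow> s2 * Lambda_mat p \<theta> \<rho> $$ (c, c')" if "c < d" "c' < d" for c c'
  proof -
    have "avg (\<lambda>k. L c k * L c' k) = (\<lambda>n. \<Sum>l<d. \<Sum>l'<d. (Lambda_factor p \<theta> \<rho> c l * Lambda_factor p \<theta> \<rho> c' l') * avg (\<lambda>k. basis l k * basis l' k) n)"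
      unfolding avg_cmult[symmetric] avg_sum[symmetric] L_def sum_product by (simp add: mult_ac)
    also have "\<dots> \<longlonglongrightarrow> (\<Sum>l<d. \<Sum>l'<d. (Lambda_factor p \<theta> \<rho> c l * Lambda_factor p \<theta> \<rho> c' l') * (if l = l' then s2 else 0))"
      by (intro tendsto_sum tendsto_mult tendsto_const basis_orthogonal) (auto simp: d)
    also have "(\<Sum>l<d. \<Sum>l'<d. (Lambda_factor p \<theta> \<rho> c l * Lambda_factor p \<theta> \<rho> c' l') * (if l = l' then s2 else 0)) = (\<Sum>l<d. Lambda_factor p \<theta> \<rho> c l * Lambda_factor p \<theta> \<rho> c' l * s2)"
      by (intro sum.cong refl) (simp add: if_distrib[of "\<lambda>y. _ * y"] cong: if_cong)
    also have "\<dots> = s2 * Lambda_mat p \<theta> \<rho> $$ (c, c')"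
      unfolding Lambda_factorization[OF \<rho> that[unfolded d]] d[symmetric] sum_distrib_left
      by (intro sum.cong refl mult.commute)
    finally show ?thesis .
  qed
  have bd: "sq_bounded (L c)" if "c < d" for c
    using LL[OF that that] by (intro sq_boundedI) (simp add: power2_eq_square)
  obtain w where w: "null_avg w" "\<And>k. \<Phi> (k + (p + 2)) $ i = L i k + w k" using regressor_expansion[OF i[unfolded d]] unfolding L_def d by blast
  obtain w' where w': "null_avg w'" "\<And>k. \<Phi> (k + (p + 2)) $ j = L j k + w' k" using regressor_expansion[OF j[unfolded d]] unfolding L_def d by blast
  have "avg (\<lambda>k. \<Phi> (k + (p + 2)) $ i * \<Phi> (k + (p + 2)) $ j) \<longlonglongrightarrow> s2 * Lambda_mat p \<theta> \<rho> $$ (i, j)"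
    unfolding w w' by (intro avg_perturb LL bd w(1) w'(1) i j)
  then show ?thesis by (rule avg_unshift)
qed

end

subsection \<open>The asymptotic covariance\<close>

lemma mult_mat_index:
  assumes "A \<in> carrier_mat a b" "B \<in> carrier_mat b c" "i < a" "j < c"
  shows "(A * B) $$ (i, j) = (\<Sum>k<b. A $$ (i, k) * B $$ (k, j))"
  using assms by (simp add: scalar_prod_def atLeast0LessThan)

lemma inv_mat_unique:
  fixes A :: "real mat"
  assumes A: "A \<in> carrier_mat n n" and B: "B \<in> carrier_mat n n" and AB: "A * B = 1\<^sub>m n"
  shows "Determinant.det A \<noteq> 0" "inv_mat A = B"
proof -
  have "Determinant.det A * Determinant.det B = 1" using det_mult[OF A B] AB by simp
  then show det: "Determinant.det A \<noteq> 0" by auto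
  have "inv_mat A = inv_mat A * (A * B)" using inv_mat_props(1)[OF A det] AB by simp
  also have "\<dots> = (inv_mat A * A) * B" using assoc_mult_mat[OF inv_mat_props(1)[OF A det] A B] by simp
  also have "\<dots> = B" using inv_mat_props(3)[OF A det] B by simp
  finally show "inv_mat A = B" .
qed

lemma inv_mat_smult:
  fixes A :: "real mat"
  assumes A: "A \<in> carrier_mat n n" and det: "Determinant.det A \<noteq> 0" and c: "c \<noteq> 0"
  shows "Determinant.det (c \<cdot>\<^sub>m A) \<noteq> 0" "inv_mat (c \<cdot>\<^sub>m A) = (1 / c) \<cdot>\<^sub>m inv_mat A"
proof -
  note I = inv_mat_props[OF A det]
  have "(c \<cdot>\<^sub>m A) * ((1 / c) \<cdot>\<^sub>m inv_mat A) = c \<cdot>\<^sub>m (A * ((1 / c) \<cdot>\<^sub>m inv_mat A))"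
    using A I(1) by (intro mult_smult_assoc_mat[of _ n n _ n]) auto
  also have "A * ((1 / c) \<cdot>\<^sub>m inv_mat A) = (1 / c) \<cdot>\<^sub>m (A * inv_mat A)" using A I(1) by (intro mult_smult_distrib) auto
  also have "c \<cdot>\<^sub>m ((1 / c) \<cdot>\<^sub>m (A * inv_mat A)) = 1\<^sub>m n" unfolding I(2) using c by (intro eq_matI) auto
  finally have "(c \<cdot>\<^sub>m A) * ((1 / c) \<cdot>\<^sub>m inv_mat A) = 1\<^sub>m n" .
  from inv_mat_unique[OF _ _ this] A I(1) show "Determinant.det (c \<cdot>\<^sub>m A) \<noteq> 0" "inv_mat (c \<cdot>\<^sub>m A) = (1 / c) \<cdot>\<^sub>m inv_mat A" by auto
qed

locale covariance =
  fixes p d :: nat and \<theta> :: "nat \<Rightarrow> real" and \<rho> :: real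
  assumes d: "d = p + 2" and \<rho>: "\<bar>\<rho>\<bar> < 1" "\<rho> \<noteq> 0"
begin

definition "B = mat d d (\<lambda>(i, l). Lambda_factor p \<theta> \<rho> i l)"
definition "\<Lambda> = Lambda_mat p \<theta> \<rho>"
definition "J = inv_mat \<Lambda>"
definition "Nab = nabla_mat p \<theta> \<rho>"
text \<open>As B B^t = \<Lambda>, this is an explicit square root of the asymptotic covariance, from
  which a Gaussian law with that covariance is built.\<close>

definition "A = Nab * J * B"

lemma B_carrier [simp]: "B \<in> carrier_mat d d" by (simp add: B_def)
lemma \<Lambda>_carrier [simp]: "\<Lambda> \<in> carrier_mat d d" by (auto simp: \<Lambda>_def Lambda_mat_def d K_row_def intro!: carrier_matI)
lemma Nab_carrier: "Nab \<in> carrier_mat (p + 1) d" by (simp add: Nab_def nabla_mat_def d)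
lemmas Nab_carrier_Suc [simp] = Nab_carrier[simplified]

lemma \<rho>2: "0 < 1 - \<rho>\<^sup>2" using \<rho> by (simp add: abs_square_less_1)

lemma \<Lambda>_eq: "\<Lambda> = B * B\<^sup>T"
proof (intro eq_matI)
  fix i j assume ij: "i < dim_row (B * B\<^sup>T)" "j < dim_col (B * B\<^sup>T)"
  then have ij': "i < d" "j < d" by (simp_all add: B_def)
  have "(B * B\<^sup>T) $$ (i, j) = (\<Sum>l<d. Lambda_factor p \<theta> \<rho> i l * Lambda_factor p \<theta> \<rho> j l)"
    using ij' by (simp add: B_def scalar_prod_def atLeast0LessThan)
  then show "\<Lambda> $$ (i, j) = (B * B\<^sup>T) $$ (i, j)"
    using Lambda_factorization[OF \<rho>(1) ij'[unfolded d]] by (simp only: \<Lambda>_def d)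
qed (auto simp: B_def carrier_matD[OF \<Lambda>_carrier])

text \<open>Triangular, with all diagonal entries 1 except the last, which is a multiple of
  \<rho>^(p+1) and nonzero because \<rho> \<noteq> 0.\<close>

lemma det_B: "Determinant.det B \<noteq> 0"
proof -
  have diag: "B $$ (i, j) = Lambda_factor p \<theta> \<rho> i j" if "i < d" "j < d" for i j
    using that by (simp add: B_def)
  have "B $$ (i, j) = 0" if "i < j" "j < d" for i j
  proof -
    have "j < p + 2" using that d by simp
    then have "Lambda_factor p \<theta> \<rho> i j = 0" using that(1) by (auto simp: Lambda_factor_def)
    then show ?thesis using diag[of i j] that by simp
  qed
  then have "Determinant.det B = prod_list (diag_mat B)" by (intro det_lower_triangular[OF _ B_carrier])
  moreover have "B $$ (i, i) \<noteq> 0" if "i < d" for i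
    unfolding diag[OF that that] using \<rho> \<rho>2 by (auto simp: Lambda_factor_def)
  then have "0 \<notin> set (diag_mat B)" by (auto simp: diag_mat_def B_def)
  ultimately show ?thesis by (simp add: prod_list_zero_iff)
qed

lemma det_\<Lambda>: "Determinant.det \<Lambda> \<noteq> 0"
proof -
  have "Determinant.det (B * B\<^sup>T) = Determinant.det B * Determinant.det (B\<^sup>T)"
    by (rule det_mult[OF B_carrier]) simp
  also have "Determinant.det (B\<^sup>T) = Determinant.det B" by (rule det_transpose[OF B_carrier])
  finally show ?thesis using det_B by (simp add: \<Lambda>_eq)
qed

lemma J_carrier [simp]: "J \<in> carrier_mat d d" and \<Lambda>J: "\<Lambda> * J = 1\<^sub>m d" and J\<Lambda>: "J * \<Lambda> = 1\<^sub>m d"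
  using inv_mat_props[OF \<Lambda>_carrier det_\<Lambda>] by (simp_all add: J_def)

lemma \<Lambda>_symmetric: "\<Lambda>\<^sup>T = \<Lambda>"
  unfolding \<Lambda>_eq using transpose_mult[OF B_carrier, of "B\<^sup>T" d] by simp

lemma J_symmetric: "J\<^sup>T = J"
proof -
  have "(J * \<Lambda>)\<^sup>T = \<Lambda>\<^sup>T * J\<^sup>T" by (rule transpose_mult[OF J_carrier \<Lambda>_carrier])
  then have "\<Lambda> * J\<^sup>T = 1\<^sub>m d" by (simp add: J\<Lambda> \<Lambda>_symmetric)
  from inv_mat_unique(2)[OF \<Lambda>_carrier _ this] show ?thesis by (simp add: J_def[symmetric])
qed

lemma A_carrier: "A \<in> carrier_mat (p + 1) d"
  unfolding A_def by (intro mult_carrier_mat[of _ _ d]) simp_all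

lemmas A_carrier_Suc [simp] = A_carrier[simplified]

lemma Sigma_eq: "Sigma_mat p \<theta> \<rho> = A * A\<^sup>T"
proof -
  have NJ: "Nab * J \<in> carrier_mat (p + 1) d" by (intro mult_carrier_mat[of _ _ d]) simp_all
  have NJT: "(Nab * J)\<^sup>T \<in> carrier_mat d (p + 1)" using NJ by simp
  have "A\<^sup>T = B\<^sup>T * (Nab * J)\<^sup>T" unfolding A_def by (rule transpose_mult[OF NJ B_carrier])
  then have "A * A\<^sup>T = Nab * J * (B * (B\<^sup>T * (Nab * J)\<^sup>T))"
    unfolding A_def using assoc_mult_mat[OF NJ B_carrier, of "B\<^sup>T * (Nab * J)\<^sup>T" "p + 1"] NJT by (simp add: mult_carrier_mat[of _ d d])
  also have "B * (B\<^sup>T * (Nab * J)\<^sup>T) = \<Lambda> * (Nab * J)\<^sup>T"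
    unfolding \<Lambda>_eq using assoc_mult_mat[OF B_carrier _ NJT, of "B\<^sup>T"] by simp
  also have "(Nab * J)\<^sup>T = J * Nab\<^sup>T" unfolding transpose_mult[OF Nab_carrier J_carrier] J_symmetric ..
  also have "\<Lambda> * (J * Nab\<^sup>T) = Nab\<^sup>T"
    using assoc_mult_mat[OF \<Lambda>_carrier J_carrier, of "Nab\<^sup>T" "p + 1"] left_mult_one_mat[of "Nab\<^sup>T" d "p + 1"] \<Lambda>J by simp
  finally show ?thesis by (simp add: Sigma_mat_def Nab_def[symmetric] J_def[symmetric] \<Lambda>_def[symmetric])
qed

text \<open>The row vector t^t \<nabla> \<Lambda>^(-1). Divided by \<sigma>^2 it gives the
  coefficients of the normalised martingales in the linear form t of the estimation error.\<close>

definition "h t i = (\<Sum>j<p+1. t j * (\<Sum>c<d. Nab $$ (j, c) * J $$ (c, i)))" for t :: "nat \<Rightarrow> real" and i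

lemma A_index: "j < p + 1 \<Longrightarrow> l < d \<Longrightarrow> A $$ (j, l) = (\<Sum>i<d. (\<Sum>c<d. Nab $$ (j, c) * J $$ (c, i)) * Lambda_factor p \<theta> \<rho> i l)"
proof -
  assume j: "j < p + 1" and l: "l < d"
  have NJ: "Nab * J \<in> carrier_mat (p + 1) d" by (intro mult_carrier_mat[of _ _ d]) simp_all
  have "A $$ (j, l) = (\<Sum>i<d. (Nab * J) $$ (j, i) * B $$ (i, l))"
    unfolding A_def by (rule mult_mat_index[OF NJ B_carrier j l])
  also have "\<dots> = (\<Sum>i<d. (\<Sum>c<d. Nab $$ (j, c) * J $$ (c, i)) * Lambda_factor p \<theta> \<rho> i l)"
  proof (intro sum.cong refl)
    fix i assume i: "i \<in> {..<d}"
    have "(Nab * J) $$ (j, i) = (\<Sum>c<d. Nab $$ (j, c) * J $$ (c, i))"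
      using i by (intro mult_mat_index[OF Nab_carrier J_carrier j]) simp
    then show "(Nab * J) $$ (j, i) * B $$ (i, l) = (\<Sum>c<d. Nab $$ (j, c) * J $$ (c, i)) * Lambda_factor p \<theta> \<rho> i l"
      using i l by (simp add: B_def)
  qed
  finally show ?thesis .
qed

lemma h_A: "l < d \<Longrightarrow> (\<Sum>i<d. h t i * Lambda_factor p \<theta> \<rho> i l) = (\<Sum>j<p+1. t j * A $$ (j, l))"
proof -
  assume l: "l < d"
  have "(\<Sum>i<d. h t i * Lambda_factor p \<theta> \<rho> i l) = (\<Sum>i<d. \<Sum>j<p+1. t j * ((\<Sum>c<d. Nab $$ (j, c) * J $$ (c, i)) * Lambda_factor p \<theta> \<rho> i l))"
    by (intro sum.cong refl, unfold h_def, subst sum_distrib_right) (simp only: mult.assoc)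
  also have "\<dots> = (\<Sum>j<p+1. t j * A $$ (j, l))"
    by (subst sum.swap, intro sum.cong refl) (simp add: A_index[OF _ l] sum_distrib_left)
  finally show ?thesis .
qed

lemma quadratic_h: "(\<Sum>i<d. \<Sum>i'<d. h t i * h t i' * \<Lambda> $$ (i, i')) = (\<Sum>l<d. (\<Sum>j<p+1. t j * A $$ (j, l))\<^sup>2)"
proof -
  have "(\<Sum>i<d. \<Sum>i'<d. h t i * h t i' * \<Lambda> $$ (i, i')) = (\<Sum>i<d. \<Sum>i'<d. \<Sum>l<d. (h t i * Lambda_factor p \<theta> \<rho> i l) * (h t i' * Lambda_factor p \<theta> \<rho> i' l))"
  proof (intro sum.cong refl)
    fix i i' assume ii: "i \<in> {..<d}" "i' \<in> {..<d}"
    have "\<Lambda> $$ (i, i') = (\<Sum>l<d. Lambda_factor p \<theta> \<rho> i l * Lambda_factor p \<theta> \<rho> i' l)"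
      using Lambda_factorization[OF \<rho>(1), of i p i' \<theta>] ii by (simp only: \<Lambda>_def d lessThan_iff)
    then show "h t i * h t i' * \<Lambda> $$ (i, i') = (\<Sum>l<d. (h t i * Lambda_factor p \<theta> \<rho> i l) * (h t i' * Lambda_factor p \<theta> \<rho> i' l))"
      by (simp add: sum_distrib_left mult_ac)
  qed
  also have "\<dots> = (\<Sum>l<d. \<Sum>i<d. \<Sum>i'<d. (h t i * Lambda_factor p \<theta> \<rho> i l) * (h t i' * Lambda_factor p \<theta> \<rho> i' l))"
    by (rule trans[OF sum.cong[OF refl sum.swap] sum.swap])
  also have "\<dots> = (\<Sum>l<d. (\<Sum>i<d. h t i * Lambda_factor p \<theta> \<rho> i l)\<^sup>2)"
    unfolding power2_eq_square sum_product ..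
  also have "\<dots> = (\<Sum>l<d. (\<Sum>j<p+1. t j * A $$ (j, l))\<^sup>2)"
    by (intro sum.cong refl) (simp only: h_A lessThan_iff)
  finally show ?thesis .
qed

lemma Sigma_quadratic:
  assumes t: "t \<in> carrier_vec (p + 1)"
  shows "t \<bullet> (Sigma_mat p \<theta> \<rho> *\<^sub>v t) = (\<Sum>l<d. (\<Sum>j<p+1. t $ j * A $$ (j, l))\<^sup>2)"
proof -
  have w: "A\<^sup>T *\<^sub>v t \<in> carrier_vec d" using A_carrier t by (intro mult_mat_vec_carrier[of _ _ "p + 1"]) auto
  have "t \<bullet> (Sigma_mat p \<theta> \<rho> *\<^sub>v t) = t \<bullet> (A *\<^sub>v (A\<^sup>T *\<^sub>v t))"
    unfolding Sigma_eq using assoc_mult_mat_vec[OF A_carrier _ t, of "A\<^sup>T"] A_carrier by simp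
  also have "\<dots> = (A\<^sup>T *\<^sub>v t) \<bullet> (A\<^sup>T *\<^sub>v t)"
    using transpose_vec_mult_scalar[OF A_carrier w t] by simp
  also have "\<dots> = (\<Sum>l<d. ((A\<^sup>T *\<^sub>v t) $ l)\<^sup>2)"
    unfolding scalar_prod_def carrier_vecD[OF w] atLeast0LessThan power2_eq_square ..
  also have "\<dots> = (\<Sum>l<d. (\<Sum>j<p+1. t $ j * A $$ (j, l))\<^sup>2)"
  proof (intro sum.cong refl arg_cong[where f = "\<lambda>x. x\<^sup>2"])
    fix l assume "l \<in> {..<d}"
    then show "(A\<^sup>T *\<^sub>v t) $ l = (\<Sum>j<p+1. t $ j * A $$ (j, l))"
      using carrier_matD[OF A_carrier] carrier_vecD[OF t] by (simp add: scalar_prod_def atLeast0LessThan mult.commute)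
  qed
  finally show ?thesis .
qed

lemma Sigma_symmetric: "(Sigma_mat p \<theta> \<rho>)\<^sup>T = Sigma_mat p \<theta> \<rho>"
  unfolding Sigma_eq using transpose_mult[OF A_carrier, of "A\<^sup>T" "p + 1"] A_carrier by simp

lemma Sigma_carrier: "Sigma_mat p \<theta> \<rho> \<in> carrier_mat (p + 1) (p + 1)"
  unfolding Sigma_eq using A_carrier by (intro mult_carrier_mat[of _ _ d]) auto

text \<open>The vector u is the last row of \<Lambda>^(-1) B, and u B^t is a unit vector. The first
  p + 1 rows of B are unit vectors too, so u is supported on the last coordinate, where it is the
  reciprocal of the last diagonal entry of B.\<close>

lemma last_variance: "(\<Sum>l<d. (A $$ (p, l))\<^sup>2) = (1 - \<rho>\<^sup>2) / \<rho> ^ (2 * (p + 1))"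
proof -
  define u where "u l = (\<Sum>i<d. J $$ (p + 1, i) * Lambda_factor p \<theta> \<rho> i l)" for l
  have Apl: "A $$ (p, l) = - u l" if l: "l < d" for l
  proof -
    have "(\<Sum>c<d. Nab $$ (p, c) * J $$ (c, i)) = - J $$ (p + 1, i)" for i
    proof -
      have "(\<Sum>c<d. Nab $$ (p, c) * J $$ (c, i)) = (\<Sum>c<d. if c = p + 1 then - J $$ (p + 1, i) else 0)"
        by (intro sum.cong) (auto simp: Nab_def nabla_mat_def d)
      also have "\<dots> = - J $$ (p + 1, i)" using d by (subst sum.delta) auto
      finally show ?thesis .
    qed
    then show ?thesis using A_index[OF _ l, of p] by (simp add: u_def sum_negf)
  qed
  have uB: "(\<Sum>l<d. u l * Lambda_factor p \<theta> \<rho> i l) = (if i = p + 1 then 1 else 0)" if i: "i < d" for i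
  proof -
    have "(\<Sum>l<d. u l * Lambda_factor p \<theta> \<rho> i l) = (\<Sum>l<d. \<Sum>i'<d. J $$ (p + 1, i') * (Lambda_factor p \<theta> \<rho> i' l * Lambda_factor p \<theta> \<rho> i l))"
      by (simp add: u_def sum_distrib_right mult.assoc)
    also have "\<dots> = (\<Sum>i'<d. J $$ (p + 1, i') * \<Lambda> $$ (i', i))"
    proof (subst sum.swap, intro sum.cong refl)
      fix i' assume "i' \<in> {..<d}"
      then have "\<Lambda> $$ (i', i) = (\<Sum>l<d. Lambda_factor p \<theta> \<rho> i' l * Lambda_factor p \<theta> \<rho> i l)"
        using Lambda_factorization[OF \<rho>(1), of i' p i \<theta>] i by (simp only: \<Lambda>_def d lessThan_iff)
      then show "(\<Sum>l<d. J $$ (p + 1, i') * (Lambda_factor p \<theta> \<rho> i' l * Lambda_factor p \<theta> \<rho> i l)) = J $$ (p + 1, i') * \<Lambda> $$ (i', i)"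
        by (simp add: sum_distrib_left)
    qed
    also have "\<dots> = (J * \<Lambda>) $$ (p + 1, i)"
      using i d by (intro mult_mat_index[OF J_carrier \<Lambda>_carrier, symmetric]) simp_all
    finally show ?thesis using i d by (simp add: J\<Lambda>)
  qed
  have u0: "u i = 0" if i: "i \<le> p" for i
  proof -
    have "(\<Sum>l<d. u l * Lambda_factor p \<theta> \<rho> i l) = (\<Sum>l<d. if l = i then u i else 0)"
      using i by (intro sum.cong) (auto simp: Lambda_factor_def)
    also have "\<dots> = u i" using i d by (subst sum.delta) auto
    finally show ?thesis using uB[of i] i d by simp
  qed
  have split: "(\<Sum>l<d. g l) = (\<Sum>l<p+1. g l) + g (p + 1)" for g :: "nat \<Rightarrow> real" by (simp add: d)
  have "(\<Sum>l<p+1. u l * Lambda_factor p \<theta> \<rho> (p + 1) l) = 0" using u0 by (intro sum.neutral) auto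
  then have "u (p + 1) * Lambda_factor p \<theta> \<rho> (p + 1) (p + 1) = 1"
    using uB[of "p + 1"] d unfolding split by simp
  then have "(u (p + 1))\<^sup>2 * (Lambda_factor p \<theta> \<rho> (p + 1) (p + 1))\<^sup>2 = 1" by (simp only: power_mult_distrib[symmetric] power_one)
  moreover have "(Lambda_factor p \<theta> \<rho> (p + 1) (p + 1))\<^sup>2 = \<rho> ^ (2 * (p + 1)) / (1 - \<rho>\<^sup>2)"
    using \<rho>2 by (simp add: Lambda_factor_def power_divide power_mult[symmetric] mult.commute del: power_Suc)
  ultimately have u1: "(u (p + 1))\<^sup>2 * (\<rho> ^ (2 * (p + 1)) / (1 - \<rho>\<^sup>2)) = 1" by (simp only:)
  have "(\<Sum>l<d. (A $$ (p, l))\<^sup>2) = (\<Sum>l<d. (u l)\<^sup>2)" by (intro sum.cong) (auto simp: Apl)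
  also have "\<dots> = (u (p + 1))\<^sup>2" unfolding split using u0 by simp
  also have "\<dots> = (1 - \<rho>\<^sup>2) / \<rho> ^ (2 * (p + 1))" 
  proof -
    have "y = q / P" if "y * (P / q) = 1" "q \<noteq> 0" "P \<noteq> 0" for y q P :: real
      using that by (simp add: field_simps)
    from this[OF u1] show ?thesis using \<rho>2 \<rho> by simp
  qed
  finally show ?thesis .
qed

end

text \<open>\<open>theta_ext\<close> prolongs \<open>theta_hat\<close> to \<open>k = 0\<close> with the value \<open>-1\<close>, which makes the defining
  triangular recursion hold from the start.\<close>

definition theta_ext :: "nat \<Rightarrow> real vec \<Rightarrow> nat \<Rightarrow> real" where
  "theta_ext p v k = (if k = 0 then - 1 else theta_hat p v k)"

lemma theta_ext_closed: "theta_ext p v k = (\<Sum>i<k. rho_hat p v ^ (k - 1 - i) * v $ i) - rho_hat p v ^ k"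
proof (cases k)
  case (Suc m)
  have "(\<Sum>i=1..k. rho_hat p v ^ (k - i) * v $ (i - 1)) = (\<Sum>i\<in>Suc ` {..<k}. rho_hat p v ^ (k - i) * v $ (i - 1))"
    by (simp add: image_Suc_lessThan)
  also have "\<dots> = (\<Sum>i<k. rho_hat p v ^ (k - 1 - i) * v $ i)" by (subst sum.reindex) auto
  finally show ?thesis using Suc by (simp add: theta_ext_def theta_hat_def rho_hat_def)
qed (simp add: theta_ext_def)

lemma theta_ext_Suc: "theta_ext p v (Suc k) = rho_hat p v * theta_ext p v k + v $ k"
proof -
  have "(\<Sum>i<k. rho_hat p v ^ (k - i) * v $ i) = rho_hat p v * (\<Sum>i<k. rho_hat p v ^ (k - 1 - i) * v $ i)"
    unfolding sum_distrib_left
  proof (intro sum.cong refl)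
    fix i assume "i \<in> {..<k}"
    then have "k - i = Suc (k - 1 - i)" by auto
    then show "rho_hat p v ^ (k - i) * v $ i = rho_hat p v * (rho_hat p v ^ (k - 1 - i) * v $ i)" by simp
  qed
  then show ?thesis by (simp add: theta_ext_closed algebra_simps)
qed

text \<open>Row k is the gradient of \<open>theta_ext\<close> at the true parameter; row 0 vanishes
  because the prolonged value -1 is constant.\<close>

definition nabla_ext :: "nat \<Rightarrow> (nat \<Rightarrow> real) \<Rightarrow> real \<Rightarrow> nat \<Rightarrow> nat \<Rightarrow> real" where
  "nabla_ext p \<theta> \<rho> k c = (if k = 0 then 0 else nabla_mat p \<theta> \<rho> $$ (k - 1, c))"

text \<open>The recursion of \<open>theta_ext\<close> differentiated at the true parameter; the last
  term arises because \<open>rho_hat\<close> is minus the last coordinate.\<close>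

lemma nabla_ext_Suc:
  assumes k: "k < p" and c: "c < p + 2"
  shows "nabla_ext p \<theta> \<rho> (Suc k) c = \<rho> * nabla_ext p \<theta> \<rho> k c + (if c = k then 1 else 0)
    - (if c = p + 1 then (if k = 0 then - 1 else \<theta> k) else 0)"
proof (cases "c = p + 1")
  case True
  have "xi \<theta> \<rho> k = \<rho> * xi \<theta> \<rho> (k - 1) + \<theta> k" if k0: "k \<noteq> 0"
  proof -
    obtain m where m: "k = Suc m" using k0 by (cases k) auto
    have "(\<Sum>i=1..m. \<rho> ^ (Suc m - i) * \<theta> i) = \<rho> * (\<Sum>i=1..m. \<rho> ^ (m - i) * \<theta> i)"
      unfolding sum_distrib_left by (intro sum.cong refl) (auto simp: Suc_diff_le)
    then show ?thesis by (simp add: m xi_def)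
  qed
  moreover have "xi \<theta> \<rho> 0 = 0" by (simp add: xi_def)
  moreover have "\<rho> ^ k = \<rho> * \<rho> ^ (k - 1)" if "k \<noteq> 0" using that by (cases k) auto
  ultimately show ?thesis using True k by (auto simp: nabla_ext_def nabla_mat_def algebra_simps)
next
  case False
  have "\<rho> ^ (k - c) = \<rho> * \<rho> ^ (k - Suc c)" if "c < k"
  proof -
    have "k - c = Suc (k - Suc c)" using that by auto
    then show ?thesis by simp
  qed
  then show ?thesis using False k c by (auto simp: nabla_ext_def nabla_mat_def Suc_le_eq)
qed

text \<open>An exact identity in place of a Taylor expansion: the linearisation error obeys a
  recursion with factor \<rho>, driven only by a product of two estimation errors.\<close>

lemma estimation_error_recursion:
  fixes v :: "real vec" and \<theta> :: "nat \<Rightarrow> real" and \<rho> :: real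
  assumes k: "k < p"
  defines "\<theta>' \<equiv> \<lambda>k. if k = 0 then - 1 else \<theta> k"
  defines "e \<equiv> \<lambda>c. v $ c - true_param p \<theta> \<rho> $ c"
  shows "(theta_ext p v (Suc k) - \<theta>' (Suc k)) - (\<Sum>c<p+2. nabla_ext p \<theta> \<rho> (Suc k) c * e c)
    = \<rho> * ((theta_ext p v k - \<theta>' k) - (\<Sum>c<p+2. nabla_ext p \<theta> \<rho> k c * e c)) - e (p + 1) * (theta_ext p v k - \<theta>' k)"
proof -
  have "(\<Sum>c<p+2. nabla_ext p \<theta> \<rho> (Suc k) c * e c) = (\<Sum>c<p+2. \<rho> * (nabla_ext p \<theta> \<rho> k c * e c) + (if c = k then e k else 0) - (if c = p + 1 then \<theta>' k * e (p + 1) else 0))"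
    by (intro sum.cong) (auto simp: nabla_ext_Suc[OF k] \<theta>'_def algebra_simps)
  also have "\<dots> = \<rho> * (\<Sum>c<p+2. nabla_ext p \<theta> \<rho> k c * e c) + (\<Sum>c<p+2. if c = k then e k else 0) - (\<Sum>c<p+2. if c = p + 1 then \<theta>' k * e (p + 1) else 0)"
    by (simp only: sum_subtractf sum.distrib sum_distrib_left)
  also have "(\<Sum>c<p+2. if c = k then e k else 0) = e k" using k by (subst sum.delta) auto
  also have "(\<Sum>c<p+2. if c = p + 1 then \<theta>' k * e (p + 1) else 0) = \<theta>' k * e (p + 1)" by (subst sum.delta) auto
  finally have N: "(\<Sum>c<p+2. nabla_ext p \<theta> \<rho> (Suc k) c * e c) = \<rho> * (\<Sum>c<p+2. nabla_ext p \<theta> \<rho> k c * e c) + e k - \<theta>' k * e (p + 1)" .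
  have vk: "v $ k = e k + \<theta>' (Suc k) - \<rho> * \<theta>' k" using k by (simp add: e_def true_param_def \<theta>'_def)
  have r: "rho_hat p v = \<rho> - e (p + 1)" by (simp add: e_def true_param_def rho_hat_def)
  show ?thesis unfolding N theta_ext_Suc vk r by (simp add: algebra_simps)
qed

subsection \<open>Asymptotic normality\<close>

lemma scalar_prod_measurable:
  fixes u v :: "'a \<Rightarrow> real vec"
  assumes "\<And>\<omega>. \<omega> \<in> space N \<Longrightarrow> v \<omega> \<in> carrier_vec n"
    and [measurable]: "\<And>i. i < n \<Longrightarrow> (\<lambda>\<omega>. u \<omega> $ i) \<in> borel_measurable N" "\<And>i. i < n \<Longrightarrow> (\<lambda>\<omega>. v \<omega> $ i) \<in> borel_measurable N"
  shows "(\<lambda>\<omega>. u \<omega> \<bullet> v \<omega>) \<in> borel_measurable N"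
proof -
  have "(\<lambda>\<omega>. \<Sum>i=0..<n. u \<omega> $ i * v \<omega> $ i) \<in> borel_measurable N"
    by (intro borel_measurable_sum borel_measurable_times assms) auto
  moreover have "u \<omega> \<bullet> v \<omega> = (\<Sum>i=0..<n. u \<omega> $ i * v \<omega> $ i)" if "\<omega> \<in> space N" for \<omega>
    using carrier_vecD[OF assms(1)[OF that]] by (simp add: scalar_prod_def)
  ultimately show ?thesis by (subst measurable_cong) auto
qed

lemma bounded_multiple_of_eventually:
  fixes u h :: "nat \<Rightarrow> real"
  assumes ev: "eventually (\<lambda>n. \<bar>u n\<bar> \<le> C * h n) sequentially" and h: "\<And>n. 1 \<le> n \<Longrightarrow> 1 \<le> h n" and C: "0 \<le> C"
  obtains D where "0 \<le> D" "\<And>n. 1 \<le> n \<Longrightarrow> \<bar>u n\<bar> \<le> D * h n"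
proof -
  obtain N where N: "\<And>n. N \<le> n \<Longrightarrow> \<bar>u n\<bar> \<le> C * h n" using ev by (auto simp: eventually_sequentially)
  define D where "D = C + (\<Sum>k<N. \<bar>u k\<bar>)"
  have S: "0 \<le> (\<Sum>k<N. \<bar>u k\<bar>)" by (intro sum_nonneg) auto
  have "\<bar>u n\<bar> \<le> D * h n" if n: "1 \<le> n" for n
  proof (cases "N \<le> n")
    case True
    have "C * h n \<le> D * h n" using h[OF n] S by (intro mult_right_mono) (auto simp: D_def)
    then show ?thesis using N[OF True] by simp
  next
    case False
    then have "\<bar>u n\<bar> \<le> (\<Sum>k<N. \<bar>u k\<bar>)" by (intro member_le_sum) auto
    also have "\<dots> \<le> D * 1" using C by (simp add: D_def)
    also have "\<dots> \<le> D * h n" using h[OF n] S C by (intro mult_left_mono) (auto simp: D_def)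
    finally show ?thesis .
  qed
  moreover have "0 \<le> D" using S C by (simp add: D_def)
  ultimately show thesis using that by blast
qed

section \<open>Adaptedness of the controlled system\<close>

locale arx = noise M F V \<sigma> a for M :: "'a measure" and F V \<sigma> a +
  fixes p d :: nat and \<theta> :: "nat \<Rightarrow> real" and \<rho> :: real and X U :: "int \<Rightarrow> 'a \<Rightarrow> real"
    and \<epsilon> x :: "nat \<Rightarrow> 'a \<Rightarrow> real" and \<Phi> vh :: "nat \<Rightarrow> 'a \<Rightarrow> real vec"
  assumes p: "1 \<le> p" and d: "d = p + 2" and \<rho>: "\<bar>\<rho>\<bar> < 1" "\<rho> \<noteq> 0"
    and model: "\<And>n \<omega>. \<omega> \<in> space M \<Longrightarrow>
      X (int n + 1) \<omega> = (\<Sum>k=1..p. \<theta> k * X (int n - int k + 1) \<omega>) + U (int n) \<omega> + \<epsilon> (n + 1) \<omega>"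
    and ar1: "\<And>n \<omega>. \<omega> \<in> space M \<Longrightarrow> \<epsilon> (n + 1) \<omega> = \<rho> * \<epsilon> n \<omega> + V (n + 1) \<omega>"
    and X0: "\<And>k. k \<le> 0 \<Longrightarrow> X k \<in> borel_measurable (F 0)" and \<epsilon>0: "\<epsilon> 0 \<in> borel_measurable (F 0)"
    and U0: "U 0 \<in> borel_measurable (F 0)" "U (- 1) \<in> borel_measurable (F 0)"
    and x_F: "\<And>n. x (n + 1) \<in> borel_measurable (F n)"
    and x_small: "AE \<omega> in M. (\<lambda>n. \<Sum>k=1..n. (x k \<omega>)\<^sup>2) \<in> o(\<lambda>n. real n)"
    and x_reg: "\<And>b. 2 \<le> b \<Longrightarrow> b < a \<Longrightarrow> AE \<omega> in M. (\<lambda>n. \<Sum>k=1..n. \<bar>x k \<omega>\<bar> powr b) \<in> O(\<lambda>n. real n)"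
    and \<Phi>: "\<Phi> = regressor p X U"
    and vh0: "\<And>\<omega>. \<omega> \<in> space M \<Longrightarrow> vh 0 \<omega> \<in> carrier_vec d"
    and vh0_F: "\<And>j. j < d \<Longrightarrow> (\<lambda>\<omega>. vh 0 \<omega> $ j) \<in> borel_measurable (F 0)"
    and lse: "\<And>n \<omega>. \<omega> \<in> space M \<Longrightarrow>
      vh (n + 1) \<omega> = vh n \<omega> + (X (int n + 1) \<omega> - U (int n) \<omega> - vh n \<omega> \<bullet> \<Phi> n \<omega>) \<cdot>\<^sub>v
        (inv_mat (gram_matrix d (\<lambda>k. \<Phi> k \<omega>) n) *\<^sub>v \<Phi> n \<omega>)"
    and control: "\<And>n \<omega>. 1 \<le> n \<Longrightarrow> \<omega> \<in> space M \<Longrightarrow> U (int n) \<omega> = x (n + 1) \<omega> - vh n \<omega> \<bullet> \<Phi> n \<omega>"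
begin

lemma \<Phi>_vec: "\<Phi> n \<omega> = vec d (\<lambda>j. if j \<le> p then X (int n - int j) \<omega> else U (int n - 1) \<omega>)"
  by (simp only: \<Phi> regressor_def d)

lemma \<Phi>_dim [simp]: "\<Phi> n \<omega> \<in> carrier_vec d" by (simp add: \<Phi>_vec)

lemma path:
  assumes "\<omega> \<in> space M"
  shows "arx_path p d \<theta> \<rho> (\<lambda>k. X k \<omega>) (\<lambda>k. U k \<omega>) (\<lambda>n. \<epsilon> n \<omega>) (\<lambda>n. V n \<omega>) (\<lambda>n. x n \<omega>) (\<lambda>n. \<Phi> n \<omega>) (\<lambda>n. vh n \<omega>)"
  by (rule arx_path.intro[OF p d \<rho>(1) model[OF assms] ar1[OF assms] \<Phi>_vec vh0[OF assms] lse[OF assms] control[OF _ assms]])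

lemma gram: "gram d (\<lambda>k. \<Phi> k \<omega>)" by (rule gram.intro) simp

lemma space_F: "space (F n) = space M" using sub by (simp add: subalgebra_def)

lemma vh_dim: "\<omega> \<in> space M \<Longrightarrow> vh n \<omega> \<in> carrier_vec d"
  using arx_path.vh_carrier[OF path] by simp

definition "S n \<omega> = gram_matrix d (\<lambda>k. \<Phi> k \<omega>) n"
definition "R n \<omega> = Determinant.det (S n \<omega>)"
definition "E n \<omega> = vh n \<omega> - true_param p \<theta> \<rho>"

lemma S_carrier [simp]: "S n \<omega> \<in> carrier_mat d d"
  using gram.S_carrier[OF gram, of \<omega> n] by (simp add: S_def gram.S_def[OF gram])

lemma R_eq: "gram.r d (\<lambda>k. \<Phi> k \<omega>) n = R n \<omega>"
  by (simp add: R_def S_def gram.r_def[OF gram] gram.S_def[OF gram])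

lemma R_nz: "R n \<omega> \<noteq> 0" using gram.r_nz[OF gram, of _ n] by (simp add: R_eq)

lemma S_index: "i < d \<Longrightarrow> j < d \<Longrightarrow> S n \<omega> $$ (i, j) = (\<Sum>k=0..n. \<Phi> k \<omega> $ i * \<Phi> k \<omega> $ j) + (if i = j then 1 else 0)"
  unfolding S_def gram.S_def[OF gram, symmetric] by (rule gram.S_index[OF gram])

lemma S_measurable:
  assumes "\<And>k j. k \<le> m \<Longrightarrow> j < d \<Longrightarrow> (\<lambda>\<omega>. \<Phi> k \<omega> $ j) \<in> borel_measurable N" "i < d" "j < d"
  shows "(\<lambda>\<omega>. S m \<omega> $$ (i, j)) \<in> borel_measurable N"
  unfolding S_index[OF assms(2,3)]
  by (intro borel_measurable_add borel_measurable_sum borel_measurable_times assms(1)) (use assms(2,3) in auto)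

lemma E_dim: "\<omega> \<in> space M \<Longrightarrow> E n \<omega> \<in> carrier_vec d"
  unfolding E_def using vh_dim[of \<omega> n] by (intro minus_carrier_vec) (simp_all add: true_param_def d)

lemma E_index: "i < d \<Longrightarrow> E n \<omega> $ i = vh n \<omega> $ i - true_param p \<theta> \<rho> $ i"
  by (simp add: E_def true_param_def d)

lemma measurable_equality:
  assumes "f \<in> borel_measurable (F n)" "\<And>\<omega>. \<omega> \<in> space M \<Longrightarrow> g \<omega> = f \<omega>"
  shows "(g :: 'a \<Rightarrow> real) \<in> borel_measurable (F n)"
  using assms by (subst measurable_cong[where g = f]) (auto simp: space_F)

definition "adapted_upto n \<longleftrightarrow> (\<forall>k\<le>int n. X k \<in> borel_measurable (F n)) \<and>
  (\<forall>k. - 1 \<le> k \<and> k \<le> int n \<longrightarrow> U k \<in> borel_measurable (F n)) \<and> \<epsilon> n \<in> borel_measurable (F n) \<and>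
  (\<forall>j<d. (\<lambda>\<omega>. vh n \<omega> $ j) \<in> borel_measurable (F n))"

lemma \<Phi>_measurable:
  assumes "\<And>k. k \<le> int n \<Longrightarrow> X k \<in> borel_measurable N" "U (int n - 1) \<in> borel_measurable N" "j < d"
  shows "(\<lambda>\<omega>. \<Phi> n \<omega> $ j) \<in> borel_measurable N"
  using assms by (cases "j \<le> p") (simp_all add: \<Phi>_vec)

text \<open>Noise, output, estimator and control determine one another, hence the joint induction.
  Within a step the order is noise, output, regressors, estimator, control; the control at time n is
  \<open>F n\<close>-measurable since x_(n+1) is predictable.\<close>

lemma adapted: "adapted_upto n"
proof (induction n)
  case 0
  have "U k \<in> borel_measurable (F 0)" if "- 1 \<le> k" "k \<le> 0" for k
  proof -
    have "k = - 1 \<or> k = 0" using that by auto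
    then show ?thesis using U0 by auto
  qed
  then show ?case using X0 \<epsilon>0 vh0_F by (simp add: adapted_upto_def)
next
  case (Suc n)
  note IH = Suc[unfolded adapted_upto_def]
  have up: "f \<in> borel_measurable (F n) \<Longrightarrow> f \<in> borel_measurable (F (Suc n))" for f :: "'a \<Rightarrow> real"
    by (erule F_mono) simp
  have Xn: "X k \<in> borel_measurable (F (Suc n))" if "k \<le> int n" for k
    using IH that by (intro up) blast
  have Un: "U k \<in> borel_measurable (F (Suc n))" if "- 1 \<le> k" "k \<le> int n" for k
    using IH that by (intro up) blast
  have vn: "(\<lambda>\<omega>. vh n \<omega> $ j) \<in> borel_measurable (F (Suc n))" if "j < d" for j
    using IH that by (intro up) blast
  have "\<epsilon> n \<in> borel_measurable (F (Suc n))"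
    using IH by (intro up) blast
  then have "(\<lambda>\<omega>. \<rho> * \<epsilon> n \<omega> + V (n + 1) \<omega>) \<in> borel_measurable (F (Suc n))"
    using V_F[of n] by (intro borel_measurable_add borel_measurable_times borel_measurable_const) simp_all
  then have \<epsilon>': "\<epsilon> (Suc n) \<in> borel_measurable (F (Suc n))"
    by (rule measurable_equality) (use ar1[of _ n] in simp)
  have X1: "X (int n + 1) \<in> borel_measurable (F (Suc n))"
  proof (rule measurable_equality[OF _ model])
    show "(\<lambda>\<omega>. (\<Sum>k=1..p. \<theta> k * X (int n - int k + 1) \<omega>) + U (int n) \<omega> + \<epsilon> (n + 1) \<omega>) \<in> borel_measurable (F (Suc n))"
      using \<epsilon>' Un[of "int n"] by (intro borel_measurable_add borel_measurable_sum borel_measurable_times borel_measurable_const Xn) simp_all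
  qed
  have X': "X k \<in> borel_measurable (F (Suc n))" if "k \<le> int (Suc n)" for k
  proof (cases "k \<le> int n")
    case False
    then have "k = int n + 1" using that by simp
    then show ?thesis using X1 by simp
  qed (rule Xn)
  have \<Phi>n: "(\<lambda>\<omega>. \<Phi> m \<omega> $ j) \<in> borel_measurable (F (Suc n))" if "j < d" "m \<le> Suc n" for j m
    using that by (intro \<Phi>_measurable X' Un) simp_all
  have Sm: "(\<lambda>\<omega>. S n \<omega> $$ (i, j)) \<in> borel_measurable (F (Suc n))" if "i < d" "j < d" for i j
    using that by (rule S_measurable[rotated 1]) (auto intro: \<Phi>n)
  have Tm: "(\<lambda>\<omega>. inv_mat (S n \<omega>) $$ (i, j)) \<in> borel_measurable (F (Suc n))" if "i < d" "j < d" for i j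
    using that R_nz[unfolded R_def] by (intro inv_mat_measurable[of _ _ d] Sm S_carrier) simp_all
  have v': "(\<lambda>\<omega>. vh (Suc n) \<omega> $ j) \<in> borel_measurable (F (Suc n))" if j: "j < d" for j
  proof (rule measurable_equality)
    show "(\<lambda>\<omega>. vh n \<omega> $ j + (X (int n + 1) \<omega> - U (int n) \<omega> - vh n \<omega> \<bullet> \<Phi> n \<omega>) * (\<Sum>i=0..<d. inv_mat (S n \<omega>) $$ (j, i) * \<Phi> n \<omega> $ i)) \<in> borel_measurable (F (Suc n))"
      using j by (intro borel_measurable_add borel_measurable_times borel_measurable_diff borel_measurable_sum vn X1 Un
        scalar_prod_measurable[of _ _ d] Tm \<Phi>n) auto
    fix \<omega> assume \<omega>: "\<omega> \<in> space M"
    have T: "inv_mat (S n \<omega>) \<in> carrier_mat d d" using inv_mat_props(1)[OF S_carrier R_nz[unfolded R_def]] .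
    have "(inv_mat (S n \<omega>) *\<^sub>v \<Phi> n \<omega>) $ j = (\<Sum>i=0..<d. inv_mat (S n \<omega>) $$ (j, i) * \<Phi> n \<omega> $ i)"
    proof -
      have "dim_vec (\<Phi> n \<omega>) = d" by (simp add: \<Phi>_vec)
      moreover have "(inv_mat (S n \<omega>) *\<^sub>v \<Phi> n \<omega>) $ j = Matrix.row (inv_mat (S n \<omega>)) j \<bullet> \<Phi> n \<omega>"
        using j carrier_matD[OF T] by simp
      ultimately show ?thesis using j carrier_matD[OF T] by (simp only: scalar_prod_def) (intro sum.cong, auto)
    qed
    moreover have "dim_vec (inv_mat (S n \<omega>) *\<^sub>v \<Phi> n \<omega>) = d" using carrier_matD[OF T] by simp
    ultimately show "vh (Suc n) \<omega> $ j = vh n \<omega> $ j + (X (int n + 1) \<omega> - U (int n) \<omega> - vh n \<omega> \<bullet> \<Phi> n \<omega>) * (\<Sum>i=0..<d. inv_mat (S n \<omega>) $$ (j, i) * \<Phi> n \<omega> $ i)"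
      using lse[OF \<omega>, of n, folded S_def] j by (simp del: index_mult_mat_vec)
  qed
  have "U (int (Suc n)) \<in> borel_measurable (F (Suc n))"
  proof (rule measurable_equality[OF _ control])
    show "(\<lambda>\<omega>. x (Suc n + 1) \<omega> - vh (Suc n) \<omega> \<bullet> \<Phi> (Suc n) \<omega>) \<in> borel_measurable (F (Suc n))"
      by (intro borel_measurable_diff x_F scalar_prod_measurable[of _ _ d] v' \<Phi>n) auto
  qed auto
  then have "U k \<in> borel_measurable (F (Suc n))" if "- 1 \<le> k" "k \<le> int (Suc n)" for k
    using Un[of k] that by (cases "k = int (Suc n)") auto
  then show ?case using X' \<epsilon>' v' by (simp add: adapted_upto_def)
qed

lemma \<Phi>_F: "j < d \<Longrightarrow> k \<le> n \<Longrightarrow> (\<lambda>\<omega>. \<Phi> k \<omega> $ j) \<in> borel_measurable (F n)"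
  using adapted[of n] by (intro \<Phi>_measurable) (auto simp: adapted_upto_def)

lemma E_F: "j < d \<Longrightarrow> (\<lambda>\<omega>. E n \<omega> $ j) \<in> borel_measurable (F n)"
  using adapted[of n] by (subst E_index) (auto simp: adapted_upto_def)

lemma R_F: "k \<le> n \<Longrightarrow> R k \<in> borel_measurable (F n)"
  unfolding R_def
  by (intro det_measurable[of _ _ d] S_carrier S_measurable[OF \<Phi>_F]) auto

lemma prediction_F: "k \<le> n \<Longrightarrow> (\<lambda>\<omega>. E n \<omega> \<bullet> \<Phi> k \<omega>) \<in> borel_measurable (F n)"
  by (intro scalar_prod_measurable[of _ _ d] E_F \<Phi>_F) auto

text \<open>Undivided, the Lyapunov form gains f_n V_(n+1)^2 with f_n = 1 - R_(n-1)/R_n, and the sum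
  of the f_n need not be bounded. Division by R^\<eta> changes this weight to (R_n - R_(n-1)) /
  R_n^(1+\<eta>), whose sum is at most 1/\<eta> on every path by telescoping.\<close>

lemma prediction_errors_bounded:
  assumes \<eta>: "0 < \<eta>"
  shows "AE \<omega> in M. \<exists>A. \<forall>n. (\<Sum>k=1..n. (E k \<omega> \<bullet> \<Phi> k \<omega>)\<^sup>2 * R (k - 1) \<omega> / R k \<omega> powr (1 + \<eta>)) \<le> A"
proof -
  \<comment> \<open>For n \<ge> 1 this is E_n^t S_(n-1) E_n written through inner products, so that
    its measurability at time n is visible.\<close>
  define W where "W n \<omega> = E n \<omega> \<bullet> E n \<omega> + (\<Sum>k=0..n - 1. (\<Phi> k \<omega> \<bullet> E n \<omega>) * (\<Phi> k \<omega> \<bullet> E n \<omega>))" for n \<omega>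
  define al where "al n \<omega> = (E n \<omega> \<bullet> \<Phi> n \<omega>)\<^sup>2 * R (n - 1) \<omega> / R n \<omega> powr (1 + \<eta>)" for n \<omega>
  define g where "g n \<omega> = (E n \<omega> \<bullet> \<Phi> n \<omega>) * R (n - 1) \<omega> / R n \<omega> powr (1 + \<eta>)" for n \<omega>
  define c where "c n \<omega> = (R n \<omega> - R (n - 1) \<omega>) / R n \<omega> powr (1 + \<eta>)" for n \<omega>
  define w where "w n \<omega> = W n \<omega> / R (n - 1) \<omega> powr \<eta>" for n \<omega>
  have R1: "1 \<le> R n \<omega>" for n \<omega>
    unfolding R_eq[symmetric] by (rule gram.r_pos[OF gram])
  have R_mono: "R n \<omega> \<le> R (Suc n) \<omega>" for n \<omega>
    unfolding R_eq[symmetric] by (rule gram.r_mono[OF gram])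
  have facts: "W (Suc (Suc m)) \<omega> = W (Suc m) \<omega> - R m \<omega> / R (Suc m) \<omega> * (E (Suc m) \<omega> \<bullet> \<Phi> (Suc m) \<omega>)\<^sup>2
      + 2 * (R m \<omega> / R (Suc m) \<omega> * (E (Suc m) \<omega> \<bullet> \<Phi> (Suc m) \<omega>)) * V (Suc (Suc m)) \<omega>
      + (1 - R m \<omega> / R (Suc m) \<omega>) * (V (Suc (Suc m)) \<omega>)\<^sup>2 \<and>
      R m \<omega> / R (Suc m) \<omega> * (E (Suc m) \<omega> \<bullet> \<Phi> (Suc m) \<omega>)\<^sup>2 \<le> W (Suc m) \<omega>" if \<omega>: "\<omega> \<in> space M" for m \<omega>
  proof -
    interpret P: arx_path p d \<theta> \<rho> "\<lambda>k. X k \<omega>" "\<lambda>k. U k \<omega>" "\<lambda>n. \<epsilon> n \<omega>" "\<lambda>n. V n \<omega>" "\<lambda>n. x n \<omega>" "\<lambda>n. \<Phi> n \<omega>" "\<lambda>n. vh n \<omega>"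
      by (rule path[OF \<omega>])
    have r: "P.r n = R n \<omega>" for n by (rule R_eq)
    have e: "P.e n = E n \<omega>" for n by (simp add: P.e_def E_def)
    have W: "E (Suc n) \<omega> \<bullet> (P.S n *\<^sub>v E (Suc n) \<omega>) = W (Suc n) \<omega>" for n
      using P.S_bilinear[OF P.e_carrier P.e_carrier] by (simp add: W_def e)
    define q where "q = R m \<omega> / R (Suc m) \<omega>"
    have f: "P.f (Suc m) = 1 - q" using P.r_Suc[of m] R1[of "Suc m" \<omega>] by (simp add: r q_def)
    show ?thesis
      using P.lyapunov[of m] P.lyapunov_dominates[of m] unfolding e W f q_def[symmetric] by simp
  qed
  have R0: "0 < R n \<omega>" for n \<omega> using R1[of n \<omega>] by linarith
  have Rp: "1 \<le> R n \<omega> powr \<eta>" for n \<omega> using R1[of n \<omega>] \<eta> by (intro ge_one_powr_ge_zero) auto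
  have Rs: "R n \<omega> powr (1 + \<eta>) = R n \<omega> * R n \<omega> powr \<eta>" for n \<omega> using R0[of n \<omega>] by (simp add: powr_add)
  have Wn: "0 \<le> W n \<omega>" for n \<omega>
    unfolding W_def using gram.scalar_prod_self_nonneg[OF gram, of "E n \<omega>"] by (intro add_nonneg_nonneg sum_nonneg) auto
  have "AE \<omega> in M. summable (\<lambda>n. al (Suc n) \<omega>)"
  proof (rule summable_of_almost_supermartingale[where w = w and g = g and c = c and C = "1 / \<eta>"])
    fix n :: nat and \<omega> assume n: "1 \<le> n" and \<omega>: "\<omega> \<in> space M"
    obtain m where m: "n = Suc m" using n by (cases n) auto
    define \<pi> V1 f q where "\<pi> = E n \<omega> \<bullet> \<Phi> n \<omega>" and "V1 = V (Suc n) \<omega>" and "f = R m \<omega> / R n \<omega>" and "q = R n \<omega> powr \<eta>"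
    have q: "1 \<le> q" using Rp by (simp add: q_def)
    have f: "0 \<le> f" "f \<le> 1" using R0[of m \<omega>] R0[of n \<omega>] R_mono[of m \<omega>] by (auto simp: f_def m)
    have W1: "W (Suc n) \<omega> = W n \<omega> - f * \<pi>\<^sup>2 + 2 * (f * \<pi>) * V1 + (1 - f) * V1\<^sup>2" and W2: "f * \<pi>\<^sup>2 \<le> W n \<omega>"
      using facts[OF \<omega>, of m] by (simp_all add: m f_def \<pi>_def V1_def)
    have al: "al n \<omega> = f * \<pi>\<^sup>2 / q" unfolding al_def Rs f_def \<pi>_def q_def using m by simp
    have g: "g n \<omega> = f * \<pi> / q" unfolding g_def Rs f_def \<pi>_def q_def using m by simp
    have "1 - f = (R n \<omega> - R m \<omega>) / R n \<omega>" using R0[of n \<omega>] by (simp add: f_def diff_divide_distrib)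
    then have c: "c n \<omega> = (1 - f) / q" unfolding c_def Rs q_def using m by simp
    \<comment> \<open>The old form carries the smaller denominator R_(n-1)^\<eta>; passing to
      R_n^\<eta> only decreases it, which is the direction needed for an upper bound on the next
      term.\<close>
    have "R m \<omega> powr \<eta> \<le> q" unfolding q_def m using R_mono R0[of m \<omega>] \<eta> by (intro powr_mono2) auto
    then have wn: "W n \<omega> / q \<le> w n \<omega>" using Wn q Rp[of m \<omega>] unfolding w_def m by (intro divide_left_mono mult_pos_pos) auto
    have split: "(w0 - f * \<pi>\<^sup>2 + 2 * (f * \<pi>) * V1 + g0 * V1\<^sup>2) / q = w0 / q - f * \<pi>\<^sup>2 / q + 2 * (f * \<pi> / q) * V1 + g0 / q * V1\<^sup>2" for w0 g0
      by (simp add: add_divide_distrib diff_divide_distrib)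
    have "w (Suc n) \<omega> = W n \<omega> / q - al n \<omega> + 2 * g n \<omega> * V1 + c n \<omega> * V1\<^sup>2"
      unfolding w_def W1 al g c diff_Suc_1 q_def[symmetric] by (rule split)
    then show "w (Suc n) \<omega> \<le> w n \<omega> - al n \<omega> + 2 * g n \<omega> * V (Suc n) \<omega> + c n \<omega> * (V (Suc n) \<omega>)\<^sup>2"
      using wn by (simp add: V1_def)
    show "0 \<le> al n \<omega>" "0 \<le> c n \<omega>" unfolding al c using f q by auto
    show "0 \<le> w n \<omega>" using Wn by (simp add: w_def)
    have "(g n \<omega>)\<^sup>2 = (f * (f * \<pi>\<^sup>2)) / (q * q)" by (simp add: g power2_eq_square)
    also have "\<dots> \<le> (1 * W n \<omega>) / (1 * q)" using f q W2 Wn[of n \<omega>] by (intro frac_le mult_mono) auto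
    finally show "(g n \<omega>)\<^sup>2 \<le> w n \<omega>" using wn by simp
  next
    fix n :: nat and \<omega> assume \<omega>: "\<omega> \<in> space M"
    have "(\<Sum>k=1..n. c k \<omega>) \<le> (\<Sum>k=1..n. (R (k - 1) \<omega> powr (- \<eta>) - R k \<omega> powr (- \<eta>)) / \<eta>)"
    proof (intro sum_mono)
      fix k assume "k \<in> {1..n}"
      then have "R (k - 1) \<omega> \<le> R k \<omega>" using R_mono[of "k - 1" \<omega>] by auto
      then show "c k \<omega> \<le> (R (k - 1) \<omega> powr (- \<eta>) - R k \<omega> powr (- \<eta>)) / \<eta>"
        unfolding c_def using R0 \<eta> by (intro power_telescope) auto
    qed
    also have "\<dots> = (\<Sum>k=1..n. R (k - 1) \<omega> powr (- \<eta>) - R k \<omega> powr (- \<eta>)) / \<eta>" by (rule sum_divide_distrib[symmetric])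
    also have "(\<Sum>k=1..n. R (k - 1) \<omega> powr (- \<eta>) - R k \<omega> powr (- \<eta>)) = R 0 \<omega> powr (- \<eta>) - R n \<omega> powr (- \<eta>)"
      by (induction n) auto
    also have "\<dots> / \<eta> \<le> 1 / \<eta>"
    proof (intro divide_right_mono)
      have "R 0 \<omega> powr (- \<eta>) \<le> 1" using Rp[of 0 \<omega>] by (simp add: powr_minus inverse_le_1_iff)
      moreover have "0 \<le> R n \<omega> powr (- \<eta>)" by simp
      ultimately show "R 0 \<omega> powr (- \<eta>) - R n \<omega> powr (- \<eta>) \<le> 1" by linarith
    qed (use \<eta> in auto)
    finally show "(\<Sum>k=1..n. c k \<omega>) \<le> 1 / \<eta>" .
  next
    fix n :: nat
    have [measurable]: "R n \<in> borel_measurable (F n)" "R (n - 1) \<in> borel_measurable (F n)"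
      "(\<lambda>\<omega>. E n \<omega> \<bullet> \<Phi> n \<omega>) \<in> borel_measurable (F n)" by (auto intro: R_F prediction_F)
    show "al n \<in> borel_measurable (F n)" "g n \<in> borel_measurable (F n)" "c n \<in> borel_measurable (F n)"
      unfolding al_def g_def c_def by measurable
    have "W n \<in> borel_measurable (F n)"
      unfolding W_def by (intro borel_measurable_add borel_measurable_sum borel_measurable_times scalar_prod_measurable[of _ _ d] E_F \<Phi>_F)
        (auto simp: space_F E_dim)
    then show "w n \<in> borel_measurable (F n)" unfolding w_def by measurable
  qed
  then show ?thesis
  proof eventually_elim
    case (elim \<omega>)
    have "(\<Sum>k=1..n. al k \<omega>) \<le> (\<Sum>n. al (Suc n) \<omega>)" for n
    proof -
      have "(\<Sum>k=1..n. al k \<omega>) = (\<Sum>k<n. al (Suc k) \<omega>)"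
        by (rule sum.reindex_bij_witness[of _ Suc "\<lambda>k. k - 1"]) auto
      also have "\<dots> \<le> (\<Sum>n. al (Suc n) \<omega>)"
        by (rule sum_le_suminf[OF elim]) (auto simp: al_def intro!: divide_nonneg_nonneg mult_nonneg_nonneg less_imp_le[OF R0])
      finally show ?thesis .
    qed
    then show ?case unfolding al_def by blast
  qed
qed


lemma gram_limit:
  "AE \<omega> in M. \<forall>i<d. \<forall>j<d. avg (\<lambda>k. \<Phi> k \<omega> $ i * \<Phi> k \<omega> $ j) \<longlonglongrightarrow> \<sigma>\<^sup>2 * Lambda_mat p \<theta> \<rho> $$ (i, j)"
proof -
  \<comment> \<open>\<gamma> = 1/2 + 1/a is the midpoint between 2/a and 1. Then \<tau> is an eighth
    of 1 - \<gamma>, m is at least 2 d / \<tau> and \<eta> = \<tau> / (2 m d), as the growth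
    argument asks.\<close>
  define s where "s = 1 / a"
  define \<gamma> where "\<gamma> = 1 / 2 + s"
  define \<tau> where "\<tau> = (1 - \<gamma>) / 8"
  define m where "m = nat \<lceil>2 * real d / \<tau>\<rceil>"
  define \<eta> where "\<eta> = \<tau> / (2 * real m * real d)"
  have s: "s < 1 / 2" "0 < s" using a_gt by (auto simp: s_def)
  have "0 < \<gamma>" unfolding \<gamma>_def using s by linarith
  moreover have "\<gamma> < 1" unfolding \<gamma>_def using s by linarith
  ultimately have \<gamma>: "0 < \<gamma>" "\<gamma> < 1" by blast+
  have \<gamma>a: "\<gamma> * a > 2" using a_gt by (simp add: \<gamma>_def s_def field_simps)
  have \<tau>: "0 < \<tau>" "8 * \<tau> \<le> 1 - \<gamma>" using \<gamma> by (auto simp: \<tau>_def)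
  have d0: "0 < real d" by (simp add: d)
  have q: "0 < 2 * real d / \<tau>" using d0 \<tau> by simp
  then have m0: "0 < real m" unfolding m_def by simp
  then have m1: "1 \<le> m" by simp
  have "2 * real d / \<tau> \<le> real m" unfolding m_def by (rule real_nat_ceiling_ge)
  then have m2: "real d \<le> real m * \<tau> / 2" using \<tau> by (simp add: field_simps)
  have \<eta>: "0 < \<eta>" "\<eta> * real m * real d \<le> \<tau> / 2" using \<tau> m0 d0 by (auto simp: \<eta>_def)
  \<comment> \<open>This exponent lies in [2, a), so the regularity of x gives |x_n|^b = O(n), that
    is |x_n| = O(n^(\<gamma>/2)), the same order as for V.\<close>
  define b where "b = 2 / \<gamma>"
  have b: "2 \<le> b" "b < a" "1 / b = \<gamma> / 2" using \<gamma> \<gamma>a a_gt by (auto simp: b_def field_simps)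
  have pow1: "1 \<le> real n powr (\<gamma> / 2)" if "1 \<le> n" for n using that \<gamma> by (intro ge_one_powr_ge_zero) auto
  have cross: "AE \<omega> in M. \<forall>j. (\<lambda>n. (\<Sum>k<n. V (Suc (k + Suc j)) \<omega> * V (Suc k) \<omega>) / real n) \<longlonglongrightarrow> 0"
    unfolding AE_all_countable by (intro allI slln_cross) simp
  from V_growth[OF \<gamma>a] slln_V2 cross x_small x_reg[OF b(1,2)] prediction_errors_bounded[OF \<eta>(1)] AE_space
  show ?thesis
  proof eventually_elim
    case (elim \<omega>)
    have \<omega>: "\<omega> \<in> space M" by (rule elim(7))
    obtain D1 where D1: "0 \<le> D1" "\<And>n. 1 \<le> n \<Longrightarrow> \<bar>V n \<omega>\<bar> \<le> D1 * real n powr (\<gamma> / 2)"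
    proof (rule bounded_multiple_of_eventually[where u = "\<lambda>n. V n \<omega>" and C = 1, OF _ pow1])
      have "eventually (\<lambda>n. \<bar>V (Suc n) \<omega>\<bar> \<le> 1 * real (Suc n) powr (\<gamma> / 2)) sequentially"
        using elim(1)
      proof eventually_elim
        case (elim n)
        have "(real n + 1) powr \<gamma> = (real (Suc n) powr (\<gamma> / 2))\<^sup>2"
          by (simp add: power2_eq_square powr_add[symmetric] add.commute)
        then have "sqrt ((V (Suc n) \<omega>)\<^sup>2) \<le> sqrt ((real (Suc n) powr (\<gamma> / 2))\<^sup>2)" using elim by (intro real_sqrt_le_mono) simp
        then show ?case by simp
      qed
      then show "eventually (\<lambda>n. \<bar>V n \<omega>\<bar> \<le> 1 * real n powr (\<gamma> / 2)) sequentially"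
        by (subst eventually_sequentially_Suc[symmetric])
    qed auto
    obtain C where C: "0 < C" "eventually (\<lambda>n. norm (\<Sum>k=1..n. \<bar>x k \<omega>\<bar> powr b) \<le> C * norm (real n)) sequentially"
      using landau_o.bigE[OF elim(5)] by blast
    obtain D2 where D2: "0 \<le> D2" "\<And>n. 1 \<le> n \<Longrightarrow> \<bar>x n \<omega>\<bar> \<le> D2 * real n powr (\<gamma> / 2)"
    proof (rule bounded_multiple_of_eventually[where u = "\<lambda>n. x n \<omega>" and C = "C powr (\<gamma> / 2)", OF _ pow1])
      show "eventually (\<lambda>n. \<bar>x n \<omega>\<bar> \<le> C powr (\<gamma> / 2) * real n powr (\<gamma> / 2)) sequentially"
        using C(2) eventually_ge_at_top[of 1]
      proof eventually_elim
        case (elim n)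
        have "\<bar>x n \<omega>\<bar> powr b \<le> (\<Sum>k=1..n. \<bar>x k \<omega>\<bar> powr b)" using elim(2) by (intro member_le_sum) auto
        also have "\<dots> \<le> C * real n" using elim(1) by simp
        finally have "(\<bar>x n \<omega>\<bar> powr b) powr (1 / b) \<le> (C * real n) powr (1 / b)" using b(1) by (intro powr_mono2) auto
        moreover have "(\<bar>x n \<omega>\<bar> powr b) powr (1 / b) = \<bar>x n \<omega>\<bar>" using b(1) by (simp add: powr_powr)
        ultimately show ?case using C(1) unfolding b(3) by (simp add: powr_mult)
      qed
    qed auto
    define Cb where "Cb = D1 + D2"
    have Cb: "D1 * real n powr (\<gamma> / 2) \<le> Cb * real n powr (\<gamma> / 2)" "D2 * real n powr (\<gamma> / 2) \<le> Cb * real n powr (\<gamma> / 2)" for n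
      using D1(1) D2(1) by (auto simp: Cb_def intro!: mult_right_mono)
    have x_avg: "avg (\<lambda>k. (x (Suc k) \<omega>)\<^sup>2) \<longlonglongrightarrow> 0"
    proof -
      have "(\<lambda>n. (\<Sum>k=1..n. (x k \<omega>)\<^sup>2) / real n) \<longlonglongrightarrow> 0" using smalloD_tendsto[OF elim(4)] .
      moreover have "(\<Sum>k=1..n. (x k \<omega>)\<^sup>2) = (\<Sum>k<n. (x (Suc k) \<omega>)\<^sup>2)" for n
        by (rule sum.reindex_bij_witness[of _ Suc "\<lambda>k. k - 1"]) auto
      ultimately show ?thesis by (simp add: avg_def[abs_def])
    qed
    obtain A where A: "\<And>n. (\<Sum>k=1..n. (E k \<omega> \<bullet> \<Phi> k \<omega>)\<^sup>2 * R (k - 1) \<omega> / R k \<omega> powr (1 + \<eta>)) \<le> A" using elim(6) by blast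
    interpret P: arx_path p d \<theta> \<rho> "\<lambda>k. X k \<omega>" "\<lambda>k. U k \<omega>" "\<lambda>n. \<epsilon> n \<omega>" "\<lambda>n. V n \<omega>" "\<lambda>n. x n \<omega>" "\<lambda>n. \<Phi> n \<omega>" "\<lambda>n. vh n \<omega>"
      by (rule path[OF \<omega>])
    have e: "P.e n = E n \<omega>" for n by (simp add: P.e_def E_def)
    interpret Q: arx_path_limit p d \<theta> \<rho> "\<lambda>k. X k \<omega>" "\<lambda>k. U k \<omega>" "\<lambda>n. \<epsilon> n \<omega>" "\<lambda>n. V n \<omega>" "\<lambda>n. x n \<omega>" "\<lambda>n. \<Phi> n \<omega>" "\<lambda>n. vh n \<omega>"
      \<gamma> \<eta> \<tau> A Cb "\<sigma>\<^sup>2" m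
    proof (unfold_locales, goal_cases)
      case (3 n) then show ?case using D1(2) Cb(1) order_trans by blast
    next
      case (4 n) then show ?case using D2(2) Cb(2) order_trans by blast
    next
      case 6 then show ?case using elim(2) by (simp add: avg_def[abs_def])
    next
      case (7 j)
      obtain j' where "j = Suc j'" using 7 by (cases j) auto
      then show ?case using elim(3)[rule_format, of j'] by (simp add: avg_def[abs_def])
    next
      case (8 n) then show ?case using A[of n] by (simp add: e R_eq)
    qed (use \<gamma> x_avg \<tau> m1 m2 \<eta> in auto)
    show ?case using Q.gram_limit_avg by blast
  qed
qed

text \<open>Index 0 is suppressed to match the normal equations, whose sum begins at 1.\<close>

definition "\<phi> i k \<omega> = (if k = 0 then 0 else \<Phi> k \<omega> $ i)" for i k :: nat
definition "Z i n \<omega> = (\<Sum>k<n. \<phi> i k \<omega> * V (Suc k) \<omega>) / sqrt (real n)"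

lemma \<phi>_F: "i < d \<Longrightarrow> \<phi> i k \<in> borel_measurable (F k)"
  unfolding \<phi>_def by (cases "k = 0") (auto intro: \<Phi>_F)

lemma Z_M: "i < d \<Longrightarrow> Z i n \<in> borel_measurable M"
  unfolding Z_def by (intro borel_measurable_divide borel_measurable_sum borel_measurable_times V_M F_M[OF \<phi>_F]) auto

text \<open>Cramer-Wold form: each linear combination is a scalar martingale transform, and its
  averaged squares converge by \<open>gram_limit\<close>.\<close>

lemma linear_clt:
  "(\<lambda>n. CLINT \<omega>|M. iexp (\<Sum>i<d. c i * Z i n \<omega>)) \<longlonglongrightarrow>
    complex_of_real (exp (- (\<sigma>^4 * (\<Sum>i<d. \<Sum>j<d. c i * c j * Lambda_mat p \<theta> \<rho> $$ (i, j))) / 2))"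
proof -
  define v where "v = \<sigma>\<^sup>2 * (\<Sum>i<d. \<Sum>j<d. c i * c j * Lambda_mat p \<theta> \<rho> $$ (i, j))"
  define \<psi> where "\<psi> k \<omega> = (\<Sum>i<d. c i * \<phi> i k \<omega>)" for k \<omega>
  have "(\<lambda>n. CLINT \<omega>|M. iexp ((\<Sum>k<n. \<psi> k \<omega> * V (Suc k) \<omega>) / sqrt (real n))) \<longlonglongrightarrow> complex_of_real (exp (- (\<sigma>\<^sup>2 * v / 2)))"
  proof (rule martingale_clt)
    show "\<psi> k \<in> borel_measurable (F k)" for k
      unfolding \<psi>_def by (intro borel_measurable_sum borel_measurable_times \<phi>_F) auto
    show "AE \<omega> in M. (\<lambda>n. (\<Sum>k<n. (\<psi> k \<omega>)\<^sup>2) / real n) \<longlonglongrightarrow> v"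
      using gram_limit
    proof eventually_elim
      case (elim \<omega>)
      have "avg (\<lambda>k. (\<Sum>i<d. c i * \<Phi> k \<omega> $ i)\<^sup>2) = (\<lambda>n. \<Sum>i<d. \<Sum>j<d. (c i * c j) * avg (\<lambda>k. \<Phi> k \<omega> $ i * \<Phi> k \<omega> $ j) n)"
      proof
        fix n
        have "(\<Sum>i<d. c i * \<Phi> k \<omega> $ i)\<^sup>2 = (\<Sum>i<d. \<Sum>j<d. (c i * c j) * (\<Phi> k \<omega> $ i * \<Phi> k \<omega> $ j))" for k
          unfolding power2_eq_square sum_product by (simp only: mult_ac)
        then show "avg (\<lambda>k. (\<Sum>i<d. c i * \<Phi> k \<omega> $ i)\<^sup>2) n = (\<Sum>i<d. \<Sum>j<d. (c i * c j) * avg (\<lambda>k. \<Phi> k \<omega> $ i * \<Phi> k \<omega> $ j) n)"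
          by (simp only: avg_sum avg_cmult)
      qed
      moreover have "(\<lambda>n. \<Sum>i<d. \<Sum>j<d. (c i * c j) * avg (\<lambda>k. \<Phi> k \<omega> $ i * \<Phi> k \<omega> $ j) n) \<longlonglongrightarrow>
          (\<Sum>i<d. \<Sum>j<d. (c i * c j) * (\<sigma>\<^sup>2 * Lambda_mat p \<theta> \<rho> $$ (i, j)))"
        using elim by (intro tendsto_sum tendsto_mult tendsto_const) auto
      moreover have "(\<Sum>i<d. \<Sum>j<d. (c i * c j) * (\<sigma>\<^sup>2 * Lambda_mat p \<theta> \<rho> $$ (i, j))) = v"
        unfolding v_def sum_distrib_left by (simp only: mult_ac)
      ultimately have "avg (\<lambda>k. (\<Sum>i<d. c i * \<Phi> k \<omega> $ i)\<^sup>2) \<longlonglongrightarrow> v" by simp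
      \<comment> \<open>A shift by one and back removes the discrepancy between \<phi> and \<Phi> at
        index 0.\<close>
      then have "avg (\<lambda>k. (\<Sum>i<d. c i * \<Phi> (k + 1) \<omega> $ i)\<^sup>2) \<longlonglongrightarrow> v" by (rule avg_shift)
      moreover have "(\<psi> (k + 1) \<omega>)\<^sup>2 = (\<Sum>i<d. c i * \<Phi> (k + 1) \<omega> $ i)\<^sup>2" for k by (simp add: \<psi>_def \<phi>_def)
      ultimately have "avg (\<lambda>k. (\<psi> (k + 1) \<omega>)\<^sup>2) \<longlonglongrightarrow> v" by simp
      then have "avg (\<lambda>k. (\<psi> k \<omega>)\<^sup>2) \<longlonglongrightarrow> v" by (rule avg_unshift)
      then show ?case by (simp add: avg_def[abs_def])
    qed
  qed
  moreover have "(\<Sum>k<n. \<psi> k \<omega> * V (Suc k) \<omega>) / sqrt (real n) = (\<Sum>i<d. c i * Z i n \<omega>)" for n \<omega>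
    unfolding \<psi>_def Z_def sum_divide_distrib sum_distrib_right sum_distrib_left
    by (subst sum.swap) (simp only: mult.assoc times_divide_eq_right)
  moreover have "\<sigma>\<^sup>2 * v / 2 = \<sigma>^4 * (\<Sum>i<d. \<Sum>j<d. c i * c j * Lambda_mat p \<theta> \<rho> $$ (i, j)) / 2"
    by (simp add: v_def power4_eq_xxxx power2_eq_square)
  ultimately show ?thesis by simp
qed

lemma Z_tight:
  assumes i: "i < d"
  shows "tight_rv (Z i)"
proof (rule tight_cong_char[where v = "\<sigma>^4 * Lambda_mat p \<theta> \<rho> $$ (i, i)"])
  show "Z i n \<in> borel_measurable M" for n by (rule Z_M[OF i])
  interpret C: covariance p d \<theta> \<rho> by (rule covariance.intro[OF d \<rho>])
  have "Lambda_mat p \<theta> \<rho> $$ (i, i) = (\<Sum>l<p+2. Lambda_factor p \<theta> \<rho> i l * Lambda_factor p \<theta> \<rho> i l)"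
    using Lambda_factorization[OF \<rho>(1), of i p i] i by (simp add: d)
  then have "0 \<le> Lambda_mat p \<theta> \<rho> $$ (i, i)" by (simp only:) (intro sum_nonneg, simp)
  then show "0 \<le> \<sigma>^4 * Lambda_mat p \<theta> \<rho> $$ (i, i)" by simp
  fix s :: real
  have one: "(\<Sum>k<d. (if k = i then s else 0) * g k) = s * g i" for g :: "nat \<Rightarrow> real"
  proof -
    have "(\<Sum>k<d. (if k = i then s else 0) * g k) = (\<Sum>k<d. if k = i then s * g i else 0)" by (intro sum.cong) auto
    then show ?thesis using i by (simp add: sum.delta)
  qed
  have "(\<Sum>k<d. \<Sum>j<d. (if k = i then s else 0) * (if j = i then s else 0) * Lambda_mat p \<theta> \<rho> $$ (k, j)) = s\<^sup>2 * Lambda_mat p \<theta> \<rho> $$ (i, i)"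
    by (simp only: mult.assoc sum_distrib_left[symmetric] one power2_eq_square)
  then show "(\<lambda>n. CLINT \<omega>|M. iexp (s * Z i n \<omega>)) \<longlonglongrightarrow> complex_of_real (exp (- (s\<^sup>2 * (\<sigma>^4 * Lambda_mat p \<theta> \<rho> $$ (i, i))) / 2))"
    using linear_clt[of "\<lambda>k. if k = i then s else 0"] by (simp only: one mult.left_commute)
qed


section \<open>From the normal equations to the joint limit\<close>

sublocale cov: covariance p d \<theta> \<rho> by (rule covariance.intro[OF d \<rho>])

text \<open>The index n - 1 appears because the estimator at time n has used the regressors 0 to n -
  1.\<close>

definition "K c i n \<omega> = real n * inv_mat (S (n - 1) \<omega>) $$ (c, i)"

lemma K_M: "c < d \<Longrightarrow> i < d \<Longrightarrow> K c i n \<in> borel_measurable M"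
  unfolding K_def
  by (intro borel_measurable_times borel_measurable_const inv_mat_measurable[of _ _ d] S_measurable F_M[OF \<Phi>_F] S_carrier)
    (auto simp: R_nz[unfolded R_def])

lemma K_limit: "AE \<omega> in M. \<forall>c<d. \<forall>i<d. (\<lambda>n. K c i n \<omega>) \<longlonglongrightarrow> cov.J $$ (c, i) / \<sigma>\<^sup>2"
  using gram_limit
proof eventually_elim
  case (elim \<omega>)
  have s2: "\<sigma>\<^sup>2 \<noteq> 0" using \<sigma>_pos by simp
  have L: "Lambda_mat p \<theta> \<rho> \<in> carrier_mat d d" "Determinant.det (Lambda_mat p \<theta> \<rho>) \<noteq> 0"
    using cov.\<Lambda>_carrier cov.det_\<Lambda> by (simp_all add: cov.\<Lambda>_def)
  note lim = inv_mat_smult[OF L s2]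
  have Sd: "Determinant.det (S m \<omega>) \<noteq> 0" for m using R_nz by (simp add: R_def)
  have c0: "1 / real (Suc m) \<noteq> 0" for m by simp
  note fin = inv_mat_smult[OF S_carrier Sd c0]
  have entry: "(\<lambda>m. ((1 / real (Suc m)) \<cdot>\<^sub>m S m \<omega>) $$ (i, j)) \<longlonglongrightarrow> (\<sigma>\<^sup>2 \<cdot>\<^sub>m Lambda_mat p \<theta> \<rho>) $$ (i, j)" if ij: "i < d" "j < d" for i j
  proof -
    have "((1 / real (Suc m)) \<cdot>\<^sub>m S m \<omega>) $$ (i, j) = avg (\<lambda>k. \<Phi> k \<omega> $ i * \<Phi> k \<omega> $ j) (Suc m) + (if i = j then 1 else 0) * (1 / real (Suc m))" for m
    proof -
      have "((1 / real (Suc m)) \<cdot>\<^sub>m S m \<omega>) $$ (i, j) = 1 / real (Suc m) * S m \<omega> $$ (i, j)"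
        using ij carrier_matD[OF S_carrier[of m \<omega>]] by simp
      also have "\<dots> = (\<Sum>k<Suc m. \<Phi> k \<omega> $ i * \<Phi> k \<omega> $ j) / real (Suc m) + (if i = j then 1 else 0) * (1 / real (Suc m))"
        unfolding S_index[OF ij] atLeast0AtMost lessThan_Suc_atMost by (simp add: add_divide_distrib)
      finally show ?thesis by (simp only: avg_def)
    qed
    moreover have "(\<lambda>m. avg (\<lambda>k. \<Phi> k \<omega> $ i * \<Phi> k \<omega> $ j) (Suc m) + (if i = j then 1 else 0) * (1 / real (Suc m))) \<longlonglongrightarrow>
        \<sigma>\<^sup>2 * Lambda_mat p \<theta> \<rho> $$ (i, j) + (if i = j then 1 else 0) * 0"
      using elim ij by (intro tendsto_add tendsto_mult tendsto_const LIMSEQ_Suc lim_1_over_n) auto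
    moreover have "(\<sigma>\<^sup>2 \<cdot>\<^sub>m Lambda_mat p \<theta> \<rho>) $$ (i, j) = \<sigma>\<^sup>2 * Lambda_mat p \<theta> \<rho> $$ (i, j)"
      using ij carrier_matD[OF L(1)] by simp
    ultimately show ?thesis by simp
  qed
  have "(\<lambda>n. K c i n \<omega>) \<longlonglongrightarrow> cov.J $$ (c, i) / \<sigma>\<^sup>2" if ci: "c < d" "i < d" for c i
  proof -
    \<comment> \<open>Inversion is continuous at the regular limit \<sigma>^2 \<Lambda>, so the
      scaled inverses converge entrywise.\<close>
    have "(\<lambda>m. inv_mat ((1 / real (Suc m)) \<cdot>\<^sub>m S m \<omega>) $$ (c, i)) \<longlonglongrightarrow> inv_mat (\<sigma>\<^sup>2 \<cdot>\<^sub>m Lambda_mat p \<theta> \<rho>) $$ (c, i)"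
      by (rule inv_mat_tendsto[OF _ fin(1) _ lim(1) entry ci]) (use L in auto)
    moreover have "inv_mat ((1 / real (Suc m)) \<cdot>\<^sub>m S m \<omega>) $$ (c, i) = K c i (Suc m) \<omega>" for m
      unfolding fin(2) using ci carrier_matD[OF inv_mat_props(1)[OF S_carrier Sd[of m]]] by (simp add: K_def)
    moreover have "inv_mat (\<sigma>\<^sup>2 \<cdot>\<^sub>m Lambda_mat p \<theta> \<rho>) $$ (c, i) = cov.J $$ (c, i) / \<sigma>\<^sup>2"
      unfolding lim(2) using ci carrier_matD[OF inv_mat_props(1)[OF L]] by (simp add: cov.J_def cov.\<Lambda>_def)
    ultimately show ?thesis by (subst filterlim_sequentially_Suc[symmetric]) simp
  qed
  then show ?case by blast
qed

definition "D c n \<omega> = sqrt (real n) * E n \<omega> $ c"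
definition "s0 i \<omega> = (\<Sum>j<d. S 0 \<omega> $$ (i, j) * E 1 \<omega> $ j)"

lemma D_M: "c < d \<Longrightarrow> D c n \<in> borel_measurable M"
  unfolding D_def by (intro borel_measurable_times borel_measurable_const F_M[OF E_F])

lemma s0_M: "i < d \<Longrightarrow> s0 i \<in> borel_measurable M"
  unfolding s0_def by (intro borel_measurable_sum borel_measurable_times S_measurable F_M[OF E_F] F_M[OF \<Phi>_F]) auto

text \<open>By the normal equations S_(n-1) E_n is the initial vector plus sqrt n times Z_n;
  applying the inverse and multiplying by sqrt n gives this form.\<close>

lemma D_eq:
  assumes \<omega>: "\<omega> \<in> space M" and c: "c < d" and n: "1 \<le> n"
  shows "D c n \<omega> = (\<Sum>i<d. K c i n \<omega> * (s0 i \<omega> / sqrt (real n) + Z i n \<omega>))"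
proof -
  obtain m where m: "n = Suc m" using n by (cases n) auto
  interpret P: arx_path p d \<theta> \<rho> "\<lambda>k. X k \<omega>" "\<lambda>k. U k \<omega>" "\<lambda>n. \<epsilon> n \<omega>" "\<lambda>n. V n \<omega>" "\<lambda>n. x n \<omega>" "\<lambda>n. \<Phi> n \<omega>" "\<lambda>n. vh n \<omega>"
    by (rule path[OF \<omega>])
  have e: "P.e n = E n \<omega>" for n by (simp add: P.e_def E_def)
  have PS: "P.S n = S n \<omega>" for n by (simp add: P.S_def S_def)
  have PT: "P.T n = inv_mat (S n \<omega>)" for n by (simp add: P.T_def PS)
  have T: "inv_mat (S m \<omega>) \<in> carrier_mat d d" using P.T_carrier[of m] by (simp only: PT)
  have E: "E k \<omega> \<in> carrier_vec d" for k by (rule E_dim[OF \<omega>])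
  have mv: "(B *\<^sub>v u) $ i = (\<Sum>j<d. B $$ (i, j) * u $ j)" if "B \<in> carrier_mat d d" "u \<in> carrier_vec d" "i < d" for B and u :: "real vec" and i
    using that by (simp add: scalar_prod_def atLeast0LessThan)
  have SE: "(S m \<omega> *\<^sub>v E n \<omega>) $ i = s0 i \<omega> + sqrt (real n) * Z i n \<omega>" if i: "i < d" for i
  proof -
    have "(\<Sum>k=1..m. \<Phi> k \<omega> $ i * V (Suc k) \<omega>) = (\<Sum>k<n. \<phi> i k \<omega> * V (Suc k) \<omega>)"
      by (rule sum.mono_neutral_cong_left) (auto simp: m \<phi>_def)
    moreover have "(S 0 \<omega> *\<^sub>v E 1 \<omega>) $ i = s0 i \<omega>" unfolding s0_def by (rule mv[OF S_carrier E i])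
    ultimately show ?thesis using P.normal_eq[OF i, of m] n by (simp add: e PS Z_def m del: index_mult_mat_vec)
  qed
  have "E n \<omega> $ c = (inv_mat (S m \<omega>) *\<^sub>v (S m \<omega> *\<^sub>v E n \<omega>)) $ c" using P.T_S_vec[OF E, of m n] by (simp add: PS PT)
  also have "\<dots> = (\<Sum>i<d. inv_mat (S m \<omega>) $$ (c, i) * (S m \<omega> *\<^sub>v E n \<omega>) $ i)"
    by (rule mv[OF T mult_mat_vec_carrier[OF S_carrier E] c])
  also have "\<dots> = (\<Sum>i<d. inv_mat (S m \<omega>) $$ (c, i) * (s0 i \<omega> + sqrt (real n) * Z i n \<omega>))"
    by (intro sum.cong refl) (simp only: SE lessThan_iff)
  finally have "D c n \<omega> = (\<Sum>i<d. sqrt (real n) * (inv_mat (S m \<omega>) $$ (c, i) * (s0 i \<omega> + sqrt (real n) * Z i n \<omega>)))"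
    unfolding D_def by (simp only: sum_distrib_left)
  also have "\<dots> = (\<Sum>i<d. K c i n \<omega> * (s0 i \<omega> / sqrt (real n) + Z i n \<omega>))"
  proof (intro sum.cong refl)
    fix i
    define q where "q = sqrt (real n)"
    have q: "q \<noteq> 0" "real n = q * q" using n by (auto simp: q_def)
    have "K c i n \<omega> = q * q * inv_mat (S m \<omega>) $$ (c, i)" by (simp add: K_def q(2)[symmetric]) (simp add: m)
    then show "sqrt (real n) * (inv_mat (S m \<omega>) $$ (c, i) * (s0 i \<omega> + sqrt (real n) * Z i n \<omega>)) = K c i n \<omega> * (s0 i \<omega> / sqrt (real n) + Z i n \<omega>)"
      unfolding q_def[symmetric] using q(1) by (simp add: field_simps)
  qed
  finally show ?thesis .
qed

text \<open>The deviation of K from its almost sure limit multiplies a tight sequence, and the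
  initial vector is divided by sqrt n; both parts are negligible.\<close>

lemma D_linear:
  assumes c: "c < d"
  shows "conv0 (\<lambda>n \<omega>. D c n \<omega> - (\<Sum>i<d. cov.J $$ (c, i) / \<sigma>\<^sup>2 * Z i n \<omega>))"
proof (rule conv0_cong)
  let ?B = "\<lambda>n \<omega>. \<Sum>i<d. (K c i n \<omega> - cov.J $$ (c, i) / \<sigma>\<^sup>2) * Z i n \<omega> + K c i n \<omega> * (s0 i \<omega> / sqrt (real n))"
  show "conv0 ?B"
  proof (intro conv0_sum conv0_add)
    fix i assume i: "i \<in> {..<d}"
    show "conv0 (\<lambda>n \<omega>. (K c i n \<omega> - cov.J $$ (c, i) / \<sigma>\<^sup>2) * Z i n \<omega>)"
    proof (intro conv0_mult_tight Z_tight conv0_AE)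
      show "AE \<omega> in M. (\<lambda>n. K c i n \<omega> - cov.J $$ (c, i) / \<sigma>\<^sup>2) \<longlonglongrightarrow> 0"
        using K_limit by eventually_elim (use c i in \<open>auto intro: LIM_zero\<close>)
    qed (use K_M[OF c] i in auto)
    show "conv0 (\<lambda>n \<omega>. K c i n \<omega> * (s0 i \<omega> / sqrt (real n)))"
    proof (rule conv0_AE)
      show "AE \<omega> in M. (\<lambda>n. K c i n \<omega> * (s0 i \<omega> / sqrt (real n))) \<longlonglongrightarrow> 0"
        using K_limit
      proof eventually_elim
        case (elim \<omega>)
        have "(\<lambda>n. 1 / sqrt (real n)) \<longlonglongrightarrow> 0" by real_asymp
        then have "(\<lambda>n. s0 i \<omega> / sqrt (real n)) \<longlonglongrightarrow> 0" using tendsto_mult_right_zero[of "\<lambda>n. 1 / sqrt (real n)" _ "s0 i \<omega>"] by simp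
        moreover have "(\<lambda>n. K c i n \<omega>) \<longlonglongrightarrow> cov.J $$ (c, i) / \<sigma>\<^sup>2" using elim c i by auto
        ultimately have "(\<lambda>n. K c i n \<omega> * (s0 i \<omega> / sqrt (real n))) \<longlonglongrightarrow> cov.J $$ (c, i) / \<sigma>\<^sup>2 * 0" by (intro tendsto_mult)
        then show ?case by simp
      qed
    qed (use K_M[OF c] s0_M i in \<open>auto intro!: borel_measurable_times borel_measurable_divide\<close>)
  qed
  show "(\<lambda>\<omega>. D c n \<omega> - (\<Sum>i<d. cov.J $$ (c, i) / \<sigma>\<^sup>2 * Z i n \<omega>)) \<in> borel_measurable M" for n
    by (intro borel_measurable_diff borel_measurable_sum borel_measurable_times borel_measurable_const Z_M D_M c) auto
  fix n :: nat and \<omega> assume "1 \<le> n" "\<omega> \<in> space M"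
  then show "D c n \<omega> - (\<Sum>i<d. cov.J $$ (c, i) / \<sigma>\<^sup>2 * Z i n \<omega>) = ?B n \<omega>"
    unfolding D_eq[OF \<open>\<omega> \<in> space M\<close> c \<open>1 \<le> n\<close>] sum_subtractf[symmetric] by (intro sum.cong refl) (simp add: algebra_simps)
qed

lemma D_tight: "c < d \<Longrightarrow> tight_rv (D c)"
  by (rule tight_diff_conv0[OF D_linear], assumption, intro tight_sum tight_cmult Z_tight) simp

text \<open>Weak consistency is a by-product of the tightness of sqrt n E_n.\<close>

lemma E_conv0:
  assumes c: "c < d"
  shows "conv0 (\<lambda>n \<omega>. E n \<omega> $ c)"
proof (rule conv0_cong)
  show "conv0 (\<lambda>n \<omega>. 1 / sqrt (real n) * D c n \<omega>)"
  proof (intro conv0_mult_tight D_tight c conv0_AE AE_I2)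
    show "(\<lambda>n. 1 / sqrt (real n)) \<longlonglongrightarrow> 0" by real_asymp
  qed auto
qed (auto simp: D_def intro: F_M[OF E_F[OF c]])

definition "err k n \<omega> = sqrt (real n) * (theta_ext p (vh n \<omega>) k - (if k = 0 then - 1 else \<theta> k))"

text \<open>Both claims are carried together: the quadratic term of the recursion is a consistent
  error times \<open>err k\<close>, negligible because \<open>err k\<close> is tight, and tightness
  at the next index comes from its linearisation.\<close>

lemma err_linear:
  "k \<le> p \<Longrightarrow> conv0 (\<lambda>n \<omega>. err k n \<omega> - (\<Sum>c<d. nabla_ext p \<theta> \<rho> k c * D c n \<omega>)) \<and> tight_rv (err k)"
proof (induction k)
  case 0
  have "err 0 n \<omega> = 0" for n \<omega> by (simp add: err_def theta_ext_def)
  then show ?case using conv0_zero tight_const[of 0] by (simp add: nabla_ext_def)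
next
  case (Suc k)
  define q where "q k n \<omega> = err k n \<omega> - (\<Sum>c<d. nabla_ext p \<theta> \<rho> k c * D c n \<omega>)" for k n \<omega>
  have IH: "conv0 (q k)" "tight_rv (err k)" using Suc by (simp_all add: q_def[abs_def])
  have "q (Suc k) n \<omega> = \<rho> * q k n \<omega> + (- 1) * (E n \<omega> $ (p + 1) * err k n \<omega>)" for n \<omega>
  proof -
    have k: "k < p" using Suc.prems by simp
    have s: "err l n \<omega> - (\<Sum>c<d. nabla_ext p \<theta> \<rho> l c * D c n \<omega>) = sqrt (real n) * ((theta_ext p (vh n \<omega>) l - (if l = 0 then - 1 else \<theta> l)) - (\<Sum>c<p+2. nabla_ext p \<theta> \<rho> l c * (vh n \<omega> $ c - true_param p \<theta> \<rho> $ c)))" for l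
      unfolding err_def right_diff_distrib[of "sqrt (real n)" "theta_ext p (vh n \<omega>) l - (if l = 0 then - 1 else \<theta> l)"] sum_distrib_left
      by (intro arg_cong2[where f = minus] sum.cong refl) (auto simp: D_def E_index d)
    have E: "E n \<omega> $ (p + 1) = vh n \<omega> $ (p + 1) - true_param p \<theta> \<rho> $ (p + 1)" by (rule E_index) (simp add: d)
    show ?thesis
      unfolding q_def s E estimation_error_recursion[OF k] unfolding err_def by (simp add: algebra_simps)
  qed
  then have "q (Suc k) = (\<lambda>n \<omega>. \<rho> * q k n \<omega> + (- 1) * (E n \<omega> $ (p + 1) * err k n \<omega>))" by (simp add: fun_eq_iff)
  then have q: "conv0 (q (Suc k))"
    using conv0_add[OF conv0_cmult[OF IH(1)] conv0_cmult[OF conv0_mult_tight[OF E_conv0[of "p + 1"] IH(2)]], of \<rho> "- 1"] d by simp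
  moreover have "tight_rv (err (Suc k))"
    using q[unfolded q_def[abs_def]] by (rule tight_diff_conv0) (auto intro!: tight_sum tight_cmult D_tight)
  ultimately show ?case by (simp add: q_def[abs_def])
qed

definition "W j n \<omega> = sqrt (real n) * estimation_error p \<theta> \<rho> (vh n \<omega>) j"

text \<open>For j = p the relation is exact, the estimator of \<rho> being minus the last
  coordinate; otherwise it is \<open>err_linear\<close>.\<close>

lemma W_linear:
  assumes j: "j < p + 1"
  shows "conv0 (\<lambda>n \<omega>. W j n \<omega> - (\<Sum>c<d. cov.Nab $$ (j, c) * D c n \<omega>))"
proof (cases "j < p")
  case True
  have "W j n \<omega> = err (Suc j) n \<omega>" for n \<omega>
    using True by (simp add: W_def err_def estimation_error_def theta_ext_def)
  moreover have "nabla_ext p \<theta> \<rho> (Suc j) c = cov.Nab $$ (j, c)" for c by (simp add: nabla_ext_def cov.Nab_def)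
  ultimately show ?thesis using err_linear[of "Suc j"] True by simp
next
  case False
  then have jp: "j = p" using j by simp
  have "W j n \<omega> - (\<Sum>c<d. cov.Nab $$ (j, c) * D c n \<omega>) = 0" for n \<omega>
  proof -
    have "(\<Sum>c<d. cov.Nab $$ (j, c) * D c n \<omega>) = (\<Sum>c<d. if c = p + 1 then - D (p + 1) n \<omega> else 0)"
      by (intro sum.cong) (auto simp: jp cov.Nab_def nabla_mat_def d)
    also have "\<dots> = - D (p + 1) n \<omega>" using d by (subst sum.delta) auto
    also have "E n \<omega> $ (p + 1) = vh n \<omega> $ (p + 1) + \<rho>" using E_index[of "p + 1"] by (simp add: d true_param_def)
    then have "- D (p + 1) n \<omega> = W j n \<omega>"
      by (simp add: D_def W_def jp estimation_error_def rho_hat_def algebra_simps)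
    finally show ?thesis by simp
  qed
  then show ?thesis using conv0_zero by simp
qed

text \<open>Measurability is recovered from the linearisation error and its linear part.\<close>

lemma W_M: "j < p + 1 \<Longrightarrow> W j n \<in> borel_measurable M"
proof -
  assume j: "j < p + 1"
  have 1: "(\<lambda>\<omega>. W j n \<omega> - (\<Sum>c<d. cov.Nab $$ (j, c) * D c n \<omega>)) \<in> borel_measurable M"
    using W_linear[OF j] by (simp add: conv0_def)
  have 2: "(\<lambda>\<omega>. \<Sum>c<d. cov.Nab $$ (j, c) * D c n \<omega>) \<in> borel_measurable M"
    by (intro borel_measurable_sum borel_measurable_times borel_measurable_const D_M) auto
  from borel_measurable_add[OF 1 2] show ?thesis by simp
qed

text \<open>The linear form splits into a combination of the Z_i with coefficients
  \<open>cov.h\<close> over \<sigma>^2 and a remainder made of the two linearisation errors, which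
  \<open>slutsky_char\<close> discards.\<close>

lemma char_limit:
  "(\<lambda>n. CLINT \<omega>|M. iexp (\<Sum>j<p+1. t j * W j n \<omega>)) \<longlonglongrightarrow>
    complex_of_real (exp (- (\<Sum>l<d. (\<Sum>j<p+1. t j * cov.A $$ (j, l))\<^sup>2) / 2))"
proof -
  define Lin where "Lin n \<omega> = (\<Sum>i<d. cov.h t i / \<sigma>\<^sup>2 * Z i n \<omega>)" for n \<omega>
  define Rem where "Rem n \<omega> = (\<Sum>j<p+1. t j * (W j n \<omega> - (\<Sum>c<d. cov.Nab $$ (j, c) * D c n \<omega>))
      + (\<Sum>c<d. t j * cov.Nab $$ (j, c) * (D c n \<omega> - (\<Sum>i<d. cov.J $$ (c, i) / \<sigma>\<^sup>2 * Z i n \<omega>))))" for n \<omega>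
  have "conv0 Rem"
    unfolding Rem_def[abs_def] by (intro conv0_sum conv0_add conv0_cmult W_linear D_linear) auto
  have h: "(\<Sum>j<p+1. \<Sum>c<d. t j * cov.Nab $$ (j, c) * (\<Sum>i<d. cov.J $$ (c, i) / \<sigma>\<^sup>2 * Z i n \<omega>)) = Lin n \<omega>" for n \<omega>
  proof -
    have "(\<Sum>j<p+1. \<Sum>c<d. t j * cov.Nab $$ (j, c) * (\<Sum>i<d. cov.J $$ (c, i) / \<sigma>\<^sup>2 * Z i n \<omega>))
        = (\<Sum>j<p+1. \<Sum>i<d. \<Sum>c<d. t j * (cov.Nab $$ (j, c) * cov.J $$ (c, i)) * (Z i n \<omega> / \<sigma>\<^sup>2))"
    proof (rule sum.cong[OF refl])
      fix j
      show "(\<Sum>c<d. t j * cov.Nab $$ (j, c) * (\<Sum>i<d. cov.J $$ (c, i) / \<sigma>\<^sup>2 * Z i n \<omega>))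
          = (\<Sum>i<d. \<Sum>c<d. t j * (cov.Nab $$ (j, c) * cov.J $$ (c, i)) * (Z i n \<omega> / \<sigma>\<^sup>2))"
        by (subst sum.swap) (simp add: sum_distrib_left mult.assoc)
    qed
    also have "\<dots> = (\<Sum>i<d. \<Sum>j<p+1. t j * (\<Sum>c<d. cov.Nab $$ (j, c) * cov.J $$ (c, i)) * (Z i n \<omega> / \<sigma>\<^sup>2))"
      by (subst sum.swap) (simp only: sum_distrib_left sum_distrib_right)
    also have "\<dots> = Lin n \<omega>" unfolding Lin_def cov.h_def sum_distrib_right[symmetric] by simp
    finally show ?thesis .
  qed
  have "(\<Sum>j<p+1. t j * W j n \<omega>) = Lin n \<omega> + Rem n \<omega>" for n \<omega>
    unfolding h[symmetric] Rem_def sum.distrib[symmetric]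
    by (intro sum.cong refl) (simp add: sum.distrib[symmetric] right_diff_distrib sum_subtractf sum_distrib_left mult.assoc)
  moreover have "(\<lambda>n. CLINT \<omega>|M. iexp (Lin n \<omega> + Rem n \<omega>)) \<longlonglongrightarrow>
    complex_of_real (exp (- (\<Sum>l<d. (\<Sum>j<p+1. t j * cov.A $$ (j, l))\<^sup>2) / 2))"
  proof (rule slutsky_char[OF _ \<open>conv0 Rem\<close>])
    show "Lin n \<in> borel_measurable M" for n
      unfolding Lin_def by (intro borel_measurable_sum borel_measurable_times borel_measurable_const Z_M) auto
    \<comment> \<open>The two factors 1/\<sigma>^2 cancel the \<sigma>^4 of the martingale limit, so
      that the covariance does not depend on the noise level.\<close>
    have "\<sigma>^4 * (\<Sum>i<d. \<Sum>j<d. (cov.h t i / \<sigma>\<^sup>2) * (cov.h t j / \<sigma>\<^sup>2) * Lambda_mat p \<theta> \<rho> $$ (i, j)) = (\<Sum>i<d. \<Sum>j<d. cov.h t i * cov.h t j * Lambda_mat p \<theta> \<rho> $$ (i, j))"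
      unfolding sum_distrib_left using \<sigma>_pos by (intro sum.cong refl) (simp add: power4_eq_xxxx power2_eq_square)
    also have "\<dots> = (\<Sum>l<d. (\<Sum>j<p+1. t j * cov.A $$ (j, l))\<^sup>2)"
      using cov.quadratic_h[of t] by (simp only: cov.\<Lambda>_def)
    finally show "(\<lambda>n. CLINT \<omega>|M. iexp (Lin n \<omega>)) \<longlonglongrightarrow> complex_of_real (exp (- (\<Sum>l<d. (\<Sum>j<p+1. t j * cov.A $$ (j, l))\<^sup>2) / 2))"
      using linear_clt[of "\<lambda>i. cov.h t i / \<sigma>\<^sup>2"] unfolding Lin_def by (simp only:)
  qed
  ultimately show ?thesis by simp
qed

text \<open>The limit law is built as the image of d standard normals under \<open>cov.A\<close>, so
  that its characteristic function is the limit found in \<open>char_limit\<close>.\<close>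

theorem joint_clt:
  "\<exists>\<mu>. mv_normal (p + 1) (0\<^sub>v (p + 1)) (Sigma_mat p \<theta> \<rho>) \<mu> \<and>
    weak_conv_on (Rn_top (p + 1)) (\<lambda>n. distr M (Rn_borel (p + 1)) (\<lambda>\<omega>. \<lambda>j\<in>{..<p + 1}. W j n \<omega>)) \<mu>"
proof -
  obtain \<mu> where \<mu>: "prob_space \<mu>" "sets \<mu> = sets (Rn_borel (p + 1))"
    "\<And>t. (CLINT x|\<mu>. iexp (\<Sum>i<p+1. t i * x i)) = complex_of_real (exp (- (\<Sum>k<d. (\<Sum>i<p+1. t i * cov.A $$ (i, k))\<^sup>2) / 2))"
    by (rule gaussian_exists[where d = "p + 1" and m = d and A = "\<lambda>i k. cov.A $$ (i, k)"], rule that)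
  have "mv_normal (p + 1) (0\<^sub>v (p + 1)) (Sigma_mat p \<theta> \<rho>) \<mu>"
    unfolding mv_normal_def
  proof (intro conjI ballI)
    fix t :: "real vec" assume t: "t \<in> carrier_vec (p + 1)"
    have "t \<bullet> 0\<^sub>v (p + 1) = 0" by (rule scalar_prod_right_zero[OF t])
    then show "(CLINT x|\<mu>. iexp (\<Sum>i<p+1. t $ i * x i)) =
        exp (\<i> * complex_of_real (t \<bullet> 0\<^sub>v (p + 1)) - complex_of_real (t \<bullet> (Sigma_mat p \<theta> \<rho> *\<^sub>v t)) / 2)"
      unfolding \<mu>(3) cov.Sigma_quadratic[OF t] exp_of_real[symmetric] by simp
  qed (simp_all only: \<mu> cov.Sigma_symmetric cov.Sigma_carrier zero_carrier_vec)
  moreover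
  define G where "G n \<omega> = (\<lambda>j\<in>{..<p + 1}. W j n \<omega>)" for n \<omega>
  have G: "G n \<in> measurable M (Rn_borel (p + 1))" for n
    unfolding G_def by (intro measurable_restrict W_M) auto
  interpret C: char_converges "p + 1" "\<lambda>n. distr M (Rn_borel (p + 1)) (G n)" \<mu>
  proof (rule char_converges.intro)
    show "prob_space (distr M (Rn_borel (p + 1)) (G n))" for n by (rule prob_space_distr[OF G])
    fix t :: "nat \<Rightarrow> real"
    have "(CLINT x|distr M (Rn_borel (p + 1)) (G n). iexp (\<Sum>i<p+1. t i * x i)) = (CLINT \<omega>|M. iexp (\<Sum>j<p+1. t j * W j n \<omega>))" for n
    proof (subst integral_distr[OF G])
      have "(\<lambda>x. \<Sum>i<p+1. t i * x i) \<in> borel_measurable (Rn_borel (p + 1))"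
        by (intro borel_measurable_sum borel_measurable_times borel_measurable_const coordinate_measurable) auto
      then show "(\<lambda>x. iexp (\<Sum>i<p+1. t i * x i)) \<in> borel_measurable (Rn_borel (p + 1))" by measurable
    qed (simp add: G_def)
    then show "(\<lambda>n. CLINT x|distr M (Rn_borel (p + 1)) (G n). iexp (\<Sum>i<p+1. t i * x i)) \<longlonglongrightarrow> (CLINT x|\<mu>. iexp (\<Sum>i<p+1. t i * x i))"
      using char_limit[of t] by (simp only: \<mu>(3))
  qed (use \<mu> in auto)
  have "weak_conv_on (Rn_top (p + 1)) (\<lambda>n. distr M (Rn_borel (p + 1)) (G n)) \<mu>" by (rule C.levy_continuity_Rn)
  ultimately show ?thesis unfolding G_def by blast
qed

text \<open>Frequencies supported on the last coordinate reduce \<open>char_limit\<close> to one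
  dimension, and \<open>cov.last_variance\<close> evaluates the variance.\<close>

theorem rho_clt:
  "weak_conv_m (\<lambda>n. distr M borel (W p n)) (density lborel (normal_density 0 (sqrt ((1 - \<rho>\<^sup>2) / \<rho> ^ (2 * (p + 1))))))"
proof (rule levy_continuity)
  define s where "s = sqrt ((1 - \<rho>\<^sup>2) / \<rho> ^ (2 * (p + 1)))"
  have pos: "0 < (1 - \<rho>\<^sup>2) / \<rho> ^ (2 * (p + 1))"
    using cov.\<rho>2 \<rho>(2) by (intro divide_pos_pos) (simp_all add: power_mult del: power_Suc mult_Suc_right)
  then have s: "0 < s" "s\<^sup>2 = (1 - \<rho>\<^sup>2) / \<rho> ^ (2 * (p + 1))" by (simp_all only: s_def real_sqrt_gt_0_iff real_sqrt_pow2 less_imp_le)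
  have W: "W p n \<in> borel_measurable M" for n by (rule W_M) simp
  show "real_distribution (density lborel (normal_density 0 (sqrt ((1 - \<rho>\<^sup>2) / \<rho> ^ (2 * (p + 1))))))"
    unfolding s_def[symmetric] by (rule char_normal(1)[OF s(1)])
  show "real_distribution (distr M borel (W p n))" for n
    using prob_space_distr[OF W] by (simp add: real_distribution_def real_distribution_axioms_def)
  fix t :: real
  have one: "(\<Sum>j<p+1. (if j = p then t else 0) * g j) = t * g p" for g :: "nat \<Rightarrow> real" by simp
  have "char (distr M borel (W p n)) t = (CLINT \<omega>|M. iexp (\<Sum>j<p+1. (if j = p then t else 0) * W j n \<omega>))" for n
    unfolding one char_def using W by (subst integral_distr) auto
  moreover have "(\<Sum>l<d. (\<Sum>j<p+1. (if j = p then t else 0) * cov.A $$ (j, l))\<^sup>2) = t\<^sup>2 * s\<^sup>2"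
    unfolding one power_mult_distrib sum_distrib_left[symmetric] cov.last_variance s(2) ..
  ultimately show "(\<lambda>n. char (distr M borel (W p n)) t) \<longlonglongrightarrow> char (density lborel (normal_density 0 (sqrt ((1 - \<rho>\<^sup>2) / \<rho> ^ (2 * (p + 1)))))) t"
    using char_limit[of "\<lambda>j. if j = p then t else 0"] unfolding s_def[symmetric] char_normal(2)[OF s(1)] by simp
qed

end

theorem corollary4p1:
  fixes M :: "'a measure"
    and F :: "nat \<Rightarrow> 'a measure"
    and p :: nat
    and \<theta> :: "nat \<Rightarrow> real"
    and \<rho> \<sigma> a :: real
    and X U :: "int \<Rightarrow> 'a \<Rightarrow> real"
    and \<epsilon> V x :: "nat \<Rightarrow> 'a \<Rightarrow> real"
    and \<Phi> vartheta_hat :: "nat \<Rightarrow> 'a \<Rightarrow> real vec"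
  assumes "prob_space M"
    and "filtration (space M) F"
    and "\<And>n. subalgebra M (F n)"
    and "p \<ge> 1" and "\<bar>\<rho>\<bar> < 1" and "\<rho> \<noteq> 0"
    \<comment> \<open>model\<close>
    and "\<And>n \<omega>. \<omega> \<in> space M \<Longrightarrow>
           X (int n + 1) \<omega> =
             (\<Sum>k=1..p. \<theta> k * X (int n - int k + 1) \<omega>) + U (int n) \<omega> + \<epsilon> (n + 1) \<omega>"
    and "\<And>n \<omega>. \<omega> \<in> space M \<Longrightarrow> \<epsilon> (n + 1) \<omega> = \<rho> * \<epsilon> n \<omega> + V (n + 1) \<omega>"
    \<comment> \<open>initial values\<close>
    and "\<And>k. k \<le> 0 \<Longrightarrow> X k \<in> borel_measurable (F 0)"
    and "\<epsilon> 0 \<in> borel_measurable (F 0)"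
    and "U 0 \<in> borel_measurable (F 0)"
    and "U (- 1) \<in> borel_measurable (F 0)"
    \<comment> \<open>driving noise\<close>
    and "martingale_difference M F V"
    and "\<sigma> > 0"
    and "\<And>n. AE \<omega> in M.
           nn_cond_exp M (F n) (\<lambda>\<omega>. ennreal ((V (n + 1) \<omega>)\<^sup>2)) \<omega> = ennreal (\<sigma>\<^sup>2)"
    and "a > 2"
    and "AE \<omega> in M.
           (SUP n. nn_cond_exp M (F n) (\<lambda>\<omega>. ennreal (\<bar>V (n + 1) \<omega>\<bar> powr a)) \<omega>) < \<infinity>"
    \<comment> \<open>reference trajectory\<close>
    and "\<And>n. x (n + 1) \<in> borel_measurable (F n)"
    and "AE \<omega> in M. (\<lambda>n. \<Sum>k=1..n. (x k \<omega>)\<^sup>2) \<in> o(\<lambda>n. real n)"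
    and "\<And>b. 2 \<le> b \<Longrightarrow> b < a \<Longrightarrow>
           AE \<omega> in M. (\<lambda>n. \<Sum>k=1..n. \<bar>x k \<omega>\<bar> powr b) \<in> O(\<lambda>n. real n)"
    \<comment> \<open>least squares estimator\<close>
    and "\<Phi> = regressor p X U"
    and "\<And>\<omega>. \<omega> \<in> space M \<Longrightarrow> vartheta_hat 0 \<omega> \<in> carrier_vec (p + 2)"
    and "\<And>j. j < p + 2 \<Longrightarrow> (\<lambda>\<omega>. vartheta_hat 0 \<omega> $ j) \<in> borel_measurable (F 0)"
    and "\<And>n \<omega>. \<omega> \<in> space M \<Longrightarrow>
           vartheta_hat (n + 1) \<omega> = vartheta_hat n \<omega> +
             (X (int n + 1) \<omega> - U (int n) \<omega> - vartheta_hat n \<omega> \<bullet> \<Phi> n \<omega>) \<cdot>\<^sub>v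
               (inv_mat (gram_matrix (p + 2) (\<lambda>k. \<Phi> k \<omega>) n) *\<^sub>v \<Phi> n \<omega>)"
    \<comment> \<open>adaptive tracking control\<close>
    and "\<And>n \<omega>. n \<ge> 1 \<Longrightarrow> \<omega> \<in> space M \<Longrightarrow>
           U (int n) \<omega> = x (n + 1) \<omega> - vartheta_hat n \<omega> \<bullet> \<Phi> n \<omega>"
  shows "(\<exists>\<mu>. mv_normal (p + 1) (0\<^sub>v (p + 1)) (Sigma_mat p \<theta> \<rho>) \<mu> \<and>
            weak_conv_on (Rn_top (p + 1))
              (\<lambda>n. distr M (Rn_borel (p + 1))
                 (\<lambda>\<omega>. \<lambda>j\<in>{..<p + 1}.
                    sqrt (real n) * estimation_error p \<theta> \<rho> (vartheta_hat n \<omega>) j))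
              \<mu>)
         \<and> weak_conv_m
             (\<lambda>n. distr M borel
                (\<lambda>\<omega>. sqrt (real n) * (rho_hat p (vartheta_hat n \<omega>) - \<rho>)))
             (density lborel (normal_density 0 (sqrt ((1 - \<rho>\<^sup>2) / \<rho> ^ (2 * (p + 1))))))"
proof -
  have "noise M F V \<sigma> a"
    by (intro noise.intro noise_axioms.intro; fact assms)
  then have arx: "arx M F V \<sigma> a p (p + 2) \<theta> \<rho> X U \<epsilon> x \<Phi> vartheta_hat"
    by (rule arx.intro) (rule arx_axioms.intro; (rule refl | fact assms))
  note W = arx.W_def[OF arx]
  have "arx.W p \<theta> \<rho> vartheta_hat p n = (\<lambda>\<omega>. sqrt (real n) * (rho_hat p (vartheta_hat n \<omega>) - \<rho>))" for n
    by (simp add: fun_eq_iff W estimation_error_def)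
  with arx.rho_clt[OF arx] arx.joint_clt[OF arx] show ?thesis
    unfolding W by simp
qed

end
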